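(* Let $0\le s<T$, let $\varrho_s\in L_2(D)$, and for $\varepsilon>0$ let $p_\varepsilon$ be the solution of the parabolic problem (described in the context) with initial value $\varrho_s$ at time $s$. Let $p:[s,T]\to L_2(D)$ be a vanishing-viscosity limit of $p_\varepsilon$ in the sense of the context. Then: a) $p$ is uniquely defined as an element of $\mathscr{B}[s,T]$; that is, if $p$ and $p'$ are two vanishing-viscosity limits of the family $\{p_\varepsilon\}_{\varepsilon>0}$ (for the same $\varrho_s$), then $p(\cdot,t)=p'(\cdot,t)$ in $L_2(D)$ for every $t\in[s,T]$. b) If $\varrho_s$ is the distribution density of a random vector $a$ such that $a\in D$ almost surely, then for every $t\in[s,T]$ and every Borel set $B\subset D$ $$P\big(y^{a,s}(t)\in B,\ \tilde\tau^{a,s}>t\big)=\int_B p(x,t)\,dx .$$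
   Context: Setting: $D\subset\mathbf{R}^n$ is a bounded simply connected domain with $C^1$-smooth boundary $\partial D$; $T>0$; $f:\mathbf{R}^n\times\mathbf{R}\to\mathbf{R}^n$, $f=f(x,t)$, is bounded and continuous and has continuous first-order partial derivatives with respect to $x$. For $a\in\mathbf{R}^n$ (possibly random) and $s\in[0,T]$, $y^{a,s}(t)$, $t\ge s$, is the solution of $\frac{dy}{dt}(t)=f(y(t),t)$, $y(s)=a$. Put $\tilde\tau^{a,s}=\inf\{t: t\ge s,\ y^{a,s}(t)\notin D\}$ (with $\inf\emptyset=+\infty$). $P$ denotes probability. $\mathscr{B}[s,T]$ is the normed space of bounded functions $u:[s,T]\to L_2(D)$ with norm $\sup_{t\in[s,T]}\|u(\cdot,t)\|_{L_2(D)}$. For $\varepsilon>0$ and $\varrho_s\in L_2(D)$, $p_\varepsilon\in C([s,T];L_2(D))\cap L_2(s,T;\mathring W_2^1(D))$ denotes the unique (weak) solution of $$\frac{\partial p_\varepsilon}{\partial t}(x,t)=-\sum_{i=1}^n\frac{\partial}{\partial x_i}\big(f_i(x,t)p_\varepsilon(x,t)\big)+\frac{\varepsilon^2}{2}\Delta p_\varepsilon(x,t)\quad\text{in } D\times[s,T],$$ $$p_\varepsilon(x,s)=\varrho_s(x),\qquad p_\varepsilon(x,t)|_{x\in\partial D}=0 .$$ Vanishing-viscosity limit: a function $p:[s,T]\to L_2(D)$ in $\mathscr{B}[s,T]$ such that for every $t\in[s,T]$ there is a sequence $\varepsilon_i=\varepsilon_i(t)>0$, $\varepsilon_i(t)\to0$,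 for which $p_{\varepsilon_i}(\cdot,t)$ converges weakly in $L_2(D)$ to $p(\cdot,t)$. At least one such $p$ exists, because $\|p_\varepsilon\|_{\mathscr{B}[s,T]}\le c_0\|\varrho_s\|_{L_2(D)}$ for all $\varepsilon>0$, where $c_0=\exp\frac12\int_0^T\sup_{x\in D}\big|\sum_{i=1}^n\frac{\partial f_i}{\partial x_i}(x,t)\big|dt$. *)

theory Defs
  imports "HOL-Probability.Probability"
begin

definition partial_deriv :: "'n::finite \<Rightarrow> (real^'n \<Rightarrow> real) \<Rightarrow> real^'n \<Rightarrow> real" where
  "partial_deriv i g x = deriv (\<lambda>h. g (x + h *\<^sub>R axis i 1)) 0"

fun C_k :: "nat \<Rightarrow> (real^'n::finite \<Rightarrow> real) \<Rightarrow> bool" where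
  "C_k 0 g \<longleftrightarrow> continuous_on UNIV g"
| "C_k (Suc k) g \<longleftrightarrow> (\<forall>x. g differentiable (at x)) \<and> (\<forall>i. C_k k (partial_deriv i g))"

text \<open>Smooth functions with compact support contained in \<open>D\<close>, extended by zero to the whole space.\<close>

definition test_functions :: "(real^'n::finite) set \<Rightarrow> (real^'n \<Rightarrow> real) set" where
  "test_functions D =
     {\<phi>. (\<forall>k. C_k k \<phi>) \<and> compact (closure {x. \<phi> x \<noteq> 0}) \<and> closure {x. \<phi> x \<noteq> 0} \<subseteq> D}"

text \<open>The boundary is locally the regular zero set of a \<open>C\<^sup>1\<close> function \<open>g\<close>, with \<open>D\<close> on the side
  \<open>g < 0\<close> only.\<close>

definition C1_boundary :: "(real^'n::finite) set \<Rightarrow> bool" where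
  "C1_boundary D \<longleftrightarrow>
     (\<forall>z\<in>frontier D. \<exists>U g. open U \<and> z \<in> U
        \<and> (\<forall>x\<in>U. g differentiable (at x))
        \<and> (\<forall>i. continuous_on U (partial_deriv i g))
        \<and> (\<forall>x\<in>U. \<exists>i. partial_deriv i g x \<noteq> 0)
        \<and> D \<inter> U = {x\<in>U. g x < 0}
        \<and> frontier D \<inter> U = {x\<in>U. g x = 0})"

text \<open>Continuity of \<open>f\<close> and of its spatial partial
  derivatives is joint in \<open>(x, t)\<close>.\<close>

definition admissible_field :: "(real^'n::finite \<Rightarrow> real \<Rightarrow> real^'n) \<Rightarrow> bool" where
  "admissible_field f \<longleftrightarrow>
     bounded (range (\<lambda>(x, t). f x t))
     \<and> continuous_on UNIV (\<lambda>(x, t). f x t)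
     \<and> (\<forall>i j x t. (\<lambda>h. f (x + h *\<^sub>R axis j 1) t $ i) differentiable (at 0))
     \<and> (\<forall>i j. continuous_on UNIV (\<lambda>(x, t). partial_deriv j (\<lambda>z. f z t $ i) x))"

definition solves_ode_from ::
  "(real^'n::finite \<Rightarrow> real \<Rightarrow> real^'n) \<Rightarrow> real \<Rightarrow> real^'n \<Rightarrow> (real \<Rightarrow> real^'n) \<Rightarrow> bool" where
  "solves_ode_from f s a y \<longleftrightarrow>
     y s = a \<and> (\<forall>t\<ge>s. (y has_vector_derivative f (y t) t) (at t within {s..}))"

text \<open>The infimum is taken in the extended reals, so a path that never leaves \<open>D\<close> has exit
  time \<open>\<infinity>\<close>.\<close>

definition exit_time :: "'a set \<Rightarrow> real \<Rightarrow> (real \<Rightarrow> 'a) \<Rightarrow> ereal" where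
  "exit_time D s y = Inf (ereal ` {t. s \<le> t \<and> y t \<notin> D})"

text \<open>Elements of \<open>L\<^sub>2(D)\<close> are represented by functions on the whole space of which only the values in
  \<open>D\<close> matter; equality in \<open>L\<^sub>2(D)\<close> is equality almost everywhere with respect to
  \<^term>\<open>lebesgue_on D\<close>.\<close>

definition L2_space :: "(real^'n::finite) set \<Rightarrow> (real^'n \<Rightarrow> real) set" where
  "L2_space D = {u \<in> borel_measurable (lebesgue_on D). integrable (lebesgue_on D) (\<lambda>x. (u x)\<^sup>2)}"

definition L2_inner ::
  "(real^'n::finite) set \<Rightarrow> (real^'n \<Rightarrow> real) \<Rightarrow> (real^'n \<Rightarrow> real) \<Rightarrow> real" where
  "L2_inner D u v = (\<integral>x. u x * v x \<partial>lebesgue_on D)"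

definition L2_norm :: "(real^'n::finite) set \<Rightarrow> (real^'n \<Rightarrow> real) \<Rightarrow> real" where
  "L2_norm D u = sqrt (L2_inner D u u)"

text \<open>Continuous linear functionals on \<open>L\<^sub>2(D)\<close> are written as inner products (Riesz).\<close>

definition L2_weakly_tendsto ::
  "(real^'n::finite) set \<Rightarrow> (nat \<Rightarrow> real^'n \<Rightarrow> real) \<Rightarrow> (real^'n \<Rightarrow> real) \<Rightarrow> bool" where
  "L2_weakly_tendsto D u v \<longleftrightarrow>
     (\<forall>k. u k \<in> L2_space D) \<and> v \<in> L2_space D
     \<and> (\<forall>\<phi>\<in>L2_space D. (\<lambda>k. L2_inner D (u k) \<phi>) \<longlonglongrightarrow> L2_inner D v \<phi>)"

text \<open>\<open>W12 D u G\<close>: \<open>u\<close> belongs to \<open>W\<^sub>2\<^sup>1(D)\<close> and \<open>G\<close> is (a representative of) its weak gradient.\<close>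

definition W12 ::
  "(real^'n::finite) set \<Rightarrow> (real^'n \<Rightarrow> real) \<Rightarrow> (real^'n \<Rightarrow> real^'n) \<Rightarrow> bool" where
  "W12 D u G \<longleftrightarrow>
     u \<in> L2_space D \<and> (\<forall>i. (\<lambda>x. G x $ i) \<in> L2_space D)
     \<and> (\<forall>\<phi>\<in>test_functions D. \<forall>i.
          L2_inner D u (partial_deriv i \<phi>) = - L2_inner D (\<lambda>x. G x $ i) \<phi>)"

text \<open>\<open>W12_0 D u G\<close>: in addition, \<open>u\<close> lies in the closure of the test functions in the norm of
  \<open>W\<^sub>2\<^sup>1(D)\<close>.\<close>

definition W12_0 ::
  "(real^'n::finite) set \<Rightarrow> (real^'n \<Rightarrow> real) \<Rightarrow> (real^'n \<Rightarrow> real^'n) \<Rightarrow> bool" where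
  "W12_0 D u G \<longleftrightarrow>
     W12 D u G
     \<and> (\<exists>\<phi>. (\<forall>k::nat. \<phi> k \<in> test_functions D)
          \<and> (\<lambda>k. L2_norm D (\<lambda>x. \<phi> k x - u x)) \<longlonglongrightarrow> 0
          \<and> (\<forall>i. (\<lambda>k. L2_norm D (\<lambda>x. partial_deriv i (\<phi> k) x - G x $ i)) \<longlonglongrightarrow> 0))"

definition B_space :: "(real^'n::finite) set \<Rightarrow> real \<Rightarrow> real \<Rightarrow> (real \<Rightarrow> real^'n \<Rightarrow> real) set" where
  "B_space D s T = {u. (\<forall>t\<in>{s..T}. u t \<in> L2_space D) \<and> (\<exists>C. \<forall>t\<in>{s..T}. L2_norm D (u t) \<le> C)}"

definition C_L2 :: "(real^'n::finite) set \<Rightarrow> real \<Rightarrow> real \<Rightarrow> (real \<Rightarrow> real^'n \<Rightarrow> real) set" where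
  "C_L2 D s T =
     {u. (\<forall>t\<in>{s..T}. u t \<in> L2_space D)
       \<and> (\<forall>t\<in>{s..T}. ((\<lambda>r. L2_norm D (\<lambda>x. u r x - u t x)) \<longlongrightarrow> 0) (at t within {s..T}))}"

text \<open>\<open>L2_W12_0 D s T u G\<close>: \<open>u\<close> belongs to the Bochner space of square integrable functions on
  \<open>[s, T]\<close> with values in the space above, with spatial weak gradient \<open>G\<close>. The value spaces are
  separable, so strong measurability is the same as weak measurability (Pettis); it is the weak form
  that is required here.\<close>

definition L2_W12_0 ::
  "(real^'n::finite) set \<Rightarrow> real \<Rightarrow> real \<Rightarrow> (real \<Rightarrow> real^'n \<Rightarrow> real) \<Rightarrow> (real \<Rightarrow> real^'n \<Rightarrow> real^'n) \<Rightarrow> bool"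
where
  "L2_W12_0 D s T u G \<longleftrightarrow>
     (AE t in lebesgue_on {s..T}. W12_0 D (u t) (G t))
     \<and> (\<forall>\<phi>\<in>L2_space D.
          (\<lambda>t. L2_inner D (u t) \<phi>) \<in> borel_measurable (lebesgue_on {s..T})
          \<and> (\<forall>i. (\<lambda>t. L2_inner D (\<lambda>x. G t x $ i) \<phi>) \<in> borel_measurable (lebesgue_on {s..T})))
     \<and> integrable (lebesgue_on {s..T})
          (\<lambda>t. (L2_norm D (u t))\<^sup>2 + (\<Sum>i\<in>UNIV. (L2_norm D (\<lambda>x. G t x $ i))\<^sup>2))"

text \<open>Weak solutions of \<open>\<partial>u/\<partial>t = - div (f u) + (\<epsilon>\<^sup>2/2) \<Delta>u\<close> with \<open>u = \<rho>\<close> at time \<open>s\<close> and zero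
  boundary values: multiply by \<open>v\<close>, integrate by parts in \<open>x\<close>, and integrate over \<open>[s, t]\<close>. The
  boundary condition is the membership of \<open>u t\<close> in the closure of the test functions.\<close>

definition weak_solution ::
  "(real^'n::finite) set \<Rightarrow> (real^'n \<Rightarrow> real \<Rightarrow> real^'n) \<Rightarrow> real \<Rightarrow> real \<Rightarrow> (real^'n \<Rightarrow> real) \<Rightarrow> real
    \<Rightarrow> (real \<Rightarrow> real^'n \<Rightarrow> real) \<Rightarrow> bool"
where
  "weak_solution D f s T \<rho> \<epsilon> u \<longleftrightarrow>
     u \<in> C_L2 D s T
     \<and> (AE x in lebesgue_on D. u s x = \<rho> x)
     \<and> (\<exists>G. L2_W12_0 D s T u G
          \<and> (\<forall>v H. W12_0 D v H \<longrightarrow>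
               (\<forall>t\<in>{s..T}. L2_inner D (u t) v = L2_inner D \<rho> v
                  + (\<integral>r. (\<integral>x. u r x * (f x r \<bullet> H x) - \<epsilon>\<^sup>2 / 2 * (G r x \<bullet> H x) \<partial>lebesgue_on D)
                       \<partial>lebesgue_on {s..t}))))"

definition vanishing_viscosity_limit ::
  "(real^'n::finite) set \<Rightarrow> real \<Rightarrow> real \<Rightarrow> (real \<Rightarrow> real \<Rightarrow> real^'n \<Rightarrow> real)
    \<Rightarrow> (real \<Rightarrow> real^'n \<Rightarrow> real) \<Rightarrow> bool"
where
  "vanishing_viscosity_limit D s T p\<epsilon> p \<longleftrightarrow>
     p \<in> B_space D s T
     \<and> (\<forall>t\<in>{s..T}. \<exists>e::nat \<Rightarrow> real. (\<forall>k. e k > 0) \<and> e \<longlonglongrightarrow> 0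
          \<and> L2_weakly_tendsto D (\<lambda>k. p\<epsilon> (e k) t) (p t))"

text \<open>\<open>\<rho>\<close> is only determined up to null sets and is Lebesgue measurable, whereas
  \<^const>\<open>distributed\<close> asks for a Borel representative of the density.\<close>

definition has_density_on ::
  "'w measure \<Rightarrow> (real^'n::finite) set \<Rightarrow> ('w \<Rightarrow> real^'n) \<Rightarrow> (real^'n \<Rightarrow> real) \<Rightarrow> bool" where
  "has_density_on M D a \<rho> \<longleftrightarrow>
     (\<exists>g. (\<forall>x. 0 \<le> g x) \<and> distributed M lborel a (\<lambda>x. ennreal (g x))
        \<and> (AE x in lebesgue_on D. \<rho> x = g x))"

end

theory Submission
  imports Defs "HOL-Real_Asymp.Real_Asymp"
begin

text \<open>
  Write \<open>I\<close> for integration over \<open>D\<close> and follow the flow of the vector field backwards from time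
  \<open>t\<close>. Points \<open>x\<close> of \<open>D\<close> fall into three classes: the backward path stays in \<open>D\<close> down to time \<open>s\<close>
  (the \<^emph>\<open>survivors\<close>), it leaves the closure of \<open>D\<close>, or it stays in the closure and touches the
  boundary (the \<^emph>\<open>tangential\<close> points). The limit is identified separately on each class, and the
  outcome does not depend on the sequence of viscosities.

  \<^item> \<^emph>\<open>Leaving the closure.\<close> There the solutions \<open>p\<^sub>\<epsilon>\<close> tend to zero strongly. This rests on the
    energy estimate \<open>I (u(t)\<^sup>2 w(t)) \<le> I (u(a)\<^sup>2 w(a)) + O(\<epsilon>\<^sup>2)\<close> for weights \<open>w = e\<^sup>g\<close> with
    \<open>\<partial>g/\<partial>t + f \<bullet> \<nabla>g + \<bar>div f\<bar> \<le> 0\<close> (lemma \<open>energy_estimate\<close>). Taking for \<open>w\<close> narrow Gaussians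
    centred on a trajectory (lemma \<open>gaussian_energy_weight\<close>) shows that mass near \<open>x\<close> at time \<open>t\<close>
    must come from mass near the backward path of \<open>x\<close>; when this path is outside the closure there
    is none (lemmas \<open>exit_decay\<close>, \<open>limit_vanishes\<close>). With \<open>w\<close> depending on time only, the same
    estimate gives the bound on \<open>p\<^sub>\<epsilon>\<close> that is uniform in \<open>\<epsilon>\<close>.
  \<^item> \<^emph>\<open>Tangential points\<close> form a null set (lemma \<open>tangential_negligible\<close>). Transported to the time
    of contact, such a set is locally met at most once by each line in the direction of the normal,
    so it has infinitely many disjoint translates in a bounded region.
  \<^item> \<^emph>\<open>Survivors.\<close> Let \<open>\<phi>\<close> be Lipschitz with compact support among the survivors. The functions
    \<open>z \<mapsto> \<phi> (flow r t z)\<close> solve the adjoint transport equation and keep their supports in a compact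
    subset of \<open>D\<close>, so after mollification they may be used as moving test functions. The viscous
    term costs \<open>O(\<epsilon>\<^sup>2)\<close>, and the result is \<open>I (q \<phi>) = I (\<rho> (\<phi> \<circ> flow s t))\<close> for every weak limit
    \<open>q\<close> at time \<open>t\<close> (lemma \<open>limit_transported\<close>).

  Approximating indicators by such \<open>\<phi>\<close>, the integral of \<open>q\<close> over any Borel set \<open>B\<close> is the integral
  of \<open>\<rho>\<close> over the starting points whose path stays in \<open>D\<close> on \<open>[s, t]\<close> and is in \<open>B\<close> at time \<open>t\<close>
  (lemma \<open>limit_on_borel\<close>). This determines \<open>q\<close> almost everywhere, and when \<open>\<rho>\<close> is the density of
  the starting point the right hand side is the probability in question.

  The energy estimate is obtained without a time derivative of \<open>p\<^sub>\<epsilon>\<close> in the dual space. Instead of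
  \<open>I (u\<^sup>2 w) / 2\<close> one follows the regularised value
  \<open>\<Psi> \<kappa> t = sup\<^sub>v I ((u v - v\<^sup>2/2 - \<kappa>/2 \<bar>\<nabla>v\<bar>\<^sup>2) w)\<close>, the supremum over test functions \<open>v\<close>. Its increments
  are controlled by inserting a near maximiser at the later time into the weak equation, where the
  near maximiser satisfies the Euler--Lagrange equation \<open>(u - v) w + \<kappa> div (w \<nabla>v) = 0\<close>
  approximately; \<open>\<kappa>\<close> tends to zero at the end.
\<close>

section \<open>Smooth functions on Euclidean space\<close>

lemma has_derivative_direction:
  assumes "(g has_derivative g') (at (x :: real^'n::finite))"
  shows "((\<lambda>h. g (x + h *\<^sub>R axis i 1)) has_real_derivative g' (axis i 1)) (at 0)"
proof -
  have a: "((\<lambda>h::real. x + h *\<^sub>R axis i 1) has_derivative (\<lambda>h. h *\<^sub>R axis i 1)) (at 0)"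
    by (auto intro!: derivative_eq_intros)
  have b: "(g has_derivative g') (at (x + 0 *\<^sub>R axis i 1))" using assms by simp
  from has_derivative_compose[OF a b]
  have "((\<lambda>h. g (x + h *\<^sub>R axis i 1)) has_derivative (\<lambda>h. g' (h *\<^sub>R axis i 1))) (at 0)" .
  moreover have "g' (h *\<^sub>R axis i 1) = g' (axis i 1) * h" for h
    using linear_cmul[OF has_derivative_linear[OF assms], of h "axis i 1"] by simp
  ultimately show ?thesis by (simp add: has_field_derivative_def)
qed

lemma partial_deriv_eq:
  assumes "(g has_derivative g') (at x)"
  shows "partial_deriv i g x = g' (axis i 1)"
  unfolding partial_deriv_def using has_derivative_direction[OF assms] by (rule DERIV_imp_deriv)

lemma partial_deriv_direction:
  assumes "g differentiable (at x)"
  shows "((\<lambda>h. g (x + h *\<^sub>R axis i 1)) has_real_derivative partial_deriv i g x) (at 0)"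
  using assms has_derivative_direction partial_deriv_eq unfolding differentiable_def by metis

lemma has_derivative_partial_sum:
  assumes "g differentiable (at (x :: real^'n::finite))"
  shows "(g has_derivative (\<lambda>k. \<Sum>i\<in>UNIV. k $ i * partial_deriv i g x)) (at x)"
proof -
  from assms obtain g' where g: "(g has_derivative g') (at x)" unfolding differentiable_def by auto
  have "g' k = (\<Sum>i\<in>UNIV. k $ i * partial_deriv i g x)" for k
  proof -
    have l: "linear g'" using g by (rule has_derivative_linear)
    have "g' k = g' (\<Sum>i\<in>UNIV. k $ i *\<^sub>R axis i 1)" by (simp only: basis_expansion scalar_mult_eq_scaleR[symmetric])
    also have "\<dots> = (\<Sum>i\<in>UNIV. k $ i * g' (axis i 1))"
      by (simp add: linear_sum[OF l] linear_cmul[OF l])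
    finally show ?thesis by (simp add: partial_deriv_eq[OF g])
  qed
  then have "g' = (\<lambda>k. \<Sum>i\<in>UNIV. k $ i * partial_deriv i g x)" by (rule ext)
  then show ?thesis using g by simp
qed

definition gradient :: "(real^'n::finite \<Rightarrow> real) \<Rightarrow> real^'n \<Rightarrow> real^'n" where
  "gradient g x = (\<chi> i. partial_deriv i g x)"

lemma gradient_nth [simp]: "gradient g x $ i = partial_deriv i g x" by (simp add: gradient_def)

lemma has_derivative_gradient:
  assumes "g differentiable (at x)"
  shows "(g has_derivative (\<lambda>k. gradient g x \<bullet> k)) (at x)"
  using has_derivative_partial_sum[OF assms] by (simp add: inner_vec_def mult.commute)

lemma partial_deriv_mult:
  assumes "f differentiable (at x)" "g differentiable (at x)"
  shows "partial_deriv i (\<lambda>x. f x * g x) x = partial_deriv i f x * g x + f x * partial_deriv i g x"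
  using partial_deriv_eq[OF has_derivative_mult[OF has_derivative_gradient[OF assms(1)] has_derivative_gradient[OF assms(2)]], of i]
  by (simp add: inner_axis)

lemma partial_deriv_add:
  assumes "f differentiable (at x)" "g differentiable (at x)"
  shows "partial_deriv i (\<lambda>x. f x + g x) x = partial_deriv i f x + partial_deriv i g x"
  using partial_deriv_eq[OF has_derivative_add[OF has_derivative_gradient[OF assms(1)] has_derivative_gradient[OF assms(2)]], of i]
  by (simp add: inner_axis)

lemma partial_deriv_outside:
  assumes "closed K" "\<And>x. x \<notin> K \<Longrightarrow> \<phi> x = 0" "x \<notin> K"
  shows "partial_deriv i \<phi> x = 0"
proof -
  have "((\<lambda>x. 0) has_derivative (\<lambda>k. 0)) (at x)" by simp
  then have "(\<phi> has_derivative (\<lambda>k. 0)) (at x)"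
    by (rule has_derivative_transform_within_open[OF _ open_Compl[OF assms(1)]]) (use assms in auto)
  then show ?thesis by (rule partial_deriv_eq)
qed

definition smooth :: "(real^'n::finite \<Rightarrow> real) \<Rightarrow> bool" where
  "smooth g \<longleftrightarrow> (\<forall>k. C_k k g)"

lemma smooth_differentiable: "smooth g \<Longrightarrow> g differentiable (at x)"
  unfolding smooth_def by (metis C_k.simps(2))

lemma smooth_partial_deriv: "smooth g \<Longrightarrow> smooth (partial_deriv i g)"
  unfolding smooth_def by (metis C_k.simps(2))

lemma smooth_continuous: "smooth g \<Longrightarrow> continuous_on S g"
  by (meson continuous_at_imp_continuous_on differentiable_imp_continuous_within smooth_differentiable)

text \<open>Iterated partial derivatives need not be computed: a class of functions that is closed under them suffices.\<close>

lemma smooth_coinduct: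
  assumes "h \<in> S"
    and diff: "\<And>h x. h \<in> S \<Longrightarrow> h differentiable (at x)"
    and part: "\<And>h i. h \<in> S \<Longrightarrow> partial_deriv i h \<in> S"
  shows "smooth h"
proof -
  have "C_k k h" if "h \<in> S" for k h
    using that
  proof (induction k arbitrary: h)
    case 0
    then show ?case
      by (simp add: continuous_at_imp_continuous_on diff differentiable_imp_continuous_within)
  qed (use diff part in auto)
  then show ?thesis using assms(1) by (simp add: smooth_def)
qed

text \<open>The factor \<open>u\<^sup>-\<^sup>j\<close> makes the family of flat functions closed under differentiation.\<close>

definition flat_exp :: "nat \<Rightarrow> real \<Rightarrow> real" where
  "flat_exp j u = (if u > 0 then exp (- inverse u) * inverse u ^ j else 0)"

lemma flat_exp_has_derivative:
  "(flat_exp j has_real_derivative flat_exp (j + 2) u - real j * flat_exp (j + 1) u) (at u)"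
proof -
  consider "u > 0" | "u < 0" | "u = 0" by linarith
  then show ?thesis
  proof cases
    case 1
    have "((\<lambda>u. exp (- inverse u) * inverse u ^ j) has_real_derivative flat_exp (j + 2) u - real j * flat_exp (j + 1) u) (at u)"
      using 1
    proof (cases j)
      case 0
      then show ?thesis using 1 by (auto intro!: derivative_eq_intros simp: flat_exp_def power2_eq_square)
    next
      case (Suc i)
      have "((\<lambda>u. exp (- inverse u) * inverse u ^ Suc i) has_real_derivative
         exp (- inverse u) * (inverse u * inverse u) * inverse u ^ Suc i
          + exp (- inverse u) * (real (Suc i) * inverse u ^ i * (- (inverse u * inverse u)))) (at u)"
      proof -
        have i: "(inverse has_real_derivative - (inverse u * inverse u)) (at u)"
          using DERIV_inverse[of u UNIV] 1 by (simp add: power2_eq_square)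
        have "((\<lambda>u. exp (- inverse u)) has_real_derivative exp (- inverse u) * (inverse u * inverse u)) (at u)"
          using DERIV_fun_exp[OF DERIV_minus[OF i]] by simp
        from DERIV_mult[OF this DERIV_power_Suc[OF i, of i]] show ?thesis
          by (simp add: algebra_simps)
      qed
      moreover have "exp (- inverse u) * (inverse u * inverse u) * inverse u ^ Suc i
          + exp (- inverse u) * (real (Suc i) * inverse u ^ i * (- (inverse u * inverse u)))
         = flat_exp (j + 2) u - real j * flat_exp (j + 1) u"
        unfolding Suc flat_exp_def using 1 by (simp add: mult.assoc mult.left_commute)
      ultimately show ?thesis using Suc by simp
    qed
    then show ?thesis
      by (rule has_field_derivative_transform_within_open[where S = "{0<..}"])
         (use 1 in \<open>auto simp: flat_exp_def\<close>)
  next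
    case 2
    have "((\<lambda>u. 0) has_real_derivative flat_exp (j + 2) u - real j * flat_exp (j + 1) u) (at u)"
      using 2 by (simp add: flat_exp_def)
    then show ?thesis
      by (rule has_field_derivative_transform_within_open[where S = "{..<0}"])
         (use 2 in \<open>auto simp: flat_exp_def\<close>)
  next
    case 3
    have "((\<lambda>u. flat_exp j u / u) \<longlongrightarrow> 0) (at_right 0)"
    proof (rule Lim_transform_eventually)
      have "((\<lambda>u. u ^ (Suc j) / exp u) \<longlongrightarrow> (0::real)) at_top" by (rule tendsto_power_div_exp_0)
      from filterlim_compose[OF this filterlim_inverse_at_top_right]
      show "((\<lambda>u. inverse u ^ (Suc j) / exp (inverse u)) \<longlongrightarrow> (0::real)) (at_right 0)" .
      show "\<forall>\<^sub>F x in at_right 0. inverse x ^ Suc j / exp (inverse x) = flat_exp j x / x"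
        using eventually_at_right_less[of "0::real"]
        by eventually_elim (simp add: flat_exp_def exp_minus divide_inverse mult.commute mult.left_commute)
    qed
    moreover have "((\<lambda>u. flat_exp j u / u) \<longlongrightarrow> 0) (at_left 0)"
      by (rule Lim_transform_eventually[OF tendsto_const])
         (auto simp: flat_exp_def eventually_at_filter)
    ultimately have "((\<lambda>u. flat_exp j u / u) \<longlongrightarrow> 0) (at 0)"
      using filterlim_split_at by blast
    then show ?thesis using 3 by (simp add: DERIV_def flat_exp_def)
  qed
qed

text \<open>The explicit functions for which smoothness is needed, closed under partial derivatives.\<close>

inductive_set smooth_terms :: "(real^'n::finite \<Rightarrow> real) set" where
  const: "(\<lambda>x. c) \<in> smooth_terms"
| coord: "(\<lambda>x. x $ i) \<in> smooth_terms"
| base: "smooth h \<Longrightarrow> h \<in> smooth_terms"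
| bump: "(\<lambda>x. flat_exp j (d - x \<bullet> x)) \<in> smooth_terms"
| gauss: "(\<lambda>x. exp (l - m * ((x - c) \<bullet> (x - c)))) \<in> smooth_terms"
| add: "h \<in> smooth_terms \<Longrightarrow> k \<in> smooth_terms \<Longrightarrow> (\<lambda>x. h x + k x) \<in> smooth_terms"
| mult: "h \<in> smooth_terms \<Longrightarrow> k \<in> smooth_terms \<Longrightarrow> (\<lambda>x. h x * k x) \<in> smooth_terms"

lemma bump_has_derivative:
  "((\<lambda>x. flat_exp j (d - x \<bullet> x)) has_derivative
     (\<lambda>k. (flat_exp (j + 2) (d - x \<bullet> x) - real j * flat_exp (j + 1) (d - x \<bullet> x)) * (- 2 * (x \<bullet> k)))) (at x)"
proof -
  have "((\<lambda>x. d - x \<bullet> x) has_derivative (\<lambda>k. - 2 * (x \<bullet> k))) (at x)"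
    by (auto intro!: derivative_eq_intros simp: inner_commute)
  from has_derivative_compose[OF this flat_exp_has_derivative[unfolded has_field_derivative_def]]
  show ?thesis by simp
qed

lemma gauss_has_derivative:
  "((\<lambda>x. exp (l - m * ((x - c) \<bullet> (x - c)))) has_derivative
     (\<lambda>k. exp (l - m * ((x - c) \<bullet> (x - c))) * (- 2 * m * ((x - c) \<bullet> k)))) (at x)"
  by (auto intro!: derivative_eq_intros simp: inner_commute algebra_simps)

lemma smooth_terms_closed:
  assumes "h \<in> smooth_terms"
  shows "h differentiable (at x) \<and> partial_deriv i h \<in> smooth_terms"
  using assms
proof (induction arbitrary: x i)
  case (const c)
  have "((\<lambda>x. c) has_derivative (\<lambda>k. 0)) (at x)" for x :: "real^'a" by simp
  from partial_deriv_eq[OF this] have "partial_deriv i (\<lambda>x::real^'a. c) = (\<lambda>x. 0)" by auto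
  then show ?case by (auto intro: smooth_terms.const)
next
  case (coord j)
  have d: "((\<lambda>x. x $ j) has_derivative (\<lambda>k. k $ j)) (at x)" for x :: "real^'a"
    by (intro bounded_linear_imp_has_derivative bounded_linear_vec_nth)
  from partial_deriv_eq[OF this] have "partial_deriv i (\<lambda>x::real^'a. x $ j) = (\<lambda>x. axis i 1 $ j)" by auto
  then show ?case using d by (auto intro: smooth_terms.const simp: differentiable_def)
next
  case (base h)
  then show ?case by (simp add: smooth_differentiable smooth_partial_deriv smooth_terms.base)
next
  case (bump j d)
  have "partial_deriv i (\<lambda>x::real^'a. flat_exp j (d - x \<bullet> x))
      = (\<lambda>x. (flat_exp (j + 2) (d - x \<bullet> x) + (- real j) * flat_exp (j + 1) (d - x \<bullet> x)) * ((- 2) * x $ i))"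
    by (rule ext, subst partial_deriv_eq[OF bump_has_derivative]) (simp add: inner_axis)
  moreover have "(\<lambda>x. (flat_exp (j + 2) (d - x \<bullet> x) + (- real j) * flat_exp (j + 1) (d - x \<bullet> x)) * ((- 2) * x $ i)) \<in> smooth_terms"
    by (intro smooth_terms.add smooth_terms.mult smooth_terms.bump smooth_terms.const smooth_terms.coord)
  moreover have "(\<lambda>x. flat_exp j (d - x \<bullet> x)) differentiable (at x)"
    unfolding differentiable_def by (intro exI) (rule bump_has_derivative)
  ultimately show ?case by (simp only: simp_thms)
next
  case (gauss l m c)
  have "partial_deriv i (\<lambda>x::real^'a. exp (l - m * ((x - c) \<bullet> (x - c))))
      = (\<lambda>x. exp (l - m * ((x - c) \<bullet> (x - c))) * (- 2 * m * (x $ i + (- c $ i))))"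
    by (rule ext, subst partial_deriv_eq[OF gauss_has_derivative]) (simp add: inner_axis)
  moreover have "(\<lambda>x. exp (l - m * ((x - c) \<bullet> (x - c))) * (- 2 * m * (x $ i + (- c $ i)))) \<in> smooth_terms"
    by (intro smooth_terms.add smooth_terms.mult smooth_terms.gauss smooth_terms.const smooth_terms.coord)
  moreover have "(\<lambda>x. exp (l - m * ((x - c) \<bullet> (x - c)))) differentiable (at x)"
    unfolding differentiable_def by (intro exI) (rule gauss_has_derivative)
  ultimately show ?case by (simp only: simp_thms)
next
  case (add h k)
  have "partial_deriv i (\<lambda>x. h x + k x) = (\<lambda>x. partial_deriv i h x + partial_deriv i k x)"
    using add.IH by (auto simp: partial_deriv_add)
  then show ?case using add.IH by (auto intro!: smooth_terms.add differentiable_add)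
next
  case (mult h k)
  have "partial_deriv i (\<lambda>x. h x * k x) = (\<lambda>x. partial_deriv i h x * k x + h x * partial_deriv i k x)"
    using mult.IH by (auto simp: partial_deriv_mult)
  then show ?case using mult by (auto intro!: smooth_terms.add smooth_terms.mult differentiable_mult)
qed

lemma smooth_terms_smooth: "h \<in> smooth_terms \<Longrightarrow> smooth h"
  by (rule smooth_coinduct[where S = smooth_terms]) (use smooth_terms_closed in auto)

lemma smooth_const: "smooth (\<lambda>x. c)"
  and smooth_bump: "smooth (\<lambda>x. flat_exp j (d - x \<bullet> x))"
  and smooth_gauss: "smooth (\<lambda>x. exp (l - m * ((x - c') \<bullet> (x - c'))))"
  and smooth_add: "smooth f \<Longrightarrow> smooth g \<Longrightarrow> smooth (\<lambda>x. f x + g x)"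
  and smooth_mult: "smooth f \<Longrightarrow> smooth g \<Longrightarrow> smooth (\<lambda>x. f x * g x)"
  by (auto intro!: smooth_terms_smooth intro: smooth_terms.intros)

section \<open>Integration by parts\<close>

lemma integrable_lborel_compact_support:
  fixes h :: "'a::euclidean_space \<Rightarrow> real"
  assumes "continuous_on UNIV h" "\<And>x. R < norm x \<Longrightarrow> h x = 0"
  shows "integrable lborel h"
proof -
  have "set_integrable lborel (cball 0 R) h"
    by (intro borel_integrable_compact[unfolded set_integrable_def[symmetric]] continuous_on_subset[OF assms(1)]) auto
  moreover have "indicator (cball 0 R) x *\<^sub>R h x = h x" for x
    using assms(2)[of x] by (cases "norm x \<le> R") (auto simp: indicator_def)
  ultimately show ?thesis unfolding set_integrable_def by (simp only:)
qed

text \<open>The translates of \<open>\<psi>\<close> in the direction of the \<open>i\<close>-th axis have the same integral, so the difference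
  quotients integrate to zero. They are bounded and supported in a fixed ball, and dominated
  convergence passes to the derivative. The partial derivative is only required along the axis,
  because the lemma is also applied to products with the vector field.\<close>

lemma integral_partial_derivative_zero:
  fixes \<psi> \<psi>' :: "real^'n::finite \<Rightarrow> real"
  assumes c: "continuous_on UNIV \<psi>" and c': "continuous_on UNIV \<psi>'"
    and d: "\<And>x. ((\<lambda>h. \<psi> (x + h *\<^sub>R axis i 1)) has_real_derivative \<psi>' x) (at 0)"
    and z: "\<And>x. R < norm x \<Longrightarrow> \<psi> x = 0"
  shows "(\<integral>x. \<psi>' x \<partial>lborel) = 0"
proof -
  define e where "e = (axis i 1 :: real^'n)"
  have ne: "norm e = 1" by (simp add: e_def)
  define H where "H n = 1 / (real n + 1)" for n
  have H: "0 < H n" "H n \<le> 1" for n by (auto simp: H_def)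
  have H0: "H \<longlonglongrightarrow> 0" unfolding H_def by real_asymp
  define q where "q n x = (\<psi> (x + H n *\<^sub>R e) - \<psi> x) / H n" for n x
  have dl: "((\<lambda>h. \<psi> (x + h *\<^sub>R e)) has_real_derivative \<psi>' (x + h *\<^sub>R e)) (at h)" for x h
  proof -
    have "((\<lambda>k. \<psi> ((x + h *\<^sub>R e) + k *\<^sub>R e)) has_real_derivative \<psi>' (x + h *\<^sub>R e)) (at 0)"
      using d unfolding e_def .
    then have "((\<lambda>k. \<psi> (x + (h + k) *\<^sub>R e)) has_real_derivative \<psi>' (x + h *\<^sub>R e)) (at 0)"
      by (simp add: algebra_simps)
    then show ?thesis using DERIV_at_within_shift[of "\<lambda>h. \<psi> (x + h *\<^sub>R e)" _ h 0 UNIV] by simp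
  qed
  have "compact (\<psi>' ` cball 0 (R + 3))" by (intro compact_continuous_image continuous_on_subset[OF c']) auto
  then obtain C where C: "\<And>x. norm x \<le> R + 3 \<Longrightarrow> \<bar>\<psi>' x\<bar> \<le> C"
    using compact_imp_bounded bounded_iff by (metis imageI mem_cball_0 real_norm_def)
  have qi: "integrable lborel (\<lambda>x. \<psi> (x + H n *\<^sub>R e))" for n
  proof (rule integrable_lborel_compact_support[where R = "R + 1"])
    show "continuous_on UNIV (\<lambda>x. \<psi> (x + H n *\<^sub>R e))"
      by (intro continuous_on_compose2[OF c] continuous_intros) auto
    show "\<psi> (x + H n *\<^sub>R e) = 0" if "R + 1 < norm x" for x
    proof -
      have "norm (H n *\<^sub>R e) \<le> 1" using H[of n] ne by simp
      then show ?thesis using that by (intro z) (smt (verit) norm_diff_ineq)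
    qed
  qed
  have pi: "integrable lborel \<psi>" by (rule integrable_lborel_compact_support[OF c z])
  have tr: "(\<integral>x. \<psi> (x + v) \<partial>lborel) = (\<integral>x. \<psi> x \<partial>lborel)" for v
  proof -
    have m: "\<psi> \<in> borel_measurable borel" by (rule borel_measurable_continuous_onI[OF c])
    have "(\<integral>x. \<psi> x \<partial>lborel) = (\<integral>x. \<psi> x \<partial>distr lborel borel ((+) v))"
      by (simp add: lborel_distr_plus)
    also have "\<dots> = (\<integral>x. \<psi> (v + x) \<partial>lborel)" using m by (subst integral_distr) auto
    finally show ?thesis by (simp add: add.commute)
  qed
  have q0: "(\<integral>x. q n x \<partial>lborel) = 0" for n
    unfolding q_def using qi pi tr by (simp add: Bochner_Integration.integral_diff)
  have qb: "\<bar>q n x\<bar> \<le> C * indicator (cball 0 (R + 1)) x" for n x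
  proof (cases "norm x \<le> R + 1")
    case True
    have "\<exists>z>0. z < H n \<and> \<psi> (x + H n *\<^sub>R e) - \<psi> (x + 0 *\<^sub>R e) = (H n - 0) * \<psi>' (x + z *\<^sub>R e)"
      by (rule MVT2) (use H dl in auto)
    then obtain u where u: "0 < u" "u < H n" "\<psi> (x + H n *\<^sub>R e) - \<psi> x = H n * \<psi>' (x + u *\<^sub>R e)" by auto
    have "norm (x + u *\<^sub>R e) \<le> norm x + norm (u *\<^sub>R e)" by (rule norm_triangle_ineq)
    also have "\<dots> \<le> R + 3" using True ne u H(2)[of n] by simp
    finally have "\<bar>\<psi>' (x + u *\<^sub>R e)\<bar> \<le> C" by (rule C)
    then show ?thesis using u H[of n] True by (simp add: q_def)
  next
    case False
    have "norm (H n *\<^sub>R e) \<le> 1" using H[of n] ne by simp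
    then have "\<psi> (x + H n *\<^sub>R e) = 0" using False by (intro z) (smt (verit) norm_diff_ineq)
    moreover have "\<psi> x = 0" using False by (intro z) auto
    ultimately show ?thesis using False by (simp add: q_def)
  qed
  have "(\<lambda>n. \<integral>x. q n x \<partial>lborel) \<longlonglongrightarrow> (\<integral>x. \<psi>' x \<partial>lborel)"
  proof (rule integral_dominated_convergence)
    show "\<psi>' \<in> borel_measurable lborel" using borel_measurable_continuous_onI[OF c'] by simp
    show "q n \<in> borel_measurable lborel" for n
      unfolding q_def using qi[of n] pi by (intro borel_measurable_divide borel_measurable_diff) auto
    show "integrable lborel (\<lambda>x. C * indicator (cball 0 (R + 1)) x)"
      using emeasure_lborel_cball_finite[of 0 "R + 1"]
      by (intro integrable_mult_right integrable_real_indicator) auto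
    show "AE x in lborel. (\<lambda>n. q n x) \<longlonglongrightarrow> \<psi>' x"
    proof (rule AE_I2)
      fix x
      have "((\<lambda>h. (\<psi> (x + h *\<^sub>R e) - \<psi> x) / h) \<longlongrightarrow> \<psi>' x) (at 0)"
        using d[of x] by (simp add: DERIV_def e_def)
      moreover have "filterlim H (at 0) sequentially"
        using H0 H(1) by (auto simp: filterlim_at intro!: always_eventually) (metis less_numeral_extra(3))
      ultimately show "(\<lambda>n. q n x) \<longlonglongrightarrow> \<psi>' x" unfolding q_def by (rule filterlim_compose)
    qed
    show "AE x in lborel. norm (q n x) \<le> C * indicator (cball 0 (R + 1)) x" for n using qb by simp
  qed
  then show ?thesis using q0 by (simp add: LIMSEQ_const_iff)
qed

lemma integral_lebesgue_on_eq_lborel: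
  fixes h :: "'a::euclidean_space \<Rightarrow> real"
  assumes "D \<in> sets lebesgue" "h \<in> borel_measurable borel" "\<And>x. x \<notin> D \<Longrightarrow> h x = 0"
  shows "(\<integral>x. h x \<partial>lebesgue_on D) = (\<integral>x. h x \<partial>lborel)"
proof -
  have "(\<integral>x. h x \<partial>lebesgue_on D) = (\<integral>x. indicator D x *\<^sub>R h x \<partial>lebesgue)"
    using assms(1) by (subst integral_restrict_space) auto
  also have "\<dots> = (\<integral>x. h x \<partial>lebesgue)"
    by (rule Bochner_Integration.integral_cong) (use assms(3) in \<open>auto simp: indicator_def\<close>)
  also have "\<dots> = (\<integral>x. h x \<partial>lborel)" using assms(2) by (intro integral_completion) simp
  finally show ?thesis .
qed

lemma norm_diff_of_sum: "A + B = C \<Longrightarrow> norm (C - A) = norm B" "A + B = C \<Longrightarrow> norm (A - C) = norm B"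
  for A B C :: "'a::real_normed_vector"
  by (auto simp: norm_minus_commute)

section \<open>The flow of a Lipschitz vector field\<close>

lemma vector_derivative_bound:
  fixes y :: "real \<Rightarrow> 'a::real_normed_vector"
  assumes "\<And>t. t \<in> {a..b} \<Longrightarrow> (y has_vector_derivative y' t) (at t within {a..b})"
    and "\<And>t. t \<in> {a..b} \<Longrightarrow> norm (y' t) \<le> B" "r \<in> {a..b}" "t \<in> {a..b}"
  shows "norm (y t - y r) \<le> B * \<bar>t - r\<bar>"
proof -
  have "norm (y t - y r) \<le> B * norm (t - r)"
    by (rule differentiable_bound[of "{a..b}" y "\<lambda>t h. h *\<^sub>R y' t"])
       (use assms in \<open>auto simp: has_vector_derivative_def[symmetric] onorm_scaleR_left bounded_linear_ident onorm_id\<close>)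
  then show ?thesis by simp
qed

locale lipschitz_field =
  fixes F :: "'a::euclidean_space \<Rightarrow> real \<Rightarrow> 'a" and a b L :: real
  assumes ab: "a < b" and L: "0 < L"
    and F_cont: "continuous_on UNIV (\<lambda>(x, t). F x t)"
    and F_lip: "\<And>x y t. norm (F x t - F y t) \<le> L * norm (x - y)"
begin

definition sol :: "(real \<Rightarrow> 'a) \<Rightarrow> bool" where
  "sol y \<longleftrightarrow> (\<forall>t\<in>{a..b}. (y has_vector_derivative F (y t) t) (at t within {a..b}))"

lemma sol_continuous: "sol y \<Longrightarrow> continuous_on {a..b} y"
  unfolding sol_def by (meson continuous_on_eq_continuous_within has_vector_derivative_continuous)

lemma F_comp_cont:
  assumes "continuous_on S y"
  shows "continuous_on S (\<lambda>t. F (y t) t)"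
  using continuous_on_compose2[OF F_cont continuous_on_Pair[OF assms continuous_on_id]] by simp

text \<open>Gronwall's inequality for \<open>\<bar>y - z\<bar>\<^sup>2\<close>, in both directions of time.\<close>

lemma sol_dist:
  assumes y: "sol y" and z: "sol z" and rt: "r \<in> {a..b}" "t \<in> {a..b}"
  shows "norm (y t - z t) \<le> exp (L * \<bar>t - r\<bar>) * norm (y r - z r)"
proof -
  define u where "u t = (y t - z t) \<bullet> (y t - z t)" for t
  define u' where "u' t = 2 * ((y t - z t) \<bullet> (F (y t) t - F (z t) t))" for t
  have uc: "continuous_on {a..b} u"
    unfolding u_def by (intro continuous_intros sol_continuous y z)
  have ud: "(u has_real_derivative u' t) (at t)" if t: "a < t" "t < b" for t
  proof -
    have "at t within {a..b} = at t" using t by (intro at_within_interior) auto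
    then have "(y has_vector_derivative F (y t) t) (at t)" "(z has_vector_derivative F (z t) t) (at t)"
      using y z t unfolding sol_def by (metis atLeastAtMost_iff less_imp_le)+
    then have "((\<lambda>t. y t - z t) has_vector_derivative F (y t) t - F (z t) t) (at t)"
      by (rule has_vector_derivative_diff)
    then have "((\<lambda>t. y t - z t) has_derivative (\<lambda>h. h *\<^sub>R (F (y t) t - F (z t) t))) (at t)"
      by (simp add: has_vector_derivative_def)
    from has_derivative_inner[OF this this] show ?thesis
      unfolding u_def u'_def has_field_derivative_def
      by (simp add: inner_commute[of _ "y t - z t"] mult.commute mult.left_commute mult_commute_abs)
  qed
  have ub: "\<bar>u' t\<bar> \<le> 2 * L * u t" for t
  proof -
    have "\<bar>u' t\<bar> \<le> 2 * (norm (y t - z t) * norm (F (y t) t - F (z t) t))"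
      unfolding u'_def by (simp add: Cauchy_Schwarz_ineq2 abs_mult)
    also have "\<dots> \<le> 2 * (norm (y t - z t) * (L * norm (y t - z t)))"
      by (intro mult_left_mono F_lip) auto
    finally show ?thesis by (simp add: u_def dot_square_norm power2_eq_square algebra_simps)
  qed
  have key: "u t \<le> exp (2 * L * \<bar>t - r\<bar>) * u r"
  proof (cases "r \<le> t")
    case True
    have "exp (- 2 * L * t) * u t \<le> exp (- 2 * L * r) * u r"
    proof (cases "r < t")
      case True
      show ?thesis
      proof (rule DERIV_nonpos_imp_decreasing_open[OF less_imp_le[OF True]])
        fix x assume x: "r < x" "x < t"
        have "((\<lambda>x. exp (- 2 * L * x) * u x) has_real_derivative
            exp (- 2 * L * x) * (- 2 * L) * u x + exp (- 2 * L * x) * u' x) (at x)"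
          using x rt by (auto intro!: derivative_eq_intros ud)
        moreover have "exp (- 2 * L * x) * (- 2 * L) * u x + exp (- 2 * L * x) * u' x
            = exp (- 2 * L * x) * (u' x - 2 * L * u x)" by (simp add: algebra_simps)
        moreover have "\<dots> \<le> 0" using ub[of x] by (intro mult_nonneg_nonpos) auto
        ultimately show "\<exists>y. ((\<lambda>x. exp (- 2 * L * x) * u x) has_real_derivative y) (at x) \<and> y \<le> 0" by auto
      qed (use rt in \<open>auto intro!: continuous_intros continuous_on_subset[OF uc]\<close>)
    qed (use True in simp)
    then have "exp (2 * L * t) * (exp (- 2 * L * t) * u t) \<le> exp (2 * L * t) * (exp (- 2 * L * r) * u r)"
      by (intro mult_left_mono) auto
    then show ?thesis using True by (simp add: exp_minus exp_diff right_diff_distrib divide_inverse mult_ac)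
  next
    case False
    then have tr: "t < r" by simp
    have "exp (2 * L * t) * u t \<le> exp (2 * L * r) * u r"
    proof (rule DERIV_nonneg_imp_increasing_open[OF less_imp_le[OF tr]])
      fix x assume x: "t < x" "x < r"
      have "((\<lambda>x. exp (2 * L * x) * u x) has_real_derivative
          exp (2 * L * x) * (2 * L) * u x + exp (2 * L * x) * u' x) (at x)"
        using x rt by (auto intro!: derivative_eq_intros ud)
      moreover have "exp (2 * L * x) * (2 * L) * u x + exp (2 * L * x) * u' x
          = exp (2 * L * x) * (u' x + 2 * L * u x)" by (simp add: algebra_simps)
      moreover have "0 \<le> \<dots>" using ub[of x] by (intro mult_nonneg_nonneg) auto
      ultimately show "\<exists>y. ((\<lambda>x. exp (2 * L * x) * u x) has_real_derivative y) (at x) \<and> 0 \<le> y" by auto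
    qed (use rt in \<open>auto intro!: continuous_intros continuous_on_subset[OF uc]\<close>)
    then have "exp (- 2 * L * t) * (exp (2 * L * t) * u t) \<le> exp (- 2 * L * t) * (exp (2 * L * r) * u r)"
      by (intro mult_left_mono) auto
    then show ?thesis using tr by (simp add: exp_minus exp_diff right_diff_distrib divide_inverse mult_ac)
  qed
  have "(norm (y t - z t))\<^sup>2 \<le> (exp (L * \<bar>t - r\<bar>) * norm (y r - z r))\<^sup>2"
    using key by (simp add: u_def dot_square_norm power_mult_distrib exp_double[symmetric] mult.assoc)
  then show ?thesis by (rule power2_le_imp_le) auto
qed

text \<open>Picard iteration. The factor \<open>exp (2 L \<bar>t - t0\<bar>)\<close> divided out of the unknown makes the integral
  operator a contraction on the whole interval (with constant \<open>1/2\<close>), so that nothing has to be glued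
  from short intervals. Bounded continuous functions on the whole line with the time clamped to
  \<open>[a, b]\<close> serve as the complete metric space.\<close>

lemma sol_exists:
  assumes t0: "t0 \<in> {a..b}"
  shows "\<exists>y. sol y \<and> y t0 = x0"
proof -
  define cl where "cl t = max a (min b t)" for t :: real
  have cl: "cl t \<in> {a..b}" for t using ab by (auto simp: cl_def)
  have cl_id: "cl t = t" if "t \<in> {a..b}" for t using that by (auto simp: cl_def)
  have cl_cont: "continuous_on S cl" for S unfolding cl_def by (intro continuous_intros)
  define W where "W r = exp (2 * L * \<bar>r - t0\<bar>)" for r
  have W0: "0 < W r" for r by (simp add: W_def)
  have W_cont: "continuous_on S W" for S unfolding W_def by (intro continuous_intros)
  define h where "h z r = F (W r *\<^sub>R z r) r" for z :: "real \<Rightarrow> 'a" and r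
  have h_cont: "continuous_on S (h z)" if "continuous_on S z" for S z
    unfolding h_def by (intro F_comp_cont continuous_intros W_cont that)
  define P where "P z t = x0 + (integral {a..t} (h z) - integral {a..t0} (h z))" for z t
  define Q where "Q z t = inverse (W (cl t)) *\<^sub>R P z (cl t)" for z t
  have P_cont: "continuous_on {a..b} (P z)" if "continuous_on UNIV z" for z
    unfolding P_def
    by (intro continuous_intros indefinite_integral_continuous_1 integrable_continuous_real
        h_cont continuous_on_subset[OF that]) auto
  have Q_b: "Q z \<in> bcontfun" if z: "continuous_on UNIV z" for z
  proof -
    have c: "continuous_on {a..b} (\<lambda>t. inverse (W t) *\<^sub>R P z t)"
      by (rule continuous_on_scaleR[OF continuous_on_inverse[OF W_cont] P_cont[OF z]]) (simp add: W_def)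
    then have "bounded ((\<lambda>t. inverse (W t) *\<^sub>R P z t) ` {a..b})"
      by (intro compact_imp_bounded compact_continuous_image) auto
    then obtain B where B: "\<And>t. t \<in> {a..b} \<Longrightarrow> norm (inverse (W t) *\<^sub>R P z t) \<le> B"
      unfolding bounded_iff by blast
    show ?thesis
    proof (rule bcontfun_normI)
      show "continuous_on UNIV (Q z)"
        unfolding Q_def using cl by (intro continuous_on_compose2[OF c] cl_cont) auto
      show "norm (Q z t) \<le> B" for t unfolding Q_def by (rule B[OF cl])
    qed
  qed
  define T where "T z = Bcontfun (Q (apply_bcontfun z))" for z
  have T: "apply_bcontfun (T z) = Q (apply_bcontfun z)" for z
    unfolding T_def using Q_b by (intro Bcontfun_inverse) auto
  have int_W: "integral {t0..t} (\<lambda>r. L * W r) \<le> W t / 2" if "t0 \<le> t" for t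
  proof -
    have "((\<lambda>r. L * W r) has_integral (exp (2 * L * (t - t0)) / 2 - exp (2 * L * (t0 - t0)) / 2)) {t0..t}"
      using L that
      by (intro fundamental_theorem_of_calculus)
         (auto intro!: derivative_eq_intros simp: W_def has_real_derivative_iff_has_vector_derivative[symmetric])
    from integral_unique[OF this] show ?thesis using that by (simp add: W_def)
  qed
  have int_W': "integral {t..t0} (\<lambda>r. L * W r) \<le> W t / 2" if "t \<le> t0" for t
  proof -
    have "((\<lambda>r. L * W r) has_integral (- exp (2 * L * (t0 - t0)) / 2 - (- exp (2 * L * (t0 - t)) / 2))) {t..t0}"
      using L that
      by (intro fundamental_theorem_of_calculus)
         (auto intro!: derivative_eq_intros simp: W_def has_real_derivative_iff_has_vector_derivative[symmetric])
    from integral_unique[OF this] show ?thesis using that by (simp add: W_def)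
  qed
  have contr: "dist (T z) (T z') \<le> (1/2) * dist z z'" for z z'
  proof (rule dist_bound)
    fix t0' define t where "t = cl t0'"
    have t: "t \<in> {a..b}" using cl by (simp add: t_def)
    let ?z = "apply_bcontfun z" and ?z' = "apply_bcontfun z'"
    let ?d = "\<lambda>r. h ?z r - h ?z' r"
    have hi: "h (apply_bcontfun z) integrable_on {p..q}" for z p q
      by (intro integrable_continuous_real h_cont) auto
    have hd: "norm (?d r) \<le> dist z z' * (L * W r)" for r
    proof -
      have "norm (?d r) \<le> L * norm (W r *\<^sub>R ?z r - W r *\<^sub>R ?z' r)"
        unfolding h_def by (rule F_lip)
      also have "\<dots> = L * (W r * norm (?z r - ?z' r))"
        using W0[of r] by (simp flip: scaleR_diff_right)
      also have "\<dots> \<le> L * (W r * dist z z')"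
        using dist_bounded[of z r z'] W0[of r] L by (intro mult_left_mono) (auto simp: dist_norm)
      finally show ?thesis by (simp add: algebra_simps)
    qed
    have iW: "(\<lambda>r. dist z z' * (L * W r)) integrable_on {p..q}" for p q
      by (intro integrable_continuous_real continuous_intros W_cont)
    have "P ?z t - P ?z' t = (integral {a..t} ?d - integral {a..t0} ?d)"
      unfolding P_def using hi by (simp add: integral_diff algebra_simps)
    moreover have "norm (integral {a..t} ?d - integral {a..t0} ?d) \<le> dist z z' * (W t / 2)"
    proof (cases "t0 \<le> t")
      case True
      have "integral {a..t0} ?d + integral {t0..t} ?d = integral {a..t} ?d"
        using True t0 t hi by (intro Henstock_Kurzweil_Integration.integral_combine integrable_diff) auto
      then have "norm (integral {a..t} ?d - integral {a..t0} ?d) = norm (integral {t0..t} ?d)" by (rule norm_diff_of_sum)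
      also have "\<dots> \<le> integral {t0..t} (\<lambda>r. dist z z' * (L * W r))"
        by (intro integral_norm_bound_integral integrable_diff hi iW hd)
      also have "\<dots> = dist z z' * integral {t0..t} (\<lambda>r. L * W r)" by simp
      also have "\<dots> \<le> dist z z' * (W t / 2)" using int_W[OF True] by (intro mult_left_mono) auto
      finally show ?thesis .
    next
      case False
      then have F: "t \<le> t0" by simp
      have "integral {a..t} ?d + integral {t..t0} ?d = integral {a..t0} ?d"
        using F t0 t hi by (intro Henstock_Kurzweil_Integration.integral_combine integrable_diff) auto
      then have "norm (integral {a..t} ?d - integral {a..t0} ?d) = norm (integral {t..t0} ?d)"
        by (rule norm_diff_of_sum)
      also have "\<dots> \<le> integral {t..t0} (\<lambda>r. dist z z' * (L * W r))"
        by (intro integral_norm_bound_integral integrable_diff hi iW hd)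
      also have "\<dots> = dist z z' * integral {t..t0} (\<lambda>r. L * W r)" by simp
      also have "\<dots> \<le> dist z z' * (W t / 2)" using int_W'[OF F] by (intro mult_left_mono) auto
      finally show ?thesis .
    qed
    ultimately have "norm (P ?z t - P ?z' t) \<le> dist z z' * (W t / 2)" by simp
    then have "inverse (W t) * norm (P ?z t - P ?z' t) \<le> inverse (W t) * (dist z z' * (W t / 2))"
      using W0[of t] by (intro mult_left_mono) auto
    also have "\<dots> = (1/2) * dist z z'" using W0[of t] by (simp add: field_simps)
    finally show "dist (apply_bcontfun (T z) t0') (apply_bcontfun (T z') t0') \<le> (1/2) * dist z z'"
      unfolding T Q_def dist_norm t_def[symmetric] using W0[of t]
      by (simp flip: scaleR_diff_right)
  qed
  then obtain z where z: "T z = z" using banach_fix_type[of "1/2" T] by auto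
  define y where "y t = W t *\<^sub>R apply_bcontfun z t" for t
  have yP: "y t = P (apply_bcontfun z) t" if "t \<in> {a..b}" for t
  proof -
    have "apply_bcontfun z t = inverse (W t) *\<^sub>R P (apply_bcontfun z) t"
      using fun_cong[OF T[of z, unfolded z], of t] that by (simp add: Q_def cl_id)
    then show ?thesis using W0[of t] by (simp add: y_def)
  qed
  have "sol y" unfolding sol_def
  proof
    fix t assume t: "t \<in> {a..b}"
    have "((\<lambda>t. integral {a..t} (h (apply_bcontfun z))) has_vector_derivative h (apply_bcontfun z) t) (at t within {a..b})"
      by (rule integral_has_vector_derivative) (use t in \<open>auto intro!: h_cont\<close>)
    then have "(P (apply_bcontfun z) has_vector_derivative h (apply_bcontfun z) t) (at t within {a..b})"
      unfolding P_def by (auto intro!: derivative_eq_intros)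
    then have "(P (apply_bcontfun z) has_vector_derivative F (y t) t) (at t within {a..b})"
      by (simp add: h_def y_def)
    then show "(y has_vector_derivative F (y t) t) (at t within {a..b})"
      by (rule has_vector_derivative_transform[OF t, rotated]) (simp add: yP)
  qed
  moreover have "y t0 = x0" using yP[OF t0] by (simp add: P_def)
  ultimately show ?thesis by blast
qed

definition flow :: "real \<Rightarrow> real \<Rightarrow> 'a \<Rightarrow> 'a" where
  "flow t0 t x = (SOME y. sol y \<and> y t0 = x) t"

lemma flow_sol: "t0 \<in> {a..b} \<Longrightarrow> sol (\<lambda>t. flow t0 t x)"
  and flow_init [simp]: "t0 \<in> {a..b} \<Longrightarrow> flow t0 t0 x = x"
  using someI_ex[OF sol_exists, of t0 x] by (simp_all add: flow_def)

lemma flow_unique: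
  assumes "sol y" "t0 \<in> {a..b}" "t \<in> {a..b}"
  shows "y t = flow t0 t (y t0)"
  using sol_dist[OF assms(1) flow_sol[OF assms(2)] assms(2,3), of "y t0"] assms(2) by simp

lemma flow_flow:
  assumes "t0 \<in> {a..b}" "t1 \<in> {a..b}" "t2 \<in> {a..b}"
  shows "flow t1 t2 (flow t0 t1 x) = flow t0 t2 x"
  using flow_unique[OF flow_sol[OF assms(1)] assms(2,3)] by simp

lemma flow_lipschitz:
  assumes "t0 \<in> {a..b}" "t \<in> {a..b}"
  shows "norm (flow t0 t x - flow t0 t y) \<le> exp (L * (b - a)) * norm (x - y)"
proof -
  have "norm (flow t0 t x - flow t0 t y) \<le> exp (L * \<bar>t - t0\<bar>) * norm (x - y)"
    using sol_dist[OF flow_sol flow_sol] assms by fastforce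
  also have "\<dots> \<le> exp (L * (b - a)) * norm (x - y)"
    using assms L by (intro mult_right_mono) auto
  finally show ?thesis .
qed

text \<open>Over a short time the displacement hardly depends on the starting point, so the flow keeps the direction
  of short segments; this is used at the boundary.\<close>

lemma flow_displacement:
  assumes t: "t0 \<in> {a..b}" "t \<in> {a..b}"
  shows "norm ((flow t0 t x - x) - (flow t0 t y - y)) \<le> L * exp (L * (b - a)) * norm (x - y) * \<bar>t - t0\<bar>"
proof -
  have "norm ((flow t0 t x - flow t0 t y) - (flow t0 t0 x - flow t0 t0 y)) \<le> L * exp (L * (b - a)) * norm (x - y) * \<bar>t - t0\<bar>"
  proof (rule vector_derivative_bound[where a = a and b = b])
    fix t assume t': "t \<in> {a..b}"
    show "((\<lambda>t. flow t0 t x - flow t0 t y) has_vector_derivative F (flow t0 t x) t - F (flow t0 t y) t) (at t within {a..b})"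
      using flow_sol[OF t(1)] t' unfolding sol_def by (auto intro!: has_vector_derivative_diff)
    have "norm (F (flow t0 t x) t - F (flow t0 t y) t) \<le> L * norm (flow t0 t x - flow t0 t y)" by (rule F_lip)
    also have "\<dots> \<le> L * (exp (L * (b - a)) * norm (x - y))"
      using L flow_lipschitz[OF t(1) t'] by (intro mult_left_mono) auto
    finally show "norm (F (flow t0 t x) t - F (flow t0 t y) t) \<le> L * exp (L * (b - a)) * norm (x - y)"
      by (simp add: mult.assoc)
  qed (use t in auto)
  then show ?thesis using t by (simp add: algebra_simps)
qed

end

locale bounded_lipschitz_field = lipschitz_field +
  fixes C :: real
  assumes F_bound: "\<And>x t. norm (F x t) \<le> C"
begin

lemma flow_time_lipschitz:
  assumes "t0 \<in> {a..b}" "r \<in> {a..b}" "t \<in> {a..b}"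
  shows "norm (flow t0 t x - flow t0 r x) \<le> C * \<bar>t - r\<bar>"
  by (rule vector_derivative_bound[where a = a and b = b and y' = "\<lambda>t. F (flow t0 t x) t"]) (use flow_sol[OF assms(1)] F_bound assms in \<open>auto simp: sol_def\<close>)

lemma C_nonneg: "0 \<le> C"
  using F_bound norm_ge_zero order_trans by blast

lemma flow_joint_dist:
  assumes "t0 \<in> {a..b}" "r \<in> {a..b}" "t \<in> {a..b}"
  shows "norm (flow t0 t x - flow t0 r y) \<le> C * \<bar>t - r\<bar> + exp (L * (b - a)) * norm (x - y)"
proof -
  have "flow t0 t x - flow t0 r y = (flow t0 t x - flow t0 r x) + (flow t0 r x - flow t0 r y)" by simp
  then show ?thesis
    using flow_time_lipschitz[OF assms, of x] flow_lipschitz[OF assms(1,2), of x y] norm_triangle_ineq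
    by (smt (verit))
qed

lemma flow_joint_continuous:
  assumes "t0 \<in> {a..b}"
  shows "continuous_on (UNIV \<times> {a..b}) (\<lambda>(x, t). flow t0 t x)"
  unfolding continuous_on_def
proof
  fix q :: "'a \<times> real" assume q: "q \<in> UNIV \<times> {a..b}"
  then have r: "snd q \<in> {a..b}" by auto
  let ?F = "at q within UNIV \<times> {a..b}"
  have "((\<lambda>p. flow t0 (snd p) (fst p) - flow t0 (snd q) (fst q)) \<longlongrightarrow> 0) ?F"
  proof (rule Lim_null_comparison)
    show "\<forall>\<^sub>F p in ?F. norm (flow t0 (snd p) (fst p) - flow t0 (snd q) (fst q))
        \<le> C * \<bar>snd p - snd q\<bar> + exp (L * (b - a)) * norm (fst p - fst q)"
      unfolding eventually_at_filter
      by (intro always_eventually allI impI) (rule flow_joint_dist[OF assms r], auto)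
    have "((\<lambda>p. C * \<bar>snd p - snd q\<bar> + exp (L * (b - a)) * norm (fst p - fst q)) \<longlongrightarrow>
        C * \<bar>snd q - snd q\<bar> + exp (L * (b - a)) * norm (fst q - fst q)) ?F"
      by (intro tendsto_intros)
    then show "((\<lambda>p. C * \<bar>snd p - snd q\<bar> + exp (L * (b - a)) * norm (fst p - fst q)) \<longlongrightarrow> 0) ?F" by simp
  qed
  then show "((\<lambda>(x, t). flow t0 t x) \<longlongrightarrow> (case q of (x, t) \<Rightarrow> flow t0 t x)) ?F"
    by (simp add: case_prod_beta' LIM_zero_iff)
qed

end

section \<open>Square integrable functions and test functions on a bounded domain\<close>

locale bounded_domain =
  fixes D :: "(real^'n::finite) set"
  assumes open_D: "open D" and bounded_D: "bounded D"
begin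

abbreviation I :: "(real^'n \<Rightarrow> real) \<Rightarrow> real" where
  "I h \<equiv> integral\<^sup>L (lebesgue_on D) h"

abbreviation vol :: real where "vol \<equiv> measure lebesgue D"

lemma D_sets [measurable]: "D \<in> sets lebesgue" using open_D by simp

lemma D_lmeasurable: "D \<in> lmeasurable"
  using D_sets bounded_D by (rule bounded_set_imp_lmeasurable[rotated])

lemma finite_measure_D: "finite_measure (lebesgue_on D)"
  by (rule finite_measure_lebesgue_on[OF D_lmeasurable])

lemma integrable_const_D: "integrable (lebesgue_on D) (\<lambda>x. c :: real)"
  by (rule finite_measure.integrable_const[OF finite_measure_D])

lemma I_const: "I (\<lambda>x. c) = c * vol"
  using D_sets by (simp add: measure_restrict_space)

lemma measurable_D: "continuous_on UNIV b \<Longrightarrow> b \<in> borel_measurable (lebesgue_on D)" for b :: "real^'n \<Rightarrow> real"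
  by (rule continuous_imp_measurable_on_sets_lebesgue[OF _ D_sets]) (rule continuous_on_subset, auto)

lemma integrable_bounded_D:
  fixes b :: "real^'n \<Rightarrow> real"
  assumes "b \<in> borel_measurable (lebesgue_on D)" "\<And>x. x \<in> D \<Longrightarrow> \<bar>b x\<bar> \<le> B"
  shows "integrable (lebesgue_on D) b"
  by (rule Bochner_Integration.integrable_bound[OF integrable_const_D[where c = B] assms(1)]) (use assms(2) in \<open>force intro!: AE_I2\<close>)

lemma L2_measurable: "u \<in> L2_space D \<Longrightarrow> u \<in> borel_measurable (lebesgue_on D)"
  and L2_square_integrable: "u \<in> L2_space D \<Longrightarrow> integrable (lebesgue_on D) (\<lambda>x. (u x)\<^sup>2)"
  by (simp_all add: L2_space_def)

lemma L2_mult_integrable: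
  assumes "u \<in> L2_space D" "v \<in> L2_space D"
  shows "integrable (lebesgue_on D) (\<lambda>x. u x * v x)"
proof (rule Bochner_Integration.integrable_bound)
  show "integrable (lebesgue_on D) (\<lambda>x. (u x)\<^sup>2 + (v x)\<^sup>2)"
    using assms by (intro Bochner_Integration.integrable_add L2_square_integrable)
  show "(\<lambda>x. u x * v x) \<in> borel_measurable (lebesgue_on D)"
    using assms by (intro borel_measurable_times L2_measurable)
  have "\<bar>a * b\<bar> \<le> a\<^sup>2 + b\<^sup>2" for a b :: real
  proof -
    have "0 \<le> \<bar>a\<bar> * \<bar>b\<bar>" by simp
    moreover have "2 * (\<bar>a\<bar> * \<bar>b\<bar>) \<le> a\<^sup>2 + b\<^sup>2"
      using sum_squares_bound[of "\<bar>a\<bar>" "\<bar>b\<bar>"] by simp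
    ultimately show ?thesis unfolding abs_mult by linarith
  qed
  then show "AE x in lebesgue_on D. norm (u x * v x) \<le> norm ((u x)\<^sup>2 + (v x)\<^sup>2)"
    by (intro AE_I2) auto
qed

lemma L2_bounded_mult:
  assumes u: "u \<in> L2_space D" and b: "b \<in> borel_measurable (lebesgue_on D)" "\<And>x. x \<in> D \<Longrightarrow> \<bar>b x\<bar> \<le> B"
  shows "(\<lambda>x. u x * b x) \<in> L2_space D"
  unfolding L2_space_def
proof (intro CollectI conjI)
  show m: "(\<lambda>x. u x * b x) \<in> borel_measurable (lebesgue_on D)" by (intro borel_measurable_times L2_measurable[OF u] b(1))
  show "integrable (lebesgue_on D) (\<lambda>x. (u x * b x)\<^sup>2)"
  proof (rule Bochner_Integration.integrable_bound)
    show "integrable (lebesgue_on D) (\<lambda>x. B\<^sup>2 * (u x)\<^sup>2)" using u by (intro integrable_mult_right L2_square_integrable)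
    show "AE x in lebesgue_on D. norm ((u x * b x)\<^sup>2) \<le> norm (B\<^sup>2 * (u x)\<^sup>2)"
    proof (intro AE_I2)
      fix x assume "x \<in> space (lebesgue_on D)"
      then have "(b x)\<^sup>2 \<le> B\<^sup>2" using b(2)[of x] by (simp add: abs_le_square_iff[symmetric])
      then show "norm ((u x * b x)\<^sup>2) \<le> norm (B\<^sup>2 * (u x)\<^sup>2)"
        by (simp add: power_mult_distrib mult.commute[of "(u x)\<^sup>2"] mult_right_mono)
    qed
  qed (use m in measurable)
qed

lemma L2_bounded:
  assumes "b \<in> borel_measurable (lebesgue_on D)" "\<And>x. x \<in> D \<Longrightarrow> \<bar>b x\<bar> \<le> B"
  shows "b \<in> L2_space D"
proof -
  have "(\<lambda>x. 1) \<in> L2_space D" by (simp add: L2_space_def integrable_const_D)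
  from L2_bounded_mult[OF this assms] show ?thesis by simp
qed

lemma L2_cmult: "u \<in> L2_space D \<Longrightarrow> (\<lambda>x. c * u x) \<in> L2_space D"
  using L2_bounded_mult[of u "\<lambda>x. c" "\<bar>c\<bar>"] by (simp add: mult.commute)

lemma L2_add:
  assumes "u \<in> L2_space D" "v \<in> L2_space D"
  shows "(\<lambda>x. u x + v x) \<in> L2_space D"
  unfolding L2_space_def
proof (intro CollectI conjI)
  show "(\<lambda>x. u x + v x) \<in> borel_measurable (lebesgue_on D)"
    using assms by (intro borel_measurable_add L2_measurable)
  have "integrable (lebesgue_on D) (\<lambda>x. (u x)\<^sup>2 + (v x)\<^sup>2 + 2 * (u x * v x))"
    using assms by (intro Bochner_Integration.integrable_add L2_square_integrable integrable_mult_right L2_mult_integrable)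
  then show "integrable (lebesgue_on D) (\<lambda>x. (u x + v x)\<^sup>2)"
    by (simp add: power2_sum mult.assoc)
qed

lemma L2_diff:
  assumes "u \<in> L2_space D" "v \<in> L2_space D"
  shows "(\<lambda>x. u x - v x) \<in> L2_space D"
  using L2_add[OF assms(1) L2_cmult[OF assms(2), of "-1"]] by simp

lemma L2_sum:
  assumes "\<And>i. i \<in> S \<Longrightarrow> u i \<in> L2_space D"
  shows "(\<lambda>x. \<Sum>i\<in>S. u i x) \<in> L2_space D"
  using assms
proof (induction S rule: infinite_finite_induct)
  case (insert x S)
  then show ?case by (auto intro!: L2_add)
qed (auto intro!: L2_bounded[where B = 0])

lemma L2_norm_sq: "(L2_norm D u)\<^sup>2 = I (\<lambda>x. (u x)\<^sup>2)"
  by (simp add: L2_norm_def L2_inner_def power2_eq_square)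

lemma L2_norm_nonneg [simp]: "0 \<le> L2_norm D u" by (simp add: L2_norm_def L2_inner_def)

lemma L2_norm_uminus: "L2_norm D (\<lambda>x. u x - v x) = L2_norm D (\<lambda>x. v x - u x)"
  by (simp add: L2_norm_def L2_inner_def power2_eq_square[symmetric] power2_commute)

lemma inner_le_norm:
  assumes "u \<in> L2_space D" "v \<in> L2_space D"
  shows "\<bar>I (\<lambda>x. u x * v x)\<bar> \<le> L2_norm D u * L2_norm D v"
proof -
  define a where "a = I (\<lambda>x. (u x)\<^sup>2)"
  define b where "b = I (\<lambda>x. (v x)\<^sup>2)"
  define p where "p = I (\<lambda>x. u x * v x)"
  have q: "0 \<le> t\<^sup>2 * a + 2 * t * p + b" for t
  proof -
    have "0 \<le> I (\<lambda>x. (t * u x + v x)\<^sup>2)" by simp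
    also have "I (\<lambda>x. (t * u x + v x)\<^sup>2) = I (\<lambda>x. t\<^sup>2 * (u x)\<^sup>2 + (2 * t) * (u x * v x) + (v x)\<^sup>2)"
      by (simp add: power2_sum power_mult_distrib algebra_simps)
    also have "\<dots> = t\<^sup>2 * a + 2 * t * p + b"
      unfolding a_def b_def p_def using assms
      by (simp add: L2_square_integrable L2_mult_integrable)
    finally show ?thesis .
  qed
  have "p\<^sup>2 \<le> a * b"
  proof (cases "a = 0")
    case True
    have "p = 0"
    proof (rule ccontr)
      assume "p \<noteq> 0"
      then show False using q[of "- (b + 1) / (2 * p)"] True by (simp add: field_simps)
    qed
    then show ?thesis using True by simp
  next
    case False
    then have "a > 0" unfolding a_def by (smt (verit) integral_nonneg_AE AE_I2 zero_le_power2)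
    then show ?thesis using q[of "- p / a"] by (simp add: field_simps power2_eq_square)
  qed
  then have "\<bar>p\<bar> \<le> sqrt (a * b)" by (rule real_le_rsqrt[of "\<bar>p\<bar>", simplified])
  then show ?thesis unfolding p_def a_def b_def
    by (simp add: L2_norm_def L2_inner_def real_sqrt_mult power2_eq_square)
qed

lemma L2_norm_triangle:
  assumes "u \<in> L2_space D" "v \<in> L2_space D"
  shows "L2_norm D (\<lambda>x. u x + v x) \<le> L2_norm D u + L2_norm D v"
proof (rule power2_le_imp_le)
  have "(L2_norm D (\<lambda>x. u x + v x))\<^sup>2 = I (\<lambda>x. (u x)\<^sup>2 + 2 * (u x * v x) + (v x)\<^sup>2)"
    by (simp add: L2_norm_sq power2_sum algebra_simps)
  also have "\<dots> = (L2_norm D u)\<^sup>2 + 2 * I (\<lambda>x. u x * v x) + (L2_norm D v)\<^sup>2"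
    unfolding L2_norm_sq using assms by (simp add: L2_square_integrable L2_mult_integrable)
  also have "\<dots> \<le> (L2_norm D u + L2_norm D v)\<^sup>2"
    using inner_le_norm[OF assms] by (simp add: power2_sum)
  finally show "(L2_norm D (\<lambda>x. u x + v x))\<^sup>2 \<le> (L2_norm D u + L2_norm D v)\<^sup>2" .
qed simp

lemma L2_norm_diff_triangle:
  assumes "u \<in> L2_space D" "v \<in> L2_space D" "w \<in> L2_space D"
  shows "L2_norm D (\<lambda>x. u x - w x) \<le> L2_norm D (\<lambda>x. u x - v x) + L2_norm D (\<lambda>x. v x - w x)"
  using L2_norm_triangle[OF L2_diff[OF assms(1,2)] L2_diff[OF assms(2,3)]] by simp

lemma L2_norm_diff_ge:
  assumes "u \<in> L2_space D" "v \<in> L2_space D"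
  shows "\<bar>L2_norm D u - L2_norm D v\<bar> \<le> L2_norm D (\<lambda>x. u x - v x)"
  using L2_norm_triangle[OF L2_diff[OF assms] assms(2)] L2_norm_triangle[OF L2_diff[OF assms(2,1)] assms(1)]
  by (simp add: L2_norm_uminus[of v u])

lemma L2_norm_bounded_mult:
  assumes u: "u \<in> L2_space D" and b: "b \<in> borel_measurable (lebesgue_on D)" "\<And>x. x \<in> D \<Longrightarrow> \<bar>b x\<bar> \<le> B"
    and "0 \<le> B"
  shows "L2_norm D (\<lambda>x. u x * b x) \<le> B * L2_norm D u"
proof (rule power2_le_imp_le)
  have "(L2_norm D (\<lambda>x. u x * b x))\<^sup>2 \<le> I (\<lambda>x. B\<^sup>2 * (u x)\<^sup>2)"
    unfolding L2_norm_sq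
  proof (rule integral_mono_AE)
    show "integrable (lebesgue_on D) (\<lambda>x. (u x * b x)\<^sup>2)" by (rule L2_square_integrable[OF L2_bounded_mult[OF u b]])
    show "integrable (lebesgue_on D) (\<lambda>x. B\<^sup>2 * (u x)\<^sup>2)" using u by (intro integrable_mult_right L2_square_integrable)
    show "AE x in lebesgue_on D. (u x * b x)\<^sup>2 \<le> B\<^sup>2 * (u x)\<^sup>2"
    proof (intro AE_I2)
      fix x assume "x \<in> space (lebesgue_on D)"
      then have "(b x)\<^sup>2 \<le> B\<^sup>2" using b(2)[of x] by (simp add: abs_le_square_iff[symmetric])
      then show "(u x * b x)\<^sup>2 \<le> B\<^sup>2 * (u x)\<^sup>2"
        by (simp add: power_mult_distrib mult.commute[of "(u x)\<^sup>2"] mult_right_mono)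
    qed
  qed
  then show "(L2_norm D (\<lambda>x. u x * b x))\<^sup>2 \<le> (B * L2_norm D u)\<^sup>2"
    using u by (simp add: L2_norm_sq power_mult_distrib)
qed (use assms in simp)

lemma L2_norm_bounded:
  assumes "b \<in> borel_measurable (lebesgue_on D)" "\<And>x. x \<in> D \<Longrightarrow> \<bar>b x\<bar> \<le> B" "0 \<le> B"
  shows "L2_norm D b \<le> B * sqrt vol"
proof -
  have 1: "(\<lambda>x. 1) \<in> L2_space D" by (simp add: L2_space_def integrable_const_D)
  have "L2_norm D (\<lambda>x. 1) = sqrt vol"
    using I_const[of 1] by (simp add: L2_norm_def L2_inner_def)
  then show ?thesis using L2_norm_bounded_mult[OF 1 assms] by simp
qed

lemma inner_bounded_le:
  assumes "u \<in> L2_space D" "b \<in> borel_measurable (lebesgue_on D)" "\<And>x. x \<in> D \<Longrightarrow> \<bar>b x\<bar> \<le> B" "0 \<le> B"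
  shows "\<bar>I (\<lambda>x. u x * b x)\<bar> \<le> B * sqrt vol * L2_norm D u"
proof -
  have "\<bar>I (\<lambda>x. u x * b x)\<bar> \<le> L2_norm D u * L2_norm D b"
    by (rule inner_le_norm[OF assms(1) L2_bounded[OF assms(2,3)]])
  also have "\<dots> \<le> L2_norm D u * (B * sqrt vol)"
    by (intro mult_left_mono L2_norm_bounded assms) auto
  finally show ?thesis by (simp add: mult_ac)
qed

lemma test_functions_iff:
  "\<phi> \<in> test_functions D \<longleftrightarrow> smooth \<phi> \<and> (\<exists>K. compact K \<and> K \<subseteq> D \<and> (\<forall>x. x \<notin> K \<longrightarrow> \<phi> x = 0))"
proof
  assume "\<phi> \<in> test_functions D"
  then have "smooth \<phi>" "compact (closure {x. \<phi> x \<noteq> 0})" "closure {x. \<phi> x \<noteq> 0} \<subseteq> D"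
    by (auto simp: test_functions_def smooth_def)
  moreover have "\<forall>x. x \<notin> closure {x. \<phi> x \<noteq> 0} \<longrightarrow> \<phi> x = 0"
    using closure_subset[of "{x. \<phi> x \<noteq> 0}"] by blast
  ultimately show "smooth \<phi> \<and> (\<exists>K. compact K \<and> K \<subseteq> D \<and> (\<forall>x. x \<notin> K \<longrightarrow> \<phi> x = 0))"
    by blast
next
  assume *: "smooth \<phi> \<and> (\<exists>K. compact K \<and> K \<subseteq> D \<and> (\<forall>x. x \<notin> K \<longrightarrow> \<phi> x = 0))"
  then obtain K where K: "compact K" "K \<subseteq> D" "\<And>x. x \<notin> K \<Longrightarrow> \<phi> x = 0" by auto
  then have "closure {x. \<phi> x \<noteq> 0} \<subseteq> K"
    by (intro closure_minimal compact_imp_closed) auto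
  moreover have "bounded (closure {x. \<phi> x \<noteq> 0})"
    using calculation K(1) bounded_subset compact_imp_bounded by blast
  ultimately show "\<phi> \<in> test_functions D"
    using * K by (auto simp: test_functions_def smooth_def compact_eq_bounded_closed)
qed

lemma test_smooth: "\<phi> \<in> test_functions D \<Longrightarrow> smooth \<phi>"
  by (simp add: test_functions_iff)

lemma test_zero: "(\<lambda>x. 0) \<in> test_functions D"
  unfolding test_functions_iff by (auto intro!: smooth_const exI[of _ "{}"])

lemma test_mult: "\<phi> \<in> test_functions D \<Longrightarrow> smooth h \<Longrightarrow> (\<lambda>x. \<phi> x * h x) \<in> test_functions D"
  unfolding test_functions_iff by (force intro: smooth_mult)

lemma test_add:
  assumes "\<phi> \<in> test_functions D" "\<psi> \<in> test_functions D"
  shows "(\<lambda>x. \<phi> x + \<psi> x) \<in> test_functions D"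
proof -
  from assms obtain K K' where "compact K" "K \<subseteq> D" "\<And>x. x \<notin> K \<Longrightarrow> \<phi> x = 0" "compact K'" "K' \<subseteq> D" "\<And>x. x \<notin> K' \<Longrightarrow> \<psi> x = 0"
    unfolding test_functions_iff by auto
  then show ?thesis using assms unfolding test_functions_iff
    by (auto intro!: smooth_add exI[of _ "K \<union> K'"] compact_Un)
qed

lemma test_cmult: "\<phi> \<in> test_functions D \<Longrightarrow> (\<lambda>x. c * \<phi> x) \<in> test_functions D"
  using test_mult[of \<phi> "\<lambda>x. c"] by (simp add: smooth_const mult.commute)

lemma test_partial: "\<phi> \<in> test_functions D \<Longrightarrow> partial_deriv i \<phi> \<in> test_functions D"
  unfolding test_functions_iff
  using smooth_partial_deriv partial_deriv_outside compact_imp_closed by metis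

lemma test_continuous: "\<phi> \<in> test_functions D \<Longrightarrow> continuous_on S \<phi>"
  using smooth_continuous test_smooth by auto

lemma test_measurable: "\<phi> \<in> test_functions D \<Longrightarrow> \<phi> \<in> borel_measurable (lebesgue_on D)"
  by (intro measurable_D test_continuous)

lemma continuous_bounded_D:
  fixes b :: "real^'n \<Rightarrow> real"
  assumes "continuous_on UNIV b"
  shows "\<exists>B\<ge>0. \<forall>x\<in>D. \<bar>b x\<bar> \<le> B"
proof -
  have "compact (closure D)" using bounded_D by simp
  then have "bounded (b ` closure D)"
    by (intro compact_imp_bounded compact_continuous_image continuous_on_subset[OF assms]) auto
  then obtain B where "\<forall>x\<in>closure D. \<bar>b x\<bar> \<le> B" by (auto simp: bounded_iff)
  then show ?thesis using closure_subset by (intro exI[of _ "max 0 B"]) (auto simp: le_max_iff_disj)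
qed

lemma L2_continuous: "continuous_on UNIV b \<Longrightarrow> b \<in> L2_space D" for b :: "real^'n \<Rightarrow> real"
  using continuous_bounded_D[of b] L2_bounded[OF measurable_D, of b] by auto

lemma L2_mult_continuous: "u \<in> L2_space D \<Longrightarrow> continuous_on UNIV b \<Longrightarrow> (\<lambda>x. u x * b x) \<in> L2_space D"
  for b :: "real^'n \<Rightarrow> real"
  using continuous_bounded_D[of b] L2_bounded_mult[OF _ measurable_D, of u b] by auto

lemma test_L2: "\<phi> \<in> test_functions D \<Longrightarrow> \<phi> \<in> L2_space D"
  by (intro L2_continuous test_continuous)

lemma integral_partial_zero_D:
  assumes K: "compact K" "K \<subseteq> D" "\<And>x. x \<notin> K \<Longrightarrow> \<psi> x = 0"
    and c: "continuous_on UNIV \<psi>" and c': "continuous_on UNIV \<psi>'"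
    and d: "\<And>x. ((\<lambda>h. \<psi> (x + h *\<^sub>R axis i 1)) has_real_derivative \<psi>' x) (at 0)"
  shows "I \<psi>' = 0"
proof -
  obtain R where R: "\<And>x. x \<in> K \<Longrightarrow> norm x \<le> R" using compact_imp_bounded[OF K(1)] by (auto simp: bounded_iff)
  have "\<psi>' x = 0" if "x \<notin> D" for x
  proof -
    have x: "x \<notin> K" using that K by auto
    have "\<forall>\<^sub>F h in nhds (0::real). x + h *\<^sub>R axis i 1 \<in> - K"
    proof -
      have "((\<lambda>h. x + h *\<^sub>R axis i 1) \<longlongrightarrow> x + 0 *\<^sub>R axis i 1) (nhds (0::real))"
        by (intro tendsto_intros filterlim_ident)
      moreover have "open (- K)" using K(1) compact_imp_closed by blast
      ultimately show ?thesis using x by (intro topological_tendstoD[of _ x]) auto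
    qed
    then have "\<forall>\<^sub>F h in nhds 0. \<psi> (x + h *\<^sub>R axis i 1) = 0" by eventually_elim (use K in auto)
    then have "((\<lambda>h. \<psi> (x + h *\<^sub>R axis i 1)) has_real_derivative 0) (at 0)"
      by (subst DERIV_cong_ev[OF refl _ refl]) auto
    then show ?thesis using DERIV_unique[OF d[of x]] by simp
  qed
  then have "I \<psi>' = (\<integral>x. \<psi>' x \<partial>lborel)"
    by (intro integral_lebesgue_on_eq_lborel borel_measurable_continuous_onI c') auto
  also have "\<dots> = 0"
    by (rule integral_partial_derivative_zero[OF c c' d, of R]) (use R K in force)
  finally show ?thesis .
qed

lemma test_integration_by_parts:
  assumes \<phi>: "\<phi> \<in> test_functions D" and h: "smooth h"
  shows "I (\<lambda>x. h x * partial_deriv i \<phi> x) = - I (\<lambda>x. partial_deriv i h x * \<phi> x)"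
proof -
  obtain K where K: "compact K" "K \<subseteq> D" "\<And>x. x \<notin> K \<Longrightarrow> \<phi> x * h x = 0"
    using \<phi> unfolding test_functions_iff by auto
  note s = test_smooth[OF \<phi>]
  have "I (\<lambda>x. partial_deriv i (\<lambda>x. \<phi> x * h x) x) = 0"
    by (rule integral_partial_zero_D[where \<psi> = "\<lambda>x. \<phi> x * h x" and i = i, OF K])
       (assumption | intro smooth_continuous smooth_partial_deriv smooth_mult s h partial_deriv_direction smooth_differentiable)+
  also have "I (\<lambda>x. partial_deriv i (\<lambda>x. \<phi> x * h x) x)
      = I (\<lambda>x. h x * partial_deriv i \<phi> x + partial_deriv i h x * \<phi> x)"
    by (rule Bochner_Integration.integral_cong) (simp_all add: partial_deriv_mult smooth_differentiable s h)
  also have "\<dots> = I (\<lambda>x. h x * partial_deriv i \<phi> x) + I (\<lambda>x. partial_deriv i h x * \<phi> x)"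
    by (intro Bochner_Integration.integral_add L2_mult_integrable L2_continuous smooth_continuous smooth_partial_deriv s h)
  finally show ?thesis by simp
qed

lemma test_W12_0:
  assumes "\<phi> \<in> test_functions D"
  shows "W12_0 D \<phi> (gradient \<phi>)"
  unfolding W12_0_def W12_def
proof (intro conjI ballI allI)
  show "\<phi> \<in> L2_space D" by (rule test_L2[OF assms])
  show "(\<lambda>x. gradient \<phi> x $ i) \<in> L2_space D" for i using test_L2[OF test_partial[OF assms]] by simp
  show "L2_inner D \<phi> (partial_deriv i \<psi>) = - L2_inner D (\<lambda>x. gradient \<phi> x $ i) \<psi>" if "\<psi> \<in> test_functions D" for \<psi> i
    using test_integration_by_parts[OF that test_smooth[OF assms]] by (simp add: L2_inner_def)
  show "\<exists>\<phi>'. (\<forall>k. \<phi>' k \<in> test_functions D) \<and> (\<lambda>k. L2_norm D (\<lambda>x. \<phi>' k x - \<phi> x)) \<longlonglongrightarrow> 0 \<and>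
     (\<forall>i. (\<lambda>k. L2_norm D (\<lambda>x. partial_deriv i (\<phi>' k) x - gradient \<phi> x $ i)) \<longlonglongrightarrow> 0)"
    using assms by (intro exI[of _ "\<lambda>k. \<phi>"]) (auto simp: L2_norm_def L2_inner_def)
qed

end

section \<open>Weak solutions in integrated form\<close>

lemma complete_measure_lebesgue_on:
  assumes "S \<in> sets lebesgue"
  shows "complete_measure (lebesgue_on S)"
proof
  fix A B :: "'a set" assume AB: "B \<subseteq> A" "A \<in> null_sets (lebesgue_on S)"
  then have "A \<in> null_sets lebesgue" "A \<subseteq> S"
    using assms by (auto simp: null_sets_restrict_space)
  then have "B \<in> sets lebesgue" "B \<subseteq> S"
    using AB(1) completion.complete by auto
  then show "B \<in> sets (lebesgue_on S)" using assms by (simp add: sets_restrict_space_iff)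
qed

text \<open>Only one of the two functions is required to be measurable: the completeness of the measure
  supplies the other. In the weak formulation, the inner integral agrees with a manifestly measurable
  function of time only almost everywhere.\<close>

lemma integral_lebesgue_on_cong_AE:
  fixes g h :: "'a::euclidean_space \<Rightarrow> real"
  assumes S: "S \<in> sets lebesgue" and g: "g \<in> borel_measurable (lebesgue_on S)"
    and ae: "AE x in lebesgue_on S. h x = g x"
  shows "integral\<^sup>L (lebesgue_on S) h = integral\<^sup>L (lebesgue_on S) g"
proof (rule integral_cong_AE)
  interpret complete_measure "lebesgue_on S" by (rule complete_measure_lebesgue_on[OF S])
  show "h \<in> borel_measurable (lebesgue_on S)"
  proof (rule measurableI)
    fix A :: "real set" assume A: "A \<in> sets borel"
    show "h -` A \<inter> space (lebesgue_on S) \<in> sets (lebesgue_on S)"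
    proof (rule in_sets_AE)
      show "AE x in lebesgue_on S. (x \<in> g -` A \<inter> space (lebesgue_on S)) = (x \<in> h -` A \<inter> space (lebesgue_on S))"
        using ae by eventually_elim simp
      show "g -` A \<inter> space (lebesgue_on S) \<in> sets (lebesgue_on S)" using g A by (rule measurable_sets)
    qed simp
  qed simp
qed (use assms in auto)

lemma AE_lebesgue_on_subset:
  assumes "AE x in lebesgue_on S. P x" "A \<subseteq> S" "S \<in> sets lebesgue" "A \<in> sets lebesgue"
  shows "AE x in lebesgue_on A. P x"
  using assms by (auto simp: AE_restrict_space_iff elim!: eventually_mono)

lemma AE_Icc_exists:
  assumes ae: "AE t in lebesgue_on {a..b}. P t" and "a \<le> c" "c < d" "d \<le> (b :: real)"
  shows "\<exists>t\<in>{c..d}. P t"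
proof (rule ccontr)
  assume "\<not> ?thesis"
  moreover have "AE t in lebesgue_on {c..d}. P t"
    by (rule AE_lebesgue_on_subset[OF ae]) (use assms in auto)
  ultimately have "AE t in lebesgue. t \<notin> {c..d}"
    by (auto simp: AE_restrict_space_iff elim!: eventually_mono)
  then have "{c..d} \<in> null_sets lebesgue"
    by (simp add: completion.null_sets_iff_AE)
  then have "negligible {c..d}" by (simp add: negligible_iff_null_sets)
  then show False using assms by (simp add: negligible_interval(1)[of c d, unfolded cbox_interval] )
qed

locale transport_domain = bounded_domain D for D :: "(real^'n::finite) set" +
  fixes f :: "real^'n \<Rightarrow> real \<Rightarrow> real^'n" and s T :: real
  assumes admissible: "admissible_field f" and sT: "s < T"
begin

lemma field_continuous: "continuous_on UNIV (\<lambda>(x, t). f x t)"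
  using admissible by (simp add: admissible_field_def)

lemma joint_uniform:
  fixes b :: "real^'n \<Rightarrow> real \<Rightarrow> 'b::real_normed_vector"
  assumes b: "continuous_on UNIV (\<lambda>(x, t). b x t)"
  shows "\<exists>B\<ge>0. \<forall>x\<in>D. \<forall>t\<in>{s..T}. norm (b x t) \<le> B"
    and "\<eta> > 0 \<Longrightarrow> \<exists>h>0. \<forall>x\<in>D. \<forall>t\<in>{s..T}. \<forall>t'\<in>{s..T}. \<bar>t' - t\<bar> < h \<longrightarrow> norm (b x t' - b x t) \<le> \<eta>"
proof -
  let ?K = "closure D \<times> {s..T}"
  have K: "compact ?K" using bounded_D by (intro compact_Times) auto
  have bK: "continuous_on ?K (\<lambda>(x, t). b x t)" by (rule continuous_on_subset[OF b]) auto
  have DK: "(x, t) \<in> ?K" if "x \<in> D" "t \<in> {s..T}" for x t using that closure_subset by auto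
  have "bounded ((\<lambda>(x, t). b x t) ` ?K)" by (intro compact_imp_bounded compact_continuous_image bK K)
  then obtain B where B: "\<And>p. p \<in> ?K \<Longrightarrow> norm (case p of (x, t) \<Rightarrow> b x t) \<le> B" unfolding bounded_iff by blast
  have "norm (b x t) \<le> max 0 B" if "x \<in> D" "t \<in> {s..T}" for x t
    using B[OF DK[OF that]] by simp
  then show "\<exists>B\<ge>0. \<forall>x\<in>D. \<forall>t\<in>{s..T}. norm (b x t) \<le> B" by (intro exI[of _ "max 0 B"]) auto
  assume "\<eta> > 0"
  then obtain h where h: "h > 0" "\<And>p q. p \<in> ?K \<Longrightarrow> q \<in> ?K \<Longrightarrow> dist q p < h \<Longrightarrow> dist (case q of (x, t) \<Rightarrow> b x t) (case p of (x, t) \<Rightarrow> b x t) < \<eta>"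
    using compact_uniformly_continuous[OF bK K] unfolding uniformly_continuous_on_def by metis
  have "norm (b x t' - b x t) \<le> \<eta>" if "x \<in> D" "t \<in> {s..T}" "t' \<in> {s..T}" "\<bar>t' - t\<bar> < h" for x t t'
    using h(2)[OF DK[OF that(1,2)] DK[OF that(1,3)]] that(4) by (simp add: dist_norm norm_Pair)
  then show "\<exists>h>0. \<forall>x\<in>D. \<forall>t\<in>{s..T}. \<forall>t'\<in>{s..T}. \<bar>t' - t\<bar> < h \<longrightarrow> norm (b x t' - b x t) \<le> \<eta>"
    using h(1) by blast
qed

lemma slice_measurable:
  fixes b :: "real^'n \<Rightarrow> real \<Rightarrow> real"
  assumes b: "continuous_on UNIV (\<lambda>(x, t). b x t)"
  shows "(\<lambda>x. b x t) \<in> borel_measurable (lebesgue_on D)"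
proof (rule measurable_D)
  have "continuous_on UNIV (\<lambda>x :: real^'n. (x, t))" by (intro continuous_intros)
  from continuous_on_compose2[OF b this] show "continuous_on UNIV (\<lambda>x. b x t)" by simp
qed

lemma C_L2_norm_bounded:
  assumes u: "u \<in> C_L2 D s T"
  shows "\<exists>M\<ge>0. \<forall>t\<in>{s..T}. L2_norm D (u t) \<le> M"
proof -
  have uL: "u t \<in> L2_space D" if "t \<in> {s..T}" for t using u that by (simp add: C_L2_def)
  have "continuous_on {s..T} (\<lambda>t. L2_norm D (u t))"
    unfolding continuous_on_def
  proof
    fix t assume t: "t \<in> {s..T}"
    have "((\<lambda>r. L2_norm D (u r) - L2_norm D (u t)) \<longlongrightarrow> 0) (at t within {s..T})"
    proof (rule Lim_null_comparison)
      show "((\<lambda>r. L2_norm D (\<lambda>x. u r x - u t x)) \<longlongrightarrow> 0) (at t within {s..T})"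
        using u t by (simp add: C_L2_def)
      show "\<forall>\<^sub>F r in at t within {s..T}. norm (L2_norm D (u r) - L2_norm D (u t)) \<le> L2_norm D (\<lambda>x. u r x - u t x)"
        using L2_norm_diff_ge[OF uL uL[OF t]] by (auto simp: eventually_at_filter)
    qed
    then show "((\<lambda>t. L2_norm D (u t)) \<longlongrightarrow> L2_norm D (u t)) (at t within {s..T})" by (simp add: LIM_zero_iff)
  qed
  then have "bounded ((\<lambda>t. L2_norm D (u t)) ` {s..T})"
    by (intro compact_imp_bounded compact_continuous_image) auto
  then obtain M where "\<forall>t\<in>{s..T}. norm (L2_norm D (u t)) \<le> M" unfolding bounded_iff by blast
  then show ?thesis by (intro exI[of _ "max 0 M"]) (auto simp: le_max_iff_disj)
qed

text \<open>The distance \<open>\<parallel>u(t) - u(t')\<parallel>\<close> is a continuous function on the compact square of pairs of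
  times and vanishes on the diagonal.\<close>

lemma C_L2_uniform:
  assumes u: "u \<in> C_L2 D s T" and "\<eta> > 0"
  shows "\<exists>h>0. \<forall>t\<in>{s..T}. \<forall>t'\<in>{s..T}. \<bar>t' - t\<bar> < h \<longrightarrow> L2_norm D (\<lambda>x. u t' x - u t x) \<le> \<eta>"
proof -
  have uL: "u t \<in> L2_space D" if "t \<in> {s..T}" for t using u that by (simp add: C_L2_def)
  define d where "d p = L2_norm D (\<lambda>x. u (fst p) x - u (snd p) x)" for p
  let ?Q = "{s..T} \<times> {s..T}"
  have "continuous_on ?Q d"
    unfolding continuous_on_def
  proof
    fix q assume q: "q \<in> ?Q"
    then have q': "fst q \<in> {s..T}" "snd q \<in> {s..T}" by auto
    have lim: "((\<lambda>p. L2_norm D (\<lambda>x. u (pr p) x - u (pr q) x)) \<longlongrightarrow> 0) (at q within ?Q)"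
      if pr: "pr q \<in> {s..T}" "pr ` ?Q \<subseteq> {s..T}" "continuous_on UNIV pr" for pr :: "real \<times> real \<Rightarrow> real"
    proof -
      let ?g = "\<lambda>r. L2_norm D (\<lambda>x. u r x - u (pr q) x)"
      have "(?g \<longlongrightarrow> ?g (pr q)) (at (pr q) within {s..T})"
        using u pr(1) by (simp add: C_L2_def L2_norm_def L2_inner_def)
      then have "continuous (at (pr q) within {s..T}) ?g" by (simp add: continuous_within)
      then have "continuous (at (pr q) within pr ` ?Q) ?g" using pr(2) by (rule continuous_within_subset)
      moreover have "continuous (at q within ?Q) pr"
        using pr(3) by (metis UNIV_I continuous_at_imp_continuous_at_within continuous_on_eq_continuous_at open_UNIV)
      ultimately have "continuous (at q within ?Q) (?g \<circ> pr)" by (intro continuous_within_compose)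
      then show ?thesis by (simp add: continuous_within o_def L2_norm_def L2_inner_def)
    qed
    have "((\<lambda>p. d p - d q) \<longlongrightarrow> 0) (at q within ?Q)"
    proof (rule Lim_null_comparison)
      show "((\<lambda>p. L2_norm D (\<lambda>x. u (fst p) x - u (fst q) x) + L2_norm D (\<lambda>x. u (snd p) x - u (snd q) x)) \<longlongrightarrow> 0) (at q within ?Q)"
        using tendsto_add[OF lim[of fst] lim[of snd]] q' continuous_on_fst[OF continuous_on_id] continuous_on_snd[OF continuous_on_id]
        by auto
      show "\<forall>\<^sub>F p in at q within ?Q. norm (d p - d q) \<le> L2_norm D (\<lambda>x. u (fst p) x - u (fst q) x) + L2_norm D (\<lambda>x. u (snd p) x - u (snd q) x)"
        unfolding eventually_at_filter
      proof (intro always_eventually allI impI)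
        fix p assume "p \<in> ?Q"
        then have p': "fst p \<in> {s..T}" "snd p \<in> {s..T}" by auto
        note L = uL[OF p'(1)] uL[OF p'(2)] uL[OF q'(1)] uL[OF q'(2)]
        have "\<bar>d p - d q\<bar> \<le> L2_norm D (\<lambda>x. (u (fst p) x - u (snd p) x) - (u (fst q) x - u (snd q) x))"
          unfolding d_def by (intro L2_norm_diff_ge L2_diff L)
        also have "\<dots> = L2_norm D (\<lambda>x. (u (fst p) x - u (fst q) x) + (u (snd q) x - u (snd p) x))"
          by (simp add: algebra_simps)
        also have "\<dots> \<le> L2_norm D (\<lambda>x. u (fst p) x - u (fst q) x) + L2_norm D (\<lambda>x. u (snd q) x - u (snd p) x)"
          by (intro L2_norm_triangle L2_diff L)
        finally show "norm (d p - d q) \<le> L2_norm D (\<lambda>x. u (fst p) x - u (fst q) x) + L2_norm D (\<lambda>x. u (snd p) x - u (snd q) x)"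
          by (simp add: L2_norm_uminus[of "u (snd q)"])
      qed
    qed
    then show "(d \<longlongrightarrow> d q) (at q within ?Q)" by (simp add: LIM_zero_iff)
  qed
  then have "uniformly_continuous_on ?Q d" by (intro compact_uniformly_continuous compact_Times) auto
  then obtain h where h: "h > 0" "\<And>p q. p \<in> ?Q \<Longrightarrow> q \<in> ?Q \<Longrightarrow> dist q p < h \<Longrightarrow> dist (d q) (d p) < \<eta>"
    using \<open>\<eta> > 0\<close> unfolding uniformly_continuous_on_def by metis
  have "L2_norm D (\<lambda>x. u t' x - u t x) \<le> \<eta>" if "t \<in> {s..T}" "t' \<in> {s..T}" "\<bar>t' - t\<bar> < h" for t t'
    using h(2)[of "(t, t)" "(t', t)"] that by (simp add: dist_norm norm_Pair d_def L2_norm_def L2_inner_def)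
  then show ?thesis using h(1) by blast
qed

lemma pairing_diff_le:
  assumes u: "u \<in> L2_space D" and v: "v \<in> L2_space D"
    and b: "b \<in> borel_measurable (lebesgue_on D)" "\<And>x. x \<in> D \<Longrightarrow> \<bar>b x\<bar> \<le> B" "0 \<le> B"
    and c: "c \<in> borel_measurable (lebesgue_on D)" "\<And>x. x \<in> D \<Longrightarrow> \<bar>b x - c x\<bar> \<le> \<eta>" "0 \<le> \<eta>"
  shows "\<bar>I (\<lambda>x. u x * b x) - I (\<lambda>x. v x * c x)\<bar>
     \<le> B * sqrt vol * L2_norm D (\<lambda>x. u x - v x) + \<eta> * sqrt vol * L2_norm D v"
proof -
  have cb: "\<bar>c x\<bar> \<le> B + \<eta>" if "x \<in> D" for x using b(2)[OF that] c(2)[OF that] by linarith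
  have Lb: "b \<in> L2_space D" and Lc: "c \<in> L2_space D" using L2_bounded[OF b(1,2)] L2_bounded[OF c(1) cb] by auto
  have "I (\<lambda>x. u x * b x) - I (\<lambda>x. v x * c x) = I (\<lambda>x. (u x - v x) * b x) + I (\<lambda>x. v x * (b x - c x))"
    using L2_mult_integrable[OF u Lb] L2_mult_integrable[OF v Lb] L2_mult_integrable[OF v Lc]
    by (simp add: left_diff_distrib right_diff_distrib)
  moreover have "\<bar>I (\<lambda>x. (u x - v x) * b x)\<bar> \<le> B * sqrt vol * L2_norm D (\<lambda>x. u x - v x)"
    by (rule inner_bounded_le[OF L2_diff[OF u v] b])
  moreover have "\<bar>I (\<lambda>x. v x * (b x - c x))\<bar> \<le> \<eta> * sqrt vol * L2_norm D v"
    by (rule inner_bounded_le[OF v _ c(2,3)]) (intro borel_measurable_diff b c)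
  ultimately show ?thesis by linarith
qed

lemma pairing_time_continuous:
  fixes b :: "real^'n \<Rightarrow> real \<Rightarrow> real"
  assumes u: "u \<in> C_L2 D s T" and b: "continuous_on UNIV (\<lambda>(x, t). b x t)"
  shows "continuous_on {s..T} (\<lambda>t. I (\<lambda>x. u t x * b x t))"
  unfolding continuous_on_iff
proof (intro ballI allI impI)
  have uL: "u t \<in> L2_space D" if "t \<in> {s..T}" for t using u that by (simp add: C_L2_def)
  fix t and e :: real assume t: "t \<in> {s..T}" and e: "e > 0"
  obtain B where B: "B \<ge> 0" "\<And>x t. x \<in> D \<Longrightarrow> t \<in> {s..T} \<Longrightarrow> \<bar>b x t\<bar> \<le> B" using joint_uniform(1)[OF b] by auto
  define Z where "Z = B * sqrt vol + sqrt vol * L2_norm D (u t) + 1"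
  have Z: "Z > 0" using B(1) unfolding Z_def by (intro add_nonneg_pos add_nonneg_nonneg mult_nonneg_nonneg) auto
  define \<eta> where "\<eta> = e / (2 * Z)"
  have \<eta>: "\<eta> > 0" using e Z by (simp add: \<eta>_def)
  obtain h1 where h1: "h1 > 0" "\<And>x t t'. x \<in> D \<Longrightarrow> t \<in> {s..T} \<Longrightarrow> t' \<in> {s..T} \<Longrightarrow> \<bar>t' - t\<bar> < h1 \<Longrightarrow> \<bar>b x t' - b x t\<bar> \<le> \<eta>"
    using joint_uniform(2)[OF b \<eta>] by (auto simp: real_norm_def)
  obtain h2 where h2: "h2 > 0" "\<And>t t'. t \<in> {s..T} \<Longrightarrow> t' \<in> {s..T} \<Longrightarrow> \<bar>t' - t\<bar> < h2 \<Longrightarrow> L2_norm D (\<lambda>x. u t' x - u t x) \<le> \<eta>"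
    using C_L2_uniform[OF u \<eta>] by blast
  show "\<exists>d>0. \<forall>t'\<in>{s..T}. dist t' t < d \<longrightarrow> dist (I (\<lambda>x. u t' x * b x t')) (I (\<lambda>x. u t x * b x t)) < e"
  proof (intro exI[of _ "min h1 h2"] conjI ballI impI)
    fix t' assume t': "t' \<in> {s..T}" "dist t' t < min h1 h2"
    then have d: "\<bar>t' - t\<bar> < h1" "\<bar>t' - t\<bar> < h2" by (auto simp: dist_real_def)
    have "\<bar>I (\<lambda>x. u t' x * b x t') - I (\<lambda>x. u t x * b x t)\<bar>
        \<le> B * sqrt vol * L2_norm D (\<lambda>x. u t' x - u t x) + \<eta> * sqrt vol * L2_norm D (u t)"
      by (rule pairing_diff_le[OF uL[OF t'(1)] uL[OF t] slice_measurable[OF b] _ B(1) slice_measurable[OF b]])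
         (use B t t' h1 d \<eta> in auto)
    also have "\<dots> \<le> B * sqrt vol * \<eta> + \<eta> * sqrt vol * L2_norm D (u t)"
      using h2(2)[OF t t'(1) d(2)] B(1) by (intro add_right_mono mult_left_mono) auto
    also have "\<dots> \<le> \<eta> * Z" using \<eta> by (simp add: Z_def algebra_simps)
    also have "\<dots> < e" using Z e by (simp add: \<eta>_def)
    finally show "dist (I (\<lambda>x. u t' x * b x t')) (I (\<lambda>x. u t x * b x t)) < e" by (simp add: dist_real_def)
  qed (use h1 h2 in auto)
qed

lemma field_pairing_continuous:
  assumes "smooth V"
  shows "continuous_on UNIV (\<lambda>(x, t). f x t \<bullet> gradient V x)"
proof -
  have "continuous_on UNIV (gradient V)"
    unfolding gradient_def by (intro continuous_intros smooth_continuous smooth_partial_deriv assms)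
  then have g: "continuous_on UNIV (\<lambda>p :: (real^'n) \<times> real. gradient V (fst p))"
    by (rule continuous_on_compose2) (auto intro!: continuous_intros)
  show ?thesis
    using continuous_on_inner[OF field_continuous g] by (simp add: case_prod_beta')
qed

end

locale viscous_solution = transport_domain D f s T
  for D :: "(real^'n::finite) set" and f and s T :: real +
  fixes \<rho> :: "real^'n \<Rightarrow> real" and \<epsilon> :: real and u :: "real \<Rightarrow> real^'n \<Rightarrow> real" and G :: "real \<Rightarrow> real^'n \<Rightarrow> real^'n"
  assumes \<epsilon>: "\<epsilon> > 0" and u: "u \<in> C_L2 D s T"
    and G: "L2_W12_0 D s T u G"
    and weak: "\<And>v H t. W12_0 D v H \<Longrightarrow> t \<in> {s..T} \<Longrightarrow> L2_inner D (u t) v = L2_inner D \<rho> v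
        + (\<integral>r. (\<integral>x. u r x * (f x r \<bullet> H x) - \<epsilon>\<^sup>2 / 2 * (G r x \<bullet> H x) \<partial>lebesgue_on D) \<partial>lebesgue_on {s..t})"
begin

lemma u_L2: "t \<in> {s..T} \<Longrightarrow> u t \<in> L2_space D"
  using u by (simp add: C_L2_def)

lemma u_W12_0: "AE t in lebesgue_on {s..T}. W12_0 D (u t) (G t)"
  using G by (simp add: L2_W12_0_def)

definition energy_density :: "real \<Rightarrow> real" where
  "energy_density t = (L2_norm D (u t))\<^sup>2 + (\<Sum>i\<in>UNIV. (L2_norm D (\<lambda>x. G t x $ i))\<^sup>2)"

lemma energy_density_integrable: "integrable (lebesgue_on {s..T}) energy_density"
  using G by (simp add: L2_W12_0_def energy_density_def[abs_def])

lemma energy_density_nonneg: "0 \<le> energy_density t"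
  by (auto simp: energy_density_def intro!: add_nonneg_nonneg sum_nonneg)

lemma gradient_norm_le: "L2_norm D (\<lambda>x. G t x $ i) \<le> 1 + energy_density t"
proof -
  have "(L2_norm D (\<lambda>x. G t x $ i))\<^sup>2 \<le> (\<Sum>i\<in>UNIV. (L2_norm D (\<lambda>x. G t x $ i))\<^sup>2)"
    by (rule member_le_sum[of i UNIV "\<lambda>i. (L2_norm D (\<lambda>x. G t x $ i))\<^sup>2"]) auto
  then have "(L2_norm D (\<lambda>x. G t x $ i))\<^sup>2 \<le> energy_density t"
    unfolding energy_density_def using zero_le_power2[of "L2_norm D (u t)"] by linarith
  moreover have "a \<le> 1 + a\<^sup>2" if "0 \<le> a" for a :: real
    using sum_squares_bound[of a 1] that by (simp add: power2_eq_square)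
  ultimately show ?thesis using L2_norm_nonneg[of "\<lambda>x. G t x $ i"] by (smt (verit))
qed

definition gradient_pairing :: "(real^'n \<Rightarrow> real^'n) \<Rightarrow> real \<Rightarrow> real" where
  "gradient_pairing H t = (\<Sum>i\<in>UNIV. I (\<lambda>x. G t x $ i * H x $ i))"

lemma gradient_pairing_integrable:
  assumes H: "\<And>i. (\<lambda>x. H x $ i) \<in> L2_space D"
  shows "integrable (lebesgue_on {s..T}) (gradient_pairing H)"
  unfolding gradient_pairing_def
proof (rule Bochner_Integration.integrable_sum)
  fix i
  show "integrable (lebesgue_on {s..T}) (\<lambda>t. I (\<lambda>x. G t x $ i * H x $ i))"
  proof (rule Bochner_Integration.integrable_bound)
    show "integrable (lebesgue_on {s..T}) (\<lambda>t. L2_norm D (\<lambda>x. H x $ i) * (1 + energy_density t))"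
      by (intro integrable_mult_right Bochner_Integration.integrable_add energy_density_integrable continuous_imp_integrable_real continuous_intros)
    show "(\<lambda>t. I (\<lambda>x. G t x $ i * H x $ i)) \<in> borel_measurable (lebesgue_on {s..T})"
      using G H[of i] by (simp add: L2_W12_0_def L2_inner_def)
    show "AE t in lebesgue_on {s..T}. norm (I (\<lambda>x. G t x $ i * H x $ i)) \<le> norm (L2_norm D (\<lambda>x. H x $ i) * (1 + energy_density t))"
      using u_W12_0
    proof eventually_elim
      case (elim t)
      then have "\<bar>I (\<lambda>x. G t x $ i * H x $ i)\<bar> \<le> L2_norm D (\<lambda>x. G t x $ i) * L2_norm D (\<lambda>x. H x $ i)"
        using H by (intro inner_le_norm) (auto simp: W12_0_def W12_def)
      also have "\<dots> \<le> (1 + energy_density t) * L2_norm D (\<lambda>x. H x $ i)"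
        by (intro mult_right_mono gradient_norm_le) auto
      finally show ?case using energy_density_nonneg[of t] by (simp add: mult.commute abs_mult)
    qed
  qed
qed

definition transport_pairing :: "(real^'n \<Rightarrow> real) \<Rightarrow> real \<Rightarrow> real" where
  "transport_pairing V t = I (\<lambda>x. u t x * (f x t \<bullet> gradient V x))"

lemma transport_pairing_continuous: "smooth V \<Longrightarrow> continuous_on {s..T} (transport_pairing V)"
  unfolding transport_pairing_def by (intro pairing_time_continuous u field_pairing_continuous)

text \<open>The weak formulation at two times, subtracted. The splitting of its inner integral into transport and
  diffusion is legitimate only at times at which the gradient slice is square integrable, hence almost
  everywhere.\<close>

lemma weak_increment:
  assumes V: "V \<in> test_functions D" and r: "s \<le> r" "r \<le> r'" "r' \<le> T"
  shows "integrable (lebesgue_on {r..r'}) (\<lambda>t. transport_pairing V t - \<epsilon>\<^sup>2 / 2 * gradient_pairing (gradient V) t)"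
    and "I (\<lambda>x. u r' x * V x) - I (\<lambda>x. u r x * V x)
      = (\<integral>t. transport_pairing V t - \<epsilon>\<^sup>2 / 2 * gradient_pairing (gradient V) t \<partial>lebesgue_on {r..r'})"
proof -
  note sV = test_smooth[OF V]
  define g where "g t = transport_pairing V t - \<epsilon>\<^sup>2 / 2 * gradient_pairing (gradient V) t" for t
  define \<Phi> where "\<Phi> t = I (\<lambda>x. u t x * (f x t \<bullet> gradient V x) - \<epsilon>\<^sup>2 / 2 * (G t x \<bullet> gradient V x))" for t
  have gi: "integrable (lebesgue_on {s..T}) g"
    unfolding g_def
    by (intro Bochner_Integration.integrable_diff integrable_mult_right continuous_imp_integrable_real
        transport_pairing_continuous gradient_pairing_integrable sV)
       (simp add: test_L2 test_partial V)
  have \<Phi>g: "AE t in lebesgue_on {s..T}. \<Phi> t = g t"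
  proof -
    have "AE t in lebesgue_on {s..T}. t \<in> {s..T}" by (rule AE_I2) simp
    with u_W12_0 show ?thesis
    proof eventually_elim
      case (elim t)
      have L: "(\<lambda>x. G t x $ i * partial_deriv i V x) \<in> borel_measurable (lebesgue_on D) \<and> integrable (lebesgue_on D) (\<lambda>x. G t x $ i * partial_deriv i V x)" for i
        using elim test_L2[OF test_partial[OF V]] L2_mult_integrable[of "\<lambda>x. G t x $ i" "partial_deriv i V"]
        by (auto simp: W12_0_def W12_def)
      have 1: "integrable (lebesgue_on D) (\<lambda>x. u t x * (f x t \<bullet> gradient V x))"
      proof (rule L2_mult_integrable[OF u_L2])
        obtain B where "\<forall>x\<in>D. \<forall>t\<in>{s..T}. norm (f x t \<bullet> gradient V x) \<le> B"
          using joint_uniform(1)[OF field_pairing_continuous[OF sV]] by blast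
        then have "\<And>x. x \<in> D \<Longrightarrow> \<bar>f x t \<bullet> gradient V x\<bar> \<le> B"
          using elim(2) by (simp add: real_norm_def)
        then show "(\<lambda>x. f x t \<bullet> gradient V x) \<in> L2_space D"
          by (rule L2_bounded[OF slice_measurable[OF field_pairing_continuous[OF sV]]])
      qed (use elim in simp)
      have 2: "integrable (lebesgue_on D) (\<lambda>x. G t x \<bullet> gradient V x)"
        unfolding inner_vec_def using L by (intro Bochner_Integration.integrable_sum) simp
      have "\<Phi> t = I (\<lambda>x. u t x * (f x t \<bullet> gradient V x)) - \<epsilon>\<^sup>2 / 2 * I (\<lambda>x. G t x \<bullet> gradient V x)"
        unfolding \<Phi>_def using 1 2 by simp
      also have "I (\<lambda>x. G t x \<bullet> gradient V x) = gradient_pairing (gradient V) t"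
        unfolding gradient_pairing_def inner_vec_def using L
        by (subst Bochner_Integration.integral_sum) auto
      finally show ?case by (simp add: g_def transport_pairing_def)
    qed
  qed
  have W: "I (\<lambda>x. u t x * V x) = L2_inner D \<rho> V + integral\<^sup>L (lebesgue_on {s..t}) g" if t: "t \<in> {s..T}" for t
  proof -
    have "integral\<^sup>L (lebesgue_on {s..t}) \<Phi> = integral\<^sup>L (lebesgue_on {s..t}) g"
    proof (rule integral_lebesgue_on_cong_AE)
      show "g \<in> borel_measurable (lebesgue_on {s..t})"
        using integrable_subinterval[OF gi, of s t] t by auto
      show "AE x in lebesgue_on {s..t}. \<Phi> x = g x" by (rule AE_lebesgue_on_subset[OF \<Phi>g]) (use t in auto)
    qed simp
    then show ?thesis using weak[OF test_W12_0[OF V] t] by (simp add: L2_inner_def \<Phi>_def[abs_def])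
  qed
  show "integrable (lebesgue_on {r..r'}) (\<lambda>t. transport_pairing V t - \<epsilon>\<^sup>2 / 2 * gradient_pairing (gradient V) t)"
    using Equivalence_Lebesgue_Henstock_Integration.integrable_subinterval[OF gi, of r r'] r by (simp add: g_def[abs_def])
  have gi': "integrable (lebesgue_on {s..r'}) g"
    using Equivalence_Lebesgue_Henstock_Integration.integrable_subinterval[OF gi, of s r'] r by simp
  have "integral\<^sup>L (lebesgue_on {s..r'}) g = integral\<^sup>L (lebesgue_on {s..r}) g + integral\<^sup>L (lebesgue_on {r..r'}) g"
    by (rule Equivalence_Measurable_On_Borel.integral_combine[OF gi']) (use r in auto)
  then show "I (\<lambda>x. u r' x * V x) - I (\<lambda>x. u r x * V x)
      = (\<integral>t. transport_pairing V t - \<epsilon>\<^sup>2 / 2 * gradient_pairing (gradient V) t \<partial>lebesgue_on {r..r'})"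
    using W[of r'] W[of r] r by (simp add: g_def[abs_def])
qed

lemma test_approximation:
  assumes t: "t \<in> {s..T}" and e: "e > 0"
  shows "\<exists>\<phi>\<in>test_functions D. L2_norm D (\<lambda>x. \<phi> x - u t x) < e"
proof -
  obtain h where h: "h > 0" "\<And>t t'. t \<in> {s..T} \<Longrightarrow> t' \<in> {s..T} \<Longrightarrow> \<bar>t' - t\<bar> < h \<Longrightarrow> L2_norm D (\<lambda>x. u t' x - u t x) \<le> e / 3"
    using C_L2_uniform[OF u, of "e / 3"] e by auto
  define c where "c = max s (t - h / 2)"
  define d where "d = min T (t + h / 2)"
  have "\<exists>t'\<in>{c..d}. W12_0 D (u t') (G t')"
    by (rule AE_Icc_exists[OF u_W12_0]) (use t h sT in \<open>auto simp: c_def d_def\<close>)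
  then obtain t' where t': "t' \<in> {c..d}" "W12_0 D (u t') (G t')" by auto
  then obtain \<phi> where \<phi>: "\<And>k::nat. \<phi> k \<in> test_functions D" "(\<lambda>k. L2_norm D (\<lambda>x. \<phi> k x - u t' x)) \<longlonglongrightarrow> 0"
    unfolding W12_0_def by auto
  have "\<forall>\<^sub>F k in sequentially. L2_norm D (\<lambda>x. \<phi> k x - u t' x) < e / 3"
    by (rule order_tendstoD(2)[OF \<phi>(2)]) (use e in simp)
  then obtain k where k: "L2_norm D (\<lambda>x. \<phi> k x - u t' x) < e / 3" by (auto simp: eventually_sequentially)
  have t'': "t' \<in> {s..T}" "\<bar>t' - t\<bar> < h" using t' t h by (auto simp: c_def d_def)
  have "L2_norm D (\<lambda>x. \<phi> k x - u t x) \<le> L2_norm D (\<lambda>x. \<phi> k x - u t' x) + L2_norm D (\<lambda>x. u t' x - u t x)"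
    by (intro L2_norm_diff_triangle test_L2 \<phi> u_L2 t t'')
  also have "\<dots> < e" using k h(2)[OF t t''] e by linarith
  finally show ?thesis using \<phi>(1) by blast
qed

end

section \<open>A regularised weighted energy\<close>

text \<open>Increment bounds on short intervals add up. Neither continuity nor differentiability of \<open>\<Psi>\<close> is
  involved, which matters because \<open>\<Psi>\<close> will be a supremum.\<close>

lemma chain_increments:
  fixes \<Psi> :: "real \<Rightarrow> real"
  assumes "a \<le> b" "h > 0" and inc: "\<And>r r'. a \<le> r \<Longrightarrow> r < r' \<Longrightarrow> r' \<le> b \<Longrightarrow> r' - r < h \<Longrightarrow> \<Psi> r' - \<Psi> r \<le> c * (r' - r)"
  shows "\<Psi> b - \<Psi> a \<le> c * (b - a)"
proof -
  obtain N :: nat where N: "(b - a) / h < real N" using reals_Archimedean2 by blast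
  define d where "d = (b - a) / real (Suc N)"
  have d: "0 \<le> d" "d < h" "d * real (Suc N) = b - a"
  proof -
    show "0 \<le> d" using assms(1) by (simp add: d_def)
    have "b - a < h * real (Suc N)" using N \<open>h > 0\<close> by (simp add: field_simps)
    then show "d < h" by (simp add: d_def field_simps)
    show "d * real (Suc N) = b - a" by (simp add: d_def)
  qed
  have "\<Psi> (a + real k * d) - \<Psi> a \<le> c * (real k * d)" if "k \<le> Suc N" for k
    using that
  proof (induction k)
    case (Suc k)
    have le: "a + real (Suc k) * d \<le> b"
      using mult_left_mono[of "real (Suc k)" "real (Suc N)" d] d Suc.prems by (simp add: mult.commute)
    show ?case
    proof (cases "d = 0")
      case False
      have "\<Psi> (a + real (Suc k) * d) - \<Psi> (a + real k * d) \<le> c * ((a + real (Suc k) * d) - (a + real k * d))"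
        by (rule inc) (use le d False in \<open>auto simp: algebra_simps\<close>)
      then show ?thesis using Suc by (simp add: algebra_simps)
    qed simp
  qed simp
  from this[of "Suc N"] d(3) show ?thesis by (simp add: mult.commute)
qed

context bounded_domain begin

lemma integrable_continuous: "continuous_on UNIV c \<Longrightarrow> integrable (lebesgue_on D) c" for c :: "real^'n \<Rightarrow> real"
  using continuous_bounded_D[of c] integrable_bounded_D[OF measurable_D, of c] by auto

lemma integrable_L2_continuous: "a \<in> L2_space D \<Longrightarrow> continuous_on UNIV c \<Longrightarrow> integrable (lebesgue_on D) (\<lambda>x. a x * c x)"
  for c :: "real^'n \<Rightarrow> real"
  by (rule L2_mult_integrable[OF _ L2_continuous])

lemma triple_le:
  assumes "a \<in> L2_space D" "z \<in> L2_space D" "c \<in> borel_measurable (lebesgue_on D)" "\<And>x. x \<in> D \<Longrightarrow> \<bar>c x\<bar> \<le> B" "0 \<le> B"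
  shows "\<bar>I (\<lambda>x. a x * (z x * c x))\<bar> \<le> B * L2_norm D a * L2_norm D z"
proof -
  have "\<bar>I (\<lambda>x. a x * (z x * c x))\<bar> \<le> L2_norm D a * L2_norm D (\<lambda>x. z x * c x)"
    by (intro inner_le_norm L2_bounded_mult[OF assms(2-4)] assms)
  also have "\<dots> \<le> L2_norm D a * (B * L2_norm D z)"
    by (intro mult_left_mono L2_norm_bounded_mult assms) auto
  finally show ?thesis by (simp add: mult_ac)
qed

lemma gradient_continuous: "smooth v \<Longrightarrow> continuous_on S (gradient v)"
  unfolding gradient_def by (intro continuous_intros smooth_continuous smooth_partial_deriv)

lemma gradient_add_cmult:
  assumes "smooth v" "smooth \<phi>"
  shows "gradient (\<lambda>x. v x + r * \<phi> x) x = gradient v x + r *\<^sub>R gradient \<phi> x"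
proof -
  have "partial_deriv i (\<lambda>x. v x + r * \<phi> x) x = partial_deriv i v x + r * partial_deriv i \<phi> x" for i
    by (subst partial_deriv_eq[OF has_derivative_add[OF has_derivative_gradient[OF smooth_differentiable[OF assms(1)]]
        has_derivative_mult_right[OF has_derivative_gradient[OF smooth_differentiable[OF assms(2)]]]]])
       (simp add: inner_axis)
  then show ?thesis by (simp add: vec_eq_iff)
qed

definition sobolev_sq :: "(real^'n \<Rightarrow> real) \<Rightarrow> (real^'n \<Rightarrow> real^'n) \<Rightarrow> real" where
  "sobolev_sq a A = (L2_norm D a)\<^sup>2 + (\<Sum>i\<in>UNIV. (L2_norm D (\<lambda>x. A x $ i))\<^sup>2)"

end

context transport_domain begin

definition field_div :: "real^'n \<Rightarrow> real \<Rightarrow> real" where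
  "field_div x t = (\<Sum>i\<in>UNIV. partial_deriv i (\<lambda>z. f z t $ i) x)"

lemma field_partial_continuous: "continuous_on UNIV (\<lambda>(x, t). partial_deriv j (\<lambda>z. f z t $ i) x)"
  using admissible by (simp add: admissible_field_def)

lemma field_div_continuous: "continuous_on UNIV (\<lambda>(x, t). field_div x t)"
  unfolding field_div_def using field_partial_continuous
  by (auto simp: case_prod_beta' intro!: continuous_on_sum)

lemma field_partial_direction:
  "((\<lambda>h. f (x + h *\<^sub>R axis j 1) t $ i) has_real_derivative partial_deriv j (\<lambda>z. f z t $ i) x) (at 0)"
proof -
  have "(\<lambda>h. f (x + h *\<^sub>R axis j 1) t $ i) differentiable (at 0)"
    using admissible by (simp add: admissible_field_def)
  then show ?thesis unfolding partial_deriv_def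
    using DERIV_deriv_iff_real_differentiable by blast
qed

lemma slice_continuous: "continuous_on UNIV (\<lambda>(x, t). b x t) \<Longrightarrow> continuous_on UNIV (\<lambda>x. b x t)"
  for b :: "real^'n \<Rightarrow> real \<Rightarrow> 'b::topological_space"
proof -
  assume b: "continuous_on UNIV (\<lambda>(x, t). b x t)"
  have "continuous_on UNIV (\<lambda>x :: real^'n. (x, t))" by (intro continuous_intros)
  from continuous_on_compose2[OF b this] show ?thesis by simp
qed

lemmas field_slice = slice_continuous[OF field_continuous]

lemma field_slice_nth: "continuous_on UNIV (\<lambda>x. f x t $ i)"
  by (intro continuous_on_component field_slice)

end

text \<open>The weight is \<open>w = e\<^sup>g\<close>; the other parameters are \<open>gt = \<partial>g/\<partial>t\<close>, \<open>b = \<nabla>g\<close> and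
  \<open>\<Gamma> = \<Delta>w / w\<close>. Under the last assumption, transport does not increase the weighted energy.\<close>

locale energy_weight = transport_domain D f s T for D :: "(real^'n::finite) set" and f and s T :: real +
  fixes w gt \<Gamma> :: "real^'n \<Rightarrow> real \<Rightarrow> real" and b :: "real^'n \<Rightarrow> real \<Rightarrow> real^'n"
  assumes w_pos: "\<And>x t. 0 < w x t"
    and w_smooth: "\<And>t. smooth (\<lambda>x. w x t)"
    and w_cont: "continuous_on UNIV (\<lambda>(x, t). w x t)"
    and b_cont: "continuous_on UNIV (\<lambda>(x, t). b x t)"
    and \<Gamma>_cont: "continuous_on UNIV (\<lambda>(x, t). \<Gamma> x t)"
    and gt_cont: "continuous_on UNIV (\<lambda>(x, t). gt x t)"
    and w_partial: "\<And>i x t. partial_deriv i (\<lambda>x. w x t) x = w x t * b x t $ i"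
    and w_laplace: "\<And>x t. (\<Sum>i\<in>UNIV. partial_deriv i (partial_deriv i (\<lambda>x. w x t)) x) = w x t * \<Gamma> x t"
    and w_time: "\<And>x t. t \<in> {s..T} \<Longrightarrow> ((\<lambda>t. w x t) has_real_derivative w x t * gt x t) (at t within {s..T})"
    and w_sub: "\<And>x t. x \<in> D \<Longrightarrow> t \<in> {s..T} \<Longrightarrow> gt x t + f x t \<bullet> b x t + \<bar>field_div x t\<bar> \<le> 0"
begin

lemmas w_slice = slice_continuous[OF w_cont]
lemmas b_slice = slice_continuous[OF b_cont]
lemmas \<Gamma>_slice = slice_continuous[OF \<Gamma>_cont]
lemmas gt_slice = slice_continuous[OF gt_cont]

lemma w_lower: "\<exists>w0>0. \<forall>x\<in>D. \<forall>t\<in>{s..T}. w0 \<le> w x t"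
proof -
  have "continuous_on UNIV (\<lambda>(x, t). inverse (w x t))"
    using continuous_on_inverse[OF w_cont] w_pos by (auto simp: case_prod_beta' less_imp_neq[symmetric])
  from joint_uniform(1)[OF this] obtain B where B: "B \<ge> 0" "\<forall>x\<in>D. \<forall>t\<in>{s..T}. norm (inverse (w x t)) \<le> B" by auto
  have "inverse (B + 1) \<le> w x t" if "x \<in> D" "t \<in> {s..T}" for x t
  proof -
    have "norm (inverse (w x t)) \<le> B" using B(2) that by blast
    then have "inverse (w x t) \<le> B + 1" unfolding real_norm_def by linarith
    then show ?thesis using w_pos[of x t] by (metis inverse_inverse_eq inverse_positive_iff_positive le_imp_inverse_le)
  qed
  then show ?thesis using B(1) by (intro exI[of _ "inverse (B + 1)"]) auto
qed

lemma w_time_uniform: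
  assumes "\<eta> > 0"
  shows "\<exists>h>0. \<forall>x\<in>D. \<forall>r r'. s \<le> r \<and> r < r' \<and> r' \<le> T \<and> r' - r < h \<longrightarrow>
     \<bar>w x r' - w x r - (r' - r) * (w x r' * gt x r')\<bar> \<le> \<eta> * (r' - r)"
proof -
  have "continuous_on UNIV (\<lambda>(x, t). w x t * gt x t)"
    using continuous_on_mult[OF w_cont gt_cont] by (simp add: case_prod_beta')
  from joint_uniform(2)[OF this assms] obtain h where h: "h > 0"
    "\<And>x t t'. x \<in> D \<Longrightarrow> t \<in> {s..T} \<Longrightarrow> t' \<in> {s..T} \<Longrightarrow> \<bar>t' - t\<bar> < h \<Longrightarrow> \<bar>w x t' * gt x t' - w x t * gt x t\<bar> \<le> \<eta>"
    by (auto simp: real_norm_def)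
  have "\<bar>w x r' - w x r - (r' - r) * (w x r' * gt x r')\<bar> \<le> \<eta> * (r' - r)"
    if x: "x \<in> D" and r: "s \<le> r" "r < r'" "r' \<le> T" "r' - r < h" for x r r'
  proof -
    have "\<exists>\<xi>\<in>{r<..<r'}. w x r' - w x r = (r' - r) * (w x \<xi> * gt x \<xi>)"
    proof -
      have "\<exists>\<xi>\<in>{r<..<r'}. w x r' - w x r = (\<lambda>k. w x \<xi> * gt x \<xi> * k) (r' - r)"
      proof (rule mvt_simple)
        fix \<xi> assume "r \<le> \<xi>" "\<xi> \<le> r'"
        then have "((\<lambda>t. w x t) has_real_derivative w x \<xi> * gt x \<xi>) (at \<xi> within {r..r'})"
          using w_time[of \<xi> x] r by (auto elim: DERIV_subset)
        then show "(w x has_derivative (*) (w x \<xi> * gt x \<xi>)) (at \<xi> within {r..r'})"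
          by (simp add: has_field_derivative_def)
      qed (use r in auto)
      then show ?thesis by (auto simp: mult.commute)
    qed
    then obtain \<xi> where \<xi>: "r < \<xi>" "\<xi> < r'" "w x r' - w x r = (r' - r) * (w x \<xi> * gt x \<xi>)" by auto
    have "\<bar>w x \<xi> * gt x \<xi> - w x r' * gt x r'\<bar> \<le> \<eta>"
      by (rule h(2)[OF x]) (use r \<xi> in auto)
    moreover have "w x r' - w x r - (r' - r) * (w x r' * gt x r') = (r' - r) * (w x \<xi> * gt x \<xi> - w x r' * gt x r')"
      using \<xi>(3) by (simp add: algebra_simps)
    ultimately show ?thesis using r(2) by (simp add: abs_mult mult.commute)
  qed
  then show ?thesis using h(1) by blast
qed

end

locale weighted_solution = viscous_solution D f s T \<rho> \<epsilon> u G + energy_weight D f s T w gt \<Gamma> b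
  for D :: "(real^'n::finite) set" and f and s T :: real and \<rho> \<epsilon> u G w gt \<Gamma> b
begin

text \<open>Without the gradient penalty the supremum over \<open>v\<close> is \<open>I (u\<^sup>2 w) / 2\<close>, attained at \<open>v = u\<close>; the penalty
  keeps near maximisers bounded in the Sobolev norm.\<close>

definition J :: "real \<Rightarrow> real \<Rightarrow> (real^'n \<Rightarrow> real) \<Rightarrow> real" where
  "J \<kappa> t v = I (\<lambda>x. u t x * (v x * w x t) - ((v x)\<^sup>2 / 2 + \<kappa> / 2 * (gradient v x \<bullet> gradient v x)) * w x t)"

text \<open>The first variation of \<open>J\<close> at \<open>v\<close> in the direction \<open>a\<close> with gradient \<open>A\<close>. The gradient is a separate argument
  because the direction may be a Sobolev function.\<close>

definition DJ :: "real \<Rightarrow> real \<Rightarrow> (real^'n \<Rightarrow> real) \<Rightarrow> (real^'n \<Rightarrow> real) \<Rightarrow> (real^'n \<Rightarrow> real^'n) \<Rightarrow> real" where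
  "DJ \<kappa> t v a A = I (\<lambda>x. a x * ((u t x - v x) * w x t)) - \<kappa> * (\<Sum>i\<in>UNIV. I (\<lambda>x. A x $ i * (partial_deriv i v x * w x t)))"

lemma J_integrable:
  assumes "t \<in> {s..T}" "smooth v"
  shows "integrable (lebesgue_on D) (\<lambda>x. u t x * (v x * w x t) - ((v x)\<^sup>2 / 2 + \<kappa> / 2 * (gradient v x \<bullet> gradient v x)) * w x t)"
    and "integrable (lebesgue_on D) (\<lambda>x. u t x * (v x * w x t))"
    and "integrable (lebesgue_on D) (\<lambda>x. ((v x)\<^sup>2 / 2 + \<kappa> / 2 * (gradient v x \<bullet> gradient v x)) * w x t)"
proof -
  show 1: "integrable (lebesgue_on D) (\<lambda>x. u t x * (v x * w x t))"
    by (intro integrable_L2_continuous u_L2 continuous_intros w_slice smooth_continuous assms)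
  show 2: "integrable (lebesgue_on D) (\<lambda>x. ((v x)\<^sup>2 / 2 + \<kappa> / 2 * (gradient v x \<bullet> gradient v x)) * w x t)"
    by (intro integrable_continuous continuous_intros w_slice smooth_continuous gradient_continuous assms) auto
  show "integrable (lebesgue_on D) (\<lambda>x. u t x * (v x * w x t) - ((v x)\<^sup>2 / 2 + \<kappa> / 2 * (gradient v x \<bullet> gradient v x)) * w x t)"
    by (intro Bochner_Integration.integrable_diff 1 2)
qed

lemma u_square_integrable: "t \<in> {s..T} \<Longrightarrow> integrable (lebesgue_on D) (\<lambda>x. (u t x)\<^sup>2 * w x t)"
  using L2_mult_integrable[OF u_L2 L2_mult_continuous[OF u_L2 w_slice], of t t t]
  by (simp add: power2_eq_square mult.assoc)

lemma J_le: assumes t: "t \<in> {s..T}" and v: "smooth v" and "\<kappa> \<ge> 0"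
  shows "J \<kappa> t v \<le> I (\<lambda>x. (u t x)\<^sup>2 * w x t) / 2"
proof -
  have "J \<kappa> t v \<le> I (\<lambda>x. ((u t x)\<^sup>2 * w x t) / 2)"
    unfolding J_def
  proof (rule integral_mono[OF J_integrable(1)[OF t v]])
    show "integrable (lebesgue_on D) (\<lambda>x. (u t x)\<^sup>2 * w x t / 2)" using u_square_integrable[OF t] by simp
    fix x
    have "0 \<le> (u t x - v x)\<^sup>2 * w x t" "0 \<le> \<kappa> * (gradient v x \<bullet> gradient v x) * w x t"
      using w_pos[of x t] \<open>\<kappa> \<ge> 0\<close> by (auto intro!: mult_nonneg_nonneg)
    then show "u t x * (v x * w x t) - ((v x)\<^sup>2 / 2 + \<kappa> / 2 * (gradient v x \<bullet> gradient v x)) * w x t \<le> (u t x)\<^sup>2 * w x t / 2"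
      by (simp add: power2_diff algebra_simps)
  qed
  then show ?thesis by simp
qed

definition \<Psi> :: "real \<Rightarrow> real \<Rightarrow> real" where
  "\<Psi> \<kappa> t = (SUP v\<in>test_functions D. J \<kappa> t v)"

lemma J_bdd: "t \<in> {s..T} \<Longrightarrow> \<kappa> \<ge> 0 \<Longrightarrow> bdd_above (J \<kappa> t ` test_functions D)"
  using J_le test_smooth by (intro bdd_aboveI2) blast

lemma J_le_\<Psi>: "t \<in> {s..T} \<Longrightarrow> \<kappa> \<ge> 0 \<Longrightarrow> v \<in> test_functions D \<Longrightarrow> J \<kappa> t v \<le> \<Psi> \<kappa> t"
  unfolding \<Psi>_def by (intro cSUP_upper J_bdd)

lemma \<Psi>_le: "t \<in> {s..T} \<Longrightarrow> \<kappa> \<ge> 0 \<Longrightarrow> \<Psi> \<kappa> t \<le> I (\<lambda>x. (u t x)\<^sup>2 * w x t) / 2"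
  unfolding \<Psi>_def using test_zero by (intro cSUP_least J_le test_smooth) auto

lemma \<Psi>_nonneg: "t \<in> {s..T} \<Longrightarrow> \<kappa> \<ge> 0 \<Longrightarrow> 0 \<le> \<Psi> \<kappa> t"
proof -
  assume "t \<in> {s..T}" "\<kappa> \<ge> 0"
  moreover have "J \<kappa> t (\<lambda>x. 0) = 0"
  proof -
    have "gradient (\<lambda>x::real^'n. 0) x = 0" for x
      using partial_deriv_outside[of "{}" "\<lambda>x::real^'n. 0"] by (simp add: vec_eq_iff)
    then show ?thesis by (simp add: J_def)
  qed
  ultimately show ?thesis using J_le_\<Psi>[OF _ _ test_zero] by metis
qed

lemma near_maximiser_exists:
  assumes "t \<in> {s..T}" "\<kappa> \<ge> 0" "\<theta> > 0"
  shows "\<exists>v\<in>test_functions D. \<Psi> \<kappa> t \<le> J \<kappa> t v + \<theta>"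
proof -
  have "\<exists>v\<in>test_functions D. \<Psi> \<kappa> t - \<theta> < J \<kappa> t v"
    unfolding \<Psi>_def using assms test_zero by (subst less_cSUP_iff[symmetric]) (auto intro!: J_bdd)
  then show ?thesis by force
qed

lemma DJ_test:
  assumes "t \<in> {s..T}" "smooth v" "smooth \<phi>"
  shows "integrable (lebesgue_on D) (\<lambda>x. \<phi> x * ((u t x - v x) * w x t) - \<kappa> * (gradient v x \<bullet> gradient \<phi> x) * w x t)"
    and "DJ \<kappa> t v \<phi> (gradient \<phi>) = I (\<lambda>x. \<phi> x * ((u t x - v x) * w x t) - \<kappa> * (gradient v x \<bullet> gradient \<phi> x) * w x t)"
proof -
  have 1: "integrable (lebesgue_on D) (\<lambda>x. \<phi> x * ((u t x - v x) * w x t))"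
    by (intro L2_mult_integrable L2_mult_continuous L2_diff u_L2 L2_continuous smooth_continuous w_slice assms)
  have 2: "integrable (lebesgue_on D) (\<lambda>x. partial_deriv i \<phi> x * (partial_deriv i v x * w x t))" for i
    by (intro integrable_continuous continuous_intros smooth_continuous smooth_partial_deriv w_slice assms)
  have 3: "(gradient v x \<bullet> gradient \<phi> x) * w x t = (\<Sum>i\<in>UNIV. partial_deriv i \<phi> x * (partial_deriv i v x * w x t))" for x
    unfolding inner_vec_def sum_distrib_right by (simp add: mult_ac)
  have 4: "integrable (lebesgue_on D) (\<lambda>x. \<kappa> * (gradient v x \<bullet> gradient \<phi> x) * w x t)"
    by (intro integrable_continuous continuous_intros smooth_continuous gradient_continuous w_slice assms)
  show "integrable (lebesgue_on D) (\<lambda>x. \<phi> x * ((u t x - v x) * w x t) - \<kappa> * (gradient v x \<bullet> gradient \<phi> x) * w x t)"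
    by (intro Bochner_Integration.integrable_diff 1 4)
  have "I (\<lambda>x. \<phi> x * ((u t x - v x) * w x t) - \<kappa> * (gradient v x \<bullet> gradient \<phi> x) * w x t)
      = I (\<lambda>x. \<phi> x * ((u t x - v x) * w x t)) - I (\<lambda>x. \<kappa> * (gradient v x \<bullet> gradient \<phi> x) * w x t)"
    by (intro Bochner_Integration.integral_diff 1 4)
  also have "I (\<lambda>x. \<kappa> * (gradient v x \<bullet> gradient \<phi> x) * w x t) = \<kappa> * I (\<lambda>x. (\<Sum>i\<in>UNIV. partial_deriv i \<phi> x * (partial_deriv i v x * w x t)))"
    by (simp only: mult.assoc 3 Bochner_Integration.integral_mult_right_zero)
  finally show "DJ \<kappa> t v \<phi> (gradient \<phi>) = I (\<lambda>x. \<phi> x * ((u t x - v x) * w x t) - \<kappa> * (gradient v x \<bullet> gradient \<phi> x) * w x t)"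
    unfolding DJ_def using 2 by (simp add: Bochner_Integration.integral_sum)
qed

lemma weighted_sobolev_le:
  assumes t: "t \<in> {s..T}" and \<phi>: "smooth \<phi>" and \<kappa>: "0 \<le> \<kappa>" "\<kappa> \<le> 1" and W: "\<And>x. x \<in> D \<Longrightarrow> w x t \<le> W"
  shows "I (\<lambda>x. ((\<phi> x)\<^sup>2 + \<kappa> * (gradient \<phi> x \<bullet> gradient \<phi> x)) * w x t) \<le> W * sobolev_sq \<phi> (gradient \<phi>)"
proof -
  have i: "integrable (lebesgue_on D) (\<lambda>x. (\<phi> x)\<^sup>2)" "integrable (lebesgue_on D) (\<lambda>x. (partial_deriv i \<phi> x)\<^sup>2)" for i
    by (intro integrable_continuous continuous_intros smooth_continuous smooth_partial_deriv \<phi>)+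
  have "I (\<lambda>x. ((\<phi> x)\<^sup>2 + \<kappa> * (gradient \<phi> x \<bullet> gradient \<phi> x)) * w x t)
      \<le> I (\<lambda>x. W * ((\<phi> x)\<^sup>2 + (\<Sum>i\<in>UNIV. (partial_deriv i \<phi> x)\<^sup>2)))"
  proof (rule integral_mono)
    show "integrable (lebesgue_on D) (\<lambda>x. ((\<phi> x)\<^sup>2 + \<kappa> * (gradient \<phi> x \<bullet> gradient \<phi> x)) * w x t)"
      by (intro integrable_continuous continuous_intros w_slice smooth_continuous gradient_continuous \<phi>)
    show "integrable (lebesgue_on D) (\<lambda>x. W * ((\<phi> x)\<^sup>2 + (\<Sum>i\<in>UNIV. (partial_deriv i \<phi> x)\<^sup>2)))"
      by (intro integrable_continuous continuous_intros smooth_continuous smooth_partial_deriv \<phi>)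
    fix x assume "x \<in> space (lebesgue_on D)"
    then have x: "x \<in> D" by simp
    have "\<kappa> * (gradient \<phi> x \<bullet> gradient \<phi> x) \<le> 1 * (gradient \<phi> x \<bullet> gradient \<phi> x)"
      using \<kappa> by (intro mult_right_mono) auto
    then have "(\<phi> x)\<^sup>2 + \<kappa> * (gradient \<phi> x \<bullet> gradient \<phi> x) \<le> (\<phi> x)\<^sup>2 + (\<Sum>i\<in>UNIV. (partial_deriv i \<phi> x)\<^sup>2)"
      by (simp add: inner_vec_def power2_eq_square)
    moreover have "0 \<le> (\<phi> x)\<^sup>2 + \<kappa> * (gradient \<phi> x \<bullet> gradient \<phi> x)" using \<kappa> by simp
    ultimately show "((\<phi> x)\<^sup>2 + \<kappa> * (gradient \<phi> x \<bullet> gradient \<phi> x)) * w x t \<le> W * ((\<phi> x)\<^sup>2 + (\<Sum>i\<in>UNIV. (partial_deriv i \<phi> x)\<^sup>2))"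
      using W[OF x] w_pos[of x t] by (subst mult.commute[of W]) (intro mult_mono, auto)
  qed
  also have "\<dots> = W * sobolev_sq \<phi> (gradient \<phi>)"
    unfolding sobolev_sq_def L2_norm_sq using i by (simp add: Bochner_Integration.integral_sum Bochner_Integration.integral_add)
  finally show ?thesis .
qed

text \<open>\<open>J\<close> is quadratic, so moving a \<open>\<theta>\<close>-near maximiser in the direction \<open>r \<phi>\<close> gives
  \<open>r DJ - r\<^sup>2/2 Q \<le> \<theta>\<close> for all real \<open>r\<close>, with \<open>Q\<close> the weighted energy of \<open>\<phi>\<close>. Optimising over \<open>r\<close>
  bounds the first variation by the square root of \<open>\<theta>\<close>.\<close>

lemma euler_lagrange_test:
  assumes t: "t \<in> {s..T}" and v: "v \<in> test_functions D" and \<kappa>: "0 \<le> \<kappa>" "\<kappa> \<le> 1"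
    and max: "\<Psi> \<kappa> t \<le> J \<kappa> t v + \<theta>" and \<phi>: "\<phi> \<in> test_functions D"
    and W: "\<And>x. x \<in> D \<Longrightarrow> w x t \<le> W"
  shows "(DJ \<kappa> t v \<phi> (gradient \<phi>))\<^sup>2 \<le> 2 * \<theta> * (W * sobolev_sq \<phi> (gradient \<phi>))"
proof -
  note sv = test_smooth[OF v] and s\<phi> = test_smooth[OF \<phi>]
  define dj where "dj x = \<phi> x * ((u t x - v x) * w x t) - \<kappa> * (gradient v x \<bullet> gradient \<phi> x) * w x t" for x
  define q where "q x = ((\<phi> x)\<^sup>2 + \<kappa> * (gradient \<phi> x \<bullet> gradient \<phi> x)) * w x t" for x
  have dji: "integrable (lebesgue_on D) dj" unfolding dj_def by (rule DJ_test(1)[OF t sv s\<phi>])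
  have qi: "integrable (lebesgue_on D) q" unfolding q_def
    by (intro integrable_continuous continuous_intros w_slice smooth_continuous gradient_continuous s\<phi>)
  define d where "d = DJ \<kappa> t v \<phi> (gradient \<phi>)"
  have d: "d = I dj" unfolding d_def dj_def by (rule DJ_test(2)[OF t sv s\<phi>])
  have Q0: "0 \<le> I q" unfolding q_def using \<kappa> w_pos by (intro integral_nonneg_AE AE_I2 mult_nonneg_nonneg add_nonneg_nonneg) (auto intro: less_imp_le)
  have \<theta>0: "0 \<le> \<theta>" using max J_le_\<Psi>[OF t \<kappa>(1) v] by linarith
  have key: "r * d - r\<^sup>2 / 2 * I q \<le> \<theta>" for r
  proof -
    have "J \<kappa> t (\<lambda>x. v x + r * \<phi> x) \<le> J \<kappa> t v + \<theta>"
      using J_le_\<Psi>[OF t \<kappa>(1) test_add[OF v test_cmult[OF \<phi>, of r]]] max by linarith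
    moreover have "J \<kappa> t (\<lambda>x. v x + r * \<phi> x)
      = I (\<lambda>x. (u t x * (v x * w x t) - ((v x)\<^sup>2 / 2 + \<kappa> / 2 * (gradient v x \<bullet> gradient v x)) * w x t)
          + r * dj x - r\<^sup>2 / 2 * q x)"
      unfolding J_def
    proof (intro Bochner_Integration.integral_cong refl)
      fix x
      have 1: "(A + r *\<^sub>R B) \<bullet> (A + r *\<^sub>R B) = A \<bullet> A + 2 * r * (A \<bullet> B) + r\<^sup>2 * (B \<bullet> B)" for A B :: "real^'n"
        by (simp add: inner_add_left inner_add_right inner_commute[of B A] algebra_simps power2_eq_square)
      have 2: "y * ((z + r * p) * q) - ((z + r * p)\<^sup>2 / 2 + \<kappa> / 2 * (P + 2 * r * R + r\<^sup>2 * S)) * q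
        = y * (z * q) - (z\<^sup>2 / 2 + \<kappa> / 2 * P) * q + r * (p * ((y - z) * q) - \<kappa> * R * q) - r\<^sup>2 / 2 * ((p\<^sup>2 + \<kappa> * S) * q)"
        for y z p q P R S :: real
        by (simp add: field_simps power2_eq_square)
      show "u t x * ((v x + r * \<phi> x) * w x t) - ((v x + r * \<phi> x)\<^sup>2 / 2 + \<kappa> / 2 *
          (gradient (\<lambda>x. v x + r * \<phi> x) x \<bullet> gradient (\<lambda>x. v x + r * \<phi> x) x)) * w x t
        = u t x * (v x * w x t) - ((v x)\<^sup>2 / 2 + \<kappa> / 2 * (gradient v x \<bullet> gradient v x)) * w x t + r * dj x - r\<^sup>2 / 2 * q x"
        unfolding gradient_add_cmult[OF sv s\<phi>] dj_def q_def 1 2 ..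
    qed
    moreover have "\<dots> = J \<kappa> t v + r * d - r\<^sup>2 / 2 * I q"
      unfolding d J_def using J_integrable(1)[OF t sv, of \<kappa>] dji qi
      by (simp del: times_divide_eq_left)
    ultimately show ?thesis by linarith
  qed
  have "d\<^sup>2 \<le> 2 * \<theta> * I q"
  proof (cases "I q = 0")
    case True
    have "d = 0"
    proof (rule ccontr)
      assume "d \<noteq> 0"
      then show False using key[of "(\<theta> + 1) / d"] True by simp
    qed
    then show ?thesis using True by simp
  next
    case False
    then have "I q > 0" using Q0 by simp
    then show ?thesis using key[of "d / I q"] by (simp add: field_simps power2_eq_square)
  qed
  also have "\<dots> \<le> 2 * \<theta> * (W * sobolev_sq \<phi> (gradient \<phi>))"
    unfolding q_def using \<theta>0 by (intro mult_left_mono weighted_sobolev_le t s\<phi> \<kappa> W) auto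
  finally show ?thesis unfolding d_def .
qed

text \<open>By density of test functions; the direction needed later is the solution itself at another time.\<close>

lemma euler_lagrange_W12_0:
  assumes t: "t \<in> {s..T}" and v: "v \<in> test_functions D" and \<kappa>: "0 \<le> \<kappa>" "\<kappa> \<le> 1"
    and max: "\<Psi> \<kappa> t \<le> J \<kappa> t v + \<theta>" and aA: "W12_0 D a A"
    and W: "\<And>x. x \<in> D \<Longrightarrow> w x t \<le> W"
  shows "(DJ \<kappa> t v a A)\<^sup>2 \<le> 2 * \<theta> * (W * sobolev_sq a A)"
proof -
  from aA obtain \<phi> where \<phi>: "\<And>k::nat. \<phi> k \<in> test_functions D"
    "(\<lambda>k. L2_norm D (\<lambda>x. \<phi> k x - a x)) \<longlonglongrightarrow> 0"
    "\<And>i. (\<lambda>k. L2_norm D (\<lambda>x. partial_deriv i (\<phi> k) x - A x $ i)) \<longlonglongrightarrow> 0"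
    unfolding W12_0_def by auto
  have L: "a \<in> L2_space D" "(\<lambda>x. A x $ i) \<in> L2_space D" for i using aA by (auto simp: W12_0_def W12_def)
  have norm_lim: "(\<lambda>k. L2_norm D (z k)) \<longlonglongrightarrow> L2_norm D z'"
    if "\<And>k. z k \<in> L2_space D" "z' \<in> L2_space D" "(\<lambda>k. L2_norm D (\<lambda>x. z k x - z' x)) \<longlonglongrightarrow> 0" for z z'
  proof -
    have "(\<lambda>k. L2_norm D (z k) - L2_norm D z') \<longlonglongrightarrow> 0"
      by (rule Lim_null_comparison[OF _ that(3)]) (simp add: L2_norm_diff_ge that)
    then show ?thesis by (simp add: LIM_zero_iff)
  qed
  have inner_lim: "(\<lambda>k. I (\<lambda>x. z k x * c x)) \<longlonglongrightarrow> I (\<lambda>x. z' x * c x)"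
    if "\<And>k. z k \<in> L2_space D" "z' \<in> L2_space D" "c \<in> L2_space D" "(\<lambda>k. L2_norm D (\<lambda>x. z k x - z' x)) \<longlonglongrightarrow> 0" for z z' c
  proof -
    have "(\<lambda>k. I (\<lambda>x. z k x * c x) - I (\<lambda>x. z' x * c x)) \<longlonglongrightarrow> 0"
    proof (rule Lim_null_comparison)
      show "(\<lambda>k. L2_norm D (\<lambda>x. z k x - z' x) * L2_norm D c) \<longlonglongrightarrow> 0"
        using tendsto_mult[OF that(4) tendsto_const[of "L2_norm D c"]] by simp
      have "I (\<lambda>x. z k x * c x) - I (\<lambda>x. z' x * c x) = I (\<lambda>x. (z k x - z' x) * c x)" for k
        using L2_mult_integrable that by (simp add: left_diff_distrib)
      then show "\<forall>\<^sub>F k in sequentially. norm (I (\<lambda>x. z k x * c x) - I (\<lambda>x. z' x * c x)) \<le> L2_norm D (\<lambda>x. z k x - z' x) * L2_norm D c"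
        using inner_le_norm[OF L2_diff[OF that(1,2)] that(3)] by simp
    qed
    then show ?thesis by (simp add: LIM_zero_iff)
  qed
  have c: "(\<lambda>x. (u t x - v x) * w x t) \<in> L2_space D" "(\<lambda>x. partial_deriv i v x * w x t) \<in> L2_space D" for i
    by (intro L2_mult_continuous L2_diff u_L2 t test_L2 test_partial v w_slice)+
  have "(\<lambda>k. (DJ \<kappa> t v (\<phi> k) (gradient (\<phi> k)))\<^sup>2) \<longlonglongrightarrow> (DJ \<kappa> t v a A)\<^sup>2"
    unfolding DJ_def
    by (intro tendsto_intros inner_lim) (auto intro: L test_L2 \<phi> test_partial c)
  moreover have "(\<lambda>k. 2 * \<theta> * (W * sobolev_sq (\<phi> k) (gradient (\<phi> k)))) \<longlonglongrightarrow> 2 * \<theta> * (W * sobolev_sq a A)"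
    unfolding sobolev_sq_def
    by (intro tendsto_intros norm_lim) (auto intro!: L test_L2 \<phi> test_partial)
  ultimately show ?thesis
    by (rule LIMSEQ_le) (use euler_lagrange_test[OF t v \<kappa> max \<phi>(1) W] in auto)
qed

end

section \<open>The weighted energy estimate\<close>

lemma mult_le_weighted_squares:
  fixes x y c :: real
  assumes "c > 0"
  shows "x * y \<le> c * x\<^sup>2 + y\<^sup>2 / (4 * c)"
proof -
  have "0 \<le> (2 * c * x - y)\<^sup>2 / (4 * c)" using assms by simp
  also have "\<dots> = c * x\<^sup>2 + y\<^sup>2 / (4 * c) - x * y"
    using assms by (simp add: field_simps power2_eq_square)
  finally show ?thesis by simp
qed

text \<open>The pointwise estimate behind the energy inequality, with \<open>d = u - v\<close>, \<open>z\<close> the gradient of \<open>v\<close>, \<open>dv\<close> the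
  divergence of the field and \<open>e = \<epsilon>\<^sup>2\<close>; the weight has logarithmic gradient \<open>b\<close>. The term
  \<open>v\<^sup>2/2 (gt + f \<bullet> b - dv)\<close> has the good sign by the hypothesis on the weight. All terms that contain
  \<open>d\<close> are absorbed by the penalty \<open>e/(2 \<kappa>) d\<^sup>2\<close>, which is large when \<open>\<kappa>\<close> is small, and all
  terms that contain \<open>z\<close> by the viscosity \<open>e/2 \<bar>z\<bar>\<^sup>2\<close>.\<close>

lemma dissipation_inequality:
  fixes d v gt \<Gamma> dv e \<kappa> F Bb B3 Cg :: real and f b z :: "real^'n::finite"
  assumes e: "e > 0" and \<kappa>: "\<kappa> > 0"
    and F: "norm f \<le> F" and Bb: "norm b \<le> Bb" and B3: "\<bar>f \<bullet> b + gt\<bar> \<le> B3"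
    and sub: "gt + f \<bullet> b + \<bar>dv\<bar> \<le> 0"
    and \<kappa>1: "\<kappa> * \<bar>gt\<bar> \<le> e / 4"
    and \<kappa>2: "2 * F\<^sup>2 / e + e / 2 * Bb\<^sup>2 + e / 4 \<le> 3 * e / (8 * \<kappa>)"
    and Cg: "(norm b)\<^sup>2 / 2 + \<bar>\<Gamma>\<bar> / 2 + \<Gamma>\<^sup>2 / 4 \<le> Cg"
  shows "d * (f \<bullet> z) + d * v * (f \<bullet> b + gt) + v\<^sup>2 / 2 * (gt + f \<bullet> b - dv) - e / (2 * \<kappa>) * d\<^sup>2 - e / 2 * (z \<bullet> z)
      + e / 2 * (v + d) * (z \<bullet> b + v * \<Gamma>) - \<kappa> / 2 * (z \<bullet> z) * gt
    \<le> (Cg * e + 2 * B3\<^sup>2 * \<kappa> / e) * v\<^sup>2"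
proof -
  define Z where "Z = norm z"
  have Z: "z \<bullet> z = Z\<^sup>2" by (simp add: Z_def dot_square_norm)
  have Z0: "0 \<le> Z" by (simp add: Z_def)
  have F0: "0 \<le> F" using F norm_ge_zero order_trans by blast
  have a1: "d * (f \<bullet> z) \<le> e / 8 * Z\<^sup>2 + 2 * F\<^sup>2 / e * d\<^sup>2"
  proof -
    have "d * (f \<bullet> z) \<le> \<bar>d\<bar> * \<bar>f \<bullet> z\<bar>" by (simp add: abs_mult[symmetric])
    also have "\<dots> \<le> \<bar>d\<bar> * (F * Z)"
      using Cauchy_Schwarz_ineq2[of f z] F mult_right_mono[OF F Z0] unfolding Z_def by (intro mult_left_mono) auto
    also have "\<dots> = Z * (F * \<bar>d\<bar>)" by simp
    also have "\<dots> \<le> e / 8 * Z\<^sup>2 + (F * \<bar>d\<bar>)\<^sup>2 / (4 * (e / 8))" using e by (intro mult_le_weighted_squares) simp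
    also have "(F * \<bar>d\<bar>)\<^sup>2 / (4 * (e / 8)) = 2 * F\<^sup>2 / e * d\<^sup>2" by (simp add: power_mult_distrib)
    finally show ?thesis .
  qed
  have a2: "d * v * (f \<bullet> b + gt) \<le> e / (8 * \<kappa>) * d\<^sup>2 + 2 * B3\<^sup>2 * \<kappa> / e * v\<^sup>2"
  proof -
    have "d * v * (f \<bullet> b + gt) = d * (v * (f \<bullet> b + gt))" by simp
    also have "\<dots> \<le> e / (8 * \<kappa>) * d\<^sup>2 + (v * (f \<bullet> b + gt))\<^sup>2 / (4 * (e / (8 * \<kappa>)))"
      using e \<kappa> by (intro mult_le_weighted_squares) simp
    also have "(v * (f \<bullet> b + gt))\<^sup>2 / (4 * (e / (8 * \<kappa>))) = (2 * \<kappa> / e) * ((f \<bullet> b + gt)\<^sup>2 * v\<^sup>2)"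
      using \<kappa> by (simp add: power_mult_distrib)
    also have "(2 * \<kappa> / e) * ((f \<bullet> b + gt)\<^sup>2 * v\<^sup>2) \<le> (2 * \<kappa> / e) * (B3\<^sup>2 * v\<^sup>2)"
      using e \<kappa> B3 by (intro mult_left_mono mult_right_mono abs_le_square_iff[THEN iffD1]) auto
    finally show ?thesis by (simp add: mult_ac)
  qed
  have zb: "\<bar>z \<bullet> b\<bar> \<le> Z * norm b" using Cauchy_Schwarz_ineq2[of z b] by (simp add: Z_def)
  have a3: "e / 2 * (v * (z \<bullet> b)) \<le> e / 8 * Z\<^sup>2 + e / 2 * (norm b)\<^sup>2 * v\<^sup>2"
  proof -
    have "v * (z \<bullet> b) \<le> \<bar>v\<bar> * \<bar>z \<bullet> b\<bar>" by (simp add: abs_mult[symmetric])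
    also have "\<dots> \<le> \<bar>v\<bar> * (Z * norm b)" using zb by (intro mult_left_mono) auto
    also have "\<dots> = Z * (norm b * \<bar>v\<bar>)" by simp
    also have "\<dots> \<le> 1/4 * Z\<^sup>2 + (norm b * \<bar>v\<bar>)\<^sup>2 / (4 * (1/4))" by (intro mult_le_weighted_squares) simp
    finally have "v * (z \<bullet> b) \<le> 1/4 * Z\<^sup>2 + (norm b)\<^sup>2 * v\<^sup>2" by (simp add: power_mult_distrib)
    then have "e / 2 * (v * (z \<bullet> b)) \<le> e / 2 * (1/4 * Z\<^sup>2 + (norm b)\<^sup>2 * v\<^sup>2)" using e by (intro mult_left_mono) auto
    then show ?thesis by (simp add: algebra_simps)
  qed
  have a5: "e / 2 * (d * (z \<bullet> b)) \<le> e / 8 * Z\<^sup>2 + e / 2 * Bb\<^sup>2 * d\<^sup>2"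
  proof -
    have "d * (z \<bullet> b) \<le> \<bar>d\<bar> * \<bar>z \<bullet> b\<bar>" by (simp add: abs_mult[symmetric])
    also have "\<dots> \<le> \<bar>d\<bar> * (Z * Bb)"
      using zb mult_left_mono[OF Bb Z0] by (intro mult_left_mono) auto
    also have "\<dots> = Z * (Bb * \<bar>d\<bar>)" by simp
    also have "\<dots> \<le> 1/4 * Z\<^sup>2 + (Bb * \<bar>d\<bar>)\<^sup>2 / (4 * (1/4))" by (intro mult_le_weighted_squares) simp
    finally have "d * (z \<bullet> b) \<le> 1/4 * Z\<^sup>2 + Bb\<^sup>2 * d\<^sup>2" by (simp add: power_mult_distrib)
    then have "e / 2 * (d * (z \<bullet> b)) \<le> e / 2 * (1/4 * Z\<^sup>2 + Bb\<^sup>2 * d\<^sup>2)" using e by (intro mult_left_mono) auto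
    then show ?thesis by (simp add: algebra_simps)
  qed
  have a4: "e / 2 * (v\<^sup>2 * \<Gamma>) \<le> e / 2 * \<bar>\<Gamma>\<bar> * v\<^sup>2"
  proof -
    have "v\<^sup>2 * \<Gamma> \<le> v\<^sup>2 * \<bar>\<Gamma>\<bar>" by (intro mult_left_mono) auto
    then have "e / 2 * (v\<^sup>2 * \<Gamma>) \<le> e / 2 * (v\<^sup>2 * \<bar>\<Gamma>\<bar>)" using e by (intro mult_left_mono) auto
    then show ?thesis by (simp add: mult_ac)
  qed
  have a6: "e / 2 * (d * (v * \<Gamma>)) \<le> e / 4 * d\<^sup>2 + e / 4 * \<Gamma>\<^sup>2 * v\<^sup>2"
  proof -
    have "d * (v * \<Gamma>) \<le> 1/2 * d\<^sup>2 + (v * \<Gamma>)\<^sup>2 / (4 * (1/2))" by (intro mult_le_weighted_squares) simp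
    then have "e / 2 * (d * (v * \<Gamma>)) \<le> e / 2 * (1/2 * d\<^sup>2 + (v * \<Gamma>)\<^sup>2 / 2)" using e by (intro mult_left_mono) auto
    then show ?thesis by (simp add: power_mult_distrib algebra_simps)
  qed
  have a7: "- (\<kappa> / 2 * Z\<^sup>2 * gt) \<le> e / 8 * Z\<^sup>2"
  proof -
    have "- (\<kappa> * gt) \<le> e / 4" using \<kappa>1 \<kappa> by (smt (verit) mult_left_mono mult_minus_right)
    then have "Z\<^sup>2 / 2 * (- (\<kappa> * gt)) \<le> Z\<^sup>2 / 2 * (e / 4)" by (intro mult_left_mono) auto
    then show ?thesis by (simp add: algebra_simps)
  qed
  have a8: "v\<^sup>2 / 2 * (gt + f \<bullet> b - dv) \<le> 0" using sub by (intro mult_nonneg_nonpos) auto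
  have a9: "(2 * F\<^sup>2 / e + e / 2 * Bb\<^sup>2 + e / 4) * d\<^sup>2 \<le> 3 * e / (8 * \<kappa>) * d\<^sup>2" by (intro mult_right_mono \<kappa>2) auto
  have a10: "e * ((norm b)\<^sup>2 / 2 + \<bar>\<Gamma>\<bar> / 2 + \<Gamma>\<^sup>2 / 4) * v\<^sup>2 \<le> e * Cg * v\<^sup>2"
    using e by (intro mult_right_mono mult_left_mono Cg) auto
  have a11: "e / (2 * \<kappa>) * d\<^sup>2 = e / (8 * \<kappa>) * d\<^sup>2 + 3 * e / (8 * \<kappa>) * d\<^sup>2" by (simp add: field_simps)
  have split: "e / 2 * (v + d) * (z \<bullet> b + v * \<Gamma>) = e / 2 * (v * (z \<bullet> b)) + e / 2 * (v\<^sup>2 * \<Gamma>) + e / 2 * (d * (z \<bullet> b)) + e / 2 * (d * (v * \<Gamma>))"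
    by (simp add: algebra_simps power2_eq_square)
  have a9': "(2 * F\<^sup>2 / e) * d\<^sup>2 + (e / 2 * Bb\<^sup>2) * d\<^sup>2 + (e / 4) * d\<^sup>2 \<le> 3 * e / (8 * \<kappa>) * d\<^sup>2"
    using a9 by (simp only: distrib_right)
  have a10': "e / 2 * (norm b)\<^sup>2 * v\<^sup>2 + e / 2 * \<bar>\<Gamma>\<bar> * v\<^sup>2 + e / 4 * \<Gamma>\<^sup>2 * v\<^sup>2 \<le> Cg * e * v\<^sup>2"
    using a10 by (simp add: algebra_simps)
  have fin: "(Cg * e + 2 * B3\<^sup>2 * \<kappa> / e) * v\<^sup>2 = Cg * e * v\<^sup>2 + 2 * B3\<^sup>2 * \<kappa> / e * v\<^sup>2" by (simp only: distrib_right)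
  show ?thesis unfolding Z split fin a11 using a1 a2 a3 a4 a5 a6 a7 a8 a9' a10' by linarith
qed

context bounded_domain begin

lemma L2_norm_sum_le:
  assumes "\<And>i. i \<in> S \<Longrightarrow> z i \<in> L2_space D"
  shows "L2_norm D (\<lambda>x. \<Sum>i\<in>S. z i x) \<le> (\<Sum>i\<in>S. L2_norm D (z i))"
  using assms
proof (induction S rule: infinite_finite_induct)
  case (insert i S)
  have "L2_norm D (\<lambda>x. z i x + (\<Sum>i\<in>S. z i x)) \<le> L2_norm D (z i) + L2_norm D (\<lambda>x. \<Sum>i\<in>S. z i x)"
    using insert.prems by (intro L2_norm_triangle L2_sum) auto
  then show ?case using insert by fastforce
qed (auto simp: L2_norm_def L2_inner_def)

lemma first_order_norm_le:
  assumes v: "v \<in> test_functions D" and K: "L2_norm D v \<le> K" "\<And>i. L2_norm D (partial_deriv i v) \<le> K"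
    and \<alpha>: "continuous_on UNIV \<alpha>" "\<And>x. x \<in> D \<Longrightarrow> \<bar>\<alpha> x\<bar> \<le> B"
    and \<beta>: "\<And>i. continuous_on UNIV (\<beta> i)" "\<And>i x. x \<in> D \<Longrightarrow> \<bar>\<beta> i x\<bar> \<le> B" and "0 \<le> B"
  shows "L2_norm D (\<lambda>x. v x * \<alpha> x + (\<Sum>i\<in>UNIV. partial_deriv i v x * \<beta> i x)) \<le> (1 + real CARD('n)) * B * K"
proof -
  have "L2_norm D (\<lambda>x. v x * \<alpha> x + (\<Sum>i\<in>UNIV. partial_deriv i v x * \<beta> i x))
     \<le> L2_norm D (\<lambda>x. v x * \<alpha> x) + L2_norm D (\<lambda>x. \<Sum>i\<in>UNIV. partial_deriv i v x * \<beta> i x)"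
    by (intro L2_norm_triangle L2_sum L2_mult_continuous test_L2 test_partial v \<alpha> \<beta>)
  also have "\<dots> \<le> L2_norm D (\<lambda>x. v x * \<alpha> x) + (\<Sum>i\<in>UNIV. L2_norm D (\<lambda>x. partial_deriv i v x * \<beta> i x))"
    by (intro add_left_mono L2_norm_sum_le L2_mult_continuous test_L2 test_partial v \<beta>)
  also have "\<dots> \<le> B * K + (\<Sum>i\<in>(UNIV::'n set). B * K)"
  proof (intro add_mono sum_mono)
    show "L2_norm D (\<lambda>x. v x * \<alpha> x) \<le> B * K"
      using L2_norm_bounded_mult[OF test_L2[OF v] measurable_D[OF \<alpha>(1)] \<alpha>(2) \<open>0 \<le> B\<close>] mult_left_mono[OF K(1) \<open>0 \<le> B\<close>]
      by linarith
    show "L2_norm D (\<lambda>x. partial_deriv i v x * \<beta> i x) \<le> B * K" for i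
    proof -
      have "L2_norm D (\<lambda>x. partial_deriv i v x * \<beta> i x) \<le> B * L2_norm D (partial_deriv i v)"
        by (rule L2_norm_bounded_mult[OF test_L2[OF test_partial[OF v]] measurable_D[OF \<beta>(1)] \<beta>(2) \<open>0 \<le> B\<close>])
      then show ?thesis using mult_left_mono[OF K(2)[of i] \<open>0 \<le> B\<close>] by linarith
    qed
  qed
  also have "\<dots> = (1 + real CARD('n)) * B * K" by (simp add: algebra_simps)
  finally show ?thesis .
qed

end

context transport_domain begin

lemma C_L2_mult_uniform:
  fixes b :: "real^'n \<Rightarrow> real \<Rightarrow> real"
  assumes u: "u \<in> C_L2 D s T" and b: "continuous_on UNIV (\<lambda>(x, t). b x t)" and "\<eta> > 0"
  shows "\<exists>h>0. \<forall>t\<in>{s..T}. \<forall>t'\<in>{s..T}. \<bar>t' - t\<bar> < h \<longrightarrow> L2_norm D (\<lambda>x. u t' x * b x t' - u t x * b x t) \<le> \<eta>"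
proof -
  have uL: "u t \<in> L2_space D" if "t \<in> {s..T}" for t using u that by (simp add: C_L2_def)
  obtain B where B: "B \<ge> 0" "\<And>x t. x \<in> D \<Longrightarrow> t \<in> {s..T} \<Longrightarrow> \<bar>b x t\<bar> \<le> B" using joint_uniform(1)[OF b] by auto
  obtain M where M: "M \<ge> 0" "\<And>t. t \<in> {s..T} \<Longrightarrow> L2_norm D (u t) \<le> M" using C_L2_norm_bounded[OF u] by auto
  define \<zeta> where "\<zeta> = \<eta> / (B + M + 1)"
  have \<zeta>: "\<zeta> > 0" using \<open>\<eta> > 0\<close> B(1) M(1) by (simp add: \<zeta>_def)
  obtain h1 where h1: "h1 > 0" "\<And>x t t'. x \<in> D \<Longrightarrow> t \<in> {s..T} \<Longrightarrow> t' \<in> {s..T} \<Longrightarrow> \<bar>t' - t\<bar> < h1 \<Longrightarrow> \<bar>b x t' - b x t\<bar> \<le> \<zeta>"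
    using joint_uniform(2)[OF b \<zeta>] by (auto simp: real_norm_def)
  obtain h2 where h2: "h2 > 0" "\<And>t t'. t \<in> {s..T} \<Longrightarrow> t' \<in> {s..T} \<Longrightarrow> \<bar>t' - t\<bar> < h2 \<Longrightarrow> L2_norm D (\<lambda>x. u t' x - u t x) \<le> \<zeta>"
    using C_L2_uniform[OF u \<zeta>] by blast
  have "L2_norm D (\<lambda>x. u t' x * b x t' - u t x * b x t) \<le> \<eta>"
    if t: "t \<in> {s..T}" "t' \<in> {s..T}" "\<bar>t' - t\<bar> < min h1 h2" for t t'
  proof -
    note c = slice_continuous[OF b]
    have d: "continuous_on UNIV (\<lambda>x. b x t' - b x t)" by (intro continuous_intros c)
    have "L2_norm D (\<lambda>x. u t' x * b x t' - u t x * b x t)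
        = L2_norm D (\<lambda>x. (u t' x - u t x) * b x t' + u t x * (b x t' - b x t))" by (simp add: algebra_simps)
    also have "\<dots> \<le> L2_norm D (\<lambda>x. (u t' x - u t x) * b x t') + L2_norm D (\<lambda>x. u t x * (b x t' - b x t))"
      by (intro L2_norm_triangle L2_mult_continuous L2_diff uL t c d)
    also have "\<dots> \<le> B * \<zeta> + \<zeta> * M"
    proof (rule add_mono)
      have "L2_norm D (\<lambda>x. (u t' x - u t x) * b x t') \<le> B * L2_norm D (\<lambda>x. u t' x - u t x)"
        by (rule L2_norm_bounded_mult[OF L2_diff[OF uL uL] measurable_D[OF c]]) (use t B in auto)
      also have "\<dots> \<le> B * \<zeta>" using h2(2)[OF t(1,2)] t(3) B(1) by (intro mult_left_mono) auto
      finally show "L2_norm D (\<lambda>x. (u t' x - u t x) * b x t') \<le> B * \<zeta>" .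
      have "L2_norm D (\<lambda>x. u t x * (b x t' - b x t)) \<le> \<zeta> * L2_norm D (u t)"
        by (rule L2_norm_bounded_mult[OF uL measurable_D[OF d]]) (use t h1(2)[of _ t t'] \<zeta> in auto)
      also have "\<dots> \<le> \<zeta> * M" using M(2)[OF t(1)] \<zeta> by (intro mult_left_mono) auto
      finally show "L2_norm D (\<lambda>x. u t x * (b x t' - b x t)) \<le> \<zeta> * M" .
    qed
    also have "\<dots> \<le> \<zeta> * (B + M + 1)" using \<zeta> by (simp add: algebra_simps)
    also have "\<dots> = \<eta>" using B(1) M(1) by (simp add: \<zeta>_def)
    finally show ?thesis .
  qed
  then show ?thesis using h1(1) h2(1) by (intro exI[of _ "min h1 h2"]) auto
qed

end

context weighted_solution begin

text \<open>A near maximiser does at least as well as \<open>v = 0\<close>, up to the error \<open>\<theta> \<le> 1\<close>. Its weighted norm is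
  bounded independently of \<open>\<kappa>\<close>, whereas the bound on its gradient degenerates as \<open>\<kappa>\<close> tends to zero;
  the latter is only used for fixed \<open>\<kappa>\<close>.\<close>

lemma near_maximiser_bounds:
  assumes t: "t \<in> {s..T}" and v: "v \<in> test_functions D" and \<kappa>: "0 < \<kappa>" "\<kappa> \<le> 1"
    and max: "\<Psi> \<kappa> t \<le> J \<kappa> t v + \<theta>" and "\<theta> \<le> 1"
    and M: "L2_norm D (u t) \<le> M" and W: "\<And>x. x \<in> D \<Longrightarrow> w x t \<le> W" "0 \<le> W"
    and w0: "\<And>x. x \<in> D \<Longrightarrow> w0 \<le> w x t" "0 < w0"
  shows "I (\<lambda>x. (v x)\<^sup>2 * w x t) \<le> 4 * (1 + M\<^sup>2 * W)"
    and "sobolev_sq v (gradient v) \<le> 6 * (1 + M\<^sup>2 * W) / (\<kappa> * w0)"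
proof -
  note sv = test_smooth[OF v]
  let ?g = "\<lambda>x. gradient v x \<bullet> gradient v x"
  have i1: "integrable (lebesgue_on D) (\<lambda>x. (v x)\<^sup>2 * w x t)" "integrable (lebesgue_on D) (\<lambda>x. ?g x * w x t)"
    by (intro integrable_continuous continuous_intros smooth_continuous sv w_slice gradient_continuous)+
  have "-1 \<le> J \<kappa> t v" using max \<open>\<theta> \<le> 1\<close> \<Psi>_nonneg[OF t] \<kappa> by (smt (verit))
  also have "J \<kappa> t v \<le> I (\<lambda>x. (u t x)\<^sup>2 * w x t - 1 / 4 * ((v x)\<^sup>2 * w x t) - \<kappa> / 2 * (?g x * w x t))"
    unfolding J_def
  proof (rule integral_mono[OF J_integrable(1)[OF t sv]])
    show "integrable (lebesgue_on D) (\<lambda>x. (u t x)\<^sup>2 * w x t - 1 / 4 * ((v x)\<^sup>2 * w x t) - \<kappa> / 2 * (?g x * w x t))"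
      using i1 u_square_integrable[OF t] by simp
    fix x
    \<comment> \<open>u v - v^2/2 is at most u^2 - v^2/4\<close>
    have "0 \<le> (u t x - v x / 2)\<^sup>2 * w x t" using w_pos[of x t] by (intro mult_nonneg_nonneg) auto
    then show "u t x * (v x * w x t) - ((v x)\<^sup>2 / 2 + \<kappa> / 2 * ?g x) * w x t
        \<le> (u t x)\<^sup>2 * w x t - 1 / 4 * ((v x)\<^sup>2 * w x t) - \<kappa> / 2 * (?g x * w x t)"
      by (simp add: power2_diff algebra_simps power2_eq_square)
  qed
  also have "\<dots> = I (\<lambda>x. (u t x)\<^sup>2 * w x t) - 1 / 4 * I (\<lambda>x. (v x)\<^sup>2 * w x t) - \<kappa> / 2 * I (\<lambda>x. ?g x * w x t)"
    using i1 u_square_integrable[OF t] by simp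
  also have "I (\<lambda>x. (u t x)\<^sup>2 * w x t) \<le> M\<^sup>2 * W"
  proof -
    have "I (\<lambda>x. (u t x)\<^sup>2 * w x t) \<le> I (\<lambda>x. W * (u t x)\<^sup>2)"
      by (rule integral_mono[OF u_square_integrable[OF t]])
         (use L2_square_integrable[OF u_L2[OF t]] in \<open>auto simp: mult.commute[of W] intro!: mult_left_mono W\<close>)
    also have "\<dots> = W * (L2_norm D (u t))\<^sup>2" by (simp add: L2_norm_sq)
    also have "\<dots> \<le> W * M\<^sup>2" using M W(2) by (intro mult_left_mono power_mono) auto
    finally show ?thesis by (simp add: mult.commute)
  qed
  finally have key: "1 / 4 * I (\<lambda>x. (v x)\<^sup>2 * w x t) + \<kappa> / 2 * I (\<lambda>x. ?g x * w x t) \<le> 1 + M\<^sup>2 * W" by simp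
  have nn: "0 \<le> I (\<lambda>x. (v x)\<^sup>2 * w x t)" "0 \<le> I (\<lambda>x. ?g x * w x t)"
    by (intro integral_nonneg_AE AE_I2 mult_nonneg_nonneg less_imp_le[OF w_pos] zero_le_power2 inner_ge_zero)+
  have kg: "0 \<le> \<kappa> / 2 * I (\<lambda>x. ?g x * w x t)" using nn \<kappa> by simp
  have arith: "p \<le> 4 * R" if "0 \<le> q" "1 / 4 * p + q \<le> R" for p q R :: real using that by linarith
  have arith': "\<kappa> * q \<le> 2 * R" if "0 \<le> p" "1 / 4 * p + \<kappa> / 2 * q \<le> R" for p q R :: real using that by (simp add: field_simps)
  show vw: "I (\<lambda>x. (v x)\<^sup>2 * w x t) \<le> 4 * (1 + M\<^sup>2 * W)" by (rule arith[OF kg key])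
  have gw: "\<kappa> * I (\<lambda>x. ?g x * w x t) \<le> 2 * (1 + M\<^sup>2 * W)" by (rule arith'[OF nn(1) key])
  have s1: "w0 * sobolev_sq v (gradient v) \<le> I (\<lambda>x. (v x)\<^sup>2 * w x t) + I (\<lambda>x. ?g x * w x t)"
  proof -
    have i2: "integrable (lebesgue_on D) (\<lambda>x. (v x)\<^sup>2)" "integrable (lebesgue_on D) (\<lambda>x. (partial_deriv i v x)\<^sup>2)" for i
      by (intro integrable_continuous continuous_intros smooth_continuous smooth_partial_deriv sv)+
    have "w0 * sobolev_sq v (gradient v) = I (\<lambda>x. w0 * ((v x)\<^sup>2 + (\<Sum>i\<in>UNIV. (partial_deriv i v x)\<^sup>2)))"
      unfolding sobolev_sq_def L2_norm_sq using i2 by (simp add: Bochner_Integration.integral_sum Bochner_Integration.integral_add)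
    also have "\<dots> \<le> I (\<lambda>x. (v x)\<^sup>2 * w x t + ?g x * w x t)"
    proof (rule integral_mono)
      show "integrable (lebesgue_on D) (\<lambda>x. w0 * ((v x)\<^sup>2 + (\<Sum>i\<in>UNIV. (partial_deriv i v x)\<^sup>2)))"
        by (intro integrable_continuous continuous_intros smooth_continuous smooth_partial_deriv sv)
      fix x assume "x \<in> space (lebesgue_on D)"
      then have "w0 * ((v x)\<^sup>2 + ?g x) \<le> w x t * ((v x)\<^sup>2 + ?g x)" by (intro mult_right_mono w0) auto
      then show "w0 * ((v x)\<^sup>2 + (\<Sum>i\<in>UNIV. (partial_deriv i v x)\<^sup>2)) \<le> (v x)\<^sup>2 * w x t + ?g x * w x t"
        by (simp add: inner_vec_def power2_eq_square algebra_simps)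
    qed (use i1 in simp)
    also have "\<dots> = I (\<lambda>x. (v x)\<^sup>2 * w x t) + I (\<lambda>x. ?g x * w x t)" using i1 by simp
    finally show ?thesis .
  qed
  have "\<kappa> * (w0 * sobolev_sq v (gradient v)) \<le> \<kappa> * (I (\<lambda>x. (v x)\<^sup>2 * w x t) + I (\<lambda>x. ?g x * w x t))"
    using s1 \<kappa> by (intro mult_left_mono) auto
  also have "\<dots> \<le> 1 * I (\<lambda>x. (v x)\<^sup>2 * w x t) + \<kappa> * I (\<lambda>x. ?g x * w x t)"
    using mult_right_mono[OF \<kappa>(2) nn(1)] by (simp add: distrib_left)
  also have "\<dots> \<le> 6 * (1 + M\<^sup>2 * W)" using vw gw by linarith
  finally show "sobolev_sq v (gradient v) \<le> 6 * (1 + M\<^sup>2 * W) / (\<kappa> * w0)"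
    using \<kappa> w0(2) by (simp add: field_simps)
qed

text \<open>The integral of the divergence of \<open>v\<^sup>2 w f\<close>. The field is merely differentiable once, which is enough for
  the axis-wise integration by parts.\<close>

lemma transport_by_parts:
  assumes v: "v \<in> test_functions D"
  shows "I (\<lambda>x. 2 * v x * (f x t \<bullet> gradient v x) * w x t + (v x)\<^sup>2 * w x t * (f x t \<bullet> b x t + field_div x t)) = 0"
proof -
  note sv = test_smooth[OF v]
  obtain K where K: "compact K" "K \<subseteq> D" "\<And>x. x \<notin> K \<Longrightarrow> v x = 0" using v unfolding test_functions_iff by auto
  define P where "P i x = 2 * v x * partial_deriv i v x * (w x t * (f x t $ i)) + (v x)\<^sup>2 * (w x t * b x t $ i * (f x t $ i) + w x t * partial_deriv i (\<lambda>z. f z t $ i) x)" for i x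
  have c: "continuous_on UNIV (\<lambda>x. partial_deriv i (\<lambda>z. f z t $ i) x)" "continuous_on UNIV (\<lambda>x. b x t $ i)" for i
    by (rule slice_continuous[OF field_partial_continuous]) (intro continuous_intros b_slice)
  have cv: "continuous_on UNIV v" "continuous_on UNIV (partial_deriv i v)" for i
    using sv by (auto intro: smooth_continuous smooth_partial_deriv)
  have Pc: "continuous_on UNIV (P i)" for i unfolding P_def
    by (intro c cv w_slice field_slice_nth continuous_on_mult continuous_on_add continuous_on_power continuous_on_const)
  have P0: "I (P i) = 0" for i
  proof (rule integral_partial_zero_D[OF K(1,2)])
    show "(v x)\<^sup>2 * (w x t * f x t $ i) = 0" if "x \<notin> K" for x using K(3)[OF that] by simp
    show "continuous_on UNIV (\<lambda>x. (v x)\<^sup>2 * (w x t * f x t $ i))"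
      by (intro cv w_slice field_slice_nth continuous_on_mult continuous_on_power)
    show "((\<lambda>h. (v (x + h *\<^sub>R axis i 1))\<^sup>2 * (w (x + h *\<^sub>R axis i 1) t * f (x + h *\<^sub>R axis i 1) t $ i)) has_real_derivative P i x) (at 0)" for x
      using partial_deriv_direction[OF smooth_differentiable[OF sv, of x], of i]
        partial_deriv_direction[OF smooth_differentiable[OF w_smooth, of t x], of i] field_partial_direction[of x i t i]
      unfolding P_def by (auto intro!: derivative_eq_intros simp: w_partial power2_eq_square algebra_simps)
  qed (rule Pc)
  have "2 * v x * (f x t \<bullet> gradient v x) * w x t + (v x)\<^sup>2 * w x t * (f x t \<bullet> b x t + field_div x t) = (\<Sum>i\<in>UNIV. P i x)" for x
    by (simp add: P_def inner_vec_def field_div_def sum.distrib sum_distrib_left sum_distrib_right algebra_simps)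
  then show ?thesis using P0 integrable_continuous[OF Pc] by (simp add: Bochner_Integration.integral_sum)
qed

text \<open>What remains of the weak equation tested with \<open>v w\<close> once the gradient of the solution has been
  eliminated.\<close>

definition rate :: "real \<Rightarrow> real \<Rightarrow> (real^'n \<Rightarrow> real) \<Rightarrow> real \<Rightarrow> real" where
  "rate \<kappa> t v \<tau> = transport_pairing (\<lambda>x. v x * w x t) \<tau>
     - \<epsilon>\<^sup>2 / (2 * \<kappa>) * I (\<lambda>x. u \<tau> x * ((u t x - v x) * w x t))
     + \<epsilon>\<^sup>2 / 2 * I (\<lambda>x. u \<tau> x * (w x t * (gradient v x \<bullet> b x t + v x * \<Gamma> x t)))"

lemma weighted_partial:
  assumes "smooth v"
  shows "partial_deriv i (\<lambda>x. v x * w x t) x = partial_deriv i v x * w x t + v x * (w x t * b x t $ i)"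
  using partial_deriv_mult[OF smooth_differentiable[OF assms] smooth_differentiable[OF w_smooth]]
  by (simp add: w_partial)

lemma weight_divergence:
  assumes "smooth v"
  shows "(\<Sum>i\<in>UNIV. partial_deriv i (\<lambda>y. v y * partial_deriv i (\<lambda>x. w x t) y) x)
    = w x t * (gradient v x \<bullet> b x t + v x * \<Gamma> x t)"
proof -
  have "partial_deriv i (\<lambda>y. v y * partial_deriv i (\<lambda>x. w x t) y) x
     = partial_deriv i v x * (w x t * b x t $ i) + v x * partial_deriv i (partial_deriv i (\<lambda>x. w x t)) x" for i
    using partial_deriv_mult[OF smooth_differentiable[OF assms] smooth_differentiable[OF smooth_partial_deriv[OF w_smooth]]]
    by (simp add: w_partial)
  then have "(\<Sum>i\<in>UNIV. partial_deriv i (\<lambda>y. v y * partial_deriv i (\<lambda>x. w x t) y) x)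
     = (\<Sum>i\<in>UNIV. partial_deriv i v x * (w x t * b x t $ i)) + v x * (\<Sum>i\<in>UNIV. partial_deriv i (partial_deriv i (\<lambda>x. w x t)) x)"
    by (simp only: sum.distrib sum_distrib_left)
  also have "(\<Sum>i\<in>UNIV. partial_deriv i v x * (w x t * b x t $ i)) = w x t * (gradient v x \<bullet> b x t)"
    by (simp add: inner_vec_def sum_distrib_left mult_ac)
  finally show ?thesis unfolding w_laplace by (simp add: algebra_simps)
qed

text \<open>Testing the equation with \<open>v w\<close> produces the unknown gradient of \<open>u\<close> in two places. Where it meets the
  gradient of \<open>w\<close> it is removed by integration by parts; where it meets \<open>w \<nabla>v\<close>, the Euler--Lagrange
  equation for \<open>v\<close> trades it for \<open>(u - v) w / \<kappa>\<close>, leaving the small remainder \<open>DJ\<close>.\<close>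

lemma rate_identity:
  assumes t: "t \<in> {s..T}" and \<tau>: "\<tau> \<in> {s..T}" and W: "W12_0 D (u \<tau>) (G \<tau>)"
    and v: "v \<in> test_functions D" and \<kappa>: "\<kappa> > 0"
  shows "transport_pairing (\<lambda>x. v x * w x t) \<tau> - \<epsilon>\<^sup>2 / 2 * gradient_pairing (gradient (\<lambda>x. v x * w x t)) \<tau>
    = rate \<kappa> t v \<tau> + \<epsilon>\<^sup>2 / (2 * \<kappa>) * DJ \<kappa> t v (u \<tau>) (G \<tau>)"
proof -
  note sv = test_smooth[OF v]
  have GL: "(\<lambda>x. G \<tau> x $ i) \<in> L2_space D" for i using W by (auto simp: W12_0_def W12_def)
  define dw where "dw i = partial_deriv i (\<lambda>x. w x t)" for i
  have sdw: "smooth (dw i)" for i unfolding dw_def by (rule smooth_partial_deriv[OF w_smooth])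
  define S1 where "S1 = (\<Sum>i\<in>UNIV. I (\<lambda>x. G \<tau> x $ i * (partial_deriv i v x * w x t)))"
  define S2 where "S2 = (\<Sum>i\<in>UNIV. I (\<lambda>x. G \<tau> x $ i * (v x * dw i x)))"
  have i1: "integrable (lebesgue_on D) (\<lambda>x. G \<tau> x $ i * (partial_deriv i v x * w x t))" for i
    by (rule integrable_L2_continuous[OF GL]) (intro continuous_on_mult w_slice smooth_continuous smooth_partial_deriv sv)
  have i2: "integrable (lebesgue_on D) (\<lambda>x. G \<tau> x $ i * (v x * dw i x))" for i
    by (rule integrable_L2_continuous[OF GL]) (intro continuous_on_mult smooth_continuous sdw sv)
  have gp: "gradient_pairing (gradient (\<lambda>x. v x * w x t)) \<tau> = S1 + S2"
    unfolding gradient_pairing_def S1_def S2_def sum.distrib[symmetric]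
  proof (rule sum.cong[OF refl])
    fix i
    have "I (\<lambda>x. G \<tau> x $ i * gradient (\<lambda>x. v x * w x t) x $ i)
        = I (\<lambda>x. G \<tau> x $ i * (partial_deriv i v x * w x t) + G \<tau> x $ i * (v x * dw i x))"
      by (simp add: weighted_partial[OF sv] dw_def w_partial distrib_left)
    then show "I (\<lambda>x. G \<tau> x $ i * gradient (\<lambda>x. v x * w x t) x $ i)
       = I (\<lambda>x. G \<tau> x $ i * (partial_deriv i v x * w x t)) + I (\<lambda>x. G \<tau> x $ i * (v x * dw i x))"
      using i1 i2 by simp
  qed
  have S1: "\<kappa> * S1 = I (\<lambda>x. u \<tau> x * ((u t x - v x) * w x t)) - DJ \<kappa> t v (u \<tau>) (G \<tau>)"
    by (simp add: DJ_def S1_def)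
  have S2: "S2 = - I (\<lambda>x. u \<tau> x * (w x t * (gradient v x \<bullet> b x t + v x * \<Gamma> x t)))"
  proof -
    have tv: "(\<lambda>y. v y * dw i y) \<in> test_functions D" for i by (rule test_mult[OF v sdw])
    have "I (\<lambda>x. G \<tau> x $ i * (v x * dw i x)) = - I (\<lambda>x. u \<tau> x * partial_deriv i (\<lambda>y. v y * dw i y) x)" for i
      using W tv[of i] by (simp add: W12_0_def W12_def L2_inner_def)
    then have "S2 = - (\<Sum>i\<in>UNIV. I (\<lambda>x. u \<tau> x * partial_deriv i (\<lambda>y. v y * dw i y) x))"
      by (simp add: S2_def sum_negf)
    also have "(\<Sum>i\<in>UNIV. I (\<lambda>x. u \<tau> x * partial_deriv i (\<lambda>y. v y * dw i y) x))
       = I (\<lambda>x. \<Sum>i\<in>UNIV. u \<tau> x * partial_deriv i (\<lambda>y. v y * dw i y) x)"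
      by (rule Bochner_Integration.integral_sum[symmetric])
         (intro L2_mult_integrable u_L2 \<tau> test_L2 test_partial tv)
    finally show ?thesis using weight_divergence[OF sv, of t]
      by (simp add: dw_def flip: sum_distrib_left)
  qed
  have "- (\<epsilon>\<^sup>2 / 2 * S1) = - (\<epsilon>\<^sup>2 / (2 * \<kappa>) * (\<kappa> * S1))" using \<kappa> by simp
  then show ?thesis unfolding rate_def gp S1 S2 by (simp add: algebra_simps)
qed

text \<open>Since \<open>rate\<close> does not contain the gradient of \<open>u\<close>, it depends on time continuously, with a modulus that
  is uniform over all \<open>v\<close> of bounded energy.\<close>

lemma rate_continuity:
  assumes t: "t \<in> {s..T}" and \<tau>: "\<tau> \<in> {s..T}" and v: "v \<in> test_functions D" and \<kappa>: "\<kappa> > 0"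
    and \<eta>: "L2_norm D (\<lambda>x. u \<tau> x - u t x) \<le> \<eta>" "\<And>i. L2_norm D (\<lambda>x. u \<tau> x * f x \<tau> $ i - u t x * f x t $ i) \<le> \<eta>"
    and K: "L2_norm D v \<le> K" "\<And>i. L2_norm D (partial_deriv i v) \<le> K"
    and M: "L2_norm D (u t) \<le> M" and "0 \<le> B"
    and B: "\<And>x. x \<in> D \<Longrightarrow> w x t \<le> B" "\<And>x i. x \<in> D \<Longrightarrow> \<bar>w x t * b x t $ i\<bar> \<le> B" "\<And>x. x \<in> D \<Longrightarrow> \<bar>w x t * \<Gamma> x t\<bar> \<le> B"
  shows "rate \<kappa> t v \<tau> \<le> rate \<kappa> t v t
     + (real CARD('n) * ((1 + real CARD('n)) * B * K) + \<epsilon>\<^sup>2 / (2 * \<kappa>) * (B * (M + K)) + \<epsilon>\<^sup>2 / 2 * ((1 + real CARD('n)) * B * K)) * \<eta>"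
proof -
  note sv = test_smooth[OF v]
  let ?n = "real CARD('n)"
  let ?V = "\<lambda>x. v x * w x t"
  have V: "?V \<in> test_functions D" by (rule test_mult[OF v w_smooth])
  have \<eta>0: "0 \<le> \<eta>" using \<eta>(1) L2_norm_nonneg order_trans by blast
  have wb: "continuous_on UNIV (\<lambda>x. w x t * b x t $ i)" for i
    by (intro continuous_on_mult w_slice continuous_on_component b_slice)
  have Vi: "L2_norm D (partial_deriv i ?V) \<le> (1 + ?n) * B * K" for i
  proof -
    define be where "be j x = (if j = i then w x t else 0)" for j x
    have bec: "continuous_on UNIV (be j)" for j
      by (cases "j = i") (auto simp: be_def[abs_def] w_slice)
    have "partial_deriv i ?V x = v x * (w x t * b x t $ i) + (\<Sum>j\<in>UNIV. partial_deriv j v x * be j x)" for x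
      by (simp add: weighted_partial[OF sv] be_def if_distrib[of "\<lambda>y. _ * y"] cong: if_cong)
    then have "partial_deriv i ?V = (\<lambda>x. v x * (w x t * b x t $ i) + (\<Sum>j\<in>UNIV. partial_deriv j v x * be j x))" by auto
    moreover have "L2_norm D (\<lambda>x. v x * (w x t * b x t $ i) + (\<Sum>j\<in>UNIV. partial_deriv j v x * be j x)) \<le> (1 + ?n) * B * K"
      by (rule first_order_norm_le[OF v K])
         (use wb bec B w_pos[THEN less_imp_le] \<open>0 \<le> B\<close> in \<open>auto simp: be_def\<close>)
    ultimately show ?thesis by simp
  qed
  have uf: "(\<lambda>x. u r x * f x r $ i) \<in> L2_space D" if "r \<in> {s..T}" for r i
    by (intro L2_mult_continuous u_L2 that field_slice_nth)
  have tp: "transport_pairing ?V r = (\<Sum>i\<in>UNIV. I (\<lambda>x. (u r x * f x r $ i) * partial_deriv i ?V x))" if "r \<in> {s..T}" for r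
  proof -
    have "u r x * (f x r \<bullet> gradient ?V x) = (\<Sum>i\<in>UNIV. (u r x * f x r $ i) * partial_deriv i ?V x)" for x
      by (simp add: inner_vec_def sum_distrib_left mult.assoc)
    then show ?thesis unfolding transport_pairing_def
      using L2_mult_integrable[OF uf[OF that] test_L2[OF test_partial[OF V]]] by (simp add: Bochner_Integration.integral_sum)
  qed
  have diff: "I (\<lambda>x. a x * z x) - I (\<lambda>x. a' x * z x) \<le> \<eta> * Z"
    if "a \<in> L2_space D" "a' \<in> L2_space D" "z \<in> L2_space D" "L2_norm D (\<lambda>x. a x - a' x) \<le> \<eta>" "L2_norm D z \<le> Z" for a a' z Z
  proof -
    have "I (\<lambda>x. a x * z x) - I (\<lambda>x. a' x * z x) = I (\<lambda>x. (a x - a' x) * z x)"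
      using L2_mult_integrable that by (simp add: left_diff_distrib)
    also have "\<dots> \<le> L2_norm D (\<lambda>x. a x - a' x) * L2_norm D z"
      using inner_le_norm[OF L2_diff[OF that(1,2)] that(3)] by linarith
    also have "\<dots> \<le> \<eta> * Z" using that \<eta>0 by (intro mult_mono) auto
    finally show ?thesis .
  qed
  have 1: "transport_pairing ?V \<tau> - transport_pairing ?V t \<le> ?n * ((1 + ?n) * B * K) * \<eta>"
  proof -
    have "transport_pairing ?V \<tau> - transport_pairing ?V t \<le> (\<Sum>i\<in>(UNIV::'n set). \<eta> * ((1 + ?n) * B * K))"
      unfolding tp[OF t] tp[OF \<tau>] sum_subtractf[symmetric]
      by (intro sum_mono diff uf t \<tau> \<eta> Vi test_L2 test_partial V)
    then show ?thesis by (simp add: mult_ac)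
  qed
  have 2: "I (\<lambda>x. u t x * ((u t x - v x) * w x t)) - I (\<lambda>x. u \<tau> x * ((u t x - v x) * w x t)) \<le> \<eta> * (B * (M + K))"
  proof (rule diff[OF u_L2[OF t] u_L2[OF \<tau>]])
    have d: "(\<lambda>x. u t x - v x) \<in> L2_space D" by (intro L2_diff u_L2 t test_L2 v)
    show "(\<lambda>x. (u t x - v x) * w x t) \<in> L2_space D" by (intro L2_mult_continuous d w_slice)
    show "L2_norm D (\<lambda>x. u t x - u \<tau> x) \<le> \<eta>" using \<eta>(1) by (subst L2_norm_uminus)
    have "L2_norm D (\<lambda>x. (u t x - v x) * w x t) \<le> B * L2_norm D (\<lambda>x. u t x - v x)"
      by (rule L2_norm_bounded_mult[OF d measurable_D[OF w_slice]])
         (use B(1) w_pos[THEN less_imp_le] \<open>0 \<le> B\<close> in auto)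
    also have "\<dots> \<le> B * (M + K)"
    proof (intro mult_left_mono)
      have "L2_norm D (\<lambda>x. u t x + (-1) * v x) \<le> L2_norm D (u t) + L2_norm D (\<lambda>x. (-1) * v x)"
        by (intro L2_norm_triangle u_L2 t L2_cmult test_L2 v)
      then show "L2_norm D (\<lambda>x. u t x - v x) \<le> M + K" using M K(1) by (simp add: L2_norm_def L2_inner_def)
    qed fact
    finally show "L2_norm D (\<lambda>x. (u t x - v x) * w x t) \<le> B * (M + K)" .
  qed
  have 3: "I (\<lambda>x. u \<tau> x * (w x t * (gradient v x \<bullet> b x t + v x * \<Gamma> x t))) - I (\<lambda>x. u t x * (w x t * (gradient v x \<bullet> b x t + v x * \<Gamma> x t)))
      \<le> \<eta> * ((1 + ?n) * B * K)"
  proof (rule diff[OF u_L2[OF \<tau>] u_L2[OF t]])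
    have eq: "(\<lambda>x. w x t * (gradient v x \<bullet> b x t + v x * \<Gamma> x t))
      = (\<lambda>x. v x * (w x t * \<Gamma> x t) + (\<Sum>j\<in>UNIV. partial_deriv j v x * (w x t * b x t $ j)))"
      by (simp add: inner_vec_def sum_distrib_left algebra_simps)
    show "L2_norm D (\<lambda>x. w x t * (gradient v x \<bullet> b x t + v x * \<Gamma> x t)) \<le> (1 + ?n) * B * K"
      unfolding eq by (rule first_order_norm_le[OF v K]) (use wb B \<open>0 \<le> B\<close> in \<open>auto intro!: continuous_on_mult w_slice \<Gamma>_slice\<close>)
    show "(\<lambda>x. w x t * (gradient v x \<bullet> b x t + v x * \<Gamma> x t)) \<in> L2_space D"
      unfolding eq by (intro L2_add L2_sum L2_mult_continuous test_L2 test_partial v wb continuous_on_mult w_slice \<Gamma>_slice)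
  qed (use \<eta>(1) in simp)
  have "\<epsilon>\<^sup>2 / (2 * \<kappa>) * (I (\<lambda>x. u t x * ((u t x - v x) * w x t)) - I (\<lambda>x. u \<tau> x * ((u t x - v x) * w x t))) \<le> \<epsilon>\<^sup>2 / (2 * \<kappa>) * (\<eta> * (B * (M + K)))"
    using 2 \<kappa> by (intro mult_left_mono) auto
  moreover have "\<epsilon>\<^sup>2 / 2 * (I (\<lambda>x. u \<tau> x * (w x t * (gradient v x \<bullet> b x t + v x * \<Gamma> x t))) - I (\<lambda>x. u t x * (w x t * (gradient v x \<bullet> b x t + v x * \<Gamma> x t))))
      \<le> \<epsilon>\<^sup>2 / 2 * (\<eta> * ((1 + ?n) * B * K))"
    using 3 by (intro mult_left_mono) auto
  moreover have "p' - A * q' + E * z' \<le> p - A * q + E * z + (a + A * m + E * c) * \<eta>"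
    if "A * (q - q') \<le> A * (\<eta> * m)" "E * (z' - z) \<le> E * (\<eta> * c)" "p' - p \<le> a * \<eta>"
    for p p' q q' z z' A E a m c :: real
    using that by (simp add: algebra_simps)
  ultimately show ?thesis using 1 unfolding rate_def by blast
qed

lemma J_time_increment:
  assumes r: "r \<in> {s..T}" and t: "t \<in> {s..T}" and "r < t" and v: "v \<in> test_functions D" and \<kappa>: "0 < \<kappa>" "\<kappa> \<le> 1"
    and \<eta>: "L2_norm D (\<lambda>x. u r x - u t x) \<le> \<eta>"
    and w\<eta>: "\<And>x. x \<in> D \<Longrightarrow> \<bar>w x t - w x r - (t - r) * (w x t * gt x t)\<bar> \<le> \<eta> * (t - r)"
    and K: "sobolev_sq v (gradient v) \<le> K\<^sup>2" "0 \<le> K"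
    and M: "L2_norm D (u r) \<le> M" and B: "\<And>x. x \<in> D \<Longrightarrow> \<bar>w x t * gt x t\<bar> \<le> B" "0 \<le> B"
  shows "J \<kappa> t v - J \<kappa> r v \<le> (I (\<lambda>x. u t x * (v x * w x t)) - I (\<lambda>x. u r x * (v x * w x t)))
    + (t - r) * (I (\<lambda>x. u t x * (v x * (w x t * gt x t))) - I (\<lambda>x. ((v x)\<^sup>2 / 2 + \<kappa> / 2 * (gradient v x \<bullet> gradient v x)) * (w x t * gt x t)))
    + (t - r) * (B * K + M * K + K\<^sup>2) * \<eta>"
proof -
  note sv = test_smooth[OF v]
  let ?k = "\<lambda>x. (v x)\<^sup>2 / 2 + \<kappa> / 2 * (gradient v x \<bullet> gradient v x)"
  let ?c = "\<lambda>x. w x t - w x r - (t - r) * (w x t * gt x t)"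
  have h: "0 < t - r" using \<open>r < t\<close> by simp
  have \<eta>0: "0 \<le> \<eta>" using \<eta> L2_norm_nonneg order_trans by blast
  have cv: "continuous_on UNIV v" "continuous_on UNIV ?k"
    by (intro continuous_intros smooth_continuous sv gradient_continuous; simp)+
  have cg: "continuous_on UNIV (\<lambda>x. w x t * gt x t)" by (intro continuous_on_mult w_slice gt_slice)
  have cc: "continuous_on UNIV ?c" by (intro continuous_on_diff continuous_on_mult continuous_on_const w_slice gt_slice)
  have vK: "L2_norm D v \<le> K"
  proof (rule power2_le_imp_le[OF _ K(2)])
    show "(L2_norm D v)\<^sup>2 \<le> K\<^sup>2" using K(1) unfolding sobolev_sq_def
      using sum_nonneg[of UNIV "\<lambda>i. (L2_norm D (\<lambda>x. gradient v x $ i))\<^sup>2"] by auto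
  qed
  have i: "integrable (lebesgue_on D) (\<lambda>x. u t x * (v x * w x t))" "integrable (lebesgue_on D) (\<lambda>x. u r x * (v x * w x t))"
    "integrable (lebesgue_on D) (\<lambda>x. u r x * (v x * w x r))" "integrable (lebesgue_on D) (\<lambda>x. u r x * (v x * (w x t * gt x t)))"
    "integrable (lebesgue_on D) (\<lambda>x. u r x * (v x * ?c x))"
    by (intro integrable_L2_continuous u_L2 r t continuous_on_mult cv w_slice cg cc)+
  have k: "integrable (lebesgue_on D) (\<lambda>x. ?k x * w x t)" "integrable (lebesgue_on D) (\<lambda>x. ?k x * w x r)"
    "integrable (lebesgue_on D) (\<lambda>x. ?k x * (w x t * gt x t))" "integrable (lebesgue_on D) (\<lambda>x. ?k x * ?c x)" "integrable (lebesgue_on D) ?k"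
    by (intro integrable_continuous continuous_on_mult cv w_slice cg cc)+
  have Jt: "J \<kappa> t v = I (\<lambda>x. u t x * (v x * w x t)) - I (\<lambda>x. ?k x * w x t)"
    unfolding J_def by (rule Bochner_Integration.integral_diff[OF i(1) k(1)])
  have Jr: "J \<kappa> r v = I (\<lambda>x. u r x * (v x * w x r)) - I (\<lambda>x. ?k x * w x r)"
    unfolding J_def by (rule Bochner_Integration.integral_diff[OF i(3) k(2)])
  have alg: "k * p - k * q = d * (k * X) + k * (p - q - d * X)"
    and alg': "j * (k * p) - j * (k * q) = d * (j * (k * X)) + j * (k * (p - q - d * X))" for j k p q d X :: real
    by (simp_all add: algebra_simps)
  have A: "I (\<lambda>x. u r x * (v x * w x t)) - I (\<lambda>x. u r x * (v x * w x r))
     = (t - r) * I (\<lambda>x. u r x * (v x * (w x t * gt x t))) + I (\<lambda>x. u r x * (v x * ?c x))"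
  proof -
    have "I (\<lambda>x. u r x * (v x * w x t)) - I (\<lambda>x. u r x * (v x * w x r)) = I (\<lambda>x. u r x * (v x * w x t) - u r x * (v x * w x r))"
      by (rule Bochner_Integration.integral_diff[symmetric, OF i(2,3)])
    also have "\<dots> = I (\<lambda>x. (t - r) * (u r x * (v x * (w x t * gt x t))) + u r x * (v x * ?c x))"
      by (rule Bochner_Integration.integral_cong[OF refl]) (rule alg')
    also have "\<dots> = (t - r) * I (\<lambda>x. u r x * (v x * (w x t * gt x t))) + I (\<lambda>x. u r x * (v x * ?c x))"
      using Bochner_Integration.integral_add[OF integrable_mult_right[OF i(4), of "t - r"] i(5)] by simp
    finally show ?thesis .
  qed
  have Bk: "I (\<lambda>x. ?k x * w x t) - I (\<lambda>x. ?k x * w x r)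
     = (t - r) * I (\<lambda>x. ?k x * (w x t * gt x t)) + I (\<lambda>x. ?k x * ?c x)"
  proof -
    have "I (\<lambda>x. ?k x * w x t) - I (\<lambda>x. ?k x * w x r) = I (\<lambda>x. ?k x * w x t - ?k x * w x r)"
      by (rule Bochner_Integration.integral_diff[symmetric, OF k(1,2)])
    also have "\<dots> = I (\<lambda>x. (t - r) * (?k x * (w x t * gt x t)) + ?k x * ?c x)"
      by (rule Bochner_Integration.integral_cong[OF refl]) (rule alg)
    also have "\<dots> = (t - r) * I (\<lambda>x. ?k x * (w x t * gt x t)) + I (\<lambda>x. ?k x * ?c x)"
      using Bochner_Integration.integral_add[OF integrable_mult_right[OF k(3), of "t - r"] k(4)] by simp
    finally show ?thesis .
  qed
  have e1: "I (\<lambda>x. u r x * (v x * ?c x)) \<le> (t - r) * (M * K) * \<eta>"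
  proof -
    have "\<bar>I (\<lambda>x. u r x * (v x * ?c x))\<bar> \<le> (\<eta> * (t - r)) * L2_norm D (u r) * L2_norm D v"
      by (rule triple_le[OF u_L2[OF r] test_L2[OF v] measurable_D[OF cc] w\<eta>]) (use \<eta>0 h in auto)
    also have "\<dots> \<le> (\<eta> * (t - r)) * M * K"
      using \<eta>0 h M vK K(2) order_trans[OF L2_norm_nonneg M] by (intro mult_mono mult_left_mono) auto
    finally show ?thesis by (simp add: mult_ac)
  qed
  have kK: "I ?k \<le> K\<^sup>2"
  proof -
    have i2: "integrable (lebesgue_on D) (\<lambda>x. (v x)\<^sup>2)" "integrable (lebesgue_on D) (\<lambda>x. (partial_deriv i v x)\<^sup>2)" for i
      by (intro integrable_continuous continuous_intros smooth_continuous smooth_partial_deriv sv)+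
    have "I ?k \<le> I (\<lambda>x. (v x)\<^sup>2 + (\<Sum>i\<in>UNIV. (partial_deriv i v x)\<^sup>2))"
    proof (rule integral_mono[OF k(5)])
      show "integrable (lebesgue_on D) (\<lambda>x. (v x)\<^sup>2 + (\<Sum>i\<in>UNIV. (partial_deriv i v x)\<^sup>2))" using i2 by simp
      fix x
      have "\<kappa> / 2 * (gradient v x \<bullet> gradient v x) \<le> 1 * (gradient v x \<bullet> gradient v x)" using \<kappa> by (intro mult_right_mono) auto
      then show "?k x \<le> (v x)\<^sup>2 + (\<Sum>i\<in>UNIV. (partial_deriv i v x)\<^sup>2)"
      proof -
        have "gradient v x \<bullet> gradient v x = (\<Sum>i\<in>UNIV. (partial_deriv i v x)\<^sup>2)"
          by (simp add: inner_vec_def power2_eq_square)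
        moreover have "(v x)\<^sup>2 / 2 \<le> (v x)\<^sup>2" by simp
        ultimately show ?thesis using \<open>\<kappa> / 2 * (gradient v x \<bullet> gradient v x) \<le> 1 * (gradient v x \<bullet> gradient v x)\<close> by linarith
      qed
    qed
    also have "\<dots> = sobolev_sq v (gradient v)"
      unfolding sobolev_sq_def L2_norm_sq using i2 by (simp add: Bochner_Integration.integral_sum Bochner_Integration.integral_add)
    finally show ?thesis using K(1) by linarith
  qed
  have e2: "- I (\<lambda>x. ?k x * ?c x) \<le> (t - r) * K\<^sup>2 * \<eta>"
  proof -
    have "- I (\<lambda>x. ?k x * ?c x) = I (\<lambda>x. - (?k x * ?c x))" by simp
    also have "\<dots> \<le> I (\<lambda>x. \<eta> * (t - r) * ?k x)"
    proof (rule integral_mono)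
      fix x assume "x \<in> space (lebesgue_on D)"
      then have "?k x * (- ?c x) \<le> ?k x * (\<eta> * (t - r))" using w\<eta>[of x] \<kappa> by (intro mult_left_mono) auto
      then show "- (?k x * ?c x) \<le> \<eta> * (t - r) * ?k x"
        by (simp only: mult_minus_right mult.commute[of "\<eta> * (t - r)"])
    qed (use k in auto)
    also have "\<dots> = \<eta> * (t - r) * I ?k" by simp
    also have "\<dots> \<le> \<eta> * (t - r) * K\<^sup>2" using kK \<eta>0 h by (intro mult_left_mono) auto
    finally show ?thesis by (simp add: mult_ac)
  qed
  have e3: "I (\<lambda>x. u r x * (v x * (w x t * gt x t))) \<le> I (\<lambda>x. u t x * (v x * (w x t * gt x t))) + B * K * \<eta>"
  proof -
    have it: "integrable (lebesgue_on D) (\<lambda>x. u t x * (v x * (w x t * gt x t)))"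
      by (intro integrable_L2_continuous u_L2 t continuous_on_mult cv w_slice gt_slice)
    have "I (\<lambda>x. u r x * (v x * (w x t * gt x t))) - I (\<lambda>x. u t x * (v x * (w x t * gt x t)))
       = I (\<lambda>x. (u r x - u t x) * (v x * (w x t * gt x t)))"
      using i(4) it by (simp add: left_diff_distrib)
    also have "\<dots> \<le> B * L2_norm D (\<lambda>x. u r x - u t x) * L2_norm D v"
      using triple_le[OF L2_diff[OF u_L2[OF r] u_L2[OF t]] test_L2[OF v] measurable_D[OF cg] B] by linarith
    also have "\<dots> \<le> B * \<eta> * K" using B(2) \<eta> vK \<eta>0 K(2) by (intro mult_mono mult_left_mono) auto
    finally show ?thesis by (simp add: mult_ac)
  qed
  have "(t - r) * I (\<lambda>x. u r x * (v x * (w x t * gt x t))) \<le> (t - r) * (I (\<lambda>x. u t x * (v x * (w x t * gt x t))) + B * K * \<eta>)"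
    using e3 h by (intro mult_left_mono) auto
  with e1 e2 A Bk show ?thesis unfolding Jt Jr by (simp add: algebra_simps)
qed

text \<open>Half of \<open>transport_by_parts\<close> is subtracted from the integrand, and one multiple of \<open>DJ\<close> in the
  direction \<open>v\<close> is added to produce the viscous term \<open>-\<epsilon>\<^sup>2/2 \<bar>\<nabla>v\<bar>\<^sup>2 w\<close>. What remains is
  estimated pointwise by \<open>dissipation_inequality\<close>.\<close>

lemma rate_le:
  assumes t: "t \<in> {s..T}" and v: "v \<in> test_functions D" and \<kappa>: "0 < \<kappa>"
    and F: "\<And>x. x \<in> D \<Longrightarrow> norm (f x t) \<le> F" and Bb: "\<And>x. x \<in> D \<Longrightarrow> norm (b x t) \<le> Bb"
    and B3: "\<And>x. x \<in> D \<Longrightarrow> \<bar>f x t \<bullet> b x t + gt x t\<bar> \<le> B3"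
    and \<kappa>1: "\<And>x. x \<in> D \<Longrightarrow> \<kappa> * \<bar>gt x t\<bar> \<le> \<epsilon>\<^sup>2 / 4"
    and \<kappa>2: "2 * F\<^sup>2 / \<epsilon>\<^sup>2 + \<epsilon>\<^sup>2 / 2 * Bb\<^sup>2 + \<epsilon>\<^sup>2 / 4 \<le> 3 * \<epsilon>\<^sup>2 / (8 * \<kappa>)"
    and Cg: "\<And>x. x \<in> D \<Longrightarrow> (norm (b x t))\<^sup>2 / 2 + \<bar>\<Gamma> x t\<bar> / 2 + (\<Gamma> x t)\<^sup>2 / 4 \<le> Cg"
  shows "rate \<kappa> t v t + (I (\<lambda>x. u t x * (v x * (w x t * gt x t))) - I (\<lambda>x. ((v x)\<^sup>2 / 2 + \<kappa> / 2 * (gradient v x \<bullet> gradient v x)) * (w x t * gt x t)))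
    \<le> (Cg * \<epsilon>\<^sup>2 + 2 * B3\<^sup>2 * \<kappa> / \<epsilon>\<^sup>2) * I (\<lambda>x. (v x)\<^sup>2 * w x t) + \<epsilon>\<^sup>2 / (2 * \<kappa>) * \<bar>DJ \<kappa> t v v (gradient v)\<bar>"
proof -
  note sv = test_smooth[OF v]
  define A where "A = \<epsilon>\<^sup>2 / (2 * \<kappa>)"
  define coef where "coef = Cg * \<epsilon>\<^sup>2 + 2 * B3\<^sup>2 * \<kappa> / \<epsilon>\<^sup>2"
  have A0: "0 \<le> A" using \<kappa> by (simp add: A_def)
  have cv: "continuous_on UNIV v" "continuous_on UNIV (gradient v)" by (rule smooth_continuous[OF sv], rule gradient_continuous[OF sv])
  have cdiv: "continuous_on UNIV (\<lambda>x. field_div x t)" by (rule slice_continuous[OF field_div_continuous])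
  note C = cv cdiv w_slice b_slice \<Gamma>_slice gt_slice field_slice
  define a1 where "a1 x = u t x * (f x t \<bullet> gradient (\<lambda>x. v x * w x t) x)" for x
  define a2 where "a2 x = u t x * ((u t x - v x) * w x t)" for x
  define a3 where "a3 x = u t x * (w x t * (gradient v x \<bullet> b x t + v x * \<Gamma> x t))" for x
  define a4 where "a4 x = u t x * (v x * (w x t * gt x t))" for x
  define a5 where "a5 x = ((v x)\<^sup>2 / 2 + \<kappa> / 2 * (gradient v x \<bullet> gradient v x)) * (w x t * gt x t)" for x
  define d1 where "d1 x = v x * ((u t x - v x) * w x t) - \<kappa> * (gradient v x \<bullet> gradient v x) * w x t" for x
  define p1 where "p1 x = 2 * v x * (f x t \<bullet> gradient v x) * w x t + (v x)\<^sup>2 * w x t * (f x t \<bullet> b x t + field_div x t)" for x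
  have grad: "gradient (\<lambda>x. v x * w x t) x = w x t *\<^sub>R gradient v x + (v x * w x t) *\<^sub>R b x t" for x
    by (simp add: vec_eq_iff weighted_partial[OF sv] mult_ac)
  have i1: "integrable (lebesgue_on D) a1" unfolding a1_def grad
    by (intro integrable_L2_continuous u_L2 t continuous_on_inner continuous_on_add continuous_on_scaleR continuous_on_mult C)
  have i2: "integrable (lebesgue_on D) a2" unfolding a2_def
    by (intro L2_mult_integrable L2_mult_continuous L2_diff u_L2 t test_L2 v w_slice)
  have i3: "integrable (lebesgue_on D) a3" unfolding a3_def
    by (intro integrable_L2_continuous u_L2 t continuous_on_inner continuous_on_add continuous_on_mult C)
  have i4: "integrable (lebesgue_on D) a4" unfolding a4_def
    by (intro integrable_L2_continuous u_L2 t continuous_on_mult C)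
  have i5: "integrable (lebesgue_on D) a5" unfolding a5_def
    by (intro integrable_continuous continuous_on_inner continuous_on_add continuous_on_mult continuous_on_divide continuous_on_power continuous_on_const C) simp
  have id: "integrable (lebesgue_on D) d1" unfolding d1_def by (rule DJ_test(1)[OF t sv sv])
  have ip: "integrable (lebesgue_on D) p1" unfolding p1_def
    by (intro integrable_continuous continuous_on_inner continuous_on_add continuous_on_mult continuous_on_power continuous_on_const C)
  have iv: "integrable (lebesgue_on D) (\<lambda>x. (v x)\<^sup>2 * w x t)"
    by (intro integrable_continuous continuous_on_mult continuous_on_power C)
  have D: "DJ \<kappa> t v v (gradient v) = I d1" unfolding d1_def by (rule DJ_test(2)[OF t sv sv])
  have P: "I p1 = 0" unfolding p1_def by (rule transport_by_parts[OF v])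
  have pw: "a1 x - A * a2 x + \<epsilon>\<^sup>2 / 2 * a3 x + a4 x - a5 x + A * d1 x - 1 / 2 * p1 x \<le> coef * ((v x)\<^sup>2 * w x t)" if x: "x \<in> D" for x
  proof -
    define d where "d = u t x - v x"
    have u: "u t x = v x + d" by (simp add: d_def)
    have alg: "(v + d) * (w * fz + v * w * fb) - e / (2 * \<kappa>) * ((v + d) * (d * w)) + e / 2 * ((v + d) * (w * (zb + v * \<Gamma>)))
        + (v + d) * (v * (w * gt)) - (v\<^sup>2 / 2 + \<kappa> / 2 * zz) * (w * gt) + e / (2 * \<kappa>) * (v * (d * w) - \<kappa> * zz * w)
        - 1 / 2 * (2 * v * fz * w + v\<^sup>2 * w * (fb + dv))
      = w * (d * fz + d * v * (fb + gt) + v\<^sup>2 / 2 * (gt + fb - dv) - e / (2 * \<kappa>) * d\<^sup>2 - e / 2 * zz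
        + e / 2 * (v + d) * (zb + v * \<Gamma>) - \<kappa> / 2 * zz * gt)"
      for v d w fz fb e zb \<Gamma> gt zz dv :: real
      using \<kappa> by (simp add: field_simps power2_eq_square)
    have "d * (f x t \<bullet> gradient v x) + d * v x * (f x t \<bullet> b x t + gt x t) + (v x)\<^sup>2 / 2 * (gt x t + f x t \<bullet> b x t - field_div x t)
        - \<epsilon>\<^sup>2 / (2 * \<kappa>) * d\<^sup>2 - \<epsilon>\<^sup>2 / 2 * (gradient v x \<bullet> gradient v x)
        + \<epsilon>\<^sup>2 / 2 * (v x + d) * (gradient v x \<bullet> b x t + v x * \<Gamma> x t) - \<kappa> / 2 * (gradient v x \<bullet> gradient v x) * gt x t
      \<le> (Cg * \<epsilon>\<^sup>2 + 2 * B3\<^sup>2 * \<kappa> / \<epsilon>\<^sup>2) * (v x)\<^sup>2"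
      by (rule dissipation_inequality[OF _ \<kappa> F[OF x] Bb[OF x] B3[OF x] w_sub[OF x t] \<kappa>1[OF x] \<kappa>2 Cg[OF x]])
         (use \<epsilon> in simp)
    from mult_left_mono[OF this less_imp_le[OF w_pos[of x t]]]
    show ?thesis
      unfolding a1_def a2_def a3_def a4_def a5_def d1_def p1_def grad inner_add_right inner_scaleR_right d_def[symmetric] A_def coef_def
      unfolding u alg by (simp only: mult_ac)
  qed
  have "I (\<lambda>x. a1 x - A * a2 x + \<epsilon>\<^sup>2 / 2 * a3 x + a4 x - a5 x + A * d1 x - 1 / 2 * p1 x) \<le> I (\<lambda>x. coef * ((v x)\<^sup>2 * w x t))"
    by (rule integral_mono) (use i1 i2 i3 i4 i5 id ip iv pw in auto)
  moreover have "I (\<lambda>x. a1 x - A * a2 x + \<epsilon>\<^sup>2 / 2 * a3 x + a4 x - a5 x + A * d1 x - 1 / 2 * p1 x)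
     = I a1 - A * I a2 + \<epsilon>\<^sup>2 / 2 * I a3 + I a4 - I a5 + A * I d1 - 1 / 2 * I p1"
    using i1 i2 i3 i4 i5 id ip by (simp del: times_divide_eq_left)
  moreover have "- (A * I d1) \<le> A * \<bar>I d1\<bar>"
    using A0 by (metis abs_ge_minus_self mult_left_mono mult_minus_right)
  ultimately show ?thesis
    unfolding rate_def D transport_pairing_def a1_def[symmetric] a2_def[symmetric] a3_def[symmetric] a4_def[symmetric] a5_def[symmetric]
      A_def[symmetric] coef_def[symmetric] P by simp
qed

text \<open>With \<open>v\<close> a near maximiser at the later time \<open>t\<close>, one has \<open>\<Psi> \<kappa> t - \<Psi> \<kappa> r \<le> J \<kappa> t v + \<theta> - J \<kappa> r v\<close>, and the
  right hand side concerns a fixed test function. The interval length \<open>h\<close> is chosen before \<open>\<theta>\<close> and \<open>v\<close>: the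
  moduli of continuity must not depend on \<open>v\<close>, while \<open>\<theta>\<close> may depend on the interval.\<close>

lemma \<Psi>_increment:
  assumes \<kappa>: "0 < \<kappa>" "\<kappa> \<le> 1"
    and M: "\<And>t. t \<in> {s..T} \<Longrightarrow> L2_norm D (u t) \<le> M" and W: "\<And>x t. x \<in> D \<Longrightarrow> t \<in> {s..T} \<Longrightarrow> w x t \<le> W" "0 \<le> W"
    and F: "\<And>x t. x \<in> D \<Longrightarrow> t \<in> {s..T} \<Longrightarrow> norm (f x t) \<le> F" and Bb: "\<And>x t. x \<in> D \<Longrightarrow> t \<in> {s..T} \<Longrightarrow> norm (b x t) \<le> Bb"
    and B3: "\<And>x t. x \<in> D \<Longrightarrow> t \<in> {s..T} \<Longrightarrow> \<bar>f x t \<bullet> b x t + gt x t\<bar> \<le> B3"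
    and \<kappa>1: "\<And>x t. x \<in> D \<Longrightarrow> t \<in> {s..T} \<Longrightarrow> \<kappa> * \<bar>gt x t\<bar> \<le> \<epsilon>\<^sup>2 / 4"
    and \<kappa>2: "2 * F\<^sup>2 / \<epsilon>\<^sup>2 + \<epsilon>\<^sup>2 / 2 * Bb\<^sup>2 + \<epsilon>\<^sup>2 / 4 \<le> 3 * \<epsilon>\<^sup>2 / (8 * \<kappa>)"
    and Cg: "\<And>x t. x \<in> D \<Longrightarrow> t \<in> {s..T} \<Longrightarrow> (norm (b x t))\<^sup>2 / 2 + \<bar>\<Gamma> x t\<bar> / 2 + (\<Gamma> x t)\<^sup>2 / 4 \<le> Cg" "0 \<le> Cg"
    and "\<eta> > 0"
  shows "\<exists>h>0. \<forall>r t. s \<le> r \<and> r < t \<and> t \<le> T \<and> t - r < h \<longrightarrow>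
    \<Psi> \<kappa> t - \<Psi> \<kappa> r \<le> ((Cg * \<epsilon>\<^sup>2 + 2 * B3\<^sup>2 * \<kappa> / \<epsilon>\<^sup>2) * (4 * (1 + M\<^sup>2 * W)) + \<eta>) * (t - r)"
proof -
  define A where "A = \<epsilon>\<^sup>2 / (2 * \<kappa>)"
  have A0: "0 \<le> A" using \<kappa> by (simp add: A_def)
  define coef where "coef = Cg * \<epsilon>\<^sup>2 + 2 * B3\<^sup>2 * \<kappa> / \<epsilon>\<^sup>2"
  have coef0: "0 \<le> coef" using Cg(2) \<kappa> by (simp add: coef_def)
  have M0: "0 \<le> M" using order_trans[OF L2_norm_nonneg M[of s]] sT by simp
  obtain w0 where w0: "w0 > 0" "\<And>x t. x \<in> D \<Longrightarrow> t \<in> {s..T} \<Longrightarrow> w0 \<le> w x t" using w_lower by auto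
  have jc: "continuous_on UNIV (\<lambda>(x, t). w x t * \<Gamma> x t)" "continuous_on UNIV (\<lambda>(x, t). w x t * gt x t)"
    "continuous_on UNIV (\<lambda>(x, t). w x t *\<^sub>R b x t)"
    using continuous_on_mult[OF w_cont \<Gamma>_cont] continuous_on_mult[OF w_cont gt_cont] continuous_on_scaleR[OF w_cont b_cont]
    by (simp_all add: case_prod_beta')
  obtain B1 where B1: "B1 \<ge> 0" "\<forall>x\<in>D. \<forall>t\<in>{s..T}. norm (w x t * \<Gamma> x t) \<le> B1" using joint_uniform(1)[OF jc(1)] by auto
  obtain B2 where B2: "B2 \<ge> 0" "\<forall>x\<in>D. \<forall>t\<in>{s..T}. norm (w x t * gt x t) \<le> B2" using joint_uniform(1)[OF jc(2)] by auto
  obtain B4 where B4: "B4 \<ge> 0" "\<forall>x\<in>D. \<forall>t\<in>{s..T}. norm (w x t *\<^sub>R b x t) \<le> B4" using joint_uniform(1)[OF jc(3)] by auto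
  define B where "B = W + B1 + B2 + B4"
  have B0: "0 \<le> B" using W(2) B1(1) B2(1) B4(1) by (simp add: B_def)
  have B: "w x t \<le> B" "\<bar>w x t * b x t $ i\<bar> \<le> B" "\<bar>w x t * \<Gamma> x t\<bar> \<le> B" "\<bar>w x t * gt x t\<bar> \<le> B"
    if "x \<in> D" "t \<in> {s..T}" for x t i
  proof -
    have "\<bar>w x t * b x t $ i\<bar> \<le> norm (w x t *\<^sub>R b x t)" using component_le_norm_cart[of "w x t *\<^sub>R b x t" i] by simp
    also have "\<dots> \<le> B4" using B4(2) that by blast
    finally show "\<bar>w x t * b x t $ i\<bar> \<le> B" using W(2) B1(1) B2(1) by (simp add: B_def)
    have "norm (w x t * \<Gamma> x t) \<le> B1" "norm (w x t * gt x t) \<le> B2" "w x t \<le> W" using B1(2) B2(2) W(1) that by blast+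
    then show "w x t \<le> B" "\<bar>w x t * \<Gamma> x t\<bar> \<le> B" "\<bar>w x t * gt x t\<bar> \<le> B"
      using W(2) B1(1) B2(1) B4(1) unfolding B_def real_norm_def by linarith+
  qed
  define K where "K = sqrt (6 * (1 + M\<^sup>2 * W) / (\<kappa> * w0))"
  have Karg: "0 \<le> 6 * (1 + M\<^sup>2 * W) / (\<kappa> * w0)" using \<kappa> w0 W(2) by simp
  have K0: "0 \<le> K" unfolding K_def using Karg by simp
  have K2: "K\<^sup>2 = 6 * (1 + M\<^sup>2 * W) / (\<kappa> * w0)" unfolding K_def using Karg by simp
  define C1 where "C1 = real CARD('n) * ((1 + real CARD('n)) * B * K) + \<epsilon>\<^sup>2 / (2 * \<kappa>) * (B * (M + K)) + \<epsilon>\<^sup>2 / 2 * ((1 + real CARD('n)) * B * K)"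
  have C10: "0 \<le> C1" unfolding C1_def using B0 K0 M0 \<kappa> by (intro add_nonneg_nonneg mult_nonneg_nonneg) auto
  define C2 where "C2 = B * K + M * K + K\<^sup>2"
  have C20: "0 \<le> C2" unfolding C2_def using B0 K0 M0 by simp
  define \<zeta> where "\<zeta> = \<eta> / (2 * (C1 + C2 + 1))"
  have \<zeta>: "0 < \<zeta>" using \<open>\<eta> > 0\<close> C10 C20 by (simp add: \<zeta>_def)
  have \<zeta>C: "(C1 + C2) * \<zeta> \<le> \<eta> / 2"
  proof -
    have "(C1 + C2) * \<zeta> \<le> (C1 + C2 + 1) * \<zeta>" using \<zeta> by (intro mult_right_mono) auto
    also have "\<dots> = \<eta> / 2" using C10 C20 by (simp add: \<zeta>_def field_simps)
    finally show ?thesis .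
  qed
  obtain h1 where h1: "h1 > 0" "\<And>t t'. t \<in> {s..T} \<Longrightarrow> t' \<in> {s..T} \<Longrightarrow> \<bar>t' - t\<bar> < h1 \<Longrightarrow> L2_norm D (\<lambda>x. u t' x - u t x) \<le> \<zeta>"
    using C_L2_uniform[OF u \<zeta>] by blast
  have fi: "continuous_on UNIV (\<lambda>(x, t). f x t $ i)" for i
    using continuous_on_component[OF field_continuous, of i] by (simp add: case_prod_beta')
  have "\<exists>h>0. \<forall>t\<in>{s..T}. \<forall>t'\<in>{s..T}. \<bar>t' - t\<bar> < h \<longrightarrow> L2_norm D (\<lambda>x. u t' x * f x t' $ i - u t x * f x t $ i) \<le> \<zeta>" for i
    by (rule C_L2_mult_uniform[OF u fi \<zeta>])
  then have "\<exists>hi. \<forall>i. hi i > 0 \<and> (\<forall>t\<in>{s..T}. \<forall>t'\<in>{s..T}. \<bar>t' - t\<bar> < hi i \<longrightarrow> L2_norm D (\<lambda>x. u t' x * f x t' $ i - u t x * f x t $ i) \<le> \<zeta>)"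
    by (intro choice allI)
  then obtain hi where hi: "\<And>i. hi i > 0"
    "\<And>i t t'. t \<in> {s..T} \<Longrightarrow> t' \<in> {s..T} \<Longrightarrow> \<bar>t' - t\<bar> < hi i \<Longrightarrow> L2_norm D (\<lambda>x. u t' x * f x t' $ i - u t x * f x t $ i) \<le> \<zeta>"
    by blast
  define h2 where "h2 = Min (range hi)"
  have h2: "h2 > 0" "\<And>i. h2 \<le> hi i" unfolding h2_def using hi(1) by auto
  obtain h3 where h3: "h3 > 0" "\<And>x r r'. x \<in> D \<Longrightarrow> s \<le> r \<Longrightarrow> r < r' \<Longrightarrow> r' \<le> T \<Longrightarrow> r' - r < h3 \<Longrightarrow>
     \<bar>w x r' - w x r - (r' - r) * (w x r' * gt x r')\<bar> \<le> \<zeta> * (r' - r)"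
    using w_time_uniform[OF \<zeta>] by blast
  define h where "h = min h1 (min h2 h3)"
  have h0: "h > 0" using h1 h2 h3 by (simp add: h_def)
  have main: "\<Psi> \<kappa> t - \<Psi> \<kappa> r \<le> (coef * (4 * (1 + M\<^sup>2 * W)) + \<eta>) * (t - r)"
    if rt: "s \<le> r" "r < t" "t \<le> T" "t - r < h" for r t
  proof -
    have r: "r \<in> {s..T}" and t: "t \<in> {s..T}" and d: "0 < t - r" using rt by auto
    define E where "E = integral\<^sup>L (lebesgue_on {r..t}) (\<lambda>\<tau>. 1 + energy_density \<tau>)"
    have iE: "integrable (lebesgue_on {r..t}) (\<lambda>\<tau>. 1 + energy_density \<tau>)"
      by (intro Bochner_Integration.integrable_add continuous_imp_integrable_real continuous_on_const
          Equivalence_Lebesgue_Henstock_Integration.integrable_subinterval[OF energy_density_integrable]) (use rt in auto)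
    define Q where "Q = A * (E + (t - r) * K)"
    \<comment> \<open>the remainders are of order sqrt \<theta> and must be small relative to the length t - r\<close>
    have "\<exists>\<theta>>0. \<theta> \<le> 1 \<and> \<theta> + sqrt (2 * \<theta> * W) * Q < \<eta> / 2 * (t - r)"
    proof -
      have "((\<lambda>\<theta>. \<theta> + sqrt (2 * \<theta> * W) * Q) \<longlongrightarrow> 0 + sqrt (2 * 0 * W) * Q) (at_right 0)"
        by (intro tendsto_intros)
      then have "\<forall>\<^sub>F \<theta> in at_right 0. \<theta> + sqrt (2 * \<theta> * W) * Q < \<eta> / 2 * (t - r)"
        using \<open>\<eta> > 0\<close> d by (intro order_tendstoD(2)[where y = 0]) auto
      moreover have "\<forall>\<^sub>F \<theta> in at_right (0::real). \<theta> < 1" by (rule eventually_at_right_real[of 0 1, THEN eventually_mono]) auto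
      moreover have "\<forall>\<^sub>F \<theta> in at_right (0::real). 0 < \<theta>" by (rule eventually_at_right_less)
      ultimately have "\<forall>\<^sub>F \<theta> in at_right 0. 0 < \<theta> \<and> \<theta> \<le> 1 \<and> \<theta> + sqrt (2 * \<theta> * W) * Q < \<eta> / 2 * (t - r)"
        by eventually_elim auto
      then show ?thesis using eventually_happens[of _ "at_right (0::real)"] by (auto simp: trivial_limit_at_right_real)
    qed
    then obtain \<theta> where \<theta>: "\<theta> > 0" "\<theta> \<le> 1" "\<theta> + sqrt (2 * \<theta> * W) * Q < \<eta> / 2 * (t - r)" by auto
    obtain v where v: "v \<in> test_functions D" and max: "\<Psi> \<kappa> t \<le> J \<kappa> t v + \<theta>"
      using near_maximiser_exists[OF t _ \<theta>(1)] \<kappa>(1) by (meson less_imp_le)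
    note nb = near_maximiser_bounds[OF t v \<kappa> max \<theta>(2) M[OF t] W(1)[OF _ t] W(2) w0(2)[OF _ t] w0(1)]
    have sob: "sobolev_sq v (gradient v) \<le> K\<^sup>2" using nb(2) by (simp add: K2)
    have vK: "L2_norm D v \<le> K" "L2_norm D (partial_deriv i v) \<le> K" for i
    proof -
      have s: "0 \<le> (L2_norm D (\<lambda>x. gradient v x $ j))\<^sup>2" for j by simp
      have "(L2_norm D v)\<^sup>2 \<le> K\<^sup>2" using sob sum_nonneg[of UNIV "\<lambda>j. (L2_norm D (\<lambda>x. gradient v x $ j))\<^sup>2", OF s]
        unfolding sobolev_sq_def by linarith
      then show "L2_norm D v \<le> K" using K0 by (rule power2_le_imp_le)
      have "(L2_norm D (\<lambda>x. gradient v x $ i))\<^sup>2 \<le> (\<Sum>j\<in>UNIV. (L2_norm D (\<lambda>x. gradient v x $ j))\<^sup>2)"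
        by (rule member_le_sum[of i UNIV "\<lambda>j. (L2_norm D (\<lambda>x. gradient v x $ j))\<^sup>2"]) auto
      then have "(L2_norm D (partial_deriv i v))\<^sup>2 \<le> K\<^sup>2"
        using sob zero_le_power2[of "L2_norm D v"] unfolding sobolev_sq_def gradient_nth by linarith
      then show "L2_norm D (partial_deriv i v) \<le> K" using K0 by (rule power2_le_imp_le)
    qed
    have DJb: "\<bar>DJ \<kappa> t v a aa\<bar> \<le> sqrt (2 * \<theta> * W) * Z" if "W12_0 D a aa" "sobolev_sq a aa \<le> Z\<^sup>2" "0 \<le> Z" for a aa Z
    proof -
      have "(DJ \<kappa> t v a aa)\<^sup>2 \<le> 2 * \<theta> * (W * sobolev_sq a aa)"
        by (rule euler_lagrange_W12_0[OF t v _ \<kappa>(2) max that(1) W(1)[OF _ t]]) (use \<kappa> in auto)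
      also have "\<dots> \<le> 2 * \<theta> * (W * Z\<^sup>2)" using that \<theta> W(2) by (intro mult_left_mono) auto
      also have "\<dots> = (sqrt (2 * \<theta> * W) * Z)\<^sup>2" using \<theta> W(2) by (simp add: power_mult_distrib)
      finally have "\<bar>DJ \<kappa> t v a aa\<bar>\<^sup>2 \<le> (sqrt (2 * \<theta> * W) * Z)\<^sup>2" by simp
      then show ?thesis by (rule power2_le_imp_le) (use \<theta> W(2) that in simp)
    qed
    have step1: "I (\<lambda>x. u t x * (v x * w x t)) - I (\<lambda>x. u r x * (v x * w x t))
       \<le> (t - r) * (rate \<kappa> t v t + C1 * \<zeta>) + A * sqrt (2 * \<theta> * W) * E"
    proof -
      let ?V = "\<lambda>x. v x * w x t"
      have V: "?V \<in> test_functions D" by (rule test_mult[OF v w_smooth])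
      let ?g = "\<lambda>\<tau>. transport_pairing ?V \<tau> - \<epsilon>\<^sup>2 / 2 * gradient_pairing (gradient ?V) \<tau>"
      let ?b = "\<lambda>\<tau>. (rate \<kappa> t v t + C1 * \<zeta>) + A * sqrt (2 * \<theta> * W) * (1 + energy_density \<tau>)"
      have ib: "integrable (lebesgue_on {r..t}) ?b"
        by (intro Bochner_Integration.integrable_add[OF _ integrable_mult_right[OF iE]] continuous_imp_integrable_real continuous_on_const)
      have "I (\<lambda>x. u t x * ?V x) - I (\<lambda>x. u r x * ?V x) = (\<integral>\<tau>. ?g \<tau> \<partial>lebesgue_on {r..t})"
        by (rule weak_increment(2)[OF V]) (use rt in auto)
      also have "\<dots> \<le> (\<integral>\<tau>. ?b \<tau> \<partial>lebesgue_on {r..t})"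
      proof (rule integral_mono_AE)
        show "integrable (lebesgue_on {r..t}) ?g" by (rule weak_increment(1)[OF V]) (use rt in auto)
        show "integrable (lebesgue_on {r..t}) ?b" by (rule ib)
        have "AE \<tau> in lebesgue_on {r..t}. W12_0 D (u \<tau>) (G \<tau>)"
          by (rule AE_lebesgue_on_subset[OF u_W12_0]) (use rt in auto)
        moreover have "AE \<tau> in lebesgue_on {r..t}. \<tau> \<in> {r..t}" by (rule AE_I2) simp
        ultimately show "AE \<tau> in lebesgue_on {r..t}. ?g \<tau> \<le> ?b \<tau>"
        proof eventually_elim
          case (elim \<tau>)
          then have \<tau>: "\<tau> \<in> {s..T}" "\<bar>\<tau> - t\<bar> < h" using rt by auto
          have ed: "sobolev_sq (u \<tau>) (G \<tau>) = energy_density \<tau>" by (simp add: sobolev_sq_def energy_density_def)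
          have "energy_density \<tau> \<le> (1 + energy_density \<tau>)\<^sup>2"
            using energy_density_nonneg[of \<tau>] by (simp add: power2_sum)
          then have "\<bar>DJ \<kappa> t v (u \<tau>) (G \<tau>)\<bar> \<le> sqrt (2 * \<theta> * W) * (1 + energy_density \<tau>)"
            using energy_density_nonneg[of \<tau>] by (intro DJb elim) (auto simp: ed)
          then have "A * DJ \<kappa> t v (u \<tau>) (G \<tau>) \<le> A * (sqrt (2 * \<theta> * W) * (1 + energy_density \<tau>))"
            using A0 by (intro mult_left_mono) auto
          moreover have "rate \<kappa> t v \<tau> \<le> rate \<kappa> t v t + C1 * \<zeta>"
            unfolding C1_def
          proof (rule rate_continuity[OF t \<tau>(1) v \<kappa>(1) _ _ vK M[OF t] B0])
            show "L2_norm D (\<lambda>x. u \<tau> x - u t x) \<le> \<zeta>" by (rule h1(2)[OF t \<tau>(1)]) (use \<tau> h_def in auto)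
            show "L2_norm D (\<lambda>x. u \<tau> x * f x \<tau> $ i - u t x * f x t $ i) \<le> \<zeta>" for i
              by (rule hi(2)[OF t \<tau>(1)]) (use \<tau> h_def h2(2)[of i] in auto)
          qed (use B[OF _ t] in auto)
          moreover have "?g \<tau> = rate \<kappa> t v \<tau> + A * DJ \<kappa> t v (u \<tau>) (G \<tau>)"
            unfolding A_def by (rule rate_identity[OF t \<tau>(1) elim(1) v \<kappa>(1)])
          ultimately show ?case by (simp only: mult.assoc)
        qed
      qed
      also have "\<dots> = (t - r) * (rate \<kappa> t v t + C1 * \<zeta>) + A * sqrt (2 * \<theta> * W) * E"
      proof -
        have "(\<integral>\<tau>. ?b \<tau> \<partial>lebesgue_on {r..t}) = (\<integral>\<tau>. (rate \<kappa> t v t + C1 * \<zeta>) \<partial>lebesgue_on {r..t}) + (\<integral>\<tau>. A * sqrt (2 * \<theta> * W) * (1 + energy_density \<tau>) \<partial>lebesgue_on {r..t})"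
          by (intro Bochner_Integration.integral_add integrable_mult_right iE continuous_imp_integrable_real continuous_on_const)
        also have "(\<integral>\<tau>. (rate \<kappa> t v t + C1 * \<zeta>) \<partial>lebesgue_on {r..t}) = (t - r) * (rate \<kappa> t v t + C1 * \<zeta>)"
          using d by (simp add: measure_restrict_space)
        finally show ?thesis by (simp only: Bochner_Integration.integral_mult_right_zero E_def)
      qed
      finally show ?thesis .
    qed
    have step2: "rate \<kappa> t v t + (I (\<lambda>x. u t x * (v x * (w x t * gt x t))) - I (\<lambda>x. ((v x)\<^sup>2 / 2 + \<kappa> / 2 * (gradient v x \<bullet> gradient v x)) * (w x t * gt x t)))
      \<le> coef * (4 * (1 + M\<^sup>2 * W)) + A * (sqrt (2 * \<theta> * W) * K)"
    proof -
      have "coef * I (\<lambda>x. (v x)\<^sup>2 * w x t) \<le> coef * (4 * (1 + M\<^sup>2 * W))" using nb(1) coef0 by (intro mult_left_mono) auto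
      moreover have "A * \<bar>DJ \<kappa> t v v (gradient v)\<bar> \<le> A * (sqrt (2 * \<theta> * W) * K)"
        using A0 DJb[OF test_W12_0[OF v] sob K0] by (intro mult_left_mono) auto
      ultimately show ?thesis
        using rate_le[OF t v \<kappa>(1) F[OF _ t] Bb[OF _ t] B3[OF _ t] \<kappa>1[OF _ t] \<kappa>2 Cg(1)[OF _ t]]
        unfolding A_def coef_def by linarith
    qed
    have step3: "J \<kappa> t v - J \<kappa> r v \<le> (I (\<lambda>x. u t x * (v x * w x t)) - I (\<lambda>x. u r x * (v x * w x t)))
      + (t - r) * (I (\<lambda>x. u t x * (v x * (w x t * gt x t))) - I (\<lambda>x. ((v x)\<^sup>2 / 2 + \<kappa> / 2 * (gradient v x \<bullet> gradient v x)) * (w x t * gt x t)))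
      + (t - r) * C2 * \<zeta>"
      unfolding C2_def
    proof (rule J_time_increment[OF r t \<open>r < t\<close> v \<kappa> _ _ sob K0 M[OF r] _ B0])
      show "L2_norm D (\<lambda>x. u r x - u t x) \<le> \<zeta>" by (rule h1(2)[OF t r]) (use rt h_def in auto)
    qed (use h3(2) rt h_def B[OF _ t] in auto)
    have "\<Psi> \<kappa> t - \<Psi> \<kappa> r \<le> J \<kappa> t v + \<theta> - J \<kappa> r v"
      using max J_le_\<Psi>[OF r _ v, of \<kappa>] \<kappa> by linarith
    moreover have arith: "h * (R + p) + S + h * X + h * q \<le> h * (Y + Z) + S + h * (p + q)"
      if "R + X \<le> Y + Z" "0 < h" for h R p S X q Y Z :: real
    proof -
      have "h * (R + X) \<le> h * (Y + Z)" using that by (intro mult_left_mono) auto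
      then show ?thesis by (simp add: distrib_left)
    qed
    moreover note arith[OF step2 d, where p = "C1 * \<zeta>" and q = "C2 * \<zeta>" and S = "A * sqrt (2 * \<theta> * W) * E"]
    moreover have "(t - r) * (C1 * \<zeta> + C2 * \<zeta>) \<le> (t - r) * (\<eta> / 2)"
      using d \<zeta>C by (intro mult_left_mono) (auto simp: distrib_right)
    moreover have "(t - r) * (coef * (4 * (1 + M\<^sup>2 * W)) + A * (sqrt (2 * \<theta> * W) * K)) + A * sqrt (2 * \<theta> * W) * E + \<theta>
       \<le> (coef * (4 * (1 + M\<^sup>2 * W))) * (t - r) + \<eta> / 2 * (t - r)"
    proof -
      have "h * (c + A * (q * K)) + A * q * E + \<theta> \<le> c * h + e" if "\<theta> + q * (A * (E + h * K)) < e" for h c q e :: real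
        using that by (simp add: algebra_simps)
      from this[OF \<theta>(3)[unfolded Q_def]] show ?thesis .
    qed
    moreover have "(coef * (4 * (1 + M\<^sup>2 * W)) + \<eta>) * (t - r) = (coef * (4 * (1 + M\<^sup>2 * W))) * (t - r) + \<eta> / 2 * (t - r) + (t - r) * (\<eta> / 2)"
      by (simp add: algebra_simps)
    ultimately show ?thesis using step1 step3 by (simp only: mult.assoc)
  qed
  show ?thesis using h0 main unfolding coef_def by blast
qed

text \<open>The increments of \<open>\<Psi>\<close> are summed for fixed \<open>\<kappa>\<close>, and then \<open>\<kappa>\<close> tends to zero for a fixed test
  function in the supremum. That test function is finally taken close to \<open>u(t)\<close>, where the
  functional with \<open>\<kappa> = 0\<close> attains the value \<open>I (u\<^sup>2 w) / 2\<close>.\<close>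

lemma energy_estimate:
  assumes M: "\<And>t. t \<in> {s..T} \<Longrightarrow> L2_norm D (u t) \<le> M" and W: "\<And>x t. x \<in> D \<Longrightarrow> t \<in> {s..T} \<Longrightarrow> w x t \<le> W" "0 \<le> W"
    and Cg: "\<And>x t. x \<in> D \<Longrightarrow> t \<in> {s..T} \<Longrightarrow> (norm (b x t))\<^sup>2 / 2 + \<bar>\<Gamma> x t\<bar> / 2 + (\<Gamma> x t)\<^sup>2 / 4 \<le> Cg" "0 \<le> Cg"
    and a: "s \<le> a" "a \<le> t" "t \<le> T"
  shows "I (\<lambda>x. (u t x)\<^sup>2 * w x t) \<le> I (\<lambda>x. (u a x)\<^sup>2 * w x a) + 8 * Cg * \<epsilon>\<^sup>2 * (1 + M\<^sup>2 * W) * (t - a)"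
proof -
  have at: "a \<in> {s..T}" "t \<in> {s..T}" using a by auto
  have jc: "continuous_on UNIV (\<lambda>(x, t). f x t \<bullet> b x t + gt x t)"
    using continuous_on_add[OF continuous_on_inner[OF field_continuous b_cont] gt_cont] by (simp add: case_prod_beta')
  obtain F where F: "F \<ge> 0" "\<And>x t. x \<in> D \<Longrightarrow> t \<in> {s..T} \<Longrightarrow> norm (f x t) \<le> F" using joint_uniform(1)[OF field_continuous] by blast
  obtain Bb where Bb: "Bb \<ge> 0" "\<And>x t. x \<in> D \<Longrightarrow> t \<in> {s..T} \<Longrightarrow> norm (b x t) \<le> Bb" using joint_uniform(1)[OF b_cont] by blast
  obtain B3 where B3: "B3 \<ge> 0" "\<And>x t. x \<in> D \<Longrightarrow> t \<in> {s..T} \<Longrightarrow> \<bar>f x t \<bullet> b x t + gt x t\<bar> \<le> B3"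
    using joint_uniform(1)[OF jc] unfolding real_norm_def by blast
  obtain Bg where Bg: "Bg \<ge> 0" "\<And>x t. x \<in> D \<Longrightarrow> t \<in> {s..T} \<Longrightarrow> \<bar>gt x t\<bar> \<le> Bg"
    using joint_uniform(1)[OF gt_cont] unfolding real_norm_def by blast
  define N where "N = 4 * (1 + M\<^sup>2 * W)"
  define X where "X = 2 * F\<^sup>2 / \<epsilon>\<^sup>2 + \<epsilon>\<^sup>2 / 2 * Bb\<^sup>2 + \<epsilon>\<^sup>2 / 4"
  define S where "S = I (\<lambda>x. (u a x)\<^sup>2 * w x a) / 2"
  have \<Psi>: "\<Psi> \<kappa> t \<le> S + (Cg * \<epsilon>\<^sup>2 + 2 * B3\<^sup>2 * \<kappa> / \<epsilon>\<^sup>2) * N * (t - a)"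
    if \<kappa>: "0 < \<kappa>" "\<kappa> \<le> 1" "\<kappa> * Bg \<le> \<epsilon>\<^sup>2 / 4" "X * \<kappa> \<le> 3 * \<epsilon>\<^sup>2 / 8" for \<kappa>
  proof -
    define c where "c = (Cg * \<epsilon>\<^sup>2 + 2 * B3\<^sup>2 * \<kappa> / \<epsilon>\<^sup>2) * N"
    have \<kappa>1: "\<kappa> * \<bar>gt x t\<bar> \<le> \<epsilon>\<^sup>2 / 4" if "x \<in> D" "t \<in> {s..T}" for x t
      using mult_left_mono[OF Bg(2)[OF that], of \<kappa>] \<kappa> by linarith
    have \<kappa>2: "2 * F\<^sup>2 / \<epsilon>\<^sup>2 + \<epsilon>\<^sup>2 / 2 * Bb\<^sup>2 + \<epsilon>\<^sup>2 / 4 \<le> 3 * \<epsilon>\<^sup>2 / (8 * \<kappa>)"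
      using \<kappa>(1,4) unfolding X_def[symmetric] by (simp add: field_simps)
    have inc: "\<Psi> \<kappa> t - \<Psi> \<kappa> a \<le> (c + \<eta>) * (t - a)" if \<eta>: "\<eta> > 0" for \<eta>
    proof -
      obtain h where h: "h > 0" "\<And>r t. s \<le> r \<Longrightarrow> r < t \<Longrightarrow> t \<le> T \<Longrightarrow> t - r < h \<Longrightarrow> \<Psi> \<kappa> t - \<Psi> \<kappa> r \<le> (c + \<eta>) * (t - r)"
        using \<Psi>_increment[OF \<kappa>(1,2) M W F(2) Bb(2) B3(2) \<kappa>1 \<kappa>2 Cg \<eta>] unfolding c_def N_def by blast
      show ?thesis by (rule chain_increments[OF a(2) h(1)]) (use h(2) a in auto)
    qed
    have "\<Psi> \<kappa> t - \<Psi> \<kappa> a \<le> c * (t - a) + e" if "e > 0" for e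
    proof -
      have "\<Psi> \<kappa> t - \<Psi> \<kappa> a \<le> (c + e / (t - a + 1)) * (t - a)" by (rule inc) (use that a in simp)
      also have "\<dots> = c * (t - a) + e * ((t - a) / (t - a + 1))" by (simp add: algebra_simps)
      also have "\<dots> \<le> c * (t - a) + e * 1" using that a by (intro add_left_mono mult_left_mono) auto
      finally show ?thesis by simp
    qed
    then have "\<Psi> \<kappa> t - \<Psi> \<kappa> a \<le> c * (t - a)" by (rule field_le_epsilon)
    moreover have "\<Psi> \<kappa> a \<le> S" unfolding S_def using \<kappa> by (intro \<Psi>_le at) auto
    ultimately show ?thesis unfolding c_def by linarith
  qed
  have \<kappa>_ev: "\<forall>\<^sub>F \<kappa> in at_right 0. 0 < \<kappa> \<and> \<kappa> \<le> 1 \<and> \<kappa> * Bg \<le> \<epsilon>\<^sup>2 / 4 \<and> X * \<kappa> \<le> 3 * \<epsilon>\<^sup>2 / 8"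
  proof -
    have l: "((\<lambda>\<kappa>. \<kappa> * Bg) \<longlongrightarrow> 0 * Bg) (at_right 0)" "((\<lambda>\<kappa>. X * \<kappa>) \<longlongrightarrow> X * 0) (at_right (0::real))"
      by (intro tendsto_intros)+
    have "\<forall>\<^sub>F \<kappa> in at_right 0. \<kappa> * Bg < \<epsilon>\<^sup>2 / 4" by (rule order_tendstoD(2)[OF l(1)]) (use \<epsilon> in simp)
    moreover have "\<forall>\<^sub>F \<kappa> in at_right 0. X * \<kappa> < 3 * \<epsilon>\<^sup>2 / 8" by (rule order_tendstoD(2)[OF l(2)]) (use \<epsilon> in simp)
    moreover have "\<forall>\<^sub>F \<kappa> in at_right (0::real). \<kappa> < 1" by (rule eventually_at_right_real[of 0 1, THEN eventually_mono]) auto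
    moreover have "\<forall>\<^sub>F \<kappa> in at_right (0::real). 0 < \<kappa>" by (rule eventually_at_right_less)
    ultimately show ?thesis by eventually_elim auto
  qed
  have test: "I (\<lambda>x. u t x * (\<phi> x * w x t) - (\<phi> x)\<^sup>2 / 2 * w x t) \<le> S + Cg * \<epsilon>\<^sup>2 * N * (t - a)"
    if \<phi>: "\<phi> \<in> test_functions D" for \<phi>
  proof -
    note s\<phi> = test_smooth[OF \<phi>]
    define P where "P = I (\<lambda>x. u t x * (\<phi> x * w x t) - (\<phi> x)\<^sup>2 / 2 * w x t)"
    define Q where "Q = I (\<lambda>x. (gradient \<phi> x \<bullet> gradient \<phi> x) * w x t)"
    have i: "integrable (lebesgue_on D) (\<lambda>x. u t x * (\<phi> x * w x t) - (\<phi> x)\<^sup>2 / 2 * w x t)"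
      by (intro Bochner_Integration.integrable_diff integrable_L2_continuous integrable_continuous u_L2 at
          continuous_on_mult continuous_on_divide continuous_on_power continuous_on_const w_slice smooth_continuous s\<phi>) simp
    have i': "integrable (lebesgue_on D) (\<lambda>x. (gradient \<phi> x \<bullet> gradient \<phi> x) * w x t)"
      by (intro integrable_continuous continuous_on_mult continuous_on_inner w_slice gradient_continuous s\<phi>)
    have J: "J \<kappa> t \<phi> = P - \<kappa> / 2 * Q" for \<kappa>
    proof -
      have "J \<kappa> t \<phi> = I (\<lambda>x. (u t x * (\<phi> x * w x t) - (\<phi> x)\<^sup>2 / 2 * w x t) - \<kappa> / 2 * ((gradient \<phi> x \<bullet> gradient \<phi> x) * w x t))"
        unfolding J_def by (simp add: algebra_simps)
      also have "\<dots> = P - \<kappa> / 2 * Q"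
        unfolding P_def Q_def using Bochner_Integration.integral_diff[OF i integrable_mult_right[OF i', of "\<kappa> / 2"]] by simp
      finally show ?thesis .
    qed
    have "((\<lambda>\<kappa>. P - \<kappa> / 2 * Q) \<longlongrightarrow> P - 0 / 2 * Q) (at_right 0)" by (intro tendsto_intros) auto
    moreover have "((\<lambda>\<kappa>. S + (Cg * \<epsilon>\<^sup>2 + 2 * B3\<^sup>2 * \<kappa> / \<epsilon>\<^sup>2) * N * (t - a)) \<longlongrightarrow> S + (Cg * \<epsilon>\<^sup>2 + 2 * B3\<^sup>2 * 0 / \<epsilon>\<^sup>2) * N * (t - a)) (at_right 0)"
      using \<epsilon> by (intro tendsto_intros) auto
    moreover have "\<forall>\<^sub>F \<kappa> in at_right 0. P - \<kappa> / 2 * Q \<le> S + (Cg * \<epsilon>\<^sup>2 + 2 * B3\<^sup>2 * \<kappa> / \<epsilon>\<^sup>2) * N * (t - a)"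
      using \<kappa>_ev
    proof eventually_elim
      case (elim \<kappa>)
      then show ?case using \<Psi>[of \<kappa>] J_le_\<Psi>[OF at(2) _ \<phi>, of \<kappa>] J by auto
    qed
    ultimately have "P - 0 / 2 * Q \<le> S + (Cg * \<epsilon>\<^sup>2 + 2 * B3\<^sup>2 * 0 / \<epsilon>\<^sup>2) * N * (t - a)"
      by (intro tendsto_le[OF trivial_limit_at_right_real])
    then show ?thesis by (simp add: P_def)
  qed
  have "I (\<lambda>x. (u t x)\<^sup>2 * w x t) / 2 \<le> S + Cg * \<epsilon>\<^sup>2 * N * (t - a) + e" if "e > 0" for e
  proof -
    \<comment> \<open>the defect of the functional at \<phi> is I ((u - \<phi>)^2 w) / 2, at most W d^2 / 2\<close>
    define d where "d = sqrt (2 * e / (W + 1))"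
    have d: "d > 0" "d\<^sup>2 = 2 * e / (W + 1)" using \<open>e > 0\<close> W(2) by (auto simp: d_def)
    obtain \<phi> where \<phi>: "\<phi> \<in> test_functions D" "L2_norm D (\<lambda>x. \<phi> x - u t x) < d"
      using test_approximation[OF at(2) d(1)] by blast
    note s\<phi> = test_smooth[OF \<phi>(1)]
    have i: "integrable (lebesgue_on D) (\<lambda>x. u t x * (\<phi> x * w x t) - (\<phi> x)\<^sup>2 / 2 * w x t)"
      by (intro Bochner_Integration.integrable_diff integrable_L2_continuous integrable_continuous u_L2 at
          continuous_on_mult continuous_on_divide continuous_on_power continuous_on_const w_slice smooth_continuous s\<phi>) simp
    have L: "(\<lambda>x. \<phi> x - u t x) \<in> L2_space D" by (intro L2_diff test_L2 \<phi> u_L2 at)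
    have i2: "integrable (lebesgue_on D) (\<lambda>x. W / 2 * (\<phi> x - u t x)\<^sup>2)" by (intro integrable_mult_right L2_square_integrable L)
    have "I (\<lambda>x. (u t x)\<^sup>2 * w x t / 2) \<le> I (\<lambda>x. (u t x * (\<phi> x * w x t) - (\<phi> x)\<^sup>2 / 2 * w x t) + W / 2 * (\<phi> x - u t x)\<^sup>2)"
    proof (rule integral_mono)
      fix x assume "x \<in> space (lebesgue_on D)"
      then have "w x t * ((\<phi> x - u t x)\<^sup>2 / 2) \<le> W * ((\<phi> x - u t x)\<^sup>2 / 2)" by (intro mult_right_mono W(1) at) auto
      moreover have "w x t * ((\<phi> x - u t x)\<^sup>2 / 2) = (u t x)\<^sup>2 * w x t / 2 - (u t x * (\<phi> x * w x t) - (\<phi> x)\<^sup>2 / 2 * w x t)"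
        by (simp add: power2_eq_square field_simps)
      ultimately show "(u t x)\<^sup>2 * w x t / 2 \<le> (u t x * (\<phi> x * w x t) - (\<phi> x)\<^sup>2 / 2 * w x t) + W / 2 * (\<phi> x - u t x)\<^sup>2" by simp
    qed (use i i2 u_square_integrable[OF at(2)] in auto)
    also have "\<dots> = I (\<lambda>x. u t x * (\<phi> x * w x t) - (\<phi> x)\<^sup>2 / 2 * w x t) + W / 2 * (L2_norm D (\<lambda>x. \<phi> x - u t x))\<^sup>2"
      using Bochner_Integration.integral_add[OF i i2] by (simp add: L2_norm_sq)
    also have "W / 2 * (L2_norm D (\<lambda>x. \<phi> x - u t x))\<^sup>2 \<le> W / 2 * d\<^sup>2"
      using \<phi>(2) W(2) by (intro mult_left_mono power_mono) auto
    also have "W / 2 * d\<^sup>2 \<le> e" unfolding d(2) using W(2) \<open>e > 0\<close> by (simp add: field_simps)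
    finally show ?thesis using test[OF \<phi>(1)] by simp
  qed
  then have "I (\<lambda>x. (u t x)\<^sup>2 * w x t) / 2 \<le> S + Cg * \<epsilon>\<^sup>2 * N * (t - a)" by (rule field_le_epsilon)
  then show ?thesis unfolding S_def N_def by (simp add: algebra_simps)
qed

end

section \<open>Gaussian weights along a trajectory\<close>

context transport_domain begin

text \<open>Along \<open>\<gamma>\<close> the quadratic exponent changes at the rate \<open>2 q (x - \<gamma>) \<bullet> (f(x) - f(\<gamma>))\<close>, which the growth
  \<open>q' = 2 L q\<close> of its coefficient dominates by the Lipschitz condition. The factor \<open>exp (- l t)\<close> pays for the
  divergence.\<close>

lemma gaussian_energy_weight:
  fixes \<gamma> :: "real \<Rightarrow> real^'n" and l m L :: real
  assumes \<gamma>: "continuous_on UNIV \<gamma>" "\<And>t. t \<in> {s..T} \<Longrightarrow> (\<gamma> has_vector_derivative f (\<gamma> t) t) (at t within {s..T})"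
    and L: "\<And>x t. x \<in> D \<Longrightarrow> t \<in> {s..T} \<Longrightarrow> norm (f x t - f (\<gamma> t) t) \<le> L * norm (x - \<gamma> t)"
    and l: "\<And>x t. x \<in> D \<Longrightarrow> t \<in> {s..T} \<Longrightarrow> \<bar>field_div x t\<bar> \<le> l" and m: "0 \<le> m"
  defines "q \<equiv> \<lambda>t. m * exp (2 * L * t)"
  shows "energy_weight D f s T (\<lambda>x t. exp (- l * t - q t * ((x - \<gamma> t) \<bullet> (x - \<gamma> t))))
     (\<lambda>x t. - l - q t * (2 * L * ((x - \<gamma> t) \<bullet> (x - \<gamma> t)) - 2 * ((x - \<gamma> t) \<bullet> f (\<gamma> t) t)))
     (\<lambda>x t. 4 * (q t)\<^sup>2 * ((x - \<gamma> t) \<bullet> (x - \<gamma> t)) - 2 * q t * real CARD('n))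
     (\<lambda>x t. (- 2 * q t) *\<^sub>R (x - \<gamma> t))"
proof
  let ?w = "\<lambda>x t. exp (- l * t - q t * ((x - \<gamma> t) \<bullet> (x - \<gamma> t)))"
  have c\<gamma>: "continuous_on UNIV (\<lambda>p :: (real^'n) \<times> real. \<gamma> (snd p))"
    by (rule continuous_on_compose2[OF \<gamma>(1)]) (auto intro!: continuous_intros)
  have cf: "continuous_on UNIV (\<lambda>p :: (real^'n) \<times> real. f (\<gamma> (snd p)) (snd p))"
    using continuous_on_compose2[OF field_continuous continuous_on_Pair[OF c\<gamma> continuous_on_snd[OF continuous_on_id]]] by simp
  have cq: "continuous_on UNIV (\<lambda>p :: (real^'n) \<times> real. q (snd p))" unfolding q_def by (intro continuous_intros)
  show "0 < ?w x t" for x t by simp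
  show "smooth (\<lambda>x. ?w x t)" for t by (rule smooth_gauss)
  show "continuous_on UNIV (\<lambda>(x, t). ?w x t)"
    unfolding case_prod_beta' by (intro continuous_intros c\<gamma> cq)
  show "continuous_on UNIV (\<lambda>(x, t). (- 2 * q t) *\<^sub>R (x - \<gamma> t))"
    unfolding case_prod_beta' by (intro continuous_intros c\<gamma> cq)
  show "continuous_on UNIV (\<lambda>(x, t). 4 * (q t)\<^sup>2 * ((x - \<gamma> t) \<bullet> (x - \<gamma> t)) - 2 * q t * real CARD('n))"
    unfolding case_prod_beta' by (intro continuous_intros c\<gamma> cq)
  show "continuous_on UNIV (\<lambda>(x, t). - l - q t * (2 * L * ((x - \<gamma> t) \<bullet> (x - \<gamma> t)) - 2 * ((x - \<gamma> t) \<bullet> f (\<gamma> t) t)))"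
    unfolding case_prod_beta' by (intro continuous_intros c\<gamma> cq cf)
  have pd: "partial_deriv i (\<lambda>x. ?w x t) x = ?w x t * ((- 2 * q t) * (x $ i - \<gamma> t $ i))" for i x t
  proof -
    have "partial_deriv i (\<lambda>x. ?w x t) x = ?w x t * (- 2 * q t * ((x - \<gamma> t) \<bullet> axis i 1))"
      by (rule partial_deriv_eq, rule gauss_has_derivative)
    also have "\<dots> = ?w x t * ((- 2 * q t) * (x $ i - \<gamma> t $ i))" by (simp add: inner_axis)
    finally show ?thesis .
  qed
  show "partial_deriv i (\<lambda>x. ?w x t) x = ?w x t * ((- 2 * q t) *\<^sub>R (x - \<gamma> t)) $ i" for i x t
    unfolding pd by (simp only: vector_scaleR_component vector_minus_component real_scaleR_def)
  show "(\<Sum>i\<in>UNIV. partial_deriv i (partial_deriv i (\<lambda>x. ?w x t)) x)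
     = ?w x t * (4 * (q t)\<^sup>2 * ((x - \<gamma> t) \<bullet> (x - \<gamma> t)) - 2 * q t * real CARD('n))" for x t
  proof -
    have "partial_deriv i (partial_deriv i (\<lambda>x. ?w x t)) x = ?w x t * (4 * (q t)\<^sup>2 * (x $ i - \<gamma> t $ i)\<^sup>2 - 2 * q t)" for i
    proof -
      have lin: "((\<lambda>x. (- 2 * q t) * (x $ i - \<gamma> t $ i)) has_derivative (\<lambda>k. (- 2 * q t) * k $ i)) (at x)"
        by (auto intro!: derivative_eq_intros bounded_linear_imp_has_derivative bounded_linear_vec_nth)
      have "partial_deriv i (partial_deriv i (\<lambda>x. ?w x t)) x = partial_deriv i (\<lambda>x. ?w x t * ((- 2 * q t) * (x $ i - \<gamma> t $ i))) x"
        by (simp only: pd[abs_def])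
      also have "\<dots> = partial_deriv i (\<lambda>x. ?w x t) x * ((- 2 * q t) * (x $ i - \<gamma> t $ i)) + ?w x t * partial_deriv i (\<lambda>x. (- 2 * q t) * (x $ i - \<gamma> t $ i)) x"
        by (rule partial_deriv_mult) (rule smooth_differentiable[OF smooth_gauss], unfold differentiable_def, rule exI, rule lin)
      also have "partial_deriv i (\<lambda>x. (- 2 * q t) * (x $ i - \<gamma> t $ i)) x = - 2 * q t" by (subst partial_deriv_eq[OF lin]) simp
      finally show ?thesis unfolding pd by (simp add: algebra_simps power2_eq_square)
    qed
    then show ?thesis
      by (simp add: sum_distrib_left[symmetric] sum_subtractf inner_vec_def power2_eq_square mult.commute)
  qed
  show "(?w x has_real_derivative ?w x t * (- l - q t * (2 * L * ((x - \<gamma> t) \<bullet> (x - \<gamma> t)) - 2 * ((x - \<gamma> t) \<bullet> f (\<gamma> t) t)))) (at t within {s..T})"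
    if t: "t \<in> {s..T}" for x t
  proof -
    have g: "((\<lambda>t. x - \<gamma> t) has_derivative (\<lambda>h. - (h *\<^sub>R f (\<gamma> t) t))) (at t within {s..T})"
      using \<gamma>(2)[OF t] unfolding has_vector_derivative_def by (auto intro!: derivative_eq_intros)
    define A where "A t = (x - \<gamma> t) \<bullet> (x - \<gamma> t)" for t
    have A': "(A has_real_derivative - 2 * ((x - \<gamma> t) \<bullet> f (\<gamma> t) t)) (at t within {s..T})"
      using has_derivative_inner[OF g g] unfolding has_field_derivative_def A_def[abs_def]
      by (rule has_derivative_eq_rhs) (auto simp: inner_commute algebra_simps)
    have q': "(q has_real_derivative 2 * L * q t) (at t within {s..T})"
      unfolding q_def by (auto intro!: derivative_eq_intros)
    have "((\<lambda>t. exp (- l * t - q t * A t)) has_real_derivative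
       exp (- l * t - q t * A t) * (- l - q t * (2 * L * A t - 2 * ((x - \<gamma> t) \<bullet> f (\<gamma> t) t)))) (at t within {s..T})"
      by (rule derivative_eq_intros refl A' q' | simp add: algebra_simps)+
    then show ?thesis unfolding A_def .
  qed
  show "- l - q t * (2 * L * ((x - \<gamma> t) \<bullet> (x - \<gamma> t)) - 2 * ((x - \<gamma> t) \<bullet> f (\<gamma> t) t)) + f x t \<bullet> (- 2 * q t) *\<^sub>R (x - \<gamma> t) + \<bar>field_div x t\<bar> \<le> 0"
    if x: "x \<in> D" and t: "t \<in> {s..T}" for x t
  proof -
    have "- ((f x t - f (\<gamma> t) t) \<bullet> (x - \<gamma> t)) \<le> norm (f x t - f (\<gamma> t) t) * norm (x - \<gamma> t)"
      using Cauchy_Schwarz_ineq2[of "f x t - f (\<gamma> t) t" "x - \<gamma> t"] by linarith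
    also have "\<dots> \<le> L * norm (x - \<gamma> t) * norm (x - \<gamma> t)" by (intro mult_right_mono L x t) auto
    finally have "0 \<le> L * ((x - \<gamma> t) \<bullet> (x - \<gamma> t)) + (f x t - f (\<gamma> t) t) \<bullet> (x - \<gamma> t)"
      by (simp add: dot_square_norm power2_eq_square)
    moreover have "0 \<le> 2 * q t" using m by (simp add: q_def)
    ultimately have "0 \<le> 2 * q t * (L * ((x - \<gamma> t) \<bullet> (x - \<gamma> t)) + (f x t - f (\<gamma> t) t) \<bullet> (x - \<gamma> t))" by (rule mult_nonneg_nonneg[rotated])
    then show ?thesis using l[OF x t] by (simp add: algebra_simps inner_diff_left inner_commute[of "f (\<gamma> t) t"])
  qed
qed

end

section \<open>Truncation of an admissible field\<close>

lemma admissible_field_lipschitz_on_ball: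
  fixes f :: "real^'n::finite \<Rightarrow> real \<Rightarrow> real^'n"
  assumes f: "admissible_field f"
  shows "\<exists>L>0. \<forall>x\<in>cball 0 R. \<forall>y\<in>cball 0 R. \<forall>t\<in>{s..T}. norm (f x t - f y t) \<le> L * norm (x - y)"
proof -
  define Q where "Q = {x :: real^'n. \<forall>i. x $ i \<in> {- R..R}}"
  have Q: "compact Q" unfolding Q_def
    using compact_cbox[of "\<chi> i. - R" "\<chi> i. R"] by (simp add: cbox_def Basis_vec_def inner_axis)
  have pc: "continuous_on UNIV (\<lambda>(x, t). partial_deriv j (\<lambda>z. f z t $ i) x)" for i j
    using f by (simp add: admissible_field_def)
  have "\<exists>B. \<forall>x\<in>Q. \<forall>t\<in>{s..T}. \<bar>partial_deriv j (\<lambda>z. f z t $ i) x\<bar> \<le> B" for i j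
  proof -
    have "bounded ((\<lambda>(x, t). partial_deriv j (\<lambda>z. f z t $ i) x) ` (Q \<times> {s..T}))"
      by (intro compact_imp_bounded compact_continuous_image continuous_on_subset[OF pc] compact_Times Q compact_Icc) auto
    then show ?thesis unfolding bounded_iff by auto
  qed
  then have "\<exists>B. \<forall>i j. \<forall>x\<in>Q. \<forall>t\<in>{s..T}. \<bar>partial_deriv j (\<lambda>z. f z t $ i) x\<bar> \<le> B i j"
    by (intro choice allI)
  then obtain B' where B': "\<And>i j x t. x \<in> Q \<Longrightarrow> t \<in> {s..T} \<Longrightarrow> \<bar>partial_deriv j (\<lambda>z. f z t $ i) x\<bar> \<le> B' i j" by blast
  define B where "B = (\<Sum>i\<in>UNIV. \<Sum>j\<in>UNIV. \<bar>B' i j\<bar>) + 1"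
  have B0: "B > 0" unfolding B_def by (intro add_nonneg_pos sum_nonneg) auto
  have B: "\<bar>partial_deriv j (\<lambda>z. f z t $ i) x\<bar> \<le> B" if "x \<in> Q" "t \<in> {s..T}" for i j x t
  proof -
    have "\<bar>B' i j\<bar> \<le> (\<Sum>j\<in>UNIV. \<bar>B' i j\<bar>)" by (rule member_le_sum) auto
    also have "\<dots> \<le> (\<Sum>i\<in>UNIV. \<Sum>j\<in>UNIV. \<bar>B' i j\<bar>)"
      by (rule member_le_sum[of i UNIV "\<lambda>i. \<Sum>j\<in>UNIV. \<bar>B' i j\<bar>"]) (auto intro!: sum_nonneg)
    finally show ?thesis using B'[OF that, of j i] unfolding B_def by linarith
  qed
  have line: "((\<lambda>h. f (z + h *\<^sub>R axis k 1) t $ i) has_real_derivative partial_deriv k (\<lambda>z. f z t $ i) (z + h *\<^sub>R axis k 1)) (at h)" for z h k t i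
  proof -
    have "(\<lambda>q. f ((z + h *\<^sub>R axis k 1) + q *\<^sub>R axis k 1) t $ i) differentiable (at 0)"
      using f by (simp add: admissible_field_def)
    then have "((\<lambda>q. f ((z + h *\<^sub>R axis k 1) + q *\<^sub>R axis k 1) t $ i) has_real_derivative partial_deriv k (\<lambda>z. f z t $ i) (z + h *\<^sub>R axis k 1)) (at 0)"
      unfolding partial_deriv_def using DERIV_deriv_iff_real_differentiable by blast
    then have "((\<lambda>q. f (z + (h + q) *\<^sub>R axis k 1) t $ i) has_real_derivative partial_deriv k (\<lambda>z. f z t $ i) (z + h *\<^sub>R axis k 1)) (at 0)"
      by (simp add: algebra_simps)
    then show ?thesis using DERIV_at_within_shift[of "\<lambda>h. f (z + h *\<^sub>R axis k 1) t $ i" _ h 0 UNIV] by simp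
  qed
  have comp: "\<bar>f y t $ i - f x t $ i\<bar> \<le> B * (\<Sum>j\<in>UNIV. \<bar>y $ j - x $ j\<bar>)"
    if x: "x \<in> Q" and y: "y \<in> Q" and t: "t \<in> {s..T}" for x y t i
  proof -
    define z where "z S = (\<chi> j. if j \<in> S then y $ j else x $ j)" for S
    have "\<bar>f (z S) t $ i - f (z {}) t $ i\<bar> \<le> B * (\<Sum>j\<in>S. \<bar>y $ j - x $ j\<bar>)" if "finite S" for S
      using that
    proof (induction S)
      case (insert k S)
      have zi: "z (insert k S) = z S + (y $ k - x $ k) *\<^sub>R axis k 1"
        using insert(2) by (auto simp: z_def vec_eq_iff axis_def)
      have "norm (f (z S + (y $ k - x $ k) *\<^sub>R axis k 1) t $ i - f (z S + 0 *\<^sub>R axis k 1) t $ i) \<le> B * norm ((y $ k - x $ k) - 0)"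
      proof (rule field_differentiable_bound[where S = "closed_segment 0 (y $ k - x $ k)" and f = "\<lambda>h. f (z S + h *\<^sub>R axis k 1) t $ i"])
        fix h assume h: "h \<in> closed_segment 0 (y $ k - x $ k)"
        show "((\<lambda>h. f (z S + h *\<^sub>R axis k 1) t $ i) has_field_derivative partial_deriv k (\<lambda>z. f z t $ i) (z S + h *\<^sub>R axis k 1)) (at h within closed_segment 0 (y $ k - x $ k))"
          using line by (rule has_field_derivative_at_within)
        have "(z S + h *\<^sub>R axis k 1) $ j \<in> {- R..R}" for j
        proof (cases "j = k")
          case True
          have "x $ k \<in> {- R..R}" "y $ k \<in> {- R..R}" using x y by (auto simp: Q_def)
          then show ?thesis using h insert(2) True
            by (auto simp: z_def closed_segment_eq_real_ivl split: if_splits)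
        next
          case False
          then show ?thesis using x y by (auto simp: z_def Q_def axis_def)
        qed
        then have "z S + h *\<^sub>R axis k 1 \<in> Q" by (simp add: Q_def)
        then show "norm (partial_deriv k (\<lambda>z. f z t $ i) (z S + h *\<^sub>R axis k 1)) \<le> B" using B t by simp
      qed auto
      then have "\<bar>f (z (insert k S)) t $ i - f (z S) t $ i\<bar> \<le> B * \<bar>y $ k - x $ k\<bar>" by (simp add: zi)
      then show ?case using insert by (simp add: distrib_left)
    qed (auto simp: z_def)
    from this[of UNIV] show ?thesis by (simp add: z_def)
  qed
  define n where "n = real CARD('n)"
  have "norm (f x t - f y t) \<le> (n * n * B) * norm (x - y)"
    if x: "x \<in> cball 0 R" and y: "y \<in> cball 0 R" and t: "t \<in> {s..T}" for x y t
  proof -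
    have Qx: "z \<in> Q" if "z \<in> cball 0 R" for z
      using that component_le_norm_cart[of z] unfolding Q_def by (auto simp: abs_le_iff) (smt (verit))+
    have "norm (f y t - f x t) \<le> (\<Sum>i\<in>UNIV. \<bar>(f y t - f x t) $ i\<bar>)" by (rule norm_le_l1_cart)
    also have "\<dots> \<le> (\<Sum>i\<in>(UNIV::'n set). B * (\<Sum>j\<in>UNIV. \<bar>y $ j - x $ j\<bar>))"
      using comp[OF Qx[OF x] Qx[OF y] t] by (intro sum_mono) simp
    also have "\<dots> \<le> (\<Sum>i\<in>(UNIV::'n set). B * (\<Sum>j\<in>(UNIV::'n set). norm (y - x)))"
      using B0 component_le_norm_cart[of "y - x"] by (intro sum_mono mult_left_mono) auto
    also have "\<dots> = (n * n * B) * norm (x - y)" by (simp add: n_def norm_minus_commute)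
    finally show ?thesis by (simp add: norm_minus_commute)
  qed
  moreover have "n * n * B > 0" using B0 by (simp add: n_def)
  ultimately show ?thesis by blast
qed

text \<open>Time is clamped and space is projected onto the ball, so the field becomes globally Lipschitz.\<close>

definition truncated_field :: "real \<Rightarrow> real \<Rightarrow> real \<Rightarrow> (real^'n::finite \<Rightarrow> real \<Rightarrow> real^'n) \<Rightarrow> real^'n \<Rightarrow> real \<Rightarrow> real^'n" where
  "truncated_field R s T f x t = f (closest_point (cball 0 R) x) (max s (min T t))"

lemma truncated_field_eq: "x \<in> cball 0 R \<Longrightarrow> t \<in> {s..T} \<Longrightarrow> truncated_field R s T f x t = f x t"
  by (simp add: truncated_field_def closest_point_self)

text \<open>The projection onto a ball is nonexpansive, so the local Lipschitz constant on the ball becomes a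
  global one.\<close>

lemma truncated_field_lipschitz:
  fixes f :: "real^'n::finite \<Rightarrow> real \<Rightarrow> real^'n"
  assumes f: "admissible_field f" and "0 < R" "s < T" and C: "\<And>x t. norm (f x t) \<le> C"
  shows "\<exists>L. bounded_lipschitz_field (truncated_field R s T f) s T L C"
proof -
  obtain L where L: "L > 0" "\<And>x y t. x \<in> cball 0 R \<Longrightarrow> y \<in> cball 0 R \<Longrightarrow> t \<in> {s..T} \<Longrightarrow> norm (f x t - f y t) \<le> L * norm (x - y)"
    using admissible_field_lipschitz_on_ball[OF f] by blast
  have S: "convex (cball (0::real^'n) R)" "closed (cball (0::real^'n) R)" "cball (0::real^'n) R \<noteq> {}" using \<open>0 < R\<close> by auto
  have "bounded_lipschitz_field (truncated_field R s T f) s T L C"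
  proof
    have "continuous_on UNIV (\<lambda>p :: (real^'n) \<times> real. (closest_point (cball 0 R) (fst p), max s (min T (snd p))))"
      by (intro continuous_intros continuous_on_compose2[OF continuous_on_closest_point[OF S, of UNIV]]) auto
    moreover have "continuous_on UNIV (\<lambda>(x, t). f x t)" using f by (simp add: admissible_field_def)
    ultimately show "continuous_on UNIV (\<lambda>(x, t). truncated_field R s T f x t)"
      using continuous_on_compose2[of UNIV "\<lambda>(x, t). f x t" UNIV] unfolding truncated_field_def
      by (fastforce simp: case_prod_beta')
    show "norm (truncated_field R s T f x t - truncated_field R s T f y t) \<le> L * norm (x - y)" for x y t
    proof -
      have "norm (truncated_field R s T f x t - truncated_field R s T f y t) \<le> L * norm (closest_point (cball 0 R) x - closest_point (cball 0 R) y)"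
        unfolding truncated_field_def using \<open>s < T\<close> by (intro L(2) closest_point_in_set S) auto
      also have "\<dots> \<le> L * norm (x - y)"
        using closest_point_lipschitz[OF S, of x y] L(1) by (intro mult_left_mono) (auto simp: dist_norm)
      finally show ?thesis .
    qed
    show "norm (truncated_field R s T f x t) \<le> C" for x t unfolding truncated_field_def by (rule C)
  qed (use L \<open>s < T\<close> in auto)
  then show ?thesis by blast
qed

section \<open>Moving test functions\<close>

context viscous_solution begin

text \<open>The motion of the test function cancels the transport term up to \<open>c0\<close>. In the viscous term, one
  integration by parts moves the gradient of the solution onto the test function, where
  its Laplacian bounds the contribution.\<close>

lemma moving_test_increment:
  assumes V: "\<And>r. r \<in> {s..t} \<Longrightarrow> V r \<in> test_functions D" and t: "t \<in> {s..T}"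
    and C2: "\<And>r x. r \<in> {s..t} \<Longrightarrow> x \<in> D \<Longrightarrow> \<bar>\<Sum>i\<in>UNIV. partial_deriv i (partial_deriv i (V r)) x\<bar> \<le> C2" "0 \<le> C2"
    and C1: "\<And>r x i. r \<in> {s..t} \<Longrightarrow> x \<in> D \<Longrightarrow> \<bar>partial_deriv i (V r) x\<bar> \<le> C1" "0 \<le> C1"
    and dV: "\<And>\<eta>. \<eta> > 0 \<Longrightarrow> \<exists>h>0. \<forall>r r'. s \<le> r \<and> r < r' \<and> r' \<le> t \<and> r' - r < h \<longrightarrow>
       (\<forall>x\<in>D. \<bar>V r' x - V r x + (r' - r) * (f x r \<bullet> gradient (V r') x)\<bar> \<le> (c0 + \<eta>) * (r' - r))" and c0: "0 \<le> c0"
    and M: "\<And>r. r \<in> {s..T} \<Longrightarrow> L2_norm D (u r) \<le> M" and "\<eta> > 0"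
  shows "\<exists>h>0. \<forall>r r'. s \<le> r \<and> r < r' \<and> r' \<le> t \<and> r' - r < h \<longrightarrow>
    \<bar>I (\<lambda>x. u r' x * V r' x) - I (\<lambda>x. u r x * V r x)\<bar> \<le> ((c0 + \<epsilon>\<^sup>2 / 2 * C2) * sqrt vol * M + \<eta>) * (r' - r)"
proof -
  have M0: "0 \<le> M" using order_trans[OF L2_norm_nonneg M[of s]] sT by simp
  define Z where "Z = real CARD('n) * (C1 * sqrt vol) + sqrt vol * M + 1"
  have Z: "Z > 0" unfolding Z_def using C1(2) M0 by (intro add_nonneg_pos add_nonneg_nonneg mult_nonneg_nonneg) auto
  define \<zeta> where "\<zeta> = \<eta> / Z"
  have \<zeta>: "\<zeta> > 0" using \<open>\<eta> > 0\<close> Z by (simp add: \<zeta>_def)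
  have \<zeta>Z: "real CARD('n) * (C1 * sqrt vol) * \<zeta> + sqrt vol * M * \<zeta> \<le> \<eta>"
  proof -
    have "Z * \<zeta> = \<eta>" using Z by (simp add: \<zeta>_def)
    then show ?thesis using \<zeta> unfolding Z_def by (simp add: distrib_right)
  qed
  have fi: "continuous_on UNIV (\<lambda>(x, t). f x t $ i)" for i
    using continuous_on_component[OF field_continuous, of i] by (simp add: case_prod_beta')
  have "\<exists>hi. \<forall>i. hi i > 0 \<and> (\<forall>t\<in>{s..T}. \<forall>t'\<in>{s..T}. \<bar>t' - t\<bar> < hi i \<longrightarrow> L2_norm D (\<lambda>x. u t' x * f x t' $ i - u t x * f x t $ i) \<le> \<zeta>)"
    by (intro choice allI C_L2_mult_uniform[OF u fi \<zeta>])
  then obtain hi where hi: "\<And>i. hi i > 0"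
    "\<And>i t t'. t \<in> {s..T} \<Longrightarrow> t' \<in> {s..T} \<Longrightarrow> \<bar>t' - t\<bar> < hi i \<Longrightarrow> L2_norm D (\<lambda>x. u t' x * f x t' $ i - u t x * f x t $ i) \<le> \<zeta>"
    by blast
  define h2 where "h2 = Min (range hi)"
  have h2: "h2 > 0" "\<And>i. h2 \<le> hi i" unfolding h2_def using hi(1) by auto
  obtain h1 where h1: "h1 > 0" "\<And>r r' x. s \<le> r \<Longrightarrow> r < r' \<Longrightarrow> r' \<le> t \<Longrightarrow> r' - r < h1 \<Longrightarrow> x \<in> D \<Longrightarrow>
     \<bar>V r' x - V r x + (r' - r) * (f x r \<bullet> gradient (V r') x)\<bar> \<le> (c0 + \<zeta>) * (r' - r)"
    using dV[OF \<zeta>] by blast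
  have main: "\<bar>I (\<lambda>x. u r' x * V r' x) - I (\<lambda>x. u r x * V r x)\<bar> \<le> ((c0 + \<epsilon>\<^sup>2 / 2 * C2) * sqrt vol * M + \<eta>) * (r' - r)"
    if rr: "s \<le> r" "r < r'" "r' \<le> t" "r' - r < min h1 h2" for r r'
  proof -
    have r: "r \<in> {s..T}" "r' \<in> {s..T}" "r \<in> {s..t}" "r' \<in> {s..t}" using rr t by auto
    have d: "0 < r' - r" using rr by simp
    note V' = V[OF r(4)]
    note sV' = test_smooth[OF V']
    have uf: "(\<lambda>x. u \<tau> x * f x \<tau> $ i) \<in> L2_space D" if "\<tau> \<in> {s..T}" for \<tau> i
      by (intro L2_mult_continuous u_L2 that field_slice_nth)
    have tp: "transport_pairing (V r') \<tau> = (\<Sum>i\<in>UNIV. I (\<lambda>x. (u \<tau> x * f x \<tau> $ i) * partial_deriv i (V r') x))" if "\<tau> \<in> {s..T}" for \<tau>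
    proof -
      have "u \<tau> x * (f x \<tau> \<bullet> gradient (V r') x) = (\<Sum>i\<in>UNIV. (u \<tau> x * f x \<tau> $ i) * partial_deriv i (V r') x)" for x
        by (simp add: inner_vec_def sum_distrib_left mult.assoc)
      then show ?thesis unfolding transport_pairing_def
        using L2_mult_integrable[OF uf[OF that] test_L2[OF test_partial[OF V']]] by (simp add: Bochner_Integration.integral_sum)
    qed
    have tpd: "\<bar>transport_pairing (V r') \<tau> - transport_pairing (V r') r\<bar> \<le> real CARD('n) * (C1 * sqrt vol) * \<zeta>"
      if \<tau>: "\<tau> \<in> {s..T}" "\<bar>\<tau> - r\<bar> < h2" for \<tau>
    proof -
      have "\<bar>I (\<lambda>x. (u \<tau> x * f x \<tau> $ i) * partial_deriv i (V r') x) - I (\<lambda>x. (u r x * f x r $ i) * partial_deriv i (V r') x)\<bar> \<le> C1 * sqrt vol * \<zeta>" for i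
      proof -
        have "I (\<lambda>x. (u \<tau> x * f x \<tau> $ i) * partial_deriv i (V r') x) - I (\<lambda>x. (u r x * f x r $ i) * partial_deriv i (V r') x)
          = I (\<lambda>x. (u \<tau> x * f x \<tau> $ i - u r x * f x r $ i) * partial_deriv i (V r') x)"
          using L2_mult_integrable[OF uf[OF \<tau>(1)] test_L2[OF test_partial[OF V']]] L2_mult_integrable[OF uf[OF r(1)] test_L2[OF test_partial[OF V']]]
          by (simp add: left_diff_distrib)
        also have "\<bar>\<dots>\<bar> \<le> C1 * sqrt vol * L2_norm D (\<lambda>x. u \<tau> x * f x \<tau> $ i - u r x * f x r $ i)"
          by (rule inner_bounded_le[OF L2_diff[OF uf[OF \<tau>(1)] uf[OF r(1)]] test_measurable[OF test_partial[OF V']] C1(1)[OF r(4)] C1(2)])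
        also have "\<dots> \<le> C1 * sqrt vol * \<zeta>"
          using hi(2)[OF r(1) \<tau>(1)] h2(2)[of i] \<tau>(2) C1(2) by (intro mult_left_mono) auto
        finally show ?thesis .
      qed
      then have "(\<Sum>i\<in>(UNIV::'n set). \<bar>I (\<lambda>x. (u \<tau> x * f x \<tau> $ i) * partial_deriv i (V r') x) - I (\<lambda>x. (u r x * f x r $ i) * partial_deriv i (V r') x)\<bar>) \<le> (\<Sum>i\<in>(UNIV::'n set). C1 * sqrt vol * \<zeta>)"
        by (intro sum_mono)
      moreover have "\<bar>transport_pairing (V r') \<tau> - transport_pairing (V r') r\<bar> \<le> (\<Sum>i\<in>(UNIV::'n set). \<bar>I (\<lambda>x. (u \<tau> x * f x \<tau> $ i) * partial_deriv i (V r') x) - I (\<lambda>x. (u r x * f x r $ i) * partial_deriv i (V r') x)\<bar>)"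
        unfolding tp[OF \<tau>(1)] tp[OF r(1)] sum_subtractf[symmetric] by (rule sum_abs)
      ultimately show ?thesis by (simp add: mult_ac)
    qed
    have gp: "\<bar>gradient_pairing (gradient (V r')) \<tau>\<bar> \<le> C2 * sqrt vol * M" if W: "W12_0 D (u \<tau>) (G \<tau>)" and \<tau>: "\<tau> \<in> {s..T}" for \<tau>
    proof -
      have L: "partial_deriv i (partial_deriv i (V r')) \<in> L2_space D" for i by (intro test_L2 test_partial V')
      have "I (\<lambda>x. G \<tau> x $ i * partial_deriv i (V r') x) = - I (\<lambda>x. u \<tau> x * partial_deriv i (partial_deriv i (V r')) x)" for i
        using W test_partial[OF V', of i] by (simp add: W12_0_def W12_def L2_inner_def)
      then have "gradient_pairing (gradient (V r')) \<tau> = - (\<Sum>i\<in>UNIV. I (\<lambda>x. u \<tau> x * partial_deriv i (partial_deriv i (V r')) x))"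
        by (simp add: gradient_pairing_def sum_negf)
      also have "(\<Sum>i\<in>UNIV. I (\<lambda>x. u \<tau> x * partial_deriv i (partial_deriv i (V r')) x)) = I (\<lambda>x. u \<tau> x * (\<Sum>i\<in>UNIV. partial_deriv i (partial_deriv i (V r')) x))"
        unfolding sum_distrib_left by (rule Bochner_Integration.integral_sum[symmetric]) (intro L2_mult_integrable u_L2 \<tau> L)
      finally have "\<bar>gradient_pairing (gradient (V r')) \<tau>\<bar> = \<bar>I (\<lambda>x. u \<tau> x * (\<Sum>i\<in>UNIV. partial_deriv i (partial_deriv i (V r')) x))\<bar>" by simp
      also have "\<dots> \<le> C2 * sqrt vol * L2_norm D (u \<tau>)"
        by (rule inner_bounded_le[OF u_L2[OF \<tau>] L2_measurable[OF L2_sum[OF L]] C2(1)[OF r(4)] C2(2)])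
      also have "\<dots> \<le> C2 * sqrt vol * M" using M[OF \<tau>] C2(2) by (intro mult_left_mono) auto
      finally show ?thesis .
    qed
    define P where "P = transport_pairing (V r') r"
    define E where "E = real CARD('n) * (C1 * sqrt vol) * \<zeta> + \<epsilon>\<^sup>2 / 2 * (C2 * sqrt vol * M)"
    have ae: "AE \<tau> in lebesgue_on {r..r'}. \<bar>(transport_pairing (V r') \<tau> - \<epsilon>\<^sup>2 / 2 * gradient_pairing (gradient (V r')) \<tau>) - P\<bar> \<le> E"
    proof -
      have "AE \<tau> in lebesgue_on {r..r'}. W12_0 D (u \<tau>) (G \<tau>)"
        by (rule AE_lebesgue_on_subset[OF u_W12_0]) (use r in auto)
      moreover have "AE \<tau> in lebesgue_on {r..r'}. \<tau> \<in> {r..r'}" by (rule AE_I2) simp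
      ultimately show ?thesis
      proof eventually_elim
        case (elim \<tau>)
        then have \<tau>: "\<tau> \<in> {s..T}" "\<bar>\<tau> - r\<bar> < h2" using rr r by auto
        have "\<epsilon>\<^sup>2 / 2 * \<bar>gradient_pairing (gradient (V r')) \<tau>\<bar> \<le> \<epsilon>\<^sup>2 / 2 * (C2 * sqrt vol * M)"
          using gp[OF elim(1) \<tau>(1)] by (intro mult_left_mono) auto
        then have "\<bar>\<epsilon>\<^sup>2 / 2 * gradient_pairing (gradient (V r')) \<tau>\<bar> \<le> \<epsilon>\<^sup>2 / 2 * (C2 * sqrt vol * M)" by (simp add: abs_mult)
        then show ?case using tpd[OF \<tau>] unfolding P_def E_def by linarith
      qed
    qed
    have int: "integrable (lebesgue_on {r..r'}) (\<lambda>\<tau>. transport_pairing (V r') \<tau> - \<epsilon>\<^sup>2 / 2 * gradient_pairing (gradient (V r')) \<tau>)"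
      by (rule weak_increment(1)[OF V']) (use r rr in auto)
    have const: "integrable (lebesgue_on {r..r'}) (\<lambda>\<tau>. c)" "(\<integral>\<tau>. c \<partial>lebesgue_on {r..r'}) = (r' - r) * c" for c :: real
      using d by (auto simp: measure_restrict_space intro!: continuous_imp_integrable_real)
    have inc: "I (\<lambda>x. u r' x * V r' x) - I (\<lambda>x. u r x * V r' x) = (\<integral>\<tau>. transport_pairing (V r') \<tau> - \<epsilon>\<^sup>2 / 2 * gradient_pairing (gradient (V r')) \<tau> \<partial>lebesgue_on {r..r'})"
      by (rule weak_increment(2)[OF V']) (use r rr in auto)
    have up: "I (\<lambda>x. u r' x * V r' x) - I (\<lambda>x. u r x * V r' x) \<le> (r' - r) * (P + E)"
      unfolding inc const(2)[symmetric] by (rule integral_mono_AE[OF int const(1)]) (use ae in \<open>eventually_elim, auto\<close>)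
    have lo: "(r' - r) * (P - E) \<le> I (\<lambda>x. u r' x * V r' x) - I (\<lambda>x. u r x * V r' x)"
      unfolding inc const(2)[symmetric] by (rule integral_mono_AE[OF const(1) int]) (use ae in \<open>eventually_elim, auto\<close>)
    have first: "\<bar>I (\<lambda>x. u r' x * V r' x) - I (\<lambda>x. u r x * V r' x) - (r' - r) * P\<bar> \<le> (r' - r) * E"
      using up lo by (simp add: algebra_simps abs_le_iff)
    have second: "\<bar>I (\<lambda>x. u r x * V r' x) - I (\<lambda>x. u r x * V r x) + (r' - r) * P\<bar> \<le> (c0 + \<zeta>) * (r' - r) * sqrt vol * M"
    proof -
      let ?e = "\<lambda>x. V r' x - V r x + (r' - r) * (f x r \<bullet> gradient (V r') x)"
      have cfg: "continuous_on UNIV (\<lambda>x. f x r \<bullet> gradient (V r') x)" by (rule slice_continuous[OF field_pairing_continuous[OF sV']])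
      have ce: "continuous_on UNIV ?e"
        by (intro continuous_on_add continuous_on_diff continuous_on_mult continuous_on_const test_continuous V r cfg)
      have i: "integrable (lebesgue_on D) (\<lambda>x. u r x * V r' x)" "integrable (lebesgue_on D) (\<lambda>x. u r x * V r x)"
        "integrable (lebesgue_on D) (\<lambda>x. u r x * (f x r \<bullet> gradient (V r') x))"
        by (intro integrable_L2_continuous u_L2 r test_continuous V cfg)+
      have "I (\<lambda>x. u r x * ?e x) = I (\<lambda>x. u r x * V r' x - u r x * V r x + (r' - r) * (u r x * (f x r \<bullet> gradient (V r') x)))"
        by (rule Bochner_Integration.integral_cong) (simp_all add: algebra_simps)
      also have "\<dots> = I (\<lambda>x. u r x * V r' x) - I (\<lambda>x. u r x * V r x) + (r' - r) * P"
        unfolding P_def transport_pairing_def using i by simp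
      finally have "\<bar>I (\<lambda>x. u r x * V r' x) - I (\<lambda>x. u r x * V r x) + (r' - r) * P\<bar> = \<bar>I (\<lambda>x. u r x * ?e x)\<bar>" by simp
      also have "\<dots> \<le> (c0 + \<zeta>) * (r' - r) * sqrt vol * L2_norm D (u r)"
        by (rule inner_bounded_le[OF u_L2[OF r(1)] measurable_D[OF ce] h1(2)]) (use rr c0 \<zeta> d in auto)
      also have "\<dots> \<le> (c0 + \<zeta>) * (r' - r) * sqrt vol * M"
        using M[OF r(1)] c0 \<zeta> d by (intro mult_left_mono) auto
      finally show ?thesis .
    qed
    have "(r' - r) * (real CARD('n) * (C1 * sqrt vol) * \<zeta> + sqrt vol * M * \<zeta>) \<le> (r' - r) * \<eta>" using \<zeta>Z d by (intro mult_left_mono) auto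
    moreover have "(r' - r) * E + (c0 + \<zeta>) * (r' - r) * sqrt vol * M
       = ((c0 + \<epsilon>\<^sup>2 / 2 * C2) * sqrt vol * M) * (r' - r) + (r' - r) * (real CARD('n) * (C1 * sqrt vol) * \<zeta> + sqrt vol * M * \<zeta>)"
      unfolding E_def by (simp add: algebra_simps)
    moreover have "((c0 + \<epsilon>\<^sup>2 / 2 * C2) * sqrt vol * M + \<eta>) * (r' - r) = ((c0 + \<epsilon>\<^sup>2 / 2 * C2) * sqrt vol * M) * (r' - r) + (r' - r) * \<eta>"
      by (simp add: algebra_simps)
    ultimately show ?thesis using first second by linarith
  qed
  show ?thesis by (rule exI[of _ "min h1 h2"]) (use main h1(1) h2(1) in auto)
qed

lemma moving_test_estimate:
  assumes V: "\<And>r. r \<in> {s..t} \<Longrightarrow> V r \<in> test_functions D" and t: "t \<in> {s..T}"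
    and C2: "\<And>r x. r \<in> {s..t} \<Longrightarrow> x \<in> D \<Longrightarrow> \<bar>\<Sum>i\<in>UNIV. partial_deriv i (partial_deriv i (V r)) x\<bar> \<le> C2" "0 \<le> C2"
    and C1: "\<And>r x i. r \<in> {s..t} \<Longrightarrow> x \<in> D \<Longrightarrow> \<bar>partial_deriv i (V r) x\<bar> \<le> C1" "0 \<le> C1"
    and dV: "\<And>\<eta>. \<eta> > 0 \<Longrightarrow> \<exists>h>0. \<forall>r r'. s \<le> r \<and> r < r' \<and> r' \<le> t \<and> r' - r < h \<longrightarrow>
       (\<forall>x\<in>D. \<bar>V r' x - V r x + (r' - r) * (f x r \<bullet> gradient (V r') x)\<bar> \<le> (c0 + \<eta>) * (r' - r))" and c0: "0 \<le> c0"
    and M: "\<And>r. r \<in> {s..T} \<Longrightarrow> L2_norm D (u r) \<le> M"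
  shows "\<bar>I (\<lambda>x. u t x * V t x) - I (\<lambda>x. u s x * V s x)\<bar> \<le> (c0 + \<epsilon>\<^sup>2 / 2 * C2) * sqrt vol * M * (t - s)"
proof -
  define c where "c = (c0 + \<epsilon>\<^sup>2 / 2 * C2) * sqrt vol * M"
  define \<Psi> where "\<Psi> r = I (\<lambda>x. u r x * V r x)" for r
  have st: "s \<le> t" using t by simp
  have "\<bar>\<Psi> t - \<Psi> s\<bar> \<le> (c + \<eta>) * (t - s)" if \<eta>: "\<eta> > 0" for \<eta>
  proof -
    obtain h where h: "h > 0" "\<And>r r'. s \<le> r \<Longrightarrow> r < r' \<Longrightarrow> r' \<le> t \<Longrightarrow> r' - r < h \<Longrightarrow> \<bar>\<Psi> r' - \<Psi> r\<bar> \<le> (c + \<eta>) * (r' - r)"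
      using moving_test_increment[OF V t C2 C1 dV c0 M \<eta>] unfolding c_def \<Psi>_def by blast
    have "\<Psi> t - \<Psi> s \<le> (c + \<eta>) * (t - s)" by (rule chain_increments[OF st h(1)]) (use h(2) in \<open>auto simp: abs_le_iff\<close>)
    moreover have "(- \<Psi> t) - (- \<Psi> s) \<le> (c + \<eta>) * (t - s)"
      by (rule chain_increments[OF st h(1), where \<Psi> = "\<lambda>r. - \<Psi> r"]) (use h(2) in \<open>auto simp: abs_le_iff\<close>)
    ultimately show ?thesis by linarith
  qed
  note * = this
  have "\<bar>\<Psi> t - \<Psi> s\<bar> \<le> c * (t - s) + e" if "e > 0" for e
  proof -
    have "\<bar>\<Psi> t - \<Psi> s\<bar> \<le> (c + e / (t - s + 1)) * (t - s)" by (rule *) (use that st in simp)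
    also have "\<dots> = c * (t - s) + e * ((t - s) / (t - s + 1))" by (simp add: algebra_simps)
    also have "\<dots> \<le> c * (t - s) + e * 1" using that st by (intro add_left_mono mult_left_mono) auto
    finally show ?thesis by simp
  qed
  then have "\<bar>\<Psi> t - \<Psi> s\<bar> \<le> c * (t - s)" by (rule field_le_epsilon)
  then show ?thesis unfolding c_def \<Psi>_def .
qed

end

section \<open>Mollification\<close>

definition conv :: "(real^'n::finite \<Rightarrow> real) \<Rightarrow> (real^'n \<Rightarrow> real) \<Rightarrow> real^'n \<Rightarrow> real" where
  "conv \<psi> v x = (\<integral>z. \<psi> (x - z) * v z \<partial>lborel)"

text \<open>The gradient is uniformly continuous, having compact support. Uniformity in the base point is what allows
  differentiation under the convolution integral.\<close>

lemma uniform_linearisation: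
  fixes \<psi> :: "real^'n::finite \<Rightarrow> real"
  assumes \<psi>: "smooth \<psi>" and supp: "\<And>x. \<delta> < norm x \<Longrightarrow> \<psi> x = 0" and "\<eta> > 0" and "0 \<le> \<delta>"
  shows "\<exists>h>0. \<forall>y k. norm k < h \<longrightarrow> \<bar>\<psi> (y + k) - \<psi> y - gradient \<psi> y \<bullet> k\<bar> \<le> \<eta> * norm k"
proof -
  have gc: "continuous_on S (gradient \<psi>)" for S
    unfolding gradient_def by (intro continuous_on_vec_lambda smooth_continuous smooth_partial_deriv \<psi>)
  have "uniformly_continuous_on (cball 0 (\<delta> + 2)) (gradient \<psi>)"
    by (rule compact_uniformly_continuous[OF gc]) simp
  then obtain h where h: "h > 0" "\<And>p q. p \<in> cball 0 (\<delta> + 2) \<Longrightarrow> q \<in> cball 0 (\<delta> + 2) \<Longrightarrow> dist q p < h \<Longrightarrow> dist (gradient \<psi> q) (gradient \<psi> p) < \<eta>"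
    using \<open>\<eta> > 0\<close> unfolding uniformly_continuous_on_def by metis
  have "\<bar>\<psi> (y + k) - \<psi> y - gradient \<psi> y \<bullet> k\<bar> \<le> \<eta> * norm k" if k: "norm k < min h 1" for y k
  proof (cases "norm y \<le> \<delta> + 1")
    case True
    have seg: "norm (y + r *\<^sub>R k) \<le> \<delta> + 2 \<and> norm (r *\<^sub>R k) \<le> norm k" if "r \<in> {0..1}" for r
    proof -
      have 1: "norm (r *\<^sub>R k) \<le> norm k" using that by (simp add: mult_left_le_one_le)
      then have "norm (y + r *\<^sub>R k) \<le> norm y + norm k" using norm_triangle_ineq[of y "r *\<^sub>R k"] by linarith
      then show ?thesis using 1 True k by simp
    qed
    define S where "S = (\<lambda>r. y + r *\<^sub>R k) ` {0..1}"
    have "norm (\<psi> (y + k) - \<psi> y - gradient \<psi> y \<bullet> (y + k - y)) \<le> norm (y + k - y) * \<eta>"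
    proof (rule differentiable_bound_linearization[of y "y + k" S \<psi> "\<lambda>x h. gradient \<psi> x \<bullet> h" y \<eta>])
      show "y + r *\<^sub>R (y + k - y) \<in> S" if "r \<in> {0..1}" for r using that by (auto simp: S_def)
      show "(\<psi> has_derivative (\<lambda>h. gradient \<psi> x \<bullet> h)) (at x within S)" if "x \<in> S" for x
        by (rule has_derivative_at_withinI[OF has_derivative_gradient[OF smooth_differentiable[OF \<psi>]]])
      show "onorm ((\<lambda>h. gradient \<psi> x \<bullet> h) - (\<lambda>h. gradient \<psi> y \<bullet> h)) \<le> \<eta>" if "x \<in> S" for x
        unfolding fun_diff_def
      proof (rule onorm_le)
        fix i :: "real^'n"
        obtain r where r: "r \<in> {0..1}" "x = y + r *\<^sub>R k" using \<open>x \<in> S\<close> by (auto simp: S_def)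
        have "dist (gradient \<psi> x) (gradient \<psi> y) < \<eta>"
        proof (rule h(2))
          show "y \<in> cball 0 (\<delta> + 2)" "x \<in> cball 0 (\<delta> + 2)" using seg[OF r(1)] True r(2) by simp_all
          show "dist x y < h" using seg[OF r(1)] k r(2) by (simp add: dist_norm)
        qed
        then have "norm (gradient \<psi> x - gradient \<psi> y) * norm i \<le> \<eta> * norm i" by (intro mult_right_mono) (auto simp: dist_norm)
        moreover have "\<bar>(gradient \<psi> x - gradient \<psi> y) \<bullet> i\<bar> \<le> norm (gradient \<psi> x - gradient \<psi> y) * norm i" by (rule Cauchy_Schwarz_ineq2)
        ultimately show "norm (gradient \<psi> x \<bullet> i - gradient \<psi> y \<bullet> i) \<le> \<eta> * norm i" by (simp add: inner_diff_left)
      qed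
      show "y \<in> S" unfolding S_def by (rule image_eqI[of _ _ 0]) auto
    qed
    then show ?thesis by (simp add: mult.commute)
  next
    case False
    have "norm y \<le> norm (y + k) + norm k" using norm_triangle_ineq4[of "y + k" k] by simp
    then have "\<psi> (y + k) = 0" using False k by (intro supp) auto
    moreover have "\<psi> y = 0" using False by (intro supp) auto
    moreover have "gradient \<psi> y = 0"
    proof -
      have "partial_deriv i \<psi> y = 0" for i
        using False supp by (intro partial_deriv_outside[of "cball 0 \<delta>"]) auto
      then show ?thesis by (simp add: vec_eq_iff)
    qed
    ultimately show ?thesis using \<open>\<eta> > 0\<close> by simp
  qed
  then show ?thesis using h(1) by (intro exI[of _ "min h 1"]) auto
qed

locale mollified =
  fixes R S :: real and v :: "real^'n::finite \<Rightarrow> real"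
  assumes v_cont: "continuous_on UNIV v" and v_bound: "\<And>z. \<bar>v z\<bar> \<le> S" and v_supp: "\<And>z. R < norm z \<Longrightarrow> v z = 0"
begin

lemma conv_integrable:
  assumes "continuous_on UNIV \<psi>"
  shows "integrable lborel (\<lambda>z. \<psi> (x - z) * v z)"
proof (rule integrable_lborel_compact_support)
  show "continuous_on UNIV (\<lambda>z. \<psi> (x - z) * v z)"
    by (intro continuous_on_mult v_cont continuous_on_compose2[OF assms] continuous_intros) auto
  show "\<psi> (x - z) * v z = 0" if "R < norm z" for z using v_supp[OF that] by simp
qed

lemma integral_against_le:
  assumes "continuous_on UNIV g" "\<And>z. \<bar>g z\<bar> \<le> B" "0 \<le> B"
  shows "\<bar>\<integral>z. g z * v z \<partial>lborel\<bar> \<le> B * (S * measure lborel (cball (0::real^'n) R))"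
proof -
  have i: "integrable lborel (\<lambda>z. g z * v z)"
    by (rule integrable_lborel_compact_support[of _ R]) (use v_supp in \<open>auto intro!: continuous_on_mult v_cont assms\<close>)
  have "\<bar>\<integral>z. g z * v z \<partial>lborel\<bar> \<le> (\<integral>z. \<bar>g z * v z\<bar> \<partial>lborel)" by (rule integral_abs_bound)
  also have "\<dots> \<le> (\<integral>z. B * S * indicator (cball (0::real^'n) R) z \<partial>lborel)"
  proof (rule Bochner_Integration.integral_mono)
    show "integrable lborel (\<lambda>z. \<bar>g z * v z\<bar>)" using i by simp
    show "integrable lborel (\<lambda>z. B * S * indicator (cball (0::real^'n) R) z)"
      using emeasure_lborel_cball_finite[of "0::real^'n" R] by (intro integrable_mult_right integrable_real_indicator) auto
    show "\<bar>g z * v z\<bar> \<le> B * S * indicator (cball 0 R) z" for z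
      using v_supp[of z] mult_mono[OF assms(2)[of z] v_bound[of z]] assms(3) by (auto simp: abs_mult indicator_def not_le)
  qed
  finally show ?thesis by (simp add: mult.assoc)
qed

lemma conv_bound:
  assumes "continuous_on UNIV \<psi>" "\<And>x. \<bar>\<psi> x\<bar> \<le> B" "0 \<le> B"
  shows "\<bar>conv \<psi> v x\<bar> \<le> B * (S * measure lborel (cball (0::real^'n) R))"
  unfolding conv_def
  by (rule integral_against_le) (use assms in \<open>auto intro!: continuous_on_compose2[OF assms(1)] continuous_intros\<close>)

lemma conv_linearisation:
  assumes \<psi>: "smooth \<psi>" and lin: "\<And>y k. norm k < h \<Longrightarrow> \<bar>\<psi> (y + k) - \<psi> y - gradient \<psi> y \<bullet> k\<bar> \<le> \<eta> * norm k"
    and k: "norm k < h" and "0 \<le> \<eta>"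
  shows "\<bar>conv \<psi> v (x + k) - conv \<psi> v x - (\<Sum>i\<in>UNIV. k $ i * conv (partial_deriv i \<psi>) v x)\<bar>
     \<le> \<eta> * norm k * (S * measure lborel (cball (0::real^'n) R))"
proof -
  note c = smooth_continuous[OF \<psi>, of UNIV] smooth_continuous[OF smooth_partial_deriv[OF \<psi>], of UNIV]
  have i1: "integrable lborel (\<lambda>z. \<psi> (x + k - z) * v z)" "integrable lborel (\<lambda>z. \<psi> (x - z) * v z)"
    "\<And>i. integrable lborel (\<lambda>z. partial_deriv i \<psi> (x - z) * v z)"
    by (intro conv_integrable c)+
  have "conv \<psi> v (x + k) - conv \<psi> v x - (\<Sum>i\<in>UNIV. k $ i * conv (partial_deriv i \<psi>) v x)
     = (\<integral>z. \<psi> (x + k - z) * v z - \<psi> (x - z) * v z - (\<Sum>i\<in>UNIV. k $ i * (partial_deriv i \<psi> (x - z) * v z)) \<partial>lborel)"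
    unfolding conv_def using i1 by (simp add: Bochner_Integration.integral_sum)
  also have "\<dots> = (\<integral>z. (\<psi> (x + k - z) - \<psi> (x - z) - gradient \<psi> (x - z) \<bullet> k) * v z \<partial>lborel)"
    unfolding inner_vec_def left_diff_distrib sum_distrib_right
    by (rule Bochner_Integration.integral_cong[OF refl]) (simp add: mult_ac)
  also have "\<bar>\<dots>\<bar> \<le> (\<eta> * norm k) * (S * measure lborel (cball (0::real^'n) R))"
  proof (rule integral_against_le)
    have gc: "continuous_on UNIV (gradient \<psi>)"
      unfolding gradient_def by (intro continuous_on_vec_lambda c)
    show "continuous_on UNIV (\<lambda>z. \<psi> (x + k - z) - \<psi> (x - z) - gradient \<psi> (x - z) \<bullet> k)"
      by (intro continuous_on_diff continuous_on_inner continuous_on_const continuous_on_compose2[OF c(1)] continuous_on_compose2[OF gc] continuous_on_id) auto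
    show "\<bar>\<psi> (x + k - z) - \<psi> (x - z) - gradient \<psi> (x - z) \<bullet> k\<bar> \<le> \<eta> * norm k" for z
      using lin[OF k, of "x - z"] by (simp add: algebra_simps)
  qed (use \<open>0 \<le> \<eta>\<close> in simp)
  finally show ?thesis .
qed

lemma conv_has_derivative:
  assumes \<psi>: "smooth \<psi>" and supp: "\<And>x. \<delta> < norm x \<Longrightarrow> \<psi> x = 0" "0 \<le> \<delta>"
  shows "(conv \<psi> v has_derivative (\<lambda>k. \<Sum>i\<in>UNIV. k $ i * conv (partial_deriv i \<psi>) v x)) (at x)"
  unfolding has_derivative_at_alt
proof (intro conjI allI impI)
  show "bounded_linear (\<lambda>k. \<Sum>i\<in>UNIV. k $ i * conv (partial_deriv i \<psi>) v x)"
    by (intro bounded_linear_sum bounded_linear_mult_const bounded_linear_vec_nth)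
  fix e :: real assume e: "e > 0"
  define Z where "Z = S * measure lborel (cball (0::real^'n) R)"
  have Z0: "0 \<le> Z" unfolding Z_def using v_bound[of 0] by (intro mult_nonneg_nonneg) auto
  define \<eta> where "\<eta> = e / (Z + 1)"
  have \<eta>: "\<eta> > 0" using e Z0 by (simp add: \<eta>_def)
  obtain h where h: "h > 0" "\<And>y k. norm k < h \<Longrightarrow> \<bar>\<psi> (y + k) - \<psi> y - gradient \<psi> y \<bullet> k\<bar> \<le> \<eta> * norm k"
    using uniform_linearisation[OF \<psi> supp(1) \<eta> supp(2)] by blast
  have "norm (conv \<psi> v y - conv \<psi> v x - (\<Sum>i\<in>UNIV. (y - x) $ i * conv (partial_deriv i \<psi>) v x)) \<le> e * norm (y - x)"
    if "norm (y - x) < h" for y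
  proof -
    have "\<bar>conv \<psi> v (x + (y - x)) - conv \<psi> v x - (\<Sum>i\<in>UNIV. (y - x) $ i * conv (partial_deriv i \<psi>) v x)\<bar> \<le> \<eta> * norm (y - x) * Z"
      unfolding Z_def by (rule conv_linearisation[OF \<psi> h(2) that]) (use \<eta> in auto)
    also have "\<dots> = (\<eta> * Z) * norm (y - x)" by simp
    also have "\<dots> \<le> e * norm (y - x)"
      using Z0 e by (intro mult_right_mono) (auto simp: \<eta>_def field_simps)
    finally show ?thesis by simp
  qed
  then show "\<exists>d>0. \<forall>y. norm (y - x) < d \<longrightarrow> norm (conv \<psi> v y - conv \<psi> v x - (\<Sum>i\<in>UNIV. (y - x) $ i * conv (partial_deriv i \<psi>) v x)) \<le> e * norm (y - x)"
    using h(1) by blast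
qed

lemma conv_partial:
  assumes \<psi>: "smooth \<psi>" and supp: "\<And>x. \<delta> < norm x \<Longrightarrow> \<psi> x = 0" "0 \<le> \<delta>"
  shows "partial_deriv i (conv \<psi> v) = conv (partial_deriv i \<psi>) v"
proof
  fix x
  show "partial_deriv i (conv \<psi> v) x = conv (partial_deriv i \<psi>) v x"
    using partial_deriv_eq[OF conv_has_derivative[OF assms], of i x]
    by (simp add: axis_def if_distrib[of "\<lambda>y. y * _"] cong: if_cong)
qed

lemma kernel_partial_supp:
  fixes \<psi> :: "real^'n \<Rightarrow> real"
  assumes supp: "\<And>x. \<delta> < norm x \<Longrightarrow> \<psi> x = 0" and "\<delta> < norm x"
  shows "partial_deriv i \<psi> x = 0"
  using assms by (intro partial_deriv_outside[of "cball 0 \<delta>"]) auto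

lemma conv_smooth:
  assumes \<psi>: "smooth \<psi>" and supp: "\<And>x. \<delta> < norm x \<Longrightarrow> \<psi> x = 0" "0 \<le> \<delta>"
  shows "smooth (conv \<psi> v)"
proof (rule smooth_coinduct)
  define A where "A = {conv \<psi> v | \<psi>. smooth \<psi> \<and> (\<forall>x. \<delta> < norm x \<longrightarrow> \<psi> x = 0)}"
  show "conv \<psi> v \<in> A" using \<psi> supp by (auto simp: A_def)
  fix g assume "g \<in> A"
  then obtain \<xi> where \<xi>: "g = conv \<xi> v" "smooth \<xi>" "\<And>x. \<delta> < norm x \<Longrightarrow> \<xi> x = 0" by (auto simp: A_def)
  show "g differentiable (at x)" for x
    unfolding \<xi>(1) differentiable_def by (intro exI) (rule conv_has_derivative[where \<psi> = \<xi> and \<delta> = \<delta>, OF \<xi>(2) \<xi>(3) supp(2)])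
  show "partial_deriv i g \<in> A" for i
  proof -
    have "partial_deriv i g = conv (partial_deriv i \<xi>) v"
      unfolding \<xi>(1) by (rule conv_partial[OF \<xi>(2) _ supp(2)]) (rule \<xi>(3))
    moreover have "partial_deriv i \<xi> x = 0" if "\<delta> < norm x" for x
      by (rule kernel_partial_supp[OF _ that]) (rule \<xi>(3))
    ultimately show ?thesis using smooth_partial_deriv[OF \<xi>(2), of i] unfolding A_def by blast
  qed
qed

lemma conv_outside:
  assumes supp: "\<And>x. \<delta> < norm x \<Longrightarrow> \<psi> x = 0" and v: "\<And>z. norm (x - z) \<le> \<delta> \<Longrightarrow> v z = 0"
  shows "conv \<psi> v x = 0"
proof -
  have "\<psi> (x - z) * v z = 0" for z using supp[of "x - z"] v[of z] by (cases "\<delta> < norm (x - z)") auto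
  then have "(\<lambda>z. \<psi> (x - z) * v z) = (\<lambda>z. 0)" by (rule ext)
  then show ?thesis unfolding conv_def by (simp only: Bochner_Integration.integral_zero)
qed

end

definition mollifier :: "real \<Rightarrow> real^'n::finite \<Rightarrow> real" where
  "mollifier \<delta> x = flat_exp 0 (\<delta>\<^sup>2 - x \<bullet> x) / (\<integral>z. flat_exp 0 (\<delta>\<^sup>2 - (z :: real^'n) \<bullet> z) \<partial>lborel)"

lemma flat_exp_nonneg: "0 \<le> flat_exp j u"
  by (simp add: flat_exp_def)

lemma bump_outside: "0 \<le> \<delta> \<Longrightarrow> \<delta> < norm x \<Longrightarrow> flat_exp j (\<delta>\<^sup>2 - x \<bullet> x) = 0"
  for x :: "real^'n::finite"
  using power_strict_mono[of \<delta> "norm x" 2] by (simp add: flat_exp_def dot_square_norm)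

lemma bump_integrable:
  assumes "0 \<le> \<delta>"
  shows "integrable lborel (\<lambda>z :: real^'n::finite. flat_exp 0 (\<delta>\<^sup>2 - z \<bullet> z))"
  by (rule integrable_lborel_compact_support[of _ \<delta>]) (use bump_outside[OF assms] smooth_continuous[OF smooth_bump] in auto)

lemma bump_integral_pos:
  assumes "0 < \<delta>"
  shows "0 < (\<integral>z. flat_exp 0 (\<delta>\<^sup>2 - (z :: real^'n::finite) \<bullet> z) \<partial>lborel)"
proof -
  let ?b = "\<lambda>z :: real^'n. flat_exp 0 (\<delta>\<^sup>2 - z \<bullet> z)"
  have i: "integrable lborel ?b" using assms by (intro bump_integrable) simp
  have "0 \<le> integral\<^sup>L lborel ?b" by (intro integral_nonneg_AE AE_I2 flat_exp_nonneg)
  moreover have "integral\<^sup>L lborel ?b \<noteq> 0"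
  proof
    assume "integral\<^sup>L lborel ?b = 0"
    then have "AE z in lborel. ?b z = 0"
      using integral_nonneg_eq_0_iff_AE[OF i] by (simp add: flat_exp_nonneg)
    then have "AE z in lborel. z \<notin> ball (0::real^'n) \<delta>"
    proof eventually_elim
      case (elim z)
      then show ?case using power_strict_mono[of "norm z" \<delta> 2] assms by (auto simp: flat_exp_def dot_square_norm split: if_splits)
    qed
    then have "ball (0::real^'n) \<delta> \<in> null_sets lborel" by (subst AE_iff_null_sets) auto
    then have "negligible (ball (0::real^'n) \<delta>)" by (simp add: negligible_iff_null_sets null_sets_completionI)
    then show False using assms open_not_negligible[of "ball (0::real^'n) \<delta>"] by auto
  qed
  ultimately show ?thesis by linarith
qed

lemma mollifier_smooth: "smooth (mollifier \<delta>)"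
  unfolding mollifier_def divide_inverse by (intro smooth_mult smooth_bump smooth_const)

lemma mollifier_nonneg: "0 \<le> mollifier \<delta> x"
  unfolding mollifier_def by (intro divide_nonneg_nonneg integral_nonneg_AE AE_I2 flat_exp_nonneg)

lemma mollifier_outside: "0 \<le> \<delta> \<Longrightarrow> \<delta> < norm x \<Longrightarrow> mollifier \<delta> x = 0"
  unfolding mollifier_def by (simp add: bump_outside)

lemma mollifier_integral: "0 < \<delta> \<Longrightarrow> (\<integral>z. mollifier \<delta> (z :: real^'n::finite) \<partial>lborel) = 1"
  unfolding mollifier_def using bump_integral_pos[of \<delta>, where 'n = 'n] by simp

lemma lborel_integral_shift:
  fixes g :: "'a::euclidean_space \<Rightarrow> real"
  assumes [measurable]: "g \<in> borel_measurable borel"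
  shows "(\<integral>z. g (v + z) \<partial>lborel) = (\<integral>z. g z \<partial>lborel)"
proof -
  have "(\<integral>z. g z \<partial>lborel) = (\<integral>z. g z \<partial>distr lborel borel ((+) v))" by (simp add: lborel_distr_plus)
  also have "\<dots> = (\<integral>z. g (v + z) \<partial>lborel)" by (subst integral_distr) auto
  finally show ?thesis by simp
qed

lemma lborel_integral_reflect:
  fixes g :: "'a::euclidean_space \<Rightarrow> real"
  assumes [measurable]: "g \<in> borel_measurable borel"
  shows "(\<integral>z. g (x - z) \<partial>lborel) = (\<integral>z. g z \<partial>lborel)"
proof -
  have "(\<integral>z. g (x - z) \<partial>lborel) = (\<integral>z. g (x + z) \<partial>distr lborel borel uminus)"
    by (subst integral_distr) auto
  also have "distr lborel borel uminus = (lborel :: 'a measure)"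
    using lborel_affine[of "-1" "0 :: 'a"] by (simp add: density_1 uminus_add_conv_diff[symmetric])
  finally show ?thesis using lborel_integral_shift[OF assms, of x] by simp
qed

text \<open>Being an average over the ball of radius \<open>\<delta>\<close>, mollification preserves bounds that hold on that
  ball only.\<close>

lemma mollifier_average_le:
  fixes g :: "real^'n::finite \<Rightarrow> real"
  assumes "0 < \<delta>" and g: "continuous_on UNIV g" and b: "\<And>z. norm (x - z) \<le> \<delta> \<Longrightarrow> \<bar>g z\<bar> \<le> B"
  shows "integrable lborel (\<lambda>z. mollifier \<delta> (x - z) * g z)" and "\<bar>\<integral>z. mollifier \<delta> (x - z) * g z \<partial>lborel\<bar> \<le> B"
proof -
  have c: "continuous_on UNIV (\<lambda>z. mollifier \<delta> (x - z))"
    by (rule continuous_on_compose2[OF smooth_continuous[OF mollifier_smooth, of UNIV]]) (auto intro!: continuous_intros)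
  have out: "mollifier \<delta> (x - z) = 0" if "norm x + \<delta> < norm z" for z
    using that norm_triangle_ineq2[of z x] \<open>0 < \<delta>\<close> by (intro mollifier_outside) (auto simp: norm_minus_commute)
  have i0: "integrable lborel (\<lambda>z. mollifier \<delta> (x - z))"
    by (rule integrable_lborel_compact_support[OF c out])
  show i: "integrable lborel (\<lambda>z. mollifier \<delta> (x - z) * g z)"
    by (rule integrable_lborel_compact_support[of _ "norm x + \<delta>"]) (auto intro!: continuous_on_mult c g simp: out)
  have "\<bar>\<integral>z. mollifier \<delta> (x - z) * g z \<partial>lborel\<bar> \<le> (\<integral>z. \<bar>mollifier \<delta> (x - z) * g z\<bar> \<partial>lborel)" by (rule integral_abs_bound)
  also have "\<dots> \<le> (\<integral>z. mollifier \<delta> (x - z) * B \<partial>lborel)"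
  proof (rule Bochner_Integration.integral_mono)
    show "\<bar>mollifier \<delta> (x - z) * g z\<bar> \<le> mollifier \<delta> (x - z) * B" for z
    proof (cases "norm (x - z) \<le> \<delta>")
      case True
      then show ?thesis using b[OF True] mollifier_nonneg[of \<delta> "x - z"] by (simp add: abs_mult mult_left_mono)
    next
      case False
      then show ?thesis using mollifier_outside[of \<delta> "x - z"] \<open>0 < \<delta>\<close> by simp
    qed
  qed (use i i0 in auto)
  also have "\<dots> = B * (\<integral>z. mollifier \<delta> (x - z) \<partial>lborel)" by simp
  also have "(\<integral>z. mollifier \<delta> (x - z) \<partial>lborel) = 1"
    using lborel_integral_reflect[OF borel_measurable_continuous_onI[OF smooth_continuous[OF mollifier_smooth]], of \<delta> x] mollifier_integral[OF \<open>0 < \<delta>\<close>, where 'n = 'n]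
    by simp
  finally show "\<bar>\<integral>z. mollifier \<delta> (x - z) * g z \<partial>lborel\<bar> \<le> B" by simp
qed

lemma mollifier_approximates:
  fixes v :: "real^'n::finite \<Rightarrow> real"
  assumes "0 < \<delta>" and v: "continuous_on UNIV v" and lip: "\<And>z z'. \<bar>v z - v z'\<bar> \<le> Lv * norm (z - z')" "0 \<le> Lv"
  shows "\<bar>conv (mollifier \<delta>) v x - v x\<bar> \<le> Lv * \<delta>"
proof -
  have b: "\<bar>v z - v x\<bar> \<le> Lv * \<delta>" if "norm (x - z) \<le> \<delta>" for z
    using lip(1)[of z x] mult_left_mono[OF that lip(2)] by (simp add: norm_minus_commute)
  have i: "integrable lborel (\<lambda>z. mollifier \<delta> (x - z) * c z)" if "continuous_on UNIV c" for c
  proof -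
    have "bounded (c ` cball x \<delta>)" by (intro compact_imp_bounded compact_continuous_image continuous_on_subset[OF that]) auto
    then obtain B where "\<forall>z\<in>cball x \<delta>. \<bar>c z\<bar> \<le> B" by (auto simp: bounded_iff)
    then show ?thesis by (intro mollifier_average_le(1)[OF \<open>0 < \<delta>\<close> that, of x B]) (auto simp: dist_norm)
  qed
  have "(\<integral>z. mollifier \<delta> (x - z) * v x \<partial>lborel) = v x"
    using lborel_integral_reflect[OF borel_measurable_continuous_onI[OF smooth_continuous[OF mollifier_smooth]], of \<delta> x] mollifier_integral[OF \<open>0 < \<delta>\<close>, where 'n = 'n]
    by simp
  then have "conv (mollifier \<delta>) v x - v x = (\<integral>z. mollifier \<delta> (x - z) * v z - mollifier \<delta> (x - z) * v x \<partial>lborel)"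
    unfolding conv_def using i[OF v] i[OF continuous_on_const, of "v x"] by simp
  also have "\<dots> = (\<integral>z. mollifier \<delta> (x - z) * (v z - v x) \<partial>lborel)" by (simp add: right_diff_distrib)
  also have "\<bar>\<dots>\<bar> \<le> Lv * \<delta>"
    by (rule mollifier_average_le(2)[OF \<open>0 < \<delta>\<close> _ b]) (intro continuous_intros v)
  finally show ?thesis .
qed

section \<open>The limit on the surviving region\<close>

lemma compactly_supported_bounded:
  fixes g :: "'a::euclidean_space \<Rightarrow> real"
  assumes "continuous_on UNIV g" "\<And>x. \<delta> < norm x \<Longrightarrow> g x = 0"
  shows "\<exists>B\<ge>0. \<forall>x. \<bar>g x\<bar> \<le> B"
proof -
  have "bounded (g ` cball 0 \<delta>)"
    by (intro compact_imp_bounded compact_continuous_image continuous_on_subset[OF assms(1)]) auto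
  then obtain B where B: "\<forall>x\<in>cball 0 \<delta>. \<bar>g x\<bar> \<le> B" by (auto simp: bounded_iff)
  have "\<bar>g x\<bar> \<le> max 0 B" for x
    using B assms(2)[of x] by (cases "norm x \<le> \<delta>") (auto simp: le_max_iff_disj)
  then show ?thesis by (intro exI[of _ "max 0 B"]) auto
qed

lemma lipschitz_continuous_on:
  fixes g :: "'a::real_normed_vector \<Rightarrow> real"
  assumes "\<And>z z'. \<bar>g z - g z'\<bar> \<le> B * norm (z - z')" "0 \<le> B"
  shows "continuous_on UNIV g"
  by (rule lipschitz_on_continuous_on[of B]) (use assms in \<open>auto intro!: lipschitz_onI simp: dist_norm\<close>)

text \<open>The globally Lipschitz field \<open>F\<close> agrees with \<open>f\<close> on a ball so large that no trajectory starting in the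
  closure of \<open>D\<close> can leave it during \<open>[s, T]\<close>.\<close>

locale flow_domain = transport_domain D f s T + bounded_lipschitz_field F s T L C
  for D :: "(real^'n::finite) set" and f and s T :: real and F :: "real^'n \<Rightarrow> real \<Rightarrow> real^'n" and L C +
  fixes R :: real
  assumes F_eq: "\<And>x t. x \<in> cball 0 R \<Longrightarrow> t \<in> {s..T} \<Longrightarrow> F x t = f x t"
    and room: "\<And>x. x \<in> closure D \<Longrightarrow> norm x + C * (T - s) \<le> R"
begin

lemma closure_in_ball: "x \<in> closure D \<Longrightarrow> x \<in> cball 0 R"
proof -
  assume "x \<in> closure D"
  from room[OF this] have "norm x + C * (T - s) \<le> R" .
  moreover have "0 \<le> C * (T - s)" using C_nonneg sT by simp
  ultimately show ?thesis by simp
qed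

lemma flow_in_ball:
  assumes "x \<in> closure D" "t \<in> {s..T}" "r \<in> {s..T}"
  shows "flow t r x \<in> cball 0 R"
proof -
  have "norm (flow t r x - flow t t x) \<le> C * \<bar>r - t\<bar>" by (rule flow_time_lipschitz) (use assms in auto)
  also have "\<dots> \<le> C * (T - s)" using C_nonneg assms by (intro mult_left_mono) auto
  finally have "norm (flow t r x) \<le> norm x + C * (T - s)"
    using norm_triangle_ineq2[of "flow t r x" x] assms by simp
  then show ?thesis using room[OF assms(1)] by simp
qed

lemma flow_solves:
  assumes "x \<in> closure D" "t \<in> {s..T}" "r \<in> {s..T}"
  shows "((\<lambda>r. flow t r x) has_vector_derivative f (flow t r x) r) (at r within {s..T})"
  using flow_sol[OF assms(2), of x] assms(3) F_eq[OF flow_in_ball[OF assms] assms(3)] unfolding sol_def by metis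

definition transported :: "(real^'n \<Rightarrow> real) \<Rightarrow> real \<Rightarrow> real \<Rightarrow> real \<Rightarrow> real^'n \<Rightarrow> real" where
  "transported \<phi> t \<delta> r = conv (mollifier \<delta>) (\<lambda>z. \<phi> (flow r t z))"

text \<open>The smooth families \<open>V\<close> that solve \<open>\<partial>V/\<partial>t + f \<bullet> \<nabla>V = 0\<close> up to an error \<open>c\<close>, in the form of increments:
  \<open>V\<close> need not be differentiable in time.\<close>

definition transport_test_family :: "real \<Rightarrow> real \<Rightarrow> (real \<Rightarrow> real^'n \<Rightarrow> real) \<Rightarrow> bool" where
  "transport_test_family t c V \<longleftrightarrow>
    (\<forall>r\<in>{s..t}. V r \<in> test_functions D) \<and>
    (\<exists>C1\<ge>0. \<forall>r\<in>{s..t}. \<forall>x i. \<bar>partial_deriv i (V r) x\<bar> \<le> C1) \<and>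
    (\<exists>C2\<ge>0. \<forall>r\<in>{s..t}. \<forall>x. \<bar>\<Sum>i\<in>UNIV. partial_deriv i (partial_deriv i (V r)) x\<bar> \<le> C2) \<and>
    (\<forall>\<eta>>0. \<exists>h>0. \<forall>r r'. s \<le> r \<and> r < r' \<and> r' \<le> t \<and> r' - r < h \<longrightarrow>
       (\<forall>x\<in>D. \<bar>V r' x - V r x + (r' - r) * (f x r \<bullet> gradient (V r') x)\<bar>
          \<le> (c + \<eta>) * (r' - r)))"

lemma pullback_lipschitz:
  assumes \<phi>: "\<And>z z'. \<bar>\<phi> z - \<phi> z'\<bar> \<le> B * norm (z - z')" "0 \<le> B" and "r \<in> {s..T}" "t \<in> {s..T}"
  shows "\<bar>\<phi> (flow r t z) - \<phi> (flow r t z')\<bar> \<le> B * exp (L * (T - s)) * norm (z - z')"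
proof -
  have "\<bar>\<phi> (flow r t z) - \<phi> (flow r t z')\<bar> \<le> B * norm (flow r t z - flow r t z')" by (rule \<phi>)
  also have "\<dots> \<le> B * (exp (L * (T - s)) * norm (z - z'))"
    by (intro mult_left_mono flow_lipschitz assms)
  finally show ?thesis by (simp add: mult.assoc)
qed

lemma flow_linear_displacement:
  assumes r: "r \<in> {s..T}" "r' \<in> {s..T}" "r < r'" and x: "x \<in> D" and z: "norm (x - z) \<le> \<delta>"
    and \<omega>: "\<And>\<tau>. \<tau> \<in> {r..r'} \<Longrightarrow> norm (f x \<tau> - f x r) \<le> \<omega>"
  shows "norm (flow r r' z - z - (r' - r) *\<^sub>R f x r) \<le> (L * (\<delta> + C * (r' - r)) + \<omega>) * (r' - r)"
proof -
  have Fx: "F x \<tau> = f x \<tau>" if "\<tau> \<in> {s..T}" for \<tau>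
    using F_eq[OF closure_in_ball that] x closure_subset by blast
  have "norm ((flow r r' z - r' *\<^sub>R f x r) - (flow r r z - r *\<^sub>R f x r)) \<le> (L * (\<delta> + C * (r' - r)) + \<omega>) * \<bar>r' - r\<bar>"
  proof (rule vector_derivative_bound[where a = r and b = r' and y' = "\<lambda>\<tau>. F (flow r \<tau> z) \<tau> - f x r"])
    fix \<tau> assume \<tau>: "\<tau> \<in> {r..r'}"
    then have \<tau>': "\<tau> \<in> {s..T}" using r by auto
    have "((\<lambda>\<tau>. flow r \<tau> z) has_vector_derivative F (flow r \<tau> z) \<tau>) (at \<tau> within {r..r'})"
    proof (rule has_vector_derivative_within_subset)
      show "((\<lambda>\<tau>. flow r \<tau> z) has_vector_derivative F (flow r \<tau> z) \<tau>) (at \<tau> within {s..T})"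
        using flow_sol[OF r(1), of z] \<tau>' unfolding sol_def by blast
    qed (use r in auto)
    then show "((\<lambda>\<tau>. flow r \<tau> z - \<tau> *\<^sub>R f x r) has_vector_derivative F (flow r \<tau> z) \<tau> - f x r) (at \<tau> within {r..r'})"
      by (auto intro!: derivative_eq_intros)
    have "norm (F (flow r \<tau> z) \<tau> - F x \<tau>) \<le> L * norm (flow r \<tau> z - x)" by (rule F_lip)
    also have "\<dots> \<le> L * (\<delta> + C * (r' - r))"
    proof (rule mult_left_mono)
      have "norm (flow r \<tau> z - flow r r z) \<le> C * \<bar>\<tau> - r\<bar>" by (rule flow_time_lipschitz[OF r(1) r(1) \<tau>'])
      also have "\<dots> \<le> C * (r' - r)" using \<tau> C_nonneg by (intro mult_left_mono) auto
      finally have "norm (flow r \<tau> z - z) \<le> C * (r' - r)" using r by simp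
      moreover have "norm (flow r \<tau> z - x) \<le> norm (flow r \<tau> z - z) + norm (z - x)"
        using norm_triangle_ineq[of "flow r \<tau> z - z" "z - x"] by simp
      ultimately show "norm (flow r \<tau> z - x) \<le> \<delta> + C * (r' - r)" using z by (simp add: norm_minus_commute)
    qed (use L in simp)
    finally have "norm (F (flow r \<tau> z) \<tau> - f x \<tau>) \<le> L * (\<delta> + C * (r' - r))" using Fx[OF \<tau>'] by simp
    then show "norm (F (flow r \<tau> z) \<tau> - f x r) \<le> L * (\<delta> + C * (r' - r)) + \<omega>"
      using \<omega>[OF \<tau>] norm_triangle_ineq[of "F (flow r \<tau> z) \<tau> - f x \<tau>" "f x \<tau> - f x r"] by simp
  qed (use r in auto)
  moreover have "(flow r r' z - r' *\<^sub>R f x r) - (flow r r z - r *\<^sub>R f x r) = flow r r' z - z - (r' - r) *\<^sub>R f x r"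
    using r by (simp add: algebra_simps)
  ultimately show ?thesis using r by simp
qed

text \<open>The unmollified function \<open>v r z = \<phi> (flow r t z)\<close> satisfies \<open>v r z = v r' (flow r r' z)\<close>. Near \<open>x\<close> and for
  small \<open>r' - r\<close> the flow is the translation by \<open>(r' - r) f(x, r)\<close> up to the error \<open>L \<delta> (r' - r)\<close>, and
  translations commute with mollification; this gives the adjoint transport equation with error
  \<open>O(\<delta>)\<close>. The supports lie within \<open>\<delta>\<close> of the compact tube swept out by \<open>K\<close>.\<close>

lemma transported_properties:
  assumes t: "t \<in> {s..T}" and \<phi>: "\<And>z z'. \<bar>\<phi> z - \<phi> z'\<bar> \<le> B * norm (z - z')" "0 \<le> B" and S: "\<And>z. \<bar>\<phi> z\<bar> \<le> S"
    and K: "compact K" "\<And>z. \<phi> z \<noteq> 0 \<Longrightarrow> z \<in> K" and KD: "\<And>z r. z \<in> K \<Longrightarrow> r \<in> {s..t} \<Longrightarrow> flow t r z \<in> D"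
  shows "\<exists>\<delta>0>0. \<forall>\<delta>. 0 < \<delta> \<and> \<delta> < \<delta>0 \<longrightarrow>
    transport_test_family t (B * exp (L * (T - s)) * L * \<delta>) (transported \<phi> t \<delta>)"
proof -
  define K' where "K' = (\<lambda>(x, r). flow t r x) ` (K \<times> {s..t})"
  have cK': "compact K'" unfolding K'_def using t
    by (intro compact_continuous_image continuous_on_subset[OF flow_joint_continuous[OF t]] compact_Times K) auto
  have K'D: "K' \<subseteq> D" unfolding K'_def using KD by auto
  obtain \<delta>0 where \<delta>0: "\<delta>0 > 0" "(\<Union>x\<in>K'. cball x \<delta>0) \<subseteq> D"
    using compact_subset_open_imp_cball_epsilon_subset[OF cK' open_D K'D] by blast
  obtain R' where R': "\<And>z. z \<in> K' \<Longrightarrow> norm z \<le> R'" using compact_imp_bounded[OF cK'] by (auto simp: bounded_iff)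
  define v where "v r z = \<phi> (flow r t z)" for r z
  define Lv where "Lv = B * exp (L * (T - s))"
  have Lv0: "0 \<le> Lv" unfolding Lv_def using \<phi>(2) by simp
  have v_lip: "\<bar>v r z - v r z'\<bar> \<le> Lv * norm (z - z')" if "r \<in> {s..t}" for r z z'
    unfolding v_def Lv_def by (rule pullback_lipschitz[OF \<phi>]) (use that t in auto)
  have v_c: "continuous_on UNIV (v r)" if "r \<in> {s..t}" for r
    by (rule lipschitz_continuous_on[OF v_lip[OF that] Lv0])
  have v_K': "z \<in> K'" if "r \<in> {s..t}" "v r z \<noteq> 0" for r z
  proof -
    have "flow r t z \<in> K" using that(2) K(2) by (simp add: v_def)
    moreover have "flow t r (flow r t z) = z"
      using flow_flow[of r t r z] that(1) t by auto
    ultimately show ?thesis unfolding K'_def using that(1) by (intro image_eqI[where x = "(flow r t z, r)"]) auto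
  qed
  have v_S: "\<bar>v r z\<bar> \<le> S" for r z by (simp add: v_def S)
  have moll: "mollified R' S (v r)" if "r \<in> {s..t}" for r
  proof
    show "v r z = 0" if "R' < norm z" for z using v_K'[OF \<open>r \<in> {s..t}\<close>, of z] R'[of z] that by fastforce
  qed (use v_c[OF that] v_S in auto)
  define Z where "Z = S * measure lborel (cball (0::real^'n) R')"
  have S0: "0 \<le> S" using S[of 0] by linarith
  have Z0: "0 \<le> Z" unfolding Z_def using S0 by simp
  show ?thesis
  proof (rule exI[of _ \<delta>0], rule conjI[OF \<delta>0(1)], rule allI, rule impI)
    fix \<delta> assume "0 < \<delta> \<and> \<delta> < \<delta>0"
    then have \<delta>: "0 < \<delta>" "\<delta> < \<delta>0" "0 \<le> \<delta>" by auto
    define m where "m = (mollifier \<delta> :: real^'n \<Rightarrow> real)"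
    have m_s: "smooth m" unfolding m_def by (rule mollifier_smooth)
    have m_o: "m x = 0" if "\<delta> < norm x" for x unfolding m_def by (rule mollifier_outside[OF \<delta>(3) that])
    have m1_s: "smooth (partial_deriv i m)" for i by (rule smooth_partial_deriv[OF m_s])
    have po: "partial_deriv i g x = 0" if "\<And>x. \<delta> < norm x \<Longrightarrow> g x = 0" "\<delta> < norm x" for g :: "real^'n \<Rightarrow> real" and x i
      using that by (intro partial_deriv_outside[of "cball 0 \<delta>"]) auto
    have m1_o: "partial_deriv i m x = 0" if "\<delta> < norm x" for x i by (rule po[OF m_o that])
    have m2_o: "partial_deriv i (partial_deriv i m) x = 0" if "\<delta> < norm x" for x i by (rule po[OF m1_o that])
    have V: "transported \<phi> t \<delta> r = conv m (v r)" for r by (simp add: transported_def m_def v_def[abs_def])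
    have V1: "partial_deriv i (conv m (v r)) = conv (partial_deriv i m) (v r)" if "r \<in> {s..t}" for i r
      by (rule mollified.conv_partial[OF moll[OF that] m_s m_o \<delta>(3)])
    have V2: "partial_deriv i (partial_deriv i (conv m (v r))) = conv (partial_deriv i (partial_deriv i m)) (v r)" if "r \<in> {s..t}" for i r
      unfolding V1[OF that] by (rule mollified.conv_partial[OF moll[OF that] m1_s m1_o \<delta>(3)])
    have "\<exists>Bi. \<forall>i. Bi i \<ge> 0 \<and> (\<forall>x. \<bar>partial_deriv i m x\<bar> \<le> Bi i)"
      by (intro choice allI) (use compactly_supported_bounded[OF smooth_continuous[OF m1_s] m1_o] in auto)
    then obtain Bi where Bi: "\<And>i. Bi i \<ge> 0" "\<And>i x. \<bar>partial_deriv i m x\<bar> \<le> Bi i" by blast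
    have "\<exists>Bj. \<forall>i. Bj i \<ge> 0 \<and> (\<forall>x. \<bar>partial_deriv i (partial_deriv i m) x\<bar> \<le> Bj i)"
      by (intro choice allI) (use compactly_supported_bounded[OF smooth_continuous[OF smooth_partial_deriv[OF m1_s]] m2_o] in auto)
    then obtain Bj where Bj: "\<And>i. Bj i \<ge> 0" "\<And>i x. \<bar>partial_deriv i (partial_deriv i m) x\<bar> \<le> Bj i" by blast
    have test: "transported \<phi> t \<delta> r \<in> test_functions D" if r: "r \<in> {s..t}" for r
    proof -
      define K'' where "K'' = {x + y | x y. x \<in> K' \<and> y \<in> cball 0 \<delta>}"
      have "K'' \<subseteq> D"
      proof
        fix p assume "p \<in> K''"
        then obtain x y where "p = x + y" "x \<in> K'" "norm y \<le> \<delta>" by (auto simp: K''_def)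
        then have "p \<in> (\<Union>x\<in>K'. cball x \<delta>0)" using \<delta> by (intro UN_I[of x]) (auto simp: dist_norm)
        then show "p \<in> D" using \<delta>0 by blast
      qed
      moreover have "compact K''" unfolding K''_def by (intro compact_sums cK' compact_cball)
      moreover have "conv m (v r) x = 0" if "x \<notin> K''" for x
      proof (rule mollified.conv_outside[OF moll[OF r] m_o])
        show "v r z = 0" if "norm (x - z) \<le> \<delta>" for z
        proof (rule ccontr)
          assume "v r z \<noteq> 0"
          then have "z \<in> K'" by (rule v_K'[OF r])
          then have "z + (x - z) \<in> K''" unfolding K''_def using that by (intro CollectI exI[of _ z] exI[of _ "x - z"]) auto
          then show False using \<open>x \<notin> K''\<close> by simp
        qed
      qed
      ultimately show ?thesis unfolding V test_functions_iff
        using mollified.conv_smooth[OF moll[OF r] m_s m_o \<delta>(3)] by blast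
    qed
    have c1: "\<exists>C1\<ge>0. \<forall>r\<in>{s..t}. \<forall>x i. \<bar>partial_deriv i (transported \<phi> t \<delta> r) x\<bar> \<le> C1"
    proof (intro exI conjI ballI allI)
      show "0 \<le> (\<Sum>i\<in>UNIV. Bi i * Z)" by (intro sum_nonneg mult_nonneg_nonneg Bi Z0)
      fix r x i assume r: "r \<in> {s..t}"
      have "\<bar>conv (partial_deriv i m) (v r) x\<bar> \<le> Bi i * Z"
        unfolding Z_def by (rule mollified.conv_bound[OF moll[OF r] smooth_continuous[OF m1_s] Bi(2) Bi(1)])
      also have "\<dots> \<le> (\<Sum>i\<in>UNIV. Bi i * Z)"
        by (rule member_le_sum[of i UNIV "\<lambda>i. Bi i * Z"]) (auto intro!: mult_nonneg_nonneg Bi Z0)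
      finally show "\<bar>partial_deriv i (transported \<phi> t \<delta> r) x\<bar> \<le> (\<Sum>i\<in>UNIV. Bi i * Z)" unfolding V V1[OF r] .
    qed
    have c2: "\<exists>C2\<ge>0. \<forall>r\<in>{s..t}. \<forall>x. \<bar>\<Sum>i\<in>UNIV. partial_deriv i (partial_deriv i (transported \<phi> t \<delta> r)) x\<bar> \<le> C2"
    proof (intro exI conjI ballI allI)
      show "0 \<le> (\<Sum>i\<in>UNIV. Bj i * Z)" by (intro sum_nonneg mult_nonneg_nonneg Bj Z0)
      fix r x assume r: "r \<in> {s..t}"
      have "\<bar>conv (partial_deriv i (partial_deriv i m)) (v r) x\<bar> \<le> Bj i * Z" for i
        unfolding Z_def by (rule mollified.conv_bound[OF moll[OF r] smooth_continuous[OF smooth_partial_deriv[OF m1_s]] Bj(2) Bj(1)])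
      then show "\<bar>\<Sum>i\<in>UNIV. partial_deriv i (partial_deriv i (transported \<phi> t \<delta> r)) x\<bar> \<le> (\<Sum>i\<in>UNIV. Bj i * Z)"
        unfolding V V2[OF r] by (intro order_trans[OF sum_abs] sum_mono)
    qed
    have dV: "\<exists>h>0. \<forall>r r'. s \<le> r \<and> r < r' \<and> r' \<le> t \<and> r' - r < h \<longrightarrow>
       (\<forall>x\<in>D. \<bar>transported \<phi> t \<delta> r' x - transported \<phi> t \<delta> r x + (r' - r) * (f x r \<bullet> gradient (transported \<phi> t \<delta> r') x)\<bar>
          \<le> (Lv * L * \<delta> + \<eta>) * (r' - r))" if \<eta>: "\<eta> > 0" for \<eta>
    proof -
      obtain Cf where Cf: "Cf \<ge> 0" "\<And>x t. x \<in> D \<Longrightarrow> t \<in> {s..T} \<Longrightarrow> norm (f x t) \<le> Cf" using joint_uniform(1)[OF field_continuous] by blast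
      define \<zeta> where "\<zeta> = \<eta> / (Cf * Z + Lv * L * C + Lv + 1)"
      have den: "Cf * Z + Lv * L * C + Lv + 1 > 0"
        using Cf(1) Z0 Lv0 L C_nonneg by (intro add_nonneg_pos add_nonneg_nonneg mult_nonneg_nonneg) auto
      have \<zeta>: "\<zeta> > 0" using \<eta> den by (simp add: \<zeta>_def)
      have \<zeta>e: "\<zeta> * Cf * Z + Lv * L * C * \<zeta> + Lv * \<zeta> \<le> \<eta>"
      proof -
        have "(Cf * Z + Lv * L * C + Lv + 1) * \<zeta> = \<eta>" using den by (simp add: \<zeta>_def)
        then show ?thesis using \<zeta> by (simp add: algebra_simps)
      qed
      obtain h1 where h1: "h1 > 0" "\<And>y k. norm k < h1 \<Longrightarrow> \<bar>m (y + k) - m y - gradient m y \<bullet> k\<bar> \<le> \<zeta> * norm k"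
        using uniform_linearisation[OF m_s m_o \<zeta> \<delta>(3)] by blast
      obtain h2 where h2: "h2 > 0" "\<And>x t t'. x \<in> D \<Longrightarrow> t \<in> {s..T} \<Longrightarrow> t' \<in> {s..T} \<Longrightarrow> \<bar>t' - t\<bar> < h2 \<Longrightarrow> norm (f x t' - f x t) \<le> \<zeta>"
        using joint_uniform(2)[OF field_continuous \<zeta>] by blast
      define h where "h = min (min \<zeta> h2) (h1 / (Cf + 1))"
      have h0: "h > 0" using \<zeta> h2(1) h1(1) Cf(1) by (simp add: h_def)
      have "\<bar>conv m (v r') x - conv m (v r) x + (r' - r) * (f x r \<bullet> gradient (conv m (v r')) x)\<bar> \<le> (Lv * L * \<delta> + \<eta>) * (r' - r)"
        if rr: "s \<le> r" "r < r'" "r' \<le> t" "r' - r < h" and x: "x \<in> D" for r r' x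
      proof -
        have r: "r \<in> {s..t}" "r' \<in> {s..t}" "r \<in> {s..T}" "r' \<in> {s..T}" using rr t by auto
        define d where "d = r' - r"
        have d: "0 < d" "d < \<zeta>" "d < h2" "d * (Cf + 1) < h1"
          using rr Cf(1) by (auto simp: d_def h_def field_simps)
        define k where "k = d *\<^sub>R f x r"
        have nk: "norm k \<le> d * Cf" unfolding k_def using Cf(2)[OF x r(3)] d by simp
        have kh: "norm k < h1" using nk d by (simp add: distrib_left)
        note mo = moll[OF r(2)]
        have lin: "\<bar>conv m (v r') (x + k) - conv m (v r') x - d * (f x r \<bullet> gradient (conv m (v r')) x)\<bar> \<le> \<zeta> * Cf * Z * d"
        proof -
          have "\<bar>conv m (v r') (x + k) - conv m (v r') x - (\<Sum>i\<in>UNIV. k $ i * conv (partial_deriv i m) (v r') x)\<bar> \<le> \<zeta> * norm k * Z"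
            unfolding Z_def by (rule mollified.conv_linearisation[OF mo m_s h1(2) kh]) (use \<zeta> in auto)
          also have "\<dots> \<le> \<zeta> * (d * Cf) * Z" using nk \<zeta> Z0 by (intro mult_right_mono mult_left_mono) auto
          also have "(\<Sum>i\<in>UNIV. k $ i * conv (partial_deriv i m) (v r') x) = d * (f x r \<bullet> gradient (conv m (v r')) x)"
            unfolding inner_vec_def gradient_nth V1[OF r(2)] k_def by (simp add: sum_distrib_left mult.assoc)
          finally show ?thesis by (simp add: mult_ac)
        qed
        have shift: "conv m (v r') (x + k) = (\<integral>z. m (x - z) * v r' (k + z) \<partial>lborel)"
        proof -
          have c: "continuous_on UNIV (\<lambda>z. m (x + k - z) * v r' z)"
            by (intro continuous_on_mult v_c r continuous_on_compose2[OF smooth_continuous[OF m_s, of UNIV]] continuous_intros) auto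
          show ?thesis unfolding conv_def
            using lborel_integral_shift[OF borel_measurable_continuous_onI[OF c], of k] by (simp add: algebra_simps)
        qed
        have flow_v: "v r z = v r' (flow r r' z)" for z
          unfolding v_def using flow_flow[OF r(3) r(4) t] by simp
        define g where "g z = v r' (k + z) - v r z" for z
        have gc: "continuous_on UNIV (\<lambda>z. v r' (k + z))"
          by (rule continuous_on_compose2[OF v_c[OF r(2)]]) (auto intro!: continuous_intros)
        have gb: "\<bar>g z\<bar> \<le> Lv * ((L * (\<delta> + C * d) + \<zeta>) * d)" if z: "norm (x - z) \<le> \<delta>" for z
        proof -
          have "\<bar>g z\<bar> \<le> Lv * norm ((k + z) - flow r r' z)" unfolding g_def flow_v by (rule v_lip[OF r(2)])
          also have "norm ((k + z) - flow r r' z) = norm (flow r r' z - z - (r' - r) *\<^sub>R f x r)"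
            unfolding k_def d_def by (subst norm_minus_commute) (simp add: algebra_simps)
          also have "Lv * \<dots> \<le> Lv * ((L * (\<delta> + C * (r' - r)) + \<zeta>) * (r' - r))"
          proof (rule mult_left_mono[OF flow_linear_displacement[OF r(3,4) rr(2) x z] Lv0])
            show "norm (f x \<tau> - f x r) \<le> \<zeta>" if "\<tau> \<in> {r..r'}" for \<tau>
              by (rule h2(2)[OF x r(3)]) (use that r d in \<open>auto simp: d_def\<close>)
          qed
          finally show ?thesis unfolding d_def .
        qed
        have gi: "continuous_on UNIV g" unfolding g_def[abs_def] by (intro continuous_on_diff gc v_c r)
        have mi: "integrable lborel (\<lambda>z. m (x - z) * c z)" if "continuous_on UNIV c" for c
        proof -
          have "bounded (c ` cball x \<delta>)" by (intro compact_imp_bounded compact_continuous_image continuous_on_subset[OF that]) auto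
          then obtain Bc where "\<forall>z\<in>cball x \<delta>. \<bar>c z\<bar> \<le> Bc" by (auto simp: bounded_iff)
          then show ?thesis unfolding m_def by (intro mollifier_average_le(1)[OF \<delta>(1) that, of x Bc]) (auto simp: dist_norm)
        qed
        have "conv m (v r') (x + k) - conv m (v r) x = (\<integral>z. m (x - z) * g z \<partial>lborel)"
          unfolding shift unfolding conv_def g_def right_diff_distrib by (rule Bochner_Integration.integral_diff[symmetric]) (intro mi gc v_c r)+
        also have "\<bar>\<dots>\<bar> \<le> Lv * ((L * (\<delta> + C * d) + \<zeta>) * d)"
          unfolding m_def by (rule mollifier_average_le(2)[OF \<delta>(1) gi gb])
        finally have comm: "\<bar>conv m (v r') (x + k) - conv m (v r) x\<bar> \<le> Lv * ((L * (\<delta> + C * d) + \<zeta>) * d)" .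
        have "Lv * ((L * (\<delta> + C * d) + \<zeta>) * d) \<le> Lv * ((L * (\<delta> + C * \<zeta>) + \<zeta>) * d)"
          using Lv0 L C_nonneg d by (intro mult_left_mono mult_right_mono add_right_mono add_left_mono) auto
        moreover have "Lv * ((L * (\<delta> + C * \<zeta>) + \<zeta>) * d) + \<zeta> * Cf * Z * d = Lv * L * \<delta> * d + (\<zeta> * Cf * Z + Lv * L * C * \<zeta> + Lv * \<zeta>) * d"
          by (simp add: algebra_simps)
        moreover have "(\<zeta> * Cf * Z + Lv * L * C * \<zeta> + Lv * \<zeta>) * d \<le> \<eta> * d" using \<zeta>e d by (intro mult_right_mono) auto
        moreover have "(Lv * L * \<delta> + \<eta>) * d = Lv * L * \<delta> * d + \<eta> * d" by (simp add: algebra_simps)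
        ultimately show ?thesis using lin comm unfolding d_def[symmetric] by linarith
      qed
      then show ?thesis unfolding V using h0 by blast
    qed
    show "transport_test_family t (B * exp (L * (T - s)) * L * \<delta>) (transported \<phi> t \<delta>)"
      unfolding transport_test_family_def Lv_def[symmetric]
      by (intro conjI ballI c1 c2 test allI impI dV)
  qed
qed

lemma weak_solution_viscous:
  assumes "weak_solution D f s T \<rho> \<epsilon> u" "\<epsilon> > 0"
  shows "\<exists>G. viscous_solution D f s T \<rho> \<epsilon> u G"
proof -
  from assms(1) obtain G where "L2_W12_0 D s T u G" and
    "\<And>v H t. W12_0 D v H \<Longrightarrow> t \<in> {s..T} \<Longrightarrow> L2_inner D (u t) v = L2_inner D \<rho> v
        + (\<integral>r. (\<integral>x. u r x * (f x r \<bullet> H x) - \<epsilon>\<^sup>2 / 2 * (G r x \<bullet> H x) \<partial>lebesgue_on D) \<partial>lebesgue_on {s..t})"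
    unfolding weak_solution_def by blast
  moreover have "u \<in> C_L2 D s T" using assms(1) by (simp add: weak_solution_def)
  ultimately have "viscous_solution D f s T \<rho> \<epsilon> u G" using assms(2) by unfold_locales auto
  then show ?thesis by blast
qed

text \<open>For fixed \<open>\<delta>\<close> the viscosity tends to zero first, because the bound on the Laplacian of the
  mollified function explodes as \<open>\<delta>\<close> tends to zero. The remaining errors are proportional to \<open>\<delta>\<close>.\<close>

lemma limit_transported:
  assumes sol: "\<And>\<epsilon>. \<epsilon> > 0 \<Longrightarrow> weak_solution D f s T \<rho> \<epsilon> (p\<epsilon> \<epsilon>)" and \<rho>: "\<rho> \<in> L2_space D"
    and M: "\<And>\<epsilon> r. \<epsilon> > 0 \<Longrightarrow> r \<in> {s..T} \<Longrightarrow> L2_norm D (p\<epsilon> \<epsilon> r) \<le> M"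
    and t: "t \<in> {s..T}" and e: "\<And>k. e k > 0" "e \<longlonglongrightarrow> 0" and lim: "L2_weakly_tendsto D (\<lambda>k. p\<epsilon> (e k) t) q"
    and \<phi>: "\<And>z z'. \<bar>\<phi> z - \<phi> z'\<bar> \<le> B * norm (z - z')" "0 \<le> B" and S: "\<And>z. \<bar>\<phi> z\<bar> \<le> S"
    and K: "compact K" "\<And>z. \<phi> z \<noteq> 0 \<Longrightarrow> z \<in> K" and KD: "\<And>z r. z \<in> K \<Longrightarrow> r \<in> {s..t} \<Longrightarrow> flow t r z \<in> D"
  shows "I (\<lambda>x. q x * \<phi> x) = I (\<lambda>x. \<rho> x * \<phi> (flow s t x))"
proof -
  obtain \<delta>0 where \<delta>0: "\<delta>0 > 0" and P: "\<And>\<delta>. 0 < \<delta> \<Longrightarrow> \<delta> < \<delta>0 \<Longrightarrow>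
    transport_test_family t (B * exp (L * (T - s)) * L * \<delta>) (transported \<phi> t \<delta>)"
    using transported_properties[OF t \<phi> S K KD] by blast
  have qL: "q \<in> L2_space D" using lim by (simp add: L2_weakly_tendsto_def)
  define Lv where "Lv = B * exp (L * (T - s))"
  have Lv0: "0 \<le> Lv" unfolding Lv_def using \<phi>(2) by simp
  have ss: "s \<in> {s..T}" using sT by simp
  have v_lip: "\<bar>\<phi> (flow r t z) - \<phi> (flow r t z')\<bar> \<le> Lv * norm (z - z')" if "r \<in> {s..T}" for r z z'
    unfolding Lv_def by (rule pullback_lipschitz[OF \<phi> that t])
  have cv: "continuous_on UNIV (\<lambda>z. \<phi> (flow r t z))" if "r \<in> {s..T}" for r
    by (rule lipschitz_continuous_on[OF v_lip[OF that] Lv0])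
  have c\<phi>: "continuous_on UNIV \<phi>" by (rule lipschitz_continuous_on[OF \<phi>])
  \<comment> \<open>the three terms come from the transport error and from mollification at the times t and s\<close>
  define Q where "Q = Lv * L * sqrt vol * M * (t - s) + Lv * sqrt vol * L2_norm D q + Lv * sqrt vol * L2_norm D \<rho>"
  have main: "\<bar>I (\<lambda>x. q x * \<phi> x) - I (\<lambda>x. \<rho> x * \<phi> (flow s t x))\<bar> \<le> Q * \<delta>" if \<delta>: "0 < \<delta>" "\<delta> < \<delta>0" for \<delta>
  proof -
    define V where "V = transported \<phi> t \<delta>"
    have fam: "transport_test_family t (Lv * L * \<delta>) V" unfolding Lv_def V_def by (rule P[OF \<delta>])
    have test: "V r \<in> test_functions D" if "r \<in> {s..t}" for r
      using fam that unfolding transport_test_family_def by (elim conjE) (rule bspec)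
    have "\<exists>C1\<ge>0. \<forall>r\<in>{s..t}. \<forall>x i. \<bar>partial_deriv i (V r) x\<bar> \<le> C1"
      using fam unfolding transport_test_family_def by (elim conjE)
    then obtain C1 where C1: "C1 \<ge> 0" "\<And>r x i. r \<in> {s..t} \<Longrightarrow> \<bar>partial_deriv i (V r) x\<bar> \<le> C1" by blast
    have "\<exists>C2\<ge>0. \<forall>r\<in>{s..t}. \<forall>x. \<bar>\<Sum>i\<in>UNIV. partial_deriv i (partial_deriv i (V r)) x\<bar> \<le> C2"
      using fam unfolding transport_test_family_def by (elim conjE)
    then obtain C2 where C2: "C2 \<ge> 0" "\<And>r x. r \<in> {s..t} \<Longrightarrow> \<bar>\<Sum>i\<in>UNIV. partial_deriv i (partial_deriv i (V r)) x\<bar> \<le> C2" by blast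
    have dV: "\<exists>h>0. \<forall>r r'. s \<le> r \<and> r < r' \<and> r' \<le> t \<and> r' - r < h \<longrightarrow>
       (\<forall>x\<in>D. \<bar>V r' x - V r x + (r' - r) * (f x r \<bullet> gradient (V r') x)\<bar> \<le> (Lv * L * \<delta> + \<eta>) * (r' - r))" if "\<eta> > 0" for \<eta>
      using fam that unfolding transport_test_family_def by (elim conjE) (drule spec, erule mp)
    have tt: "t \<in> {s..t}" "s \<in> {s..t}" using t by auto
    have est: "\<bar>I (\<lambda>x. p\<epsilon> \<epsilon> t x * V t x) - I (\<lambda>x. \<rho> x * V s x)\<bar> \<le> (Lv * L * \<delta> + \<epsilon>\<^sup>2 / 2 * C2) * sqrt vol * M * (t - s)"
      if \<epsilon>: "\<epsilon> > 0" for \<epsilon>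
    proof -
      obtain G where G: "viscous_solution D f s T \<rho> \<epsilon> (p\<epsilon> \<epsilon>) G" using weak_solution_viscous[OF sol[OF \<epsilon>] \<epsilon>] by blast
      have "\<bar>I (\<lambda>x. p\<epsilon> \<epsilon> t x * V t x) - I (\<lambda>x. p\<epsilon> \<epsilon> s x * V s x)\<bar> \<le> (Lv * L * \<delta> + \<epsilon>\<^sup>2 / 2 * C2) * sqrt vol * M * (t - s)"
        by (rule viscous_solution.moving_test_estimate[OF G test t C2(2) C2(1) C1(2) C1(1) dV _ M[OF \<epsilon>]])
           (use Lv0 L \<delta> in auto)
      moreover have "I (\<lambda>x. p\<epsilon> \<epsilon> s x * V s x) = I (\<lambda>x. \<rho> x * V s x)"
      proof (rule integral_cong_AE)
        have "p\<epsilon> \<epsilon> s \<in> L2_space D" using sol[OF \<epsilon>] ss by (simp add: weak_solution_def C_L2_def)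
        then show "(\<lambda>x. p\<epsilon> \<epsilon> s x * V s x) \<in> borel_measurable (lebesgue_on D)"
          by (intro borel_measurable_times L2_measurable test_measurable test tt)
        show "(\<lambda>x. \<rho> x * V s x) \<in> borel_measurable (lebesgue_on D)"
          by (intro borel_measurable_times L2_measurable \<rho> test_measurable test tt)
        have "AE x in lebesgue_on D. p\<epsilon> \<epsilon> s x = \<rho> x" using sol[OF \<epsilon>] by (simp add: weak_solution_def)
        then show "AE x in lebesgue_on D. p\<epsilon> \<epsilon> s x * V s x = \<rho> x * V s x" by eventually_elim simp
      qed
      ultimately show ?thesis by simp
    qed
    have l1: "(\<lambda>k. I (\<lambda>x. p\<epsilon> (e k) t x * V t x)) \<longlonglongrightarrow> I (\<lambda>x. q x * V t x)"
      using lim test_L2[OF test[OF tt(1)]] by (auto simp: L2_weakly_tendsto_def L2_inner_def)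
    have "\<bar>I (\<lambda>x. q x * V t x) - I (\<lambda>x. \<rho> x * V s x)\<bar> \<le> (Lv * L * \<delta> + 0\<^sup>2 / 2 * C2) * sqrt vol * M * (t - s)"
    proof (rule LIMSEQ_le)
      show "(\<lambda>k. \<bar>I (\<lambda>x. p\<epsilon> (e k) t x * V t x) - I (\<lambda>x. \<rho> x * V s x)\<bar>) \<longlonglongrightarrow> \<bar>I (\<lambda>x. q x * V t x) - I (\<lambda>x. \<rho> x * V s x)\<bar>"
        by (intro tendsto_intros l1)
      show "(\<lambda>k. (Lv * L * \<delta> + (e k)\<^sup>2 / 2 * C2) * sqrt vol * M * (t - s)) \<longlonglongrightarrow> (Lv * L * \<delta> + 0\<^sup>2 / 2 * C2) * sqrt vol * M * (t - s)"
        by (intro tendsto_intros e(2)) simp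
      show "\<exists>N. \<forall>k\<ge>N. \<bar>I (\<lambda>x. p\<epsilon> (e k) t x * V t x) - I (\<lambda>x. \<rho> x * V s x)\<bar> \<le> (Lv * L * \<delta> + (e k)\<^sup>2 / 2 * C2) * sqrt vol * M * (t - s)"
        using est[OF e(1)] by blast
    qed
    moreover have close: "\<bar>I (\<lambda>x. a x * V r x) - I (\<lambda>x. a x * \<phi> (flow r t x))\<bar> \<le> Lv * \<delta> * sqrt vol * L2_norm D a"
      if a: "a \<in> L2_space D" and r: "r \<in> {s..t}" for a r
    proof -
      have r': "r \<in> {s..T}" using r t by auto
      have "I (\<lambda>x. a x * V r x) - I (\<lambda>x. a x * \<phi> (flow r t x)) = I (\<lambda>x. a x * (V r x - \<phi> (flow r t x)))"
        using integrable_L2_continuous[OF a test_continuous[OF test[OF r]]] integrable_L2_continuous[OF a cv[OF r']]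
        by (simp add: right_diff_distrib)
      also have "\<bar>\<dots>\<bar> \<le> Lv * \<delta> * sqrt vol * L2_norm D a"
      proof (rule inner_bounded_le[OF a])
        show "(\<lambda>x. V r x - \<phi> (flow r t x)) \<in> borel_measurable (lebesgue_on D)"
          by (intro measurable_D continuous_on_diff test_continuous test r cv r')
        show "\<bar>V r x - \<phi> (flow r t x)\<bar> \<le> Lv * \<delta>" for x
          unfolding V_def transported_def by (rule mollifier_approximates[OF \<delta>(1) cv[OF r'] v_lip[OF r'] Lv0])
      qed (use Lv0 \<delta> in simp)
      finally show ?thesis .
    qed
    moreover have "I (\<lambda>x. q x * \<phi> (flow t t x)) = I (\<lambda>x. q x * \<phi> x)" using t by simp
    ultimately have "\<bar>I (\<lambda>x. q x * \<phi> x) - I (\<lambda>x. \<rho> x * \<phi> (flow s t x))\<bar>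
      \<le> Lv * L * \<delta> * sqrt vol * M * (t - s) + Lv * \<delta> * sqrt vol * L2_norm D q + Lv * \<delta> * sqrt vol * L2_norm D \<rho>"
      using close[OF qL tt(1)] close[OF \<rho> tt(2)] by simp
    also have "\<dots> = Q * \<delta>" by (simp add: Q_def algebra_simps)
    finally show ?thesis .
  qed
  have "\<bar>I (\<lambda>x. q x * \<phi> x) - I (\<lambda>x. \<rho> x * \<phi> (flow s t x))\<bar> \<le> Q * 0"
  proof (rule tendsto_le[OF trivial_limit_at_right_real])
    show "((\<lambda>\<delta>. Q * \<delta>) \<longlongrightarrow> Q * 0) (at_right 0)" by (intro tendsto_intros)
    show "((\<lambda>\<delta>. \<bar>I (\<lambda>x. q x * \<phi> x) - I (\<lambda>x. \<rho> x * \<phi> (flow s t x))\<bar>) \<longlongrightarrow> \<bar>I (\<lambda>x. q x * \<phi> x) - I (\<lambda>x. \<rho> x * \<phi> (flow s t x))\<bar>) (at_right (0::real))" by simp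
    show "\<forall>\<^sub>F \<delta> in at_right 0. \<bar>I (\<lambda>x. q x * \<phi> x) - I (\<lambda>x. \<rho> x * \<phi> (flow s t x))\<bar> \<le> Q * \<delta>"
      using eventually_at_right_real[OF \<delta>0] by eventually_elim (use main in auto)
  qed
  then show ?thesis by simp
qed

end

section \<open>Tangential trajectories\<close>

text \<open>The set has arbitrarily many disjoint translates in a fixed ball, all of the same measure.\<close>

lemma negligible_sparse_along_direction:
  fixes N :: "'a::euclidean_space set"
  assumes N: "compact N" and "h > 0" and sparse: "\<And>b k. b \<in> N \<Longrightarrow> 0 < k \<Longrightarrow> k < h \<Longrightarrow> b + k *\<^sub>R v \<notin> N"
  shows "negligible N"
proof -
  have lm: "N \<in> lmeasurable" using N by (rule lmeasurable_compact)
  obtain R where R: "\<And>b. b \<in> N \<Longrightarrow> norm b \<le> R" using compact_imp_bounded[OF N] by (auto simp: bounded_iff)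
  define Bm where "Bm = measure lebesgue (cball (0::'a) (R + h * norm v))"
  have le: "real k * measure lebesgue N \<le> Bm" for k
  proof -
    \<comment> \<open>k shifts between 0 and h, all differences below h\<close>
    define c where "c i = h * real i / (real k + 1)" for i
    define Ni where "Ni i = (+) (c i *\<^sub>R v) ` N" for i
    have c: "0 \<le> c i" "c i \<le> h" if "i < k" for i
      using that \<open>h > 0\<close> mult_left_mono[of "real i" "real k + 1" h] by (auto simp: c_def divide_le_eq)
    have cd: "0 < c j - c i \<and> c j - c i < h" if "i < j" "j < k" for i j
    proof -
      have "c j - c i = h * (real j - real i) / (real k + 1)" by (simp add: c_def diff_divide_distrib right_diff_distrib)
      then show ?thesis using that \<open>h > 0\<close> by (auto simp: divide_less_eq)
    qed
    have disj: "disjnt (Ni i) (Ni j)" if "i < j" "j < k" for i j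
    proof (rule ccontr)
      assume "\<not> disjnt (Ni i) (Ni j)"
      then obtain b b' where b: "b \<in> N" "b' \<in> N" "c i *\<^sub>R v + b = c j *\<^sub>R v + b'" by (auto simp: disjnt_def Ni_def)
      then have "b = b' + (c j - c i) *\<^sub>R v" by (simp add: algebra_simps)
      then show False using sparse[OF b(2), of "c j - c i"] cd[OF that] b(1) by simp
    qed
    have lmi: "Ni i \<in> lmeasurable" "measure lebesgue (Ni i) = measure lebesgue N" for i
      unfolding Ni_def using lm by (simp_all add: measurable_translation measure_translation)
    have "real k * measure lebesgue N = (\<Sum>i<k. measure lebesgue (Ni i))" by (simp add: lmi)
    also have "\<dots> = measure lebesgue (\<Union>i<k. Ni i)"
    proof (rule measure_UNION'[symmetric])
      show "pairwise (\<lambda>i j. disjnt (Ni i) (Ni j)) {..<k}"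
        unfolding pairwise_def using disj by (metis disjnt_sym lessThan_iff linorder_neqE_nat)
    qed (use lmi in auto)
    also have "\<dots> \<le> Bm" unfolding Bm_def
    proof (rule measure_mono_fmeasurable)
      show "(\<Union>i<k. Ni i) \<subseteq> cball 0 (R + h * norm v)"
      proof safe
        fix i x assume i: "i < k" and "x \<in> Ni i"
        then obtain b where b: "b \<in> N" "x = c i *\<^sub>R v + b" by (auto simp: Ni_def)
        have "norm x \<le> c i * norm v + norm b" using norm_triangle_ineq[of "c i *\<^sub>R v" b] c[OF i] b by simp
        also have "\<dots> \<le> h * norm v + R" using c[OF i] R[OF b(1)] by (intro add_mono mult_right_mono) auto
        finally show "x \<in> cball 0 (R + h * norm v)" by simp
      qed
      show "(\<Union>i<k. Ni i) \<in> sets lebesgue" using lmi by (intro sets.finite_UN) auto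
    qed simp
    finally show ?thesis .
  qed
  have "measure lebesgue N = 0"
  proof (rule ccontr)
    assume "measure lebesgue N \<noteq> 0"
    then have p: "0 < measure lebesgue N" by (simp add: less_le)
    obtain k :: nat where "Bm / measure lebesgue N < real k" using reals_Archimedean2 by blast
    then have "Bm < real k * measure lebesgue N" using p by (simp add: field_simps)
    then show False using le[of k] by simp
  qed
  then show ?thesis using lm by (simp add: negligible_iff_measure0)
qed

context flow_domain begin

definition tangential :: "real \<Rightarrow> (real^'n) set" where
  "tangential t = {x\<in>D. (\<forall>r\<in>{s..t}. flow t r x \<in> closure D) \<and> (\<exists>r\<in>{s..t}. flow t r x \<in> frontier D)}"

lemma flow_continuous: "t \<in> {s..T} \<Longrightarrow> r \<in> {s..T} \<Longrightarrow> continuous_on S (flow t r)"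
  by (rule continuous_on_subset[of UNIV], rule lipschitz_on_continuous_on[of "exp (L * (T - s))"])
     (auto intro!: lipschitz_onI flow_lipschitz simp: dist_norm)

lemma negligible_flow_image:
  assumes "negligible N" "t \<in> {s..T}" "r \<in> {s..T}"
  shows "negligible (flow t r ` N)"
proof (rule negligible_locally_Lipschitz_image[OF _ assms(1)])
  fix x assume "x \<in> N"
  show "\<exists>T B. open T \<and> x \<in> T \<and> (\<forall>y\<in>N \<inter> T. norm (flow t r y - flow t r x) \<le> B * norm (y - x))"
    using flow_lipschitz[OF assms(2,3)] by (intro exI[of _ UNIV] exI) auto
qed simp

text \<open>Let \<open>g\<close> define the boundary near \<open>z0\<close> and let \<open>v\<close> be its gradient at \<open>z0\<close>. If \<open>b\<close> and \<open>b + k v\<close> were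
  both in the set, then at the time \<open>r\<close> at which the path of \<open>b\<close> touches the boundary, the path of
  \<open>b + k v\<close> would be displaced by almost exactly \<open>k v\<close>. There \<open>g\<close> is larger than \<open>0\<close>, although that path
  should still be in the closure of \<open>D\<close>, where \<open>g \<le> 0\<close>.\<close>

lemma tangential_local:
  assumes C1: "C1_boundary D" and r0: "r0 \<in> {s..t}" and t: "t \<in> {s..T}" and z0: "z0 \<in> frontier D"
  shows "\<exists>\<eta>>0. \<exists>d>0. negligible {b\<in>cball z0 \<eta>. (\<forall>r\<in>{s..t}. flow r0 r b \<in> closure D) \<and> (\<exists>r\<in>{s..t}. \<bar>r - r0\<bar> \<le> d \<and> flow r0 r b \<in> frontier D)}"
proof -
  obtain U g where U: "open U" "z0 \<in> U" and gd: "\<And>x. x \<in> U \<Longrightarrow> g differentiable (at x)"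
    and gc: "\<And>i. continuous_on U (partial_deriv i g)" and gn: "\<And>x. x \<in> U \<Longrightarrow> \<exists>i. partial_deriv i g x \<noteq> 0"
    and gD: "D \<inter> U = {x\<in>U. g x < 0}" and gF: "frontier D \<inter> U = {x\<in>U. g x = 0}"
    using C1 z0 unfolding C1_boundary_def by meson
  define v where "v = gradient g z0"
  have v: "norm v > 0" using gn[OF U(2)] by (auto simp: v_def vec_eq_iff)
  have "continuous_on U (gradient g)" unfolding gradient_def by (intro continuous_on_vec_lambda gc)
  then have "isCont (gradient g) z0" using U by (simp add: continuous_on_eq_continuous_at)
  then obtain \<rho>1 where \<rho>1: "\<rho>1 > 0" "\<And>y. dist y z0 < \<rho>1 \<Longrightarrow> dist (gradient g y) v < norm v / 4"
    unfolding continuous_at_eps_delta v_def using v unfolding v_def by (metis divide_pos_pos zero_less_numeral)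
  obtain \<rho>2 where \<rho>2: "\<rho>2 > 0" "ball z0 \<rho>2 \<subseteq> U" using U open_contains_ball by blast
  define \<rho>0 where "\<rho>0 = min \<rho>1 \<rho>2"
  have \<rho>0: "\<rho>0 > 0" "\<And>y. y \<in> ball z0 \<rho>0 \<Longrightarrow> y \<in> U" "\<And>y. y \<in> ball z0 \<rho>0 \<Longrightarrow> norm (gradient g y - v) \<le> norm v / 4"
    using \<rho>1 \<rho>2 by (auto simp: \<rho>0_def dist_commute dist_norm[symmetric] intro: less_imp_le)
  have mono: "g y < g (y + k *\<^sub>R v + e)"
    if y: "y \<in> ball z0 \<rho>0" "y + k *\<^sub>R v + e \<in> ball z0 \<rho>0" and k: "0 < k" and e: "norm e \<le> k * norm v / 4" for y k e
  proof -
    define w where "w = k *\<^sub>R v + e"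
    have "norm (g (y + w) - g y - v \<bullet> (y + w - y)) \<le> norm (y + w - y) * (norm v / 4)"
      unfolding v_def
    proof (rule differentiable_bound_linearization[of y "y + w" "ball z0 \<rho>0" g "\<lambda>x h. gradient g x \<bullet> h" z0])
      show "y + r *\<^sub>R (y + w - y) \<in> ball z0 \<rho>0" if "r \<in> {0..1}" for r
      proof -
        have "(1 - r) *\<^sub>R y + r *\<^sub>R (y + w) \<in> ball z0 \<rho>0"
          using that y unfolding w_def by (intro convexD[OF convex_ball]) (auto simp: add.assoc)
        then show ?thesis by (simp add: algebra_simps)
      qed
      show "(g has_derivative (\<lambda>h. gradient g x \<bullet> h)) (at x within ball z0 \<rho>0)" if "x \<in> ball z0 \<rho>0" for x
        by (rule has_derivative_at_withinI[OF has_derivative_gradient[OF gd[OF \<rho>0(2)[OF that]]]])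
      show "onorm ((\<lambda>h. gradient g x \<bullet> h) - (\<lambda>h. gradient g z0 \<bullet> h)) \<le> norm (gradient g z0) / 4" if "x \<in> ball z0 \<rho>0" for x
        unfolding fun_diff_def
      proof (rule onorm_le)
        fix i :: "real^'n"
        have "\<bar>(gradient g x - v) \<bullet> i\<bar> \<le> norm (gradient g x - v) * norm i" by (rule Cauchy_Schwarz_ineq2)
        also have "\<dots> \<le> norm v / 4 * norm i" by (intro mult_right_mono \<rho>0(3) that) auto
        finally show "norm (gradient g x \<bullet> i - gradient g z0 \<bullet> i) \<le> norm (gradient g z0) / 4 * norm i"
          by (simp add: v_def inner_diff_left)
      qed
    qed (use \<rho>0 in auto)
    then have "v \<bullet> w - norm w * (norm v / 4) \<le> g (y + w) - g y"
      unfolding real_norm_def add_diff_cancel_left' by linarith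
    moreover have "norm w \<le> 5 / 4 * (k * norm v)"
      using norm_triangle_ineq[of "k *\<^sub>R v" e] e k by (simp add: w_def)
    then have "norm w * (norm v / 4) \<le> 5 / 4 * (k * norm v) * (norm v / 4)" by (intro mult_right_mono) auto
    moreover have "v \<bullet> w \<ge> k * (norm v * norm v) - norm v * (k * norm v / 4)"
    proof -
      have "\<bar>v \<bullet> e\<bar> \<le> norm v * norm e" by (rule Cauchy_Schwarz_ineq2)
      also have "\<dots> \<le> norm v * (k * norm v / 4)" by (intro mult_left_mono e) auto
      finally have "- (norm v * (k * norm v / 4)) \<le> v \<bullet> e" by linarith
      moreover have "v \<bullet> w = k * (norm v * norm v) + v \<bullet> e"
        by (simp add: w_def inner_add_right dot_square_norm power2_eq_square)
      ultimately show ?thesis by linarith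
    qed
    moreover have "0 < k * (norm v * norm v)" using k v by simp
    ultimately have "0 < g (y + w) - g y" by (simp add: algebra_simps)
    then show ?thesis by (simp add: w_def add.assoc)
  qed
  \<comment> \<open>E is the rate at which the flow distorts differences; after a time d with E d at most 1/4 the distortion is covered by mono\<close>
  define E where "E = L * exp (L * (T - s))"
  have E: "E > 0" using L by (simp add: E_def)
  define d where "d = min (1 / (4 * E)) (\<rho>0 / (4 * (C + 1)))"
  have d: "d > 0" "E * d \<le> 1 / 4" "C * d \<le> \<rho>0 / 4"
  proof -
    show "d > 0" using E \<rho>0 C_nonneg by (simp add: d_def)
    have "E * d \<le> E * (1 / (4 * E))" using E by (intro mult_left_mono) (auto simp: d_def)
    then show "E * d \<le> 1 / 4" using E by simp
    have "C * d \<le> (C + 1) * (\<rho>0 / (4 * (C + 1)))" using C_nonneg \<open>d > 0\<close> by (intro mult_mono) (auto simp: d_def)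
    also have "\<dots> = \<rho>0 / 4"
    proof -
      have "c * (\<rho>0 / (4 * c)) = \<rho>0 / 4" if "c \<noteq> 0" for c :: real using that by simp
      moreover have "C + 1 \<noteq> 0" using C_nonneg by linarith
      ultimately show ?thesis by blast
    qed
    finally show "C * d \<le> \<rho>0 / 4" .
  qed
  define \<eta> where "\<eta> = \<rho>0 / 4"
  have \<eta>: "\<eta> > 0" using \<rho>0 by (simp add: \<eta>_def)
  have r0T: "r0 \<in> {s..T}" using r0 t by auto
  define J where "J = {s..t} \<inter> {r0 - d..r0 + d}"
  have J: "compact J" "r \<in> {s..T}" "\<bar>r - r0\<bar> \<le> d" if "r \<in> J" for r
    using that t by (auto simp: J_def abs_le_iff intro: compact_Int)
  have cJ: "compact J" unfolding J_def by (intro compact_Int) auto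
  define N where "N = {b\<in>cball z0 \<eta>. (\<forall>r\<in>{s..t}. flow r0 r b \<in> closure D) \<and> (\<exists>r\<in>J. flow r0 r b \<in> frontier D)}"
  have "compact N"
  proof -
    have jc: "continuous_on (cball z0 \<eta> \<times> J) (\<lambda>(x, r). flow r0 r x)"
      by (rule continuous_on_subset[OF flow_joint_continuous[OF r0T]]) (auto dest: J(2))
    have "closedin (top_of_set (cball z0 \<eta> \<times> J)) ((cball z0 \<eta> \<times> J) \<inter> (\<lambda>(x, r). flow r0 r x) -` frontier D)"
      by (rule continuous_closedin_preimage[OF jc]) simp
    moreover have "compact (cball z0 \<eta> \<times> J)" using cJ by (intro compact_Times) auto
    ultimately have "compact ((cball z0 \<eta> \<times> J) \<inter> (\<lambda>(x, r). flow r0 r x) -` frontier D)"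
      by (metis closedin_compact)
    then have c1: "compact (fst ` ((cball z0 \<eta> \<times> J) \<inter> (\<lambda>(x, r). flow r0 r x) -` frontier D))"
      by (intro compact_continuous_image continuous_on_fst continuous_on_id)
    have c2: "closed (\<Inter>r\<in>{s..t}. flow r0 r -` closure D)"
    proof (intro closed_INT ballI)
      fix r assume "r \<in> {s..t}"
      then have "continuous_on UNIV (flow r0 r)" using t by (intro flow_continuous[OF r0T]) auto
      then show "closed (flow r0 r -` closure D)" by (intro continuous_closed_vimage) (auto simp: continuous_on_eq_continuous_at)
    qed
    have "N = fst ` ((cball z0 \<eta> \<times> J) \<inter> (\<lambda>(x, r). flow r0 r x) -` frontier D) \<inter> (\<Inter>r\<in>{s..t}. flow r0 r -` closure D)"
      unfolding N_def by force
    then show ?thesis using compact_Int_closed[OF c1 c2] by simp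
  qed
  then have "negligible N"
  proof (rule negligible_sparse_along_direction[where h = 1 and v = v])
    fix b k assume b: "b \<in> N" and k: "0 < k" "k < (1::real)"
    show "b + k *\<^sub>R v \<notin> N"
    proof
      assume b': "b + k *\<^sub>R v \<in> N"
      obtain r where r: "r \<in> J" "flow r0 r b \<in> frontier D" using b by (auto simp: N_def)
      have rT: "r \<in> {s..T}" "r \<in> {s..t}" "\<bar>r - r0\<bar> \<le> d" using J[OF r(1)] r(1) by (auto simp: J_def)
      have near: "flow r0 r x \<in> ball z0 \<rho>0" if "x \<in> cball z0 \<eta>" for x
      proof -
        have "norm (flow r0 r x - flow r0 r0 x) \<le> C * \<bar>r - r0\<bar>" by (rule flow_time_lipschitz) (use r0T rT in auto)
        also have "\<dots> \<le> C * d" using rT(3) C_nonneg by (intro mult_left_mono)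
        finally have "norm (flow r0 r x - x) \<le> \<rho>0 / 4" using d r0T by simp
        moreover have "norm (z0 - flow r0 r x) \<le> norm (z0 - x) + norm (flow r0 r x - x)"
          using norm_triangle_ineq4[of "z0 - x" "flow r0 r x - x"] by simp
        ultimately show ?thesis using that \<rho>0(1) by (simp add: \<eta>_def dist_norm)
      qed
      define y where "y = flow r0 r b"
      define y' where "y' = flow r0 r (b + k *\<^sub>R v)"
      define e where "e = y' - y - k *\<^sub>R v"
      have "b \<in> cball z0 \<eta>" "b + k *\<^sub>R v \<in> cball z0 \<eta>" using b b' by (simp_all only: N_def mem_Collect_eq)
      then have yb: "y \<in> ball z0 \<rho>0" "y' \<in> ball z0 \<rho>0" unfolding y_def y'_def by (simp_all only: near)
      have "norm e \<le> L * exp (L * (T - s)) * norm (b + k *\<^sub>R v - b) * \<bar>r - r0\<bar>"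
        using flow_displacement[OF r0T rT(1), of "b + k *\<^sub>R v" b] by (simp add: e_def y_def y'_def algebra_simps)
      also have "\<dots> = (E * \<bar>r - r0\<bar>) * (k * norm v)" using k by (simp add: E_def)
      also have "\<dots> \<le> (1 / 4) * (k * norm v)"
      proof (rule mult_right_mono)
        show "E * \<bar>r - r0\<bar> \<le> 1 / 4" using mult_left_mono[OF rT(3), of E] E d(2) by linarith
      qed (use k in auto)
      finally have e: "norm e \<le> k * norm v / 4" by simp
      have "g y < g (y + k *\<^sub>R v + e)" by (rule mono[OF yb(1) _ k(1) e]) (use yb in \<open>simp add: e_def\<close>)
      then have lt: "g y < g y'" by (simp add: e_def)
      have "g y = 0" using r(2) gF \<rho>0(2)[OF yb(1)] by (auto simp: y_def)
      moreover have "g y' \<le> 0"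
      proof -
        have "y' \<in> closure D" using b' rT(2) by (auto simp: N_def y'_def)
        then have "y' \<in> D \<or> y' \<in> frontier D" using open_D by (auto simp: frontier_def interior_open)
        moreover have "y' \<in> U" by (rule \<rho>0(2)[OF yb(2)])
        ultimately have "y' \<in> D \<inter> U \<or> y' \<in> frontier D \<inter> U" by blast
        then show ?thesis unfolding gD gF by auto
      qed
      ultimately show False using lt by simp
    qed
  qed simp
  moreover have "N = {b\<in>cball z0 \<eta>. (\<forall>r\<in>{s..t}. flow r0 r b \<in> closure D) \<and> (\<exists>r\<in>{s..t}. \<bar>r - r0\<bar> \<le> d \<and> flow r0 r b \<in> frontier D)}"
  proof -
    have "(\<exists>r\<in>J. P r) \<longleftrightarrow> (\<exists>r\<in>{s..t}. \<bar>r - r0\<bar> \<le> d \<and> P r)" for P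
    proof -
      have "r \<in> J \<longleftrightarrow> r \<in> {s..t} \<and> \<bar>r - r0\<bar> \<le> d" for r by (auto simp: J_def abs_le_iff)
      then show ?thesis by auto
    qed
    then show ?thesis unfolding N_def by simp
  qed
  ultimately show ?thesis using \<eta> d(1) by auto
qed

text \<open>The local statement concerns neighbourhoods of a pair of point and contact time. Lindelof's theorem in
  the product space leaves countably many of them, and Lipschitz maps such as the flow preserve null sets.\<close>

lemma tangential_negligible:
  assumes C1: "C1_boundary D" and t: "t \<in> {s..T}"
  shows "negligible (tangential t)"
proof -
  define TA where "TA A = {x \<in> tangential t. \<exists>r\<in>{s..t}. (x, r) \<in> A \<and> flow t r x \<in> frontier D}" for A :: "((real^'n) \<times> real) set"
  define \<F> where "\<F> = {A. open A \<and> negligible (TA A)}"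
  obtain \<F>' where F': "\<F>' \<subseteq> \<F>" "countable \<F>'" "\<Union>\<F>' = \<Union>\<F>"
    using Lindelof[of \<F>] by (auto simp: \<F>_def)
  have cover: "(x, r0) \<in> \<Union>\<F>" if x: "x \<in> tangential t" and r0: "r0 \<in> {s..t}" and fr: "flow t r0 x \<in> frontier D" for x r0
  proof -
    have r0T: "r0 \<in> {s..T}" using r0 t by auto
    define z0 where "z0 = flow t r0 x"
    obtain \<eta> d where \<eta>: "\<eta> > 0" "d > 0" and neg: "negligible {b\<in>cball z0 \<eta>. (\<forall>r\<in>{s..t}. flow r0 r b \<in> closure D) \<and> (\<exists>r\<in>{s..t}. \<bar>r - r0\<bar> \<le> d \<and> flow r0 r b \<in> frontier D)}"
      (is "negligible ?N") using tangential_local[OF C1 r0 t fr[folded z0_def]] by blast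
    define A where "A = (flow t r0 -` ball z0 \<eta>) \<times> {r0 - d<..<r0 + d}"
    have "open (flow t r0 -` ball z0 \<eta>)"
      using open_vimage[OF open_ball flow_continuous[OF t r0T, of UNIV]] by simp
    then have "open A" unfolding A_def by (intro open_Times) auto
    moreover have "TA A \<subseteq> flow r0 t ` ?N"
    proof
      fix x' assume "x' \<in> TA A"
      then obtain r where x': "x' \<in> tangential t" and r: "r \<in> {s..t}" "(x', r) \<in> A" "flow t r x' \<in> frontier D" by (auto simp: TA_def)
      have ff: "flow r0 r' (flow t r0 x') = flow t r' x'" if "r' \<in> {s..t}" for r'
        using flow_flow[OF t r0T, of r' x'] that t by auto
      have "flow t r0 x' \<in> ?N"
      proof (intro CollectI conjI ballI bexI[of _ r])
        show "flow t r0 x' \<in> cball z0 \<eta>" using r(2) by (auto simp: A_def)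
        show "flow r0 r' (flow t r0 x') \<in> closure D" if "r' \<in> {s..t}" for r'
          using x' that by (simp add: ff tangential_def)
        show "\<bar>r - r0\<bar> \<le> d" using r(2) by (auto simp: A_def)
        show "flow r0 r (flow t r0 x') \<in> frontier D" using r by (simp add: ff)
      qed (rule r)
      moreover have "flow r0 t (flow t r0 x') = x'" using flow_flow[OF t r0T t, of x'] t by simp
      ultimately show "x' \<in> flow r0 t ` ?N" by (metis (no_types, lifting) image_eqI)
    qed
    then have "negligible (TA A)" using negligible_subset[OF negligible_flow_image[OF neg r0T t]] by blast
    ultimately have "A \<in> \<F>" by (simp add: \<F>_def)
    moreover have "(x, r0) \<in> A" using \<eta> by (simp add: A_def z0_def)
    ultimately show ?thesis by blast
  qed
  have "tangential t \<subseteq> \<Union> (TA ` \<F>')"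
  proof
    fix x assume x: "x \<in> tangential t"
    then obtain r where r: "r \<in> {s..t}" "flow t r x \<in> frontier D" by (auto simp: tangential_def)
    then obtain A where "A \<in> \<F>'" "(x, r) \<in> A" using cover[OF x] F'(3) by blast
    then have "x \<in> TA A" using x r unfolding TA_def by blast
    then show "x \<in> \<Union> (TA ` \<F>')" using \<open>A \<in> \<F>'\<close> by blast
  qed
  moreover have "negligible (\<Union> (TA ` \<F>'))"
    by (rule negligible_countable_Union) (use F' in \<open>auto simp: \<F>_def\<close>)
  ultimately show ?thesis by (rule negligible_subset[rotated])
qed

end

section \<open>The limit vanishes off the surviving region\<close>

context flow_domain begin

lemma field_div_bound: "\<exists>l\<ge>0. \<forall>x\<in>D. \<forall>t\<in>{s..T}. \<bar>field_div x t\<bar> \<le> l"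
  using joint_uniform(1)[OF field_div_continuous] by (simp add: real_norm_def)

text \<open>Clamping the time makes the trajectory continuous on the whole line, as required of a weight.\<close>

definition path :: "real \<Rightarrow> real^'n \<Rightarrow> real \<Rightarrow> real^'n" where
  "path t0 x0 r = flow t0 (max s (min T r)) x0"

lemma path_eq: "r \<in> {s..T} \<Longrightarrow> path t0 x0 r = flow t0 r x0"
  by (simp add: path_def)

definition gaussian :: "real \<Rightarrow> real \<Rightarrow> real \<Rightarrow> real^'n \<Rightarrow> real^'n \<Rightarrow> real \<Rightarrow> real" where
  "gaussian l m t0 x0 x r = exp (- l * r - m * exp (2 * L * r) * ((x - path t0 x0 r) \<bullet> (x - path t0 x0 r)))"

text \<open>The constant vanishes for \<open>m = 0\<close>, when the weight does not depend on \<open>x\<close>; then the estimate is free of the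
  a priori bound \<open>M\<close> and can be used to establish one.\<close>

lemma gaussian_estimate:
  assumes x0: "x0 \<in> closure D" and t0: "t0 \<in> {s..T}" and m: "0 \<le> m" and l: "0 \<le> l" "\<And>x t. x \<in> D \<Longrightarrow> t \<in> {s..T} \<Longrightarrow> \<bar>field_div x t\<bar> \<le> l"
  shows "\<exists>Cg\<ge>0. (m = 0 \<longrightarrow> Cg = 0) \<and> (\<forall>\<epsilon> u M a t. \<epsilon> > 0 \<longrightarrow> weak_solution D f s T \<rho> \<epsilon> u \<longrightarrow> (\<forall>r\<in>{s..T}. L2_norm D (u r) \<le> M) \<longrightarrow> s \<le> a \<longrightarrow> a \<le> t \<longrightarrow> t \<le> T \<longrightarrow>
     I (\<lambda>x. (u t x)\<^sup>2 * gaussian l m t0 x0 x t) \<le> I (\<lambda>x. (u a x)\<^sup>2 * gaussian l m t0 x0 x a) + 8 * Cg * \<epsilon>\<^sup>2 * (1 + M\<^sup>2 * exp (- l * s)) * (t - a))"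
proof -
  let ?\<gamma> = "path t0 x0"
  have \<gamma>c: "continuous_on UNIV ?\<gamma>"
  proof -
    have "continuous_on {s..T} (\<lambda>r. flow t0 r x0)" by (rule sol_continuous[OF flow_sol[OF t0]])
    then show ?thesis unfolding path_def
      by (rule continuous_on_compose2) (use sT in \<open>auto intro!: continuous_intros\<close>)
  qed
  have \<gamma>d: "(?\<gamma> has_vector_derivative f (?\<gamma> r) r) (at r within {s..T})" if r: "r \<in> {s..T}" for r
    unfolding path_eq[OF r]
    by (rule has_vector_derivative_transform[OF r _ flow_solves[OF x0 t0 r]]) (simp add: path_eq)
  have \<gamma>L: "norm (f x r - f (?\<gamma> r) r) \<le> L * norm (x - ?\<gamma> r)" if "x \<in> D" "r \<in> {s..T}" for x r
  proof -
    have xc: "x \<in> closure D" using that(1) closure_subset by blast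
    have "F x r = f x r" by (rule F_eq[OF closure_in_ball[OF xc] that(2)])
    moreover have "F (flow t0 r x0) r = f (flow t0 r x0) r" by (rule F_eq[OF flow_in_ball[OF x0 t0 that(2)] that(2)])
    ultimately show ?thesis using F_lip[of x r "?\<gamma> r"] by (simp add: path_eq[OF that(2)])
  qed
  let ?q = "\<lambda>r. m * exp (2 * L * r)"
  let ?b = "\<lambda>x r. (- 2 * ?q r) *\<^sub>R (x - ?\<gamma> r)"
  let ?\<Gamma> = "\<lambda>x r. 4 * (?q r)\<^sup>2 * ((x - ?\<gamma> r) \<bullet> (x - ?\<gamma> r)) - 2 * ?q r * real CARD('n)"
  let ?gt = "\<lambda>x r. - l - ?q r * (2 * L * ((x - ?\<gamma> r) \<bullet> (x - ?\<gamma> r)) - 2 * ((x - ?\<gamma> r) \<bullet> f (?\<gamma> r) r))"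
  have ew: "energy_weight D f s T (gaussian l m t0 x0) ?gt ?\<Gamma> ?b"
    unfolding gaussian_def[abs_def] by (rule gaussian_energy_weight[OF \<gamma>c \<gamma>d \<gamma>L l(2) m])
  have bc: "continuous_on UNIV (\<lambda>(x, t). ?b x t)" and \<Gamma>c: "continuous_on UNIV (\<lambda>(x, t). ?\<Gamma> x t)"
    using energy_weight.b_cont[OF ew] energy_weight.\<Gamma>_cont[OF ew] by auto
  obtain B1 where B1: "B1 \<ge> 0" "\<And>x r. x \<in> D \<Longrightarrow> r \<in> {s..T} \<Longrightarrow> norm (?b x r) \<le> B1" using joint_uniform(1)[OF bc] by blast
  obtain B2 where B2: "B2 \<ge> 0" "\<And>x r. x \<in> D \<Longrightarrow> r \<in> {s..T} \<Longrightarrow> \<bar>?\<Gamma> x r\<bar> \<le> B2"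
    using joint_uniform(1)[OF \<Gamma>c] unfolding real_norm_def by blast
  define Cg where "Cg = (if m = 0 then 0 else B1\<^sup>2 / 2 + B2 / 2 + B2\<^sup>2 / 4)"
  have Cg: "0 \<le> Cg" "(norm (?b x r))\<^sup>2 / 2 + \<bar>?\<Gamma> x r\<bar> / 2 + (?\<Gamma> x r)\<^sup>2 / 4 \<le> Cg" if "x \<in> D" "r \<in> {s..T}" for x r
  proof -
    show "0 \<le> Cg" using B2(1) by (simp add: Cg_def)
    show "(norm (?b x r))\<^sup>2 / 2 + \<bar>?\<Gamma> x r\<bar> / 2 + (?\<Gamma> x r)\<^sup>2 / 4 \<le> Cg"
    proof (cases "m = 0")
      case True
      then show ?thesis by (simp add: Cg_def)
    next
      case False
      have "(norm (?b x r))\<^sup>2 \<le> B1\<^sup>2" using B1(2)[OF that] by (intro power_mono) auto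
      moreover have "(?\<Gamma> x r)\<^sup>2 \<le> B2\<^sup>2" using B2 B2(2)[OF that] by (simp add: abs_le_square_iff[symmetric])
      ultimately show ?thesis using B2(2)[OF that] False unfolding Cg_def by simp
    qed
  qed
  have Cg0: "0 \<le> Cg" using B2(1) by (simp add: Cg_def)
  have W: "gaussian l m t0 x0 x r \<le> exp (- l * s)" if "r \<in> {s..T}" for x r
  proof -
    have "l * s \<le> l * r" using l that by (intro mult_left_mono) auto
    moreover have "0 \<le> m * exp (2 * L * r) * ((x - ?\<gamma> r) \<bullet> (x - ?\<gamma> r))" using m by simp
    ultimately show ?thesis unfolding gaussian_def by simp
  qed
  have "I (\<lambda>x. (u t x)\<^sup>2 * gaussian l m t0 x0 x t) \<le> I (\<lambda>x. (u a x)\<^sup>2 * gaussian l m t0 x0 x a) + 8 * Cg * \<epsilon>\<^sup>2 * (1 + M\<^sup>2 * exp (- l * s)) * (t - a)"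
    if "\<epsilon> > 0" "weak_solution D f s T \<rho> \<epsilon> u" "\<forall>r\<in>{s..T}. L2_norm D (u r) \<le> M" "s \<le> a" "a \<le> t" "t \<le> T" for \<epsilon> u M a t
  proof -
    note h = that
    obtain G where G: "viscous_solution D f s T \<rho> \<epsilon> u G" using weak_solution_viscous h(1,2) by blast
    show ?thesis
      by (rule weighted_solution.energy_estimate[OF weighted_solution.intro[OF G ew]])
         (use h(3-6) W Cg Cg0 in auto)
  qed
  then show ?thesis using Cg0 by (intro exI[of _ Cg]) (auto simp: Cg_def)
qed

lemma L2_norm_cong_AE:
  assumes "u \<in> L2_space D" "\<rho> \<in> L2_space D" "AE x in lebesgue_on D. u x = \<rho> x"
  shows "L2_norm D u = L2_norm D \<rho>"
proof -
  have "I (\<lambda>x. (u x)\<^sup>2) = I (\<lambda>x. (\<rho> x)\<^sup>2)"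
  proof (rule integral_cong_AE)
    show "AE x in lebesgue_on D. (u x)\<^sup>2 = (\<rho> x)\<^sup>2" using assms(3) by eventually_elim simp
  qed (use L2_square_integrable assms in auto)
  then show ?thesis by (simp add: L2_norm_def L2_inner_def power2_eq_square)
qed

lemma viscous_uniform_bound:
  assumes "D \<noteq> {}" and sol: "\<And>\<epsilon>. \<epsilon> > 0 \<Longrightarrow> weak_solution D f s T \<rho> \<epsilon> (p\<epsilon> \<epsilon>)" and \<rho>: "\<rho> \<in> L2_space D"
  shows "\<exists>M\<ge>0. \<forall>\<epsilon>>0. \<forall>r\<in>{s..T}. L2_norm D (p\<epsilon> \<epsilon> r) \<le> M"
proof -
  obtain x0 where x0: "x0 \<in> closure D" using assms(1) closure_subset by blast
  have ss: "s \<in> {s..T}" using sT by simp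
  obtain l where l: "l \<ge> 0" "\<And>x t. x \<in> D \<Longrightarrow> t \<in> {s..T} \<Longrightarrow> \<bar>field_div x t\<bar> \<le> l" using field_div_bound by blast
  define M where "M = sqrt (exp (l * (T - s))) * L2_norm D \<rho>"
  have "L2_norm D (p\<epsilon> \<epsilon> r) \<le> M" if \<epsilon>: "\<epsilon> > 0" and r: "r \<in> {s..T}" for \<epsilon> r
  proof -
    have uC: "p\<epsilon> \<epsilon> \<in> C_L2 D s T" using sol[OF \<epsilon>] by (simp add: weak_solution_def)
    then obtain M' where M': "\<forall>r\<in>{s..T}. L2_norm D (p\<epsilon> \<epsilon> r) \<le> M'" using C_L2_norm_bounded by blast
    have uL: "p\<epsilon> \<epsilon> r \<in> L2_space D" if "r \<in> {s..T}" for r using uC that by (simp add: C_L2_def)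
    have "I (\<lambda>x. (p\<epsilon> \<epsilon> r x)\<^sup>2 * gaussian l 0 s x0 x r) \<le> I (\<lambda>x. (p\<epsilon> \<epsilon> s x)\<^sup>2 * gaussian l 0 s x0 x s)"
      using gaussian_estimate[OF x0 ss order_refl l, of \<rho>] \<epsilon> sol[OF \<epsilon>] M' r by fastforce
    then have "exp (- l * r) * (L2_norm D (p\<epsilon> \<epsilon> r))\<^sup>2 \<le> exp (- l * s) * (L2_norm D (p\<epsilon> \<epsilon> s))\<^sup>2"
      unfolding L2_norm_sq by (simp add: gaussian_def mult.commute)
    then have "exp (l * r) * (exp (- l * r) * (L2_norm D (p\<epsilon> \<epsilon> r))\<^sup>2) \<le> exp (l * r) * (exp (- l * s) * (L2_norm D (p\<epsilon> \<epsilon> s))\<^sup>2)"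
      by (intro mult_left_mono) auto
    moreover have "exp (l * r) * (exp (- l * r) * A) = A" "exp (l * r) * (exp (- l * s) * A) = exp (l * (r - s)) * A" for A
      by (simp_all add: mult.assoc[symmetric] exp_add[symmetric] right_diff_distrib)
    ultimately have "(L2_norm D (p\<epsilon> \<epsilon> r))\<^sup>2 \<le> exp (l * (r - s)) * (L2_norm D (p\<epsilon> \<epsilon> s))\<^sup>2"
      by (simp only:)
    also have "\<dots> \<le> exp (l * (T - s)) * (L2_norm D (p\<epsilon> \<epsilon> s))\<^sup>2"
      using r l(1) by (intro mult_right_mono) (auto intro!: mult_left_mono)
    also have "L2_norm D (p\<epsilon> \<epsilon> s) = L2_norm D \<rho>"
      by (rule L2_norm_cong_AE[OF uL[OF ss] \<rho>]) (use sol[OF \<epsilon>] in \<open>simp add: weak_solution_def\<close>)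
    also have "exp (l * (T - s)) * (L2_norm D \<rho>)\<^sup>2 = M\<^sup>2" by (simp add: M_def power_mult_distrib)
    finally show ?thesis by (rule power2_le_imp_le) (simp add: M_def)
  qed
  moreover have "0 \<le> M" by (simp add: M_def)
  ultimately show ?thesis by blast
qed

text \<open>The trajectory through \<open>x0\<close> is at distance at least \<open>R1\<close> from \<open>D\<close> at time \<open>r1\<close>. Hence the Gaussian weight on \<open>D\<close>
  at that time is smaller than the weight near \<open>x0\<close> at time \<open>t\<close> by a factor \<open>exp (- m Q / 2)\<close>, up to a constant.
  First \<open>m\<close> is taken large, then \<open>\<epsilon>\<close> small.\<close>

lemma exit_decay:
  assumes sol: "\<And>\<epsilon>. \<epsilon> > 0 \<Longrightarrow> weak_solution D f s T \<rho> \<epsilon> (p\<epsilon> \<epsilon>)"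
    and M: "\<And>\<epsilon> r. \<epsilon> > 0 \<Longrightarrow> r \<in> {s..T} \<Longrightarrow> L2_norm D (p\<epsilon> \<epsilon> r) \<le> M"
    and t: "t \<in> {s..T}" and x0: "x0 \<in> D" and r1: "r1 \<in> {s..t}" "flow t r1 x0 \<notin> closure D"
    and e: "\<And>k. e k > 0" "e \<longlonglongrightarrow> 0"
  shows "\<exists>\<delta>>0. (\<lambda>k. I (\<lambda>x. (p\<epsilon> (e k) t x)\<^sup>2 * indicator (ball x0 \<delta>) x)) \<longlonglongrightarrow> 0"
proof -
  have x0c: "x0 \<in> closure D" using x0 closure_subset by blast
  have r1T: "r1 \<in> {s..T}" using r1 t by auto
  obtain l where l: "l \<ge> 0" "\<And>x t. x \<in> D \<Longrightarrow> t \<in> {s..T} \<Longrightarrow> \<bar>field_div x t\<bar> \<le> l" using field_div_bound by blast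
  have "open (- closure D)" by (intro open_Compl closed_closure)
  then obtain R1 where R1: "R1 > 0" "ball (flow t r1 x0) R1 \<subseteq> - closure D"
    using r1(2) open_contains_ball by (metis ComplI)
  define Q where "Q = exp (2 * L * r1) * R1\<^sup>2"
  have Q: "Q > 0" using R1 by (simp add: Q_def)
  \<comment> \<open>chosen so that the exponent of the weight at time t is at least - m Q / 2 on the ball, as against - m Q on D at time r1\<close>
  define \<delta> where "\<delta> = sqrt (Q / (2 * exp (2 * L * t)))"
  have \<delta>: "\<delta> > 0" "exp (2 * L * t) * \<delta>\<^sup>2 = Q / 2" using Q by (auto simp: \<delta>_def field_simps)
  define X where "X k = I (\<lambda>x. (p\<epsilon> (e k) t x)\<^sup>2 * indicator (ball x0 \<delta>) x)" for k
  have uL: "p\<epsilon> \<epsilon> r \<in> L2_space D" if "\<epsilon> > 0" "r \<in> {s..T}" for \<epsilon> r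
    using sol[OF that(1)] that(2) by (simp add: weak_solution_def C_L2_def)
  have M0: "0 \<le> M" using order_trans[OF L2_norm_nonneg M[of 1 s]] sT by simp
  have bm: "indicator (ball x0 \<delta>) \<in> borel_measurable (lebesgue_on D)"
    by (rule borel_measurable_indicator[THEN measurable_restrict_space1]) simp
  have iX: "integrable (lebesgue_on D) (\<lambda>x. (p\<epsilon> (e k) t x)\<^sup>2 * indicator (ball x0 \<delta>) x)" for k
    using L2_mult_integrable[OF uL[OF e(1) t] L2_bounded_mult[OF uL[OF e(1) t] bm, of 1], of k k]
    by (simp add: power2_eq_square mult.assoc)
  have X0: "0 \<le> X k" for k unfolding X_def by simp
  have "\<forall>\<^sub>F k in sequentially. X k < \<eta>" if \<eta>: "\<eta> > 0" for \<eta>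
  proof -
    have "((\<lambda>m. exp (l * (t - r1)) * M\<^sup>2 * exp (- (m * (Q / 2)))) \<longlongrightarrow> exp (l * (t - r1)) * M\<^sup>2 * 0) at_top"
    proof (intro tendsto_intros)
      show "((\<lambda>m. exp (- (m * (Q / 2)))) \<longlongrightarrow> 0) at_top" using Q by real_asymp
    qed
    then have "\<forall>\<^sub>F m in at_top. exp (l * (t - r1)) * M\<^sup>2 * exp (- (m * (Q / 2))) < \<eta> / 2"
      using \<eta> by (intro order_tendstoD(2)) auto
    then have "\<forall>\<^sub>F m in at_top. 0 \<le> m \<and> exp (l * (t - r1)) * M\<^sup>2 * exp (- (m * (Q / 2))) < \<eta> / 2"
      by (intro eventually_conj eventually_ge_at_top)
    then obtain m where m: "0 \<le> m" "exp (l * (t - r1)) * M\<^sup>2 * exp (- (m * (Q / 2))) < \<eta> / 2"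
      by (auto simp: eventually_at_top_linorder)
    obtain Cg where Cg: "Cg \<ge> 0" "\<And>\<epsilon> u M a r. \<epsilon> > 0 \<Longrightarrow> weak_solution D f s T \<rho> \<epsilon> u \<Longrightarrow> (\<forall>r\<in>{s..T}. L2_norm D (u r) \<le> M) \<Longrightarrow> s \<le> a \<Longrightarrow> a \<le> r \<Longrightarrow> r \<le> T \<Longrightarrow>
       I (\<lambda>x. (u r x)\<^sup>2 * gaussian l m t x0 x r) \<le> I (\<lambda>x. (u a x)\<^sup>2 * gaussian l m t x0 x a) + 8 * Cg * \<epsilon>\<^sup>2 * (1 + M\<^sup>2 * exp (- l * s)) * (r - a)"
      using gaussian_estimate[OF x0c t m(1) l, of \<rho>] by blast
    define c where "c = 8 * Cg * (1 + M\<^sup>2 * exp (- l * s)) * (t - r1) * exp (l * t + m * (Q / 2))"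
    have Xb: "X k \<le> exp (l * (t - r1)) * M\<^sup>2 * exp (- (m * (Q / 2))) + c * (e k)\<^sup>2" for k
    proof -
      let ?u = "p\<epsilon> (e k)"
      let ?E = "exp (- l * t - m * (Q / 2))"
      have gc: "continuous_on UNIV (\<lambda>x. gaussian l m t x0 x r)" for r
        unfolding gaussian_def by (rule smooth_continuous[OF smooth_gauss])
      have ig: "integrable (lebesgue_on D) (\<lambda>x. (?u r x)\<^sup>2 * gaussian l m t x0 x r)" if "r \<in> {s..T}" for r
        using L2_mult_integrable[OF uL[OF e(1) that] L2_mult_continuous[OF uL[OF e(1) that] gc]]
        by (simp add: power2_eq_square mult.assoc)
      have "?E * X k = I (\<lambda>x. ?E * ((?u t x)\<^sup>2 * indicator (ball x0 \<delta>) x))" by (simp add: X_def)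
      also have "\<dots> \<le> I (\<lambda>x. (?u t x)\<^sup>2 * gaussian l m t x0 x t)"
      proof (rule Bochner_Integration.integral_mono[OF integrable_mult_right[OF iX] ig[OF t]])
        fix x
        show "?E * ((?u t x)\<^sup>2 * indicator (ball x0 \<delta>) x) \<le> (?u t x)\<^sup>2 * gaussian l m t x0 x t"
        proof (cases "x \<in> ball x0 \<delta>")
          case True
          then have "norm (x - x0) \<le> \<delta>" by (simp add: dist_norm norm_minus_commute)
          then have "(x - x0) \<bullet> (x - x0) \<le> \<delta>\<^sup>2" by (simp add: dot_square_norm power_mono)
          then have "exp (2 * L * t) * ((x - x0) \<bullet> (x - x0)) \<le> exp (2 * L * t) * \<delta>\<^sup>2" by (intro mult_left_mono) auto
          then have "m * (exp (2 * L * t) * ((x - x0) \<bullet> (x - x0))) \<le> m * (Q / 2)" unfolding \<delta>(2) using m(1) by (intro mult_left_mono)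
          then have "?E \<le> gaussian l m t x0 x t" using t by (simp add: gaussian_def path_eq mult.assoc)
          then show ?thesis using True by (simp add: mult.commute mult_left_mono)
        next
          case False
          then show ?thesis by (simp add: gaussian_def)
        qed
      qed
      also have "\<dots> \<le> I (\<lambda>x. (?u r1 x)\<^sup>2 * gaussian l m t x0 x r1) + 8 * Cg * (e k)\<^sup>2 * (1 + M\<^sup>2 * exp (- l * s)) * (t - r1)"
        by (rule Cg(2)[OF e(1) sol[OF e(1)]]) (use M[OF e(1)] r1 t in auto)
      also have "I (\<lambda>x. (?u r1 x)\<^sup>2 * gaussian l m t x0 x r1) \<le> I (\<lambda>x. exp (- l * r1 - m * Q) * (?u r1 x)\<^sup>2)"
      proof (rule Bochner_Integration.integral_mono[OF ig[OF r1T]])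
        show "integrable (lebesgue_on D) (\<lambda>x. exp (- l * r1 - m * Q) * (?u r1 x)\<^sup>2)"
          by (intro integrable_mult_right L2_square_integrable uL e r1T)
        fix x assume "x \<in> space (lebesgue_on D)"
        then have "x \<in> D" by simp
        then have "x \<notin> ball (flow t r1 x0) R1" using R1(2) closure_subset by blast
        then have "R1 \<le> norm (x - flow t r1 x0)" by (simp add: dist_norm norm_minus_commute)
        then have "R1\<^sup>2 \<le> (x - flow t r1 x0) \<bullet> (x - flow t r1 x0)" using R1(1) by (simp add: dot_square_norm power_mono)
        then have "m * Q \<le> m * (exp (2 * L * r1) * ((x - flow t r1 x0) \<bullet> (x - flow t r1 x0)))"
          unfolding Q_def using m(1) by (intro mult_left_mono) auto
        then have "gaussian l m t x0 x r1 \<le> exp (- l * r1 - m * Q)" by (simp add: gaussian_def path_eq[OF r1T] mult.assoc)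
        then show "(?u r1 x)\<^sup>2 * gaussian l m t x0 x r1 \<le> exp (- l * r1 - m * Q) * (?u r1 x)\<^sup>2"
          by (simp add: mult.commute mult_left_mono)
      qed
      also have "I (\<lambda>x. exp (- l * r1 - m * Q) * (?u r1 x)\<^sup>2) = exp (- l * r1 - m * Q) * (L2_norm D (?u r1))\<^sup>2"
        by (simp add: L2_norm_sq)
      also have "\<dots> \<le> exp (- l * r1 - m * Q) * M\<^sup>2"
        using M[OF e(1) r1T] by (intro mult_left_mono power_mono) auto
      finally have "?E * X k \<le> exp (- l * r1 - m * Q) * M\<^sup>2 + 8 * Cg * (e k)\<^sup>2 * (1 + M\<^sup>2 * exp (- l * s)) * (t - r1)" by simp
      then have "exp (l * t + m * (Q / 2)) * (?E * X k) \<le> exp (l * t + m * (Q / 2)) * (exp (- l * r1 - m * Q) * M\<^sup>2 + 8 * Cg * (e k)\<^sup>2 * (1 + M\<^sup>2 * exp (- l * s)) * (t - r1))"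
        by (intro mult_left_mono) auto
      moreover have "exp (l * t + m * (Q / 2)) * (?E * X k) = X k"
        by (simp add: mult.assoc[symmetric] exp_add[symmetric])
      moreover have "exp (l * t + m * (Q / 2)) * (exp (- l * r1 - m * Q) * M\<^sup>2) = exp (l * (t - r1)) * M\<^sup>2 * exp (- (m * (Q / 2)))"
      proof -
        have "exp (l * t + m * (Q / 2)) * exp (- l * r1 - m * Q) = exp (l * (t - r1)) * exp (- (m * (Q / 2)))"
          unfolding exp_add[symmetric] by (simp add: algebra_simps)
        then show ?thesis by (simp add: mult_ac)
      qed
      moreover have "exp (l * t + m * (Q / 2)) * (8 * Cg * (e k)\<^sup>2 * (1 + M\<^sup>2 * exp (- l * s)) * (t - r1)) = c * (e k)\<^sup>2"
        by (simp only: c_def mult_ac)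
      ultimately show ?thesis by (simp only: distrib_left)
    qed
    have "(\<lambda>k. exp (l * (t - r1)) * M\<^sup>2 * exp (- (m * (Q / 2))) + c * (e k)\<^sup>2) \<longlonglongrightarrow> exp (l * (t - r1)) * M\<^sup>2 * exp (- (m * (Q / 2))) + c * 0\<^sup>2"
      by (intro tendsto_intros e(2))
    then have "\<forall>\<^sub>F k in sequentially. exp (l * (t - r1)) * M\<^sup>2 * exp (- (m * (Q / 2))) + c * (e k)\<^sup>2 < \<eta>"
      by (rule order_tendstoD(2)) (use m(2) \<eta> in simp)
    then show ?thesis by eventually_elim (use Xb in \<open>auto intro: le_less_trans\<close>)
  qed
  note small = this
  have "X \<longlonglongrightarrow> 0"
  proof (rule order_tendstoI)
    fix c :: real assume "c < 0"
    then show "\<forall>\<^sub>F k in sequentially. c < X k" by (intro always_eventually allI less_le_trans[OF _ X0])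
  qed (rule small)
  then show ?thesis using \<delta>(1) unfolding X_def by blast
qed

definition survivors :: "real \<Rightarrow> (real^'n) set" where
  "survivors t = {x\<in>D. \<forall>r\<in>{s..t}. flow t r x \<in> D}"

text \<open>Strong convergence to zero near a point forces the weak limit to vanish there: pair it with \<open>q\<close> itself.
  Countably many such neighbourhoods cover all points that leave the closure, and the others off the
  survivors are tangential.\<close>

lemma limit_vanishes:
  assumes C1: "C1_boundary D" and sol: "\<And>\<epsilon>. \<epsilon> > 0 \<Longrightarrow> weak_solution D f s T \<rho> \<epsilon> (p\<epsilon> \<epsilon>)"
    and M: "\<And>\<epsilon> r. \<epsilon> > 0 \<Longrightarrow> r \<in> {s..T} \<Longrightarrow> L2_norm D (p\<epsilon> \<epsilon> r) \<le> M"
    and t: "t \<in> {s..T}" and e: "\<And>k. e k > 0" "e \<longlonglongrightarrow> 0" and lim: "L2_weakly_tendsto D (\<lambda>k. p\<epsilon> (e k) t) q"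
  shows "AE x in lebesgue_on D. x \<notin> survivors t \<longrightarrow> q x = 0"
proof -
  have qL: "q \<in> L2_space D" using lim by (simp add: L2_weakly_tendsto_def)
  have uL: "p\<epsilon> \<epsilon> r \<in> L2_space D" if "\<epsilon> > 0" "r \<in> {s..T}" for \<epsilon> r
    using sol[OF that(1)] that(2) by (simp add: weak_solution_def C_L2_def)
  have local: "\<exists>\<delta>>0. AE x in lebesgue_on D. x \<in> ball x0 \<delta> \<longrightarrow> q x = 0"
    if x0: "x0 \<in> D" and r1: "r1 \<in> {s..t}" "flow t r1 x0 \<notin> closure D" for x0 r1
  proof -
    obtain \<delta> where \<delta>: "\<delta> > 0" "(\<lambda>k. I (\<lambda>x. (p\<epsilon> (e k) t x)\<^sup>2 * indicator (ball x0 \<delta>) x)) \<longlonglongrightarrow> 0"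
      using exit_decay[OF sol M t x0 r1 e] by blast
    let ?i = "indicator (ball x0 \<delta>) :: real^'n \<Rightarrow> real"
    have bm: "?i \<in> borel_measurable (lebesgue_on D)"
      by (rule borel_measurable_indicator[THEN measurable_restrict_space1]) simp
    have Lm: "(\<lambda>x. a x * ?i x) \<in> L2_space D" if "a \<in> L2_space D" for a
      by (rule L2_bounded_mult[OF that bm, of 1]) simp
    have ii: "?i x * ?i x = ?i x" for x by (simp add: indicator_def)
    have "(\<lambda>k. I (\<lambda>x. p\<epsilon> (e k) t x * (q x * ?i x))) \<longlonglongrightarrow> I (\<lambda>x. q x * (q x * ?i x))"
      using lim Lm[OF qL] by (auto simp: L2_weakly_tendsto_def L2_inner_def)
    moreover have "(\<lambda>k. I (\<lambda>x. p\<epsilon> (e k) t x * (q x * ?i x))) \<longlonglongrightarrow> 0"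
    proof (rule Lim_null_comparison)
      have nk: "L2_norm D (\<lambda>x. p\<epsilon> (e k) t x * ?i x) = sqrt (I (\<lambda>x. (p\<epsilon> (e k) t x)\<^sup>2 * ?i x))" for k
      proof -
        have "(\<lambda>x. (p\<epsilon> (e k) t x * ?i x) * (p\<epsilon> (e k) t x * ?i x)) = (\<lambda>x. (p\<epsilon> (e k) t x)\<^sup>2 * ?i x)"
          by (rule ext) (simp add: power2_eq_square indicator_def)
        then show ?thesis by (simp add: L2_norm_def L2_inner_def)
      qed
      show "(\<lambda>k. sqrt (I (\<lambda>x. (p\<epsilon> (e k) t x)\<^sup>2 * ?i x)) * L2_norm D q) \<longlonglongrightarrow> 0"
        using tendsto_mult[OF tendsto_real_sqrt[OF \<delta>(2)] tendsto_const[of "L2_norm D q"]] by simp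
      have "\<bar>I (\<lambda>x. p\<epsilon> (e k) t x * (q x * ?i x))\<bar> \<le> sqrt (I (\<lambda>x. (p\<epsilon> (e k) t x)\<^sup>2 * ?i x)) * L2_norm D q" for k
        using inner_le_norm[OF Lm[OF uL[OF e(1) t]] qL, of k] unfolding nk by (simp add: mult_ac)
      then show "\<forall>\<^sub>F k in sequentially. norm (I (\<lambda>x. p\<epsilon> (e k) t x * (q x * ?i x))) \<le> sqrt (I (\<lambda>x. (p\<epsilon> (e k) t x)\<^sup>2 * ?i x)) * L2_norm D q"
        by simp
    qed
    ultimately have "I (\<lambda>x. q x * (q x * ?i x)) = 0" by (rule LIMSEQ_unique)
    moreover have int: "integrable (lebesgue_on D) (\<lambda>x. q x * (q x * ?i x))" by (intro L2_mult_integrable Lm qL)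
    moreover have "AE x in lebesgue_on D. 0 \<le> q x * (q x * ?i x)" by (simp add: mult.assoc[symmetric])
    ultimately have "AE x in lebesgue_on D. q x * (q x * ?i x) = 0" using integral_nonneg_eq_0_iff_AE by blast
    then have "AE x in lebesgue_on D. x \<in> ball x0 \<delta> \<longrightarrow> q x = 0" by eventually_elim (auto simp: indicator_def)
    then show ?thesis using \<delta>(1) by blast
  qed
  define \<F> where "\<F> = {A. open A \<and> (AE x in lebesgue_on D. x \<in> A \<longrightarrow> q x = 0)}"
  obtain \<F>' where F': "\<F>' \<subseteq> \<F>" "countable \<F>'" "\<Union>\<F>' = \<Union>\<F>"
    using Lindelof[of \<F>] by (auto simp: \<F>_def)
  have "AE x in lebesgue_on D. \<forall>A\<in>\<F>'. x \<in> A \<longrightarrow> q x = 0"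
    using F' by (subst AE_ball_countable) (auto simp: \<F>_def)
  moreover have "AE x in lebesgue_on D. x \<notin> tangential t"
  proof -
    have "tangential t \<in> null_sets lebesgue" using tangential_negligible[OF C1 t] by (simp add: negligible_iff_null_sets)
    then have "AE x in lebesgue. x \<notin> tangential t" by (rule AE_not_in)
    then have "AE x in lebesgue. x \<in> D \<longrightarrow> x \<notin> tangential t" by eventually_elim simp
    then show ?thesis by (simp add: AE_restrict_space_iff)
  qed
  moreover have "AE x in lebesgue_on D. x \<in> D" by (rule AE_I2) simp
  ultimately show ?thesis
  proof eventually_elim
    case (elim x)
    show ?case
    proof
      assume ns: "x \<notin> survivors t"
      show "q x = 0"
      proof (cases "\<forall>r\<in>{s..t}. flow t r x \<in> closure D")
        case True
        obtain r where r: "r \<in> {s..t}" "flow t r x \<notin> D" using ns elim(3) by (auto simp: survivors_def)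
        then have "flow t r x \<in> frontier D" using True open_D by (auto simp: frontier_def interior_open)
        then have "x \<in> tangential t" using True r elim(3) by (auto simp: tangential_def)
        then show ?thesis using elim(2) by simp
      next
        case False
        then obtain r1 where r1: "r1 \<in> {s..t}" "flow t r1 x \<notin> closure D" by auto
        obtain \<delta> where "\<delta> > 0" "AE y in lebesgue_on D. y \<in> ball x \<delta> \<longrightarrow> q y = 0" using local[OF elim(3) r1] by blast
        then have "ball x \<delta> \<in> \<F>" "x \<in> ball x \<delta>" by (auto simp: \<F>_def)
        then obtain A where "A \<in> \<F>'" "x \<in> A" using F'(3) by blast
        then show ?thesis using elim(1) by blast
      qed
    qed
  qed
qed

end

section \<open>The formula for the limit on Borel sets\<close>

text \<open>Dynkin's argument: two signed image measures that agree on closed sets agree on all Borel sets.\<close>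

lemma borel_pushforward_integrals_eq:
  fixes h1 h2 :: "'b \<Rightarrow> real" and T1 T2 :: "'b \<Rightarrow> 'a::topological_space"
  assumes h: "integrable M h1" "integrable M h2" and T: "T1 \<in> borel_measurable M" "T2 \<in> borel_measurable M"
    and cl: "\<And>B. closed B \<Longrightarrow> (\<integral>x. h1 x * indicator B (T1 x) \<partial>M) = (\<integral>x. h2 x * indicator B (T2 x) \<partial>M)"
    and B: "B \<in> sets borel"
  shows "(\<integral>x. h1 x * indicator B (T1 x) \<partial>M) = (\<integral>x. h2 x * indicator B (T2 x) \<partial>M)"
proof -
  have sb: "sets borel = sigma_sets (UNIV :: 'a set) (Collect closed)"
    unfolding borel_eq_closed by (simp add: sets_measure_of)
  have int: "integrable M (\<lambda>x. h x * indicator A (\<Phi> x))"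
    if "integrable M h" "\<Phi> \<in> borel_measurable M" "A \<in> sets borel" for h :: "'b \<Rightarrow> real" and \<Phi> and A :: "'a set"
  proof (rule Bochner_Integration.integrable_bound[OF that(1)])
    have "(\<lambda>x. indicator A (\<Phi> x) :: real) \<in> borel_measurable M"
      using measurable_compose[OF that(2) borel_measurable_indicator[OF that(3)]] by simp
    then show "(\<lambda>x. h x * indicator A (\<Phi> x)) \<in> borel_measurable M" using that(1) by (intro borel_measurable_times) auto
  qed (simp add: indicator_def)
  have "Int_stable (Collect (closed :: 'a set \<Rightarrow> bool))" by (auto simp: Int_stable_def)
  moreover have "Collect closed \<subseteq> Pow (UNIV :: 'a set)" by simp
  moreover have "B \<in> sigma_sets UNIV (Collect closed)" using B sb by simp
  ultimately show ?thesis
  proof (induction rule: sigma_sets_induct_disjoint)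
    case (basic A)
    then show ?case using cl by simp
  next
    case empty
    show ?case by simp
  next
    case (compl A)
    have A: "A \<in> sets borel" using compl(1) sb by simp
    have split: "(\<integral>x. h x * indicator (UNIV - A) (\<Phi> x) \<partial>M) = (\<integral>x. h x * indicator UNIV (\<Phi> x) \<partial>M) - (\<integral>x. h x * indicator A (\<Phi> x) \<partial>M)"
      if "integrable M h" "\<Phi> \<in> borel_measurable M" for h :: "'b \<Rightarrow> real" and \<Phi> :: "'b \<Rightarrow> 'a"
    proof -
      have "(\<lambda>x. h x * indicator (UNIV - A) (\<Phi> x)) = (\<lambda>x. h x * indicator UNIV (\<Phi> x) - h x * indicator A (\<Phi> x))"
        by (auto simp: indicator_def)
      then show ?thesis using int[OF that A] that(1) by simp
    qed
    show ?case unfolding split[OF h(1) T(1)] split[OF h(2) T(2)] using compl(2) cl[of UNIV] by simp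
  next
    case (union A)
    have A: "A i \<in> sets borel" for i using union(2) sb by auto
    have lim: "(\<lambda>n. \<Sum>i<n. \<integral>x. h x * indicator (A i) (\<Phi> x) \<partial>M) \<longlonglongrightarrow> (\<integral>x. h x * indicator (\<Union>i. A i) (\<Phi> x) \<partial>M)"
      if h: "integrable M h" and T: "\<Phi> \<in> borel_measurable M" for h :: "'b \<Rightarrow> real" and \<Phi> :: "'b \<Rightarrow> 'a"
    proof -
      have U: "(\<Union>i<n. A i) \<in> sets borel" for n using A by (intro sets.finite_UN) auto
      have U': "(\<Union>i. A i) \<in> sets borel" using A by (intro sets.countable_UN) auto
      have "(\<lambda>n. \<integral>x. h x * indicator (\<Union>i<n. A i) (\<Phi> x) \<partial>M) \<longlonglongrightarrow> (\<integral>x. h x * indicator (\<Union>i. A i) (\<Phi> x) \<partial>M)"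
      proof (rule integral_dominated_convergence[where w = "\<lambda>x. \<bar>h x\<bar>"])
        show "integrable M (\<lambda>x. \<bar>h x\<bar>)" using h by simp
        show "(\<lambda>x. h x * indicator (\<Union>i. A i) (\<Phi> x)) \<in> borel_measurable M" using int[OF h T U'] by simp
        show "(\<lambda>x. h x * indicator (\<Union>i<n. A i) (\<Phi> x)) \<in> borel_measurable M" for n using int[OF h T U] by simp
        show "AE x in M. (\<lambda>n. h x * indicator (\<Union>i<n. A i) (\<Phi> x)) \<longlonglongrightarrow> h x * indicator (\<Union>i. A i) (\<Phi> x)"
          by (intro AE_I2 tendsto_mult tendsto_const LIMSEQ_indicator_UN)
        show "AE x in M. norm (h x * indicator (\<Union>i<n. A i) (\<Phi> x)) \<le> \<bar>h x\<bar>" for n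
          by (intro AE_I2) (simp add: indicator_def)
      qed
      moreover have "(\<integral>x. h x * indicator (\<Union>i<n. A i) (\<Phi> x) \<partial>M) = (\<Sum>i<n. \<integral>x. h x * indicator (A i) (\<Phi> x) \<partial>M)" for n
      proof -
        have dj: "disjoint_family_on A {..<n}" using union(1) by (rule disjoint_family_on_mono[rotated]) simp
        have "(\<lambda>x. h x * indicator (\<Union>i<n. A i) (\<Phi> x)) = (\<lambda>x. \<Sum>i<n. h x * indicator (A i) (\<Phi> x))"
          by (simp add: indicator_UN_disjoint[OF _ dj] sum_distrib_left)
        then show ?thesis by (simp only:) (rule Bochner_Integration.integral_sum, rule int[OF h T A])
      qed
      ultimately show ?thesis by simp
    qed
    show ?case
      by (rule LIMSEQ_unique[OF lim[OF h(1) T(1)]]) (simp only: union(3) lim[OF h(2) T(2)])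
  qed
qed

lemma cutoff_tendsto_indicator:
  fixes K :: "'a::metric_space set"
  assumes "closed K" "K \<noteq> {}"
  shows "(\<lambda>k. max 0 (1 - real k * infdist z K)) \<longlonglongrightarrow> indicator K z"
proof (cases "z \<in> K")
  case True
  then show ?thesis by simp
next
  case False
  then have d: "infdist z K > 0" using assms in_closed_iff_infdist_zero[of K z] infdist_nonneg[of z K] by linarith
  obtain N :: nat where N: "1 / infdist z K < real N" using reals_Archimedean2 by blast
  have "max 0 (1 - real k * infdist z K) = indicator K z" if "k \<ge> N" for k
  proof -
    have "1 < real N * infdist z K" using N d by (simp add: field_simps)
    also have "\<dots> \<le> real k * infdist z K" using that d by (intro mult_right_mono) auto
    finally show ?thesis using False by simp
  qed
  then show ?thesis by (intro tendsto_eventually) (auto simp: eventually_sequentially)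
qed

context bounded_domain
begin

lemma L2_integrable:
  assumes "u \<in> L2_space D"
  shows "integrable (lebesgue_on D) u"
  using L2_mult_integrable[OF assms L2_continuous[OF continuous_on_const, of 1]] by simp

lemma bounded_convergence_L2:
  assumes u: "u \<in> L2_space D" and g: "\<And>k. g k \<in> borel_measurable (lebesgue_on D)" "\<And>k x. \<bar>g k x\<bar> \<le> 1"
    and lim: "\<And>x. (\<lambda>k. g k x) \<longlonglongrightarrow> g' x"
  shows "(\<lambda>k::nat. I (\<lambda>x. u x * g k x)) \<longlonglongrightarrow> I (\<lambda>x. u x * g' x)"
proof (rule integral_dominated_convergence[where w = "\<lambda>x. \<bar>u x\<bar>"])
  show "integrable (lebesgue_on D) (\<lambda>x. \<bar>u x\<bar>)" using L2_integrable[OF u] by simp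
  have "g' \<in> borel_measurable (lebesgue_on D)" by (rule borel_measurable_LIMSEQ_metric[OF g(1) lim])
  then show "(\<lambda>x. u x * g' x) \<in> borel_measurable (lebesgue_on D)" using L2_measurable[OF u] by (intro borel_measurable_times)
  show "(\<lambda>x. u x * g k x) \<in> borel_measurable (lebesgue_on D)" for k
    using L2_measurable[OF u] g(1) by (intro borel_measurable_times)
  show "AE x in lebesgue_on D. (\<lambda>k. u x * g k x) \<longlonglongrightarrow> u x * g' x" by (intro AE_I2 tendsto_mult tendsto_const lim)
  show "AE x in lebesgue_on D. norm (u x * g k x) \<le> \<bar>u x\<bar>" for k
    using g(2)[of k] by (intro AE_I2) (simp add: abs_mult mult_left_le)
qed

lemma L2_AE_eq_from_borel:
  assumes q: "q \<in> L2_space D" "q' \<in> L2_space D"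
    and eq: "\<And>B. B \<in> sets borel \<Longrightarrow> I (\<lambda>x. q x * indicator B x) = I (\<lambda>x. q' x * indicator B x)"
  shows "AE x in lebesgue_on D. q x = q' x"
proof (rule density_unique_real[OF L2_integrable[OF q(1)] L2_integrable[OF q(2)]])
  fix A assume A: "A \<in> sets (lebesgue_on D)"
  then have "A \<in> sets lebesgue" using D_sets by (auto simp: sets_restrict_space)
  then obtain S N N' where S: "A = S \<union> N" "N \<subseteq> N'" "N' \<in> null_sets lborel" "S \<in> sets lborel" by (rule sets_completionE)
  have SL: "S \<in> sets lebesgue" using S(4) by (rule sets_completionI_sets)
  have mb: "(indicator Z :: _ \<Rightarrow> real) \<in> borel_measurable (lebesgue_on D)" if "Z \<in> sets lebesgue" for Z
    using that by (intro measurable_restrict_space1 borel_measurable_indicator)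
  have "AE x in lborel. x \<notin> N'" using S(3) by (rule AE_not_in)
  then have "AE x in lebesgue. x \<notin> N'" by (rule AE_completion)
  then have "AE x in lebesgue. x \<in> D \<longrightarrow> x \<notin> N'" by eventually_elim simp
  then have ae: "AE x in lebesgue_on D. x \<notin> N'" by (simp add: AE_restrict_space_iff)
  have "(LINT x:A|lebesgue_on D. u x) = I (\<lambda>x. u x * indicator S x)" if u: "u \<in> L2_space D" for u
    unfolding set_lebesgue_integral_def
  proof (rule integral_cong_AE)
    show "(\<lambda>x. indicator A x *\<^sub>R u x) \<in> borel_measurable (lebesgue_on D)"
      using mb[OF \<open>A \<in> sets lebesgue\<close>] L2_measurable[OF u] by (intro borel_measurable_scaleR)
    show "(\<lambda>x. u x * indicator S x) \<in> borel_measurable (lebesgue_on D)"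
      using mb[OF SL] L2_measurable[OF u] by (intro borel_measurable_times)
    show "AE x in lebesgue_on D. indicator A x *\<^sub>R u x = u x * indicator S x"
      using ae by eventually_elim (use S(1,2) in \<open>auto simp: indicator_def\<close>)
  qed
  then show "(LINT x:A|lebesgue_on D. q x) = (LINT x:A|lebesgue_on D. q' x)"
    using q eq[of S] S(4) by simp
qed

end

context flow_domain
begin

text \<open>The path down to time \<open>s\<close> is compact in the open set \<open>D\<close>, and the flow is Lipschitz uniformly in time.\<close>

lemma open_survivors:
  assumes t: "t \<in> {s..T}"
  shows "open (survivors t)"
  unfolding open_contains_ball
proof
  fix x assume x: "x \<in> survivors t"
  have "compact ((\<lambda>r. flow t r x) ` {s..t})"
    by (intro compact_continuous_image continuous_on_subset[OF sol_continuous[OF flow_sol[OF t]]]) (use t in auto)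
  moreover have "(\<lambda>r. flow t r x) ` {s..t} \<subseteq> D" using x by (auto simp: survivors_def)
  ultimately obtain \<epsilon> where \<epsilon>: "\<epsilon> > 0" "(\<Union>z\<in>(\<lambda>r. flow t r x) ` {s..t}. ball z \<epsilon>) \<subseteq> D"
    using compact_subset_open_imp_ball_epsilon_subset[OF _ open_D] by blast
  define E where "E = exp (L * (T - s))"
  have "y \<in> survivors t" if y: "y \<in> ball x (\<epsilon> / E)" for y
  proof -
    have fl: "flow t r y \<in> D" if r: "r \<in> {s..t}" for r
    proof -
      have "norm (flow t r x - flow t r y) \<le> E * norm (x - y)"
        unfolding E_def by (rule flow_lipschitz[OF t]) (use r t in auto)
      also have "\<dots> < \<epsilon>" using y by (simp add: E_def dist_norm field_simps)
      finally have "flow t r y \<in> ball (flow t r x) \<epsilon>" by (simp add: dist_norm)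
      then show ?thesis using \<epsilon>(2) r by blast
    qed
    have "y \<in> D" using fl[of t] t by simp
    then show ?thesis using fl unfolding survivors_def by blast
  qed
  then show "\<exists>e>0. ball x e \<subseteq> survivors t" using \<epsilon>(1) by (intro exI[of _ "\<epsilon> / E"]) (auto simp: E_def)
qed

lemma flow_borel: "t \<in> {s..T} \<Longrightarrow> flow s t \<in> borel_measurable borel"
  by (intro borel_measurable_continuous_onI flow_continuous) (use sT in auto)

lemma flow_measurable_D: "t \<in> {s..T} \<Longrightarrow> flow s t \<in> borel_measurable (lebesgue_on D)"
  using flow_borel[of t] by (intro measurable_restrict_space1 measurable_completion) simp

lemma id_measurable_D: "(\<lambda>x. x) \<in> borel_measurable (lebesgue_on D)"
  by (intro measurable_restrict_space1 measurable_completion) simp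

context
  fixes \<rho> q :: "real^'n \<Rightarrow> real" and p\<epsilon> :: "real \<Rightarrow> real \<Rightarrow> real^'n \<Rightarrow> real" and M t :: real and e :: "nat \<Rightarrow> real"
  assumes sol: "\<And>\<epsilon>. \<epsilon> > 0 \<Longrightarrow> weak_solution D f s T \<rho> \<epsilon> (p\<epsilon> \<epsilon>)" and \<rho>: "\<rho> \<in> L2_space D"
    and M: "\<And>\<epsilon> r. \<epsilon> > 0 \<Longrightarrow> r \<in> {s..T} \<Longrightarrow> L2_norm D (p\<epsilon> \<epsilon> r) \<le> M"
    and t: "t \<in> {s..T}" and e: "\<And>k. e k > 0" "e \<longlonglongrightarrow> 0" and lim: "L2_weakly_tendsto D (\<lambda>k. p\<epsilon> (e k) t) q"
begin

text \<open>Lipschitz cut-offs decreasing to the indicator of \<open>K\<close>, supported among the survivors from some index on.\<close>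

lemma limit_on_compact:
  assumes K: "compact K" "K \<subseteq> survivors t"
  shows "I (\<lambda>x. q x * indicator K x) = I (\<lambda>x. \<rho> x * indicator K (flow s t x))"
proof (cases "K = {}")
  case True
  then show ?thesis by simp
next
  case False
  have qL: "q \<in> L2_space D" using lim by (simp add: L2_weakly_tendsto_def)
  obtain \<eta> where \<eta>: "\<eta> > 0" "{x. infdist x K \<le> \<eta>} \<subseteq> survivors t"
    using compact_in_open_separated[OF False K(1) open_survivors[OF t] K(2)] by blast
  obtain k0 :: nat where k0: "1 / \<eta> < real k0" using reals_Archimedean2 by blast
  define \<phi> where "\<phi> k z = max 0 (1 - real k * infdist z K)" for k z
  have \<phi>1: "\<bar>\<phi> k z\<bar> \<le> 1" for k z using infdist_nonneg[of z K] by (simp add: \<phi>_def)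
  have \<phi>L: "\<bar>\<phi> k z - \<phi> k z'\<bar> \<le> real k * norm (z - z')" for k z z'
  proof -
    have "\<bar>\<phi> k z - \<phi> k z'\<bar> \<le> \<bar>real k * infdist z K - real k * infdist z' K\<bar>" unfolding \<phi>_def by linarith
    also have "\<dots> = real k * \<bar>infdist z K - infdist z' K\<bar>" by (simp add: abs_mult right_diff_distrib[symmetric])
    also have "\<dots> \<le> real k * norm (z - z')" using infdist_triangle_abs[of z K z'] by (intro mult_left_mono) (auto simp: dist_norm)
    finally show ?thesis .
  qed
  have supp: "z \<in> {x. infdist x K \<le> \<eta>}" if "k \<ge> k0" "\<phi> k z \<noteq> 0" for k z
  proof (rule ccontr)
    assume "z \<notin> {x. infdist x K \<le> \<eta>}"
    then have d: "infdist z K > \<eta>" by simp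
    have "1 < real k0 * \<eta>" using k0 \<eta>(1) by (simp add: field_simps)
    also have "\<dots> \<le> real k * infdist z K" using that(1) d \<eta>(1) by (intro mult_mono) auto
    finally show False using that(2) by (simp add: \<phi>_def)
  qed
  have eq: "I (\<lambda>x. q x * \<phi> k x) = I (\<lambda>x. \<rho> x * \<phi> k (flow s t x))" if "k \<ge> k0" for k
  proof (rule limit_transported[OF sol \<rho> M t e lim \<phi>L _ \<phi>1 compact_infdist_le[OF False K(1) \<eta>(1)] supp[OF that]])
    show "flow t r z \<in> D" if "z \<in> {x. infdist x K \<le> \<eta>}" "r \<in> {s..t}" for z r
      using that \<eta>(2) by (auto simp: survivors_def)
  qed simp_all
  have c: "continuous_on UNIV (\<phi> k)" for k by (rule lipschitz_continuous_on[OF \<phi>L]) simp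
  have cf: "continuous_on UNIV (\<lambda>x. \<phi> k (flow s t x))" for k
    by (rule continuous_on_compose2[OF c flow_continuous]) (use t sT in auto)
  have l: "(\<lambda>k. \<phi> k z) \<longlonglongrightarrow> indicator K z" for z
    unfolding \<phi>_def by (rule cutoff_tendsto_indicator[OF compact_imp_closed[OF K(1)] False])
  have 1: "(\<lambda>k. I (\<lambda>x. q x * \<phi> k x)) \<longlonglongrightarrow> I (\<lambda>x. q x * indicator K x)"
    by (rule bounded_convergence_L2[OF qL measurable_D[OF c] \<phi>1 l])
  have 2: "(\<lambda>k. I (\<lambda>x. \<rho> x * \<phi> k (flow s t x))) \<longlonglongrightarrow> I (\<lambda>x. \<rho> x * indicator K (flow s t x))"
    by (rule bounded_convergence_L2[OF \<rho> measurable_D[OF cf] \<phi>1 l])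
  have "\<forall>\<^sub>F k in sequentially. I (\<lambda>x. q x * \<phi> k x) = I (\<lambda>x. \<rho> x * \<phi> k (flow s t x))"
    using eq by (auto simp: eventually_sequentially)
  then have "(\<lambda>k. I (\<lambda>x. q x * \<phi> k x)) \<longlonglongrightarrow> I (\<lambda>x. \<rho> x * indicator K (flow s t x))"
    using 2 tendsto_cong by fast
  then show ?thesis using 1 LIMSEQ_unique by blast
qed

text \<open>Closed sets are exhausted by compact ones inside the open set of survivors; off the survivors the limit
  vanishes.\<close>

lemma limit_on_borel:
  assumes C1: "C1_boundary D" and B: "B \<in> sets borel"
  shows "I (\<lambda>x. q x * indicator B x) = I (\<lambda>x. \<rho> x * indicator (B \<inter> survivors t) (flow s t x))"
proof -
  let ?O = "survivors t"
  have qL: "q \<in> L2_space D" using lim by (simp add: L2_weakly_tendsto_def)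
  have O: "?O \<in> sets borel" using open_survivors[OF t] by simp
  have mi: "(\<lambda>x. indicator A x :: real) \<in> borel_measurable (lebesgue_on D)"
    and mf: "(\<lambda>x. indicator A (flow s t x) :: real) \<in> borel_measurable (lebesgue_on D)" if "A \<in> sets borel" for A
    using measurable_compose[OF id_measurable_D borel_measurable_indicator[OF that]]
      measurable_compose[OF flow_measurable_D[OF t] borel_measurable_indicator[OF that]] by simp_all
  obtain C where C: "\<And>n. compact (C n)" "\<And>n. C n \<subseteq> ?O" "\<And>n. C n \<subseteq> interior (C (Suc n))" "\<Union>(range C) = ?O"
  proof (rule open_Union_compact_subsets[OF open_survivors[OF t]])
    fix C :: "nat \<Rightarrow> (real^'n) set"
    assume 1: "\<And>n. compact (C n)" and 2: "\<And>n. C n \<subseteq> ?O" and 3: "\<And>n. C n \<subseteq> interior (C (Suc n))" and 4: "\<Union>(range C) = ?O"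
    show thesis by (rule that[OF 1 2 3 4])
  qed
  have inc: "incseq C" by (intro incseq_SucI order_trans[OF C(3) interior_subset])
  have closed_eq: "I (\<lambda>x. q x * indicator A x) = I (\<lambda>x. (\<rho> x * indicator ?O (flow s t x)) * indicator A (flow s t x))"
    if A: "closed A" for A
  proof -
    have Ab: "A \<in> sets borel" using A by simp
    have "I (\<lambda>x. q x * indicator A x) = I (\<lambda>x. q x * indicator (A \<inter> ?O) x)"
    proof (rule integral_cong_AE)
      show "(\<lambda>x. q x * indicator A x) \<in> borel_measurable (lebesgue_on D)" "(\<lambda>x. q x * indicator (A \<inter> ?O) x) \<in> borel_measurable (lebesgue_on D)"
        using mi Ab O L2_measurable[OF qL] by (auto intro!: borel_measurable_times)
      have "AE x in lebesgue_on D. x \<notin> ?O \<longrightarrow> q x = 0" by (rule limit_vanishes[OF C1 sol M t e lim])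
      then show "AE x in lebesgue_on D. q x * indicator A x = q x * indicator (A \<inter> ?O) x"
        by eventually_elim (auto simp: indicator_def)
    qed
    also have "\<dots> = I (\<lambda>x. \<rho> x * indicator (A \<inter> ?O) (flow s t x))"
    proof (rule LIMSEQ_unique)
      have l: "(\<lambda>n. indicator (A \<inter> C n) z :: real) \<longlonglongrightarrow> indicator (A \<inter> ?O) z" for z
      proof -
        have "incseq (\<lambda>n. A \<inter> C n)" using inc by (fastforce simp: incseq_def)
        then have "(\<lambda>n. indicator (A \<inter> C n) z :: real) \<longlonglongrightarrow> indicator (\<Union>n. A \<inter> C n) z" by (rule LIMSEQ_indicator_incseq)
        moreover have "(\<Union>n. A \<inter> C n) = A \<inter> ?O" using C(4) by blast
        ultimately show ?thesis by simp
      qed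
      have Kn: "compact (A \<inter> C n)" "A \<inter> C n \<subseteq> ?O" for n using closed_Int_compact[OF A C(1)] C(2) by auto
      have Kb: "A \<inter> C n \<in> sets borel" for n using compact_imp_closed[OF Kn(1)] by simp
      show "(\<lambda>n. I (\<lambda>x. q x * indicator (A \<inter> C n) x)) \<longlonglongrightarrow> I (\<lambda>x. q x * indicator (A \<inter> ?O) x)"
        by (rule bounded_convergence_L2[OF qL mi[OF Kb] _ l]) (simp add: indicator_def)
      show "(\<lambda>n. I (\<lambda>x. q x * indicator (A \<inter> C n) x)) \<longlonglongrightarrow> I (\<lambda>x. \<rho> x * indicator (A \<inter> ?O) (flow s t x))"
        unfolding limit_on_compact[OF Kn]
        by (rule bounded_convergence_L2[OF \<rho> mf[OF Kb] _ l]) (simp add: indicator_def)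
    qed
    also have "(\<lambda>x. \<rho> x * indicator (A \<inter> ?O) (flow s t x)) = (\<lambda>x. (\<rho> x * indicator ?O (flow s t x)) * indicator A (flow s t x))"
      by (auto simp: indicator_def)
    finally show ?thesis .
  qed
  have "(\<lambda>x. \<rho> x * indicator ?O (flow s t x)) \<in> L2_space D"
    by (rule L2_bounded_mult[OF \<rho> mf[OF O], of 1]) (simp add: indicator_def)
  then have "I (\<lambda>x. q x * indicator B x) = I (\<lambda>x. (\<rho> x * indicator ?O (flow s t x)) * indicator B (flow s t x))"
    by (intro borel_pushforward_integrals_eq[OF L2_integrable[OF qL] L2_integrable id_measurable_D flow_measurable_D[OF t] closed_eq B])
  also have "(\<lambda>x. (\<rho> x * indicator ?O (flow s t x)) * indicator B (flow s t x)) = (\<lambda>x. \<rho> x * indicator (B \<inter> ?O) (flow s t x))"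
    by (auto simp: indicator_def)
  finally show ?thesis .
qed

end

end

section \<open>The random motion killed on leaving the domain\<close>

text \<open>As \<open>D\<close> is open, a continuous path that is in \<open>D\<close> up to and including \<open>t\<close> stays there a little longer, so the
  infimum exceeds \<open>t\<close> strictly.\<close>

lemma exit_time_greater_iff:
  fixes y :: "real \<Rightarrow> 'a::topological_space"
  assumes "open D" "continuous_on {s..} y" "s \<le> t"
  shows "exit_time D s y > ereal t \<longleftrightarrow> (\<forall>r\<in>{s..t}. y r \<in> D)"
proof
  assume *: "exit_time D s y > ereal t"
  show "\<forall>r\<in>{s..t}. y r \<in> D"
  proof (intro ballI, rule ccontr)
    fix r assume r: "r \<in> {s..t}" "y r \<notin> D"
    then have "exit_time D s y \<le> ereal r" unfolding exit_time_def by (intro Inf_lower) auto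
    also have "\<dots> \<le> ereal t" using r by simp
    finally show False using * by simp
  qed
next
  assume in_D: "\<forall>r\<in>{s..t}. y r \<in> D"
  have "(y \<longlongrightarrow> y t) (at t within {s..})" using assms(2,3) by (auto simp: continuous_on_def)
  then have "\<forall>\<^sub>F r in at t within {s..}. y r \<in> D"
    by (rule topological_tendstoD[OF _ assms(1)]) (use in_D assms(3) in auto)
  then obtain d where d: "d > 0" "\<And>r. r \<in> {s..} \<Longrightarrow> r \<noteq> t \<Longrightarrow> dist r t < d \<Longrightarrow> y r \<in> D"
    unfolding eventually_at by blast
  have "ereal (t + d) \<le> exit_time D s y"
    unfolding exit_time_def
  proof (rule Inf_greatest)
    fix w assume "w \<in> ereal ` {r. s \<le> r \<and> y r \<notin> D}"
    then obtain r where r: "w = ereal r" "s \<le> r" "y r \<notin> D" by auto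
    have "t < r" using in_D r by (meson atLeastAtMost_iff not_le)
    moreover have "\<not> dist r t < d" using d(2)[of r] r calculation by auto
    ultimately show "ereal (t + d) \<le> w" using r(1) by (simp add: dist_real_def)
  qed
  moreover have "ereal t < ereal (t + d)" using d(1) by simp
  ultimately show "exit_time D s y > ereal t" by (rule less_le_trans[rotated])
qed

context flow_domain
begin

text \<open>Within the time span the solution cannot leave the ball on which the truncation changes nothing, so it
  also solves the truncated equation, whose solutions are unique.\<close>

lemma solution_follows_flow:
  assumes f_bound: "\<And>x t. norm (f x t) \<le> C" and y: "solves_ode_from f s x y" and x: "x \<in> D" and t: "t \<in> {s..T}"
  shows "y t = flow s t x"
proof -
  have ys: "y s = x" and yd: "\<And>r. r \<in> {s..T} \<Longrightarrow> (y has_vector_derivative f (y r) r) (at r within {s..T})"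
    using y by (auto simp: solves_ode_from_def intro: has_vector_derivative_within_subset)
  have "y r \<in> cball 0 R" if r: "r \<in> {s..T}" for r
  proof -
    have "norm (y r - y s) \<le> C * \<bar>r - s\<bar>"
      by (rule vector_derivative_bound[where a = s and b = T and y' = "\<lambda>r. f (y r) r"]) (use yd f_bound r sT in auto)
    also have "\<dots> \<le> C * (T - s)" using C_nonneg r by (intro mult_left_mono) auto
    finally have "norm (y r) \<le> norm x + C * (T - s)" using norm_triangle_ineq2[of "y r" x] by (simp add: ys)
    also have "\<dots> \<le> R" using room x closure_subset by blast
    finally show ?thesis by simp
  qed
  then have "sol y" unfolding sol_def using yd F_eq by simp
  then show ?thesis using flow_unique[OF _ _ t, of y s] sT ys by simp
qed

text \<open>The event is the inverse image under \<open>a\<close> of a Borel subset of \<open>D\<close>, exactly and not only up to null sets: a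
  path that starts outside \<open>D\<close> has exit time \<open>s\<close>.\<close>

lemma killed_motion_probability:
  assumes f_bound: "\<And>x t. norm (f x t) \<le> C" and \<rho>: "\<rho> \<in> L2_space D"
    and a: "has_density_on M D a \<rho>"
    and y: "\<And>\<omega>. \<omega> \<in> space M \<Longrightarrow> solves_ode_from f s (a \<omega>) (y \<omega>)"
    and t: "t \<in> {s..T}" and B: "B \<in> sets borel"
  shows "measure M {\<omega> \<in> space M. y \<omega> t \<in> B \<and> exit_time D s (y \<omega>) > ereal t}
    = I (\<lambda>x. \<rho> x * indicator (B \<inter> survivors t) (flow s t x))"
proof -
  define S where "S = D \<inter> flow s t -` (B \<inter> survivors t)"
  have ss: "s \<in> {s..T}" using sT by simp
  have Ob: "B \<inter> survivors t \<in> sets borel" using B open_survivors[OF t] by (intro sets.Int) auto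
  have Sb: "S \<in> sets borel"
    using measurable_sets[OF flow_borel[OF t] Ob] open_D unfolding S_def by (intro sets.Int) auto
  have event: "y \<omega> t \<in> B \<and> exit_time D s (y \<omega>) > ereal t \<longleftrightarrow> a \<omega> \<in> S" if \<omega>: "\<omega> \<in> space M" for \<omega>
  proof -
    have "continuous_on {s..} (y \<omega>)"
      using y[OF \<omega>] unfolding solves_ode_from_def continuous_on_eq_continuous_within
      by (auto intro: has_vector_derivative_continuous)
    then have ex: "exit_time D s (y \<omega>) > ereal t \<longleftrightarrow> (\<forall>r\<in>{s..t}. y \<omega> r \<in> D)"
      by (rule exit_time_greater_iff[OF open_D]) (use t in auto)
    show ?thesis
    proof (cases "a \<omega> \<in> D")
      case False
      then have "y \<omega> s \<notin> D" using y[OF \<omega>] by (simp add: solves_ode_from_def)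
      moreover have "s \<in> {s..t}" using t by simp
      ultimately show ?thesis using False unfolding ex S_def by blast
    next
      case True
      have yf: "y \<omega> r = flow s r (a \<omega>)" if "r \<in> {s..T}" for r
        by (rule solution_follows_flow[OF f_bound y[OF \<omega>] True that])
      have ff: "flow t r (flow s t (a \<omega>)) = flow s r (a \<omega>)" if "r \<in> {s..t}" for r
        using flow_flow[OF ss t, of r "a \<omega>"] that t by auto
      have "flow s t (a \<omega>) \<in> survivors t \<longleftrightarrow> (\<forall>r\<in>{s..t}. flow s r (a \<omega>) \<in> D)"
        unfolding survivors_def using ff t by auto
      also have "\<dots> \<longleftrightarrow> (\<forall>r\<in>{s..t}. y \<omega> r \<in> D)" using yf t by auto
      finally show ?thesis using True yf[OF t] unfolding ex S_def by auto
    qed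
  qed
  obtain g where g: "\<And>x. 0 \<le> g x" "distributed M lborel a (\<lambda>x. ennreal (g x))" "AE x in lebesgue_on D. \<rho> x = g x"
    using a by (auto simp: has_density_on_def)
  have gm: "g \<in> borel_measurable borel" using distributed_real_measurable[OF _ g(2)] g(1) by simp
  have im: "(\<lambda>x. g x * indicator S x) \<in> borel_measurable borel" using gm Sb by (intro borel_measurable_times borel_measurable_indicator)
  have "{\<omega> \<in> space M. y \<omega> t \<in> B \<and> exit_time D s (y \<omega>) > ereal t} = a -` S \<inter> space M" using event by blast
  then have "measure M {\<omega> \<in> space M. y \<omega> t \<in> B \<and> exit_time D s (y \<omega>) > ereal t} = enn2real (\<integral>\<^sup>+x. ennreal (g x) * indicator S x \<partial>lborel)"
    using distributed_emeasure[OF g(2), of S] Sb by (simp add: measure_def)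
  also have "(\<lambda>x. ennreal (g x) * indicator S x) = (\<lambda>x. ennreal (g x * indicator S x))" by (auto simp: indicator_def)
  also have "enn2real (\<integral>\<^sup>+x. ennreal (g x * indicator S x) \<partial>lborel) = (\<integral>x. g x * indicator S x \<partial>lborel)"
    by (rule integral_eq_nn_integral[symmetric]) (use im g(1) in auto)
  also have "\<dots> = I (\<lambda>x. g x * indicator S x)"
    by (rule integral_lebesgue_on_eq_lborel[symmetric, OF D_sets im]) (simp add: S_def)
  also have "\<dots> = I (\<lambda>x. \<rho> x * indicator (B \<inter> survivors t) (flow s t x))"
  proof (rule integral_cong_AE)
    show "(\<lambda>x. g x * indicator S x) \<in> borel_measurable (lebesgue_on D)"
      using im by (intro measurable_restrict_space1 measurable_completion) simp
    show "(\<lambda>x. \<rho> x * indicator (B \<inter> survivors t) (flow s t x)) \<in> borel_measurable (lebesgue_on D)"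
      using measurable_compose[OF flow_measurable_D[OF t] borel_measurable_indicator[OF Ob]] L2_measurable[OF \<rho>]
      by (intro borel_measurable_times) simp_all
    have "AE x in lebesgue_on D. x \<in> D" by (rule AE_I2) simp
    with g(3) show "AE x in lebesgue_on D. g x * indicator S x = \<rho> x * indicator (B \<inter> survivors t) (flow s t x)"
      by eventually_elim (simp add: S_def indicator_def)
  qed
  finally show ?thesis .
qed

end

theorem theorem2p1:
  fixes D :: "(real^'n::finite) set"
    and f :: "real^'n \<Rightarrow> real \<Rightarrow> real^'n"
    and s T :: real
    and \<rho> :: "real^'n \<Rightarrow> real"
    and p\<epsilon> :: "real \<Rightarrow> real \<Rightarrow> real^'n \<Rightarrow> real"
    and p :: "real \<Rightarrow> real^'n \<Rightarrow> real"
  assumes "open D" and "connected D" and "D \<noteq> {}"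
    and "bounded D" and "simply_connected D" and "C1_boundary D"
    and "admissible_field f"
    and "0 \<le> s" and "s < T"
    and "\<rho> \<in> L2_space D"
    and "\<And>\<epsilon>. \<epsilon> > 0 \<Longrightarrow> weak_solution D f s T \<rho> \<epsilon> (p\<epsilon> \<epsilon>)"
    and "vanishing_viscosity_limit D s T p\<epsilon> p"
  shows "(\<forall>p'. vanishing_viscosity_limit D s T p\<epsilon> p' \<longrightarrow>
            (\<forall>t\<in>{s..T}. AE x in lebesgue_on D. p t x = p' t x))
       \<and> (\<forall>(M :: 'w measure) a y.
            prob_space M \<longrightarrow>
            (AE \<omega> in M. a \<omega> \<in> D) \<longrightarrow>
            has_density_on M D a \<rho> \<longrightarrow>
            (\<forall>\<omega>\<in>space M. solves_ode_from f s (a \<omega>) (y \<omega>)) \<longrightarrow>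
            (\<forall>t\<in>{s..T}. \<forall>B\<in>sets borel. B \<subseteq> D \<longrightarrow>
               measure M {\<omega> \<in> space M. y \<omega> t \<in> B \<and> exit_time D s (y \<omega>) > ereal t}
                 = (\<integral>x. p t x \<partial>lebesgue_on B)))"
proof -
  note hyps = assms
  interpret bounded_domain D by unfold_locales (fact hyps(1), fact hyps(4))
  obtain C where C: "\<And>x t. norm (f x t) \<le> C"
    using hyps(7) unfolding admissible_field_def bounded_iff by fastforce
  have "bounded (closure D)" using hyps(4) by (rule bounded_closure)
  then obtain b where b: "\<And>x. x \<in> closure D \<Longrightarrow> norm x \<le> b" unfolding bounded_iff by blast
  define R where "R = max 1 (b + C * (T - s))"
  have "0 < R" by (simp add: R_def)
  then obtain L where "bounded_lipschitz_field (truncated_field R s T f) s T L C"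
    using truncated_field_lipschitz[OF hyps(7) _ hyps(9) C] by blast
  then interpret bounded_lipschitz_field "truncated_field R s T f" s T L C .
  interpret flow_domain D f s T "truncated_field R s T f" L C R
  proof unfold_locales
    show "norm x + C * (T - s) \<le> R" if "x \<in> closure D" for x using b[OF that] by (simp add: R_def)
    show "truncated_field R s T f x t = f x t" if "x \<in> cball 0 R" "t \<in> {s..T}" for x t
      using that by (rule truncated_field_eq)
  qed (fact hyps(7), fact hyps(9))
  obtain M where M: "\<And>\<epsilon> r. \<epsilon> > 0 \<Longrightarrow> r \<in> {s..T} \<Longrightarrow> L2_norm D (p\<epsilon> \<epsilon> r) \<le> M"
    using viscous_uniform_bound[OF hyps(3) hyps(11) hyps(10)] by blast
  have borel: "I (\<lambda>x. q t x * indicator B x) = I (\<lambda>x. \<rho> x * indicator (B \<inter> survivors t) (flow s t x))"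
    if q: "vanishing_viscosity_limit D s T p\<epsilon> q" and t: "t \<in> {s..T}" and B: "B \<in> sets borel" for q t B
  proof -
    obtain e :: "nat \<Rightarrow> real" where e: "\<And>k. e k > 0" "e \<longlonglongrightarrow> 0" "L2_weakly_tendsto D (\<lambda>k. p\<epsilon> (e k) t) (q t)"
      using q t unfolding vanishing_viscosity_limit_def by blast
    show ?thesis by (rule limit_on_borel[OF hyps(11) hyps(10) M t e hyps(6) B])
  qed
  have L2: "q t \<in> L2_space D" if "vanishing_viscosity_limit D s T p\<epsilon> q" "t \<in> {s..T}" for q t
    using that by (auto simp: vanishing_viscosity_limit_def B_space_def)
  show ?thesis
  proof (intro conjI allI impI ballI)
    fix p' t assume p': "vanishing_viscosity_limit D s T p\<epsilon> p'" and t: "t \<in> {s..T}"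
    show "AE x in lebesgue_on D. p t x = p' t x"
      by (rule L2_AE_eq_from_borel[OF L2[OF hyps(12) t] L2[OF p' t]])
        (simp add: borel[OF hyps(12) t] borel[OF p' t])
  next
    fix M :: "'w measure" and a y t B
    assume a: "has_density_on M D a \<rho>" and y: "\<forall>\<omega>\<in>space M. solves_ode_from f s (a \<omega>) (y \<omega>)"
      and t: "t \<in> {s..T}" and B: "B \<in> sets borel" "B \<subseteq> D"
    have BL: "B \<in> sets lebesgue" using B(1) by simp
    have "measure M {\<omega> \<in> space M. y \<omega> t \<in> B \<and> exit_time D s (y \<omega>) > ereal t} = I (\<lambda>x. p t x * indicator B x)"
      using killed_motion_probability[OF C hyps(10) a _ t B(1)] y borel[OF hyps(12) t B(1)] by simp
    also have "\<dots> = (\<integral>x. indicator D x *\<^sub>R (p t x * indicator B x) \<partial>lebesgue)" by (simp add: integral_restrict_space)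
    also have "\<dots> = (\<integral>x. indicator B x *\<^sub>R p t x \<partial>lebesgue)"
      by (rule arg_cong[where f = "integral\<^sup>L lebesgue"]) (use B(2) in \<open>auto simp: indicator_def fun_eq_iff\<close>)
    also have "\<dots> = (\<integral>x. p t x \<partial>lebesgue_on B)" using BL by (simp add: integral_restrict_space)
    finally show "measure M {\<omega> \<in> space M. y \<omega> t \<in> B \<and> exit_time D s (y \<omega>) > ereal t} = (\<integral>x. p t x \<partial>lebesgue_on B)" .
  qed
qed

end
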